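(* Let $n\ge2$, $\boldsymbol\varsigma\in\{+,-\}^n$ and $\boldsymbol\lambda\in\mathbb C^n$ with $\sum_l\lambda_l=0$. Let $L_\pm(\boldsymbol\varsigma)=\{l:\varsigma_l=\pm\}$ and $n_\pm(\boldsymbol\varsigma)=|L_\pm(\boldsymbol\varsigma)|$. Let $$c(\boldsymbol\varsigma,\boldsymbol\lambda)=e\Big(\mp\frac{n-1}8\pm\frac{(n-1)n_\pm(\boldsymbol\varsigma)}{4n}\mp\frac12\sum_{l\in L_\pm(\boldsymbol\varsigma)}\lambda_l\Big),\qquad \xi(\boldsymbol\varsigma)=\mp e^{\mp\pi i\frac{n_\pm(\boldsymbol\varsigma)}n}$$ (the upper and lower signs give the same values). Then for all $z\in\mathbb U$ $$J(z;\boldsymbol\varsigma,\boldsymbol\lambda)=\frac{(2\pi)^{\frac{n-1}2}c(\boldsymbol\varsigma,\boldsymbol\lambda)}{\sqrt n}\,J(z;\boldsymbol\lambda;\xi(\boldsymbol\varsigma)),$$ where it is understood that $\arg\xi(\boldsymbol\varsigma)=\frac{n_-(\boldsymbol\varsigma)}n\pi=\pi-\frac{n_+(\boldsymbol\varsigma)}n\pi$.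
   Context: Notation: $e(w)=e^{2\pi iw}$, $\mathbb N=\{0,1,\dots\}$. $\mathbb U$ is the universal cover of $\mathbb C\smallsetminus\{0\}$, with elements $z=|z|e^{i\arg z}$, $\arg z\in\mathbb R$, $z^a=e^{a\log z}$; $\mathbb R_+\subset\mathbb U$ is $\{\arg z=0\}$. For $x>0$, $J(x;\boldsymbol\varsigma,\boldsymbol\lambda)=\frac1{2\pi i}\int_{\mathcal C}\prod_{l=1}^n\Gamma(s-\lambda_l)e\big(\frac{\varsigma_l(s-\lambda_l)}4\big)x^{-ns}ds$, where $\mathcal C$ is any contour going upward from $\sigma-i\infty$ to $\sigma+i\infty$ with $\sigma<\frac12+\frac1n(\mathrm{Re}\sum_l\lambda_l-1)$, with all the sets $\lambda_l-\mathbb N$ on its left and $\mathrm{Re}\,s=\sigma$ for $|\mathrm{Im}\,s|$ large on $\mathcal C$. $J(z;\boldsymbol\varsigma,\boldsymbol\lambda)$ denotes its analytic continuation to $\mathbb U$. Bessel equation of index $\boldsymbol\lambda$ and sign $\varsigma$: $$\sum_{j=1}^nV_{n,j}(\boldsymbol\lambda)z^jw^{(j)}+\big(V_{n,0}(\boldsymbol\lambda)-\varsigma(in)^nz^n\big)w=0,\qquad V_{n,j}(\boldsymbol\lambda)=\sum_{m=0}^{n-j}A_{j,n-j-m}\,n^m\sigma_m(\boldsymbol\lambda),$$ $\sigma_m$ the $m$-th elementary symmetric polynomial, $A_{0,0}=1$, $A_{0,m}=0$ ($m\ge1$), $A_{j,m}=\sum_{r=1}^j\frac{(-1)^{j-r}r^{m+j}}{r!(j-r)!}$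 ($j\ge1,m\ge0$). For a $2n$-th root of unity $\xi$ (regarded as a point of $\mathbb U$, i.e. with a chosen argument) there is a unique sequence of symmetric polynomials $B_m(\boldsymbol\lambda;\xi)$ with $B_0=1$ such that $\widehat J(z;\boldsymbol\lambda;\xi)=e^{in\xi z}z^{-\frac{n-1}2}\sum_{m\ge0}B_m(\boldsymbol\lambda;\xi)z^{-m}$ is a formal solution of the Bessel equation of sign $\xi^n$. $J(z;\boldsymbol\lambda;\xi)$ is the unique solution of that equation on $\mathbb U$ having $\widehat J(z;\boldsymbol\lambda;\xi)$ as its asymptotic expansion (as $|z|\to\infty$) on $\{z\in\mathbb U:|\arg z-(\frac\pi2-\arg\xi)|<\frac\pi n\}$. *)

theory Defs
  imports
    "HOL-Complex_Analysis.Complex_Analysis"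
    "HOL-Computational_Algebra.Formal_Laurent_Series"
    "HOL-Library.Landau_Symbols"
begin

definition e2pi :: "complex \<Rightarrow> complex" where
  "e2pi w = exp (2 * of_real pi * \<i> * w)"

(* The point z = |z| e^(i arg z) of the universal cover U of C - {0}, arg z real, is encoded by its
   logarithm log z = ln |z| + i arg z, so that the covering map is exp :: complex => complex.
   A function on U is thus a function of u = log z; it is analytic on U iff it is
   holomorphic on UNIV as a function of u. *)

type_synonym ucover = complex

definition cov_proj :: "ucover \<Rightarrow> complex" where
  "cov_proj z = exp z"

definition cov_mod :: "ucover \<Rightarrow> real" where
  "cov_mod z = exp (Re z)"

definition cov_arg :: "ucover \<Rightarrow> real" where
  "cov_arg z = Im z"

definition cov_pow :: "ucover \<Rightarrow> complex \<Rightarrow> complex" where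
  "cov_pow z a = exp (a * z)"

definition cov_polar :: "real \<Rightarrow> real \<Rightarrow> ucover" where
  "cov_polar r \<theta> = Complex (ln r) \<theta>"

(* d/dz = (dz/du)^(-1) d/du for z = exp u *)
definition cov_deriv :: "(ucover \<Rightarrow> complex) \<Rightarrow> ucover \<Rightarrow> complex" where
  "cov_deriv w = (\<lambda>z. deriv w z / cov_proj z)"


text \<open>The integral defining \<open>J(x;sg,lam)\<close>, \<open>sg\<close> the tuple of signs.  Tuples indexed by \<open>{1..n}\<close> are
  functions on \<^typ>\<open>nat\<close> whose values outside \<open>{1..n}\<close> are never used; signs are the
  integers \<open>1\<close> and \<open>-1\<close>.\<close>

definition J_integrand ::
    "nat \<Rightarrow> (nat \<Rightarrow> int) \<Rightarrow> (nat \<Rightarrow> complex) \<Rightarrow> real \<Rightarrow> complex \<Rightarrow> complex" where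
  "J_integrand n sg lam x s =
     (\<Prod>l=1..n. Gamma (s - lam l) * e2pi (of_int (sg l) * (s - lam l) / 4))
       * of_real x powr (- (of_nat n * s))"

(* The left side of a simple curve from sigma - i oo to sigma + i oo is the component of its
   complement that contains a left half-plane. *)
definition left_of_contour :: "(real \<Rightarrow> complex) \<Rightarrow> complex \<Rightarrow> bool" where
  "left_of_contour \<gamma> p \<longleftrightarrow>
     (\<exists>a. \<forall>w. Re w < a \<longrightarrow> connected_component (- range \<gamma>) p w)"

definition J_contour :: "nat \<Rightarrow> (nat \<Rightarrow> complex) \<Rightarrow> (real \<Rightarrow> complex) \<Rightarrow> bool" where
  "J_contour n lam \<gamma> \<longleftrightarrow>
     inj \<gamma> \<and>
     (\<exists>\<sigma> T. 0 < T \<and>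
        \<sigma> < 1 / 2 + (Re (\<Sum>l=1..n. lam l) - 1) / real n \<and>
        \<gamma> piecewise_C1_differentiable_on {-T..T} \<and>
        (\<forall>t. T \<le> \<bar>t\<bar> \<longrightarrow> \<gamma> t = Complex \<sigma> t)) \<and>
     (\<forall>l\<in>{1..n}. \<forall>k::nat. left_of_contour \<gamma> (lam l - of_nat k))"

definition J_pos :: "nat \<Rightarrow> (nat \<Rightarrow> int) \<Rightarrow> (nat \<Rightarrow> complex) \<Rightarrow> real \<Rightarrow> complex" where
  "J_pos n sg lam x =
     (THE v. \<forall>\<gamma>. J_contour n lam \<gamma> \<longrightarrow>
        ((\<lambda>t. J_integrand n sg lam x (\<gamma> t) * vector_derivative \<gamma> (at t))
           has_integral (2 * of_real pi * \<i> * v)) UNIV)"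

definition J_fun :: "nat \<Rightarrow> (nat \<Rightarrow> int) \<Rightarrow> (nat \<Rightarrow> complex) \<Rightarrow> ucover \<Rightarrow> complex" where
  "J_fun n sg lam =
     (THE F. F holomorphic_on UNIV \<and> (\<forall>x>0. F (cov_polar x 0) = J_pos n sg lam x))"


text \<open>The Bessel equation.\<close>

definition elem_sym :: "nat \<Rightarrow> nat \<Rightarrow> (nat \<Rightarrow> complex) \<Rightarrow> complex" where
  "elem_sym n m lam = (\<Sum>S | S \<subseteq> {1..n} \<and> card S = m. \<Prod>l\<in>S. lam l)"

definition bessel_A :: "nat \<Rightarrow> nat \<Rightarrow> complex" where
  "bessel_A j m =
     (if j = 0 then (if m = 0 then 1 else 0)
      else (\<Sum>r=1..j. (-1) ^ (j - r) * of_nat r ^ (m + j) / (fact r * fact (j - r))))"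

definition bessel_V :: "nat \<Rightarrow> nat \<Rightarrow> (nat \<Rightarrow> complex) \<Rightarrow> complex" where
  "bessel_V n j lam = (\<Sum>m=0..n-j. bessel_A j (n - j - m) * of_nat n ^ m * elem_sym n m lam)"

(* The sign \<epsilon> of the equation is a complex number, since it will be given as a power \<xi>^n. *)
definition bessel_solution ::
    "nat \<Rightarrow> (nat \<Rightarrow> complex) \<Rightarrow> complex \<Rightarrow> (ucover \<Rightarrow> complex) \<Rightarrow> bool" where
  "bessel_solution n lam \<epsilon> w \<longleftrightarrow>
     w holomorphic_on UNIV \<and>
     (\<forall>z. (\<Sum>j=1..n. bessel_V n j lam * cov_proj z ^ j * (cov_deriv ^^ j) w z)
          + (bessel_V n 0 lam - \<epsilon> * (\<i> * of_nat n) ^ n * cov_proj z ^ n) * w z = 0)"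


text \<open>A formal expression \<open>e\<^bsup>az\<^esup> z\<^bsup>\<rho>\<^esup> f\<close> is represented by the formal
  Laurent series \<open>f\<close> in the variable \<open>X = 1/z\<close>. Since \<open>d/dz = - X\<^sup>2 d/dX\<close>, differentiation
  by \<open>z\<close> sends it to \<open>e\<^bsup>az\<^esup> z\<^bsup>\<rho>\<^esup> (a f + \<rho> X f - X\<^sup>2 f')\<close>.\<close>

definition formal_deriv :: "complex \<Rightarrow> complex \<Rightarrow> complex fls \<Rightarrow> complex fls" where
  "formal_deriv a \<rho> f = fls_const a * f + fls_const \<rho> * fls_X * f - fls_X ^ 2 * fls_deriv f"

definition formal_bessel_solution ::
    "nat \<Rightarrow> (nat \<Rightarrow> complex) \<Rightarrow> complex \<Rightarrow> complex \<Rightarrow> complex \<Rightarrow> complex fls \<Rightarrow> bool" where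
  "formal_bessel_solution n lam \<epsilon> a \<rho> f \<longleftrightarrow>
     (\<Sum>j=1..n. fls_const (bessel_V n j lam) * fls_X_inv ^ j * (formal_deriv a \<rho> ^^ j) f)
     + (fls_const (bessel_V n 0 lam)
          - fls_const (\<epsilon> * (\<i> * of_nat n) ^ n) * fls_X_inv ^ n) * f = 0"

(* bessel_B n lam \<xi> m is B_m(lam;\<xi>). Only lam with sum 0 matter; for each of them separately the
   equation is a recursion that determines all B_m from B_0 = 1. *)
definition bessel_B :: "nat \<Rightarrow> (nat \<Rightarrow> complex) \<Rightarrow> ucover \<Rightarrow> nat \<Rightarrow> complex" where
  "bessel_B n lam \<xi> =
     (THE b. b 0 = 1 \<and>
        formal_bessel_solution n lam (cov_proj \<xi> ^ n)
          (\<i> * of_nat n * cov_proj \<xi>) (- (of_nat n - 1) / 2) (fps_to_fls (Abs_fps b)))"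

definition root_sector :: "nat \<Rightarrow> ucover \<Rightarrow> ucover set" where
  "root_sector n \<xi> = {z. \<bar>cov_arg z - (pi / 2 - cov_arg \<xi>)\<bar> < pi / real n}"

(* Poincare asymptotics as |z| tends to infinity within (hence uniformly on) the sector *)
definition has_J_hat_expansion ::
    "nat \<Rightarrow> (nat \<Rightarrow> complex) \<Rightarrow> ucover \<Rightarrow> (ucover \<Rightarrow> complex) \<Rightarrow> bool" where
  "has_J_hat_expansion n lam \<xi> w \<longleftrightarrow>
     (\<forall>M::nat.
        (\<lambda>z. w z / (exp (\<i> * of_nat n * cov_proj \<xi> * cov_proj z)
                     * cov_pow z (- (of_nat n - 1) / 2))
             - (\<Sum>m<M. bessel_B n lam \<xi> m / cov_proj z ^ m))
        \<in> O[inf (filtercomap cov_mod at_top) (principal (root_sector n \<xi>))](\<lambda>z. 1 / cov_proj z ^ M))"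

definition J_root :: "nat \<Rightarrow> (nat \<Rightarrow> complex) \<Rightarrow> ucover \<Rightarrow> ucover \<Rightarrow> complex" where
  "J_root n lam \<xi> =
     (THE w. bessel_solution n lam (cov_proj \<xi> ^ n) w \<and> has_J_hat_expansion n lam \<xi> w)"


definition L_set :: "nat \<Rightarrow> (nat \<Rightarrow> int) \<Rightarrow> int \<Rightarrow> nat set" where
  "L_set n sg \<delta> = {l \<in> {1..n}. sg l = \<delta>}"

definition n_sgn :: "nat \<Rightarrow> (nat \<Rightarrow> int) \<Rightarrow> int \<Rightarrow> nat" where
  "n_sgn n sg \<delta> = card (L_set n sg \<delta>)"

(* \<delta> = 1 selects the upper signs, \<delta> = -1 the lower signs. *)
definition c_const :: "nat \<Rightarrow> (nat \<Rightarrow> int) \<Rightarrow> (nat \<Rightarrow> complex) \<Rightarrow> int \<Rightarrow> complex" where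
  "c_const n sg lam \<delta> =
     e2pi (- of_int \<delta> * (of_nat n - 1) / 8
           + of_int \<delta> * (of_nat n - 1) * of_nat (n_sgn n sg \<delta>) / (4 * of_nat n)
           - of_int \<delta> * (1 / 2) * (\<Sum>l\<in>L_set n sg \<delta>. lam l))"

definition xi_const :: "nat \<Rightarrow> (nat \<Rightarrow> int) \<Rightarrow> int \<Rightarrow> complex" where
  "xi_const n sg \<delta> =
     - of_int \<delta> * exp (- of_int \<delta> * of_real pi * \<i> * of_nat (n_sgn n sg \<delta>) / of_nat n)"

definition xi_lift :: "nat \<Rightarrow> (nat \<Rightarrow> int) \<Rightarrow> ucover" where
  "xi_lift n sg = cov_polar 1 (real (n_sgn n sg (-1)) / real n * pi)"

end

theory Submission
  imports Defs "HOL-Real_Asymp.Real_Asymp"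
begin

text \<open>
  With \<open>u = log z - \<i> \<theta>\<close>, where \<open>\<theta> = \<pi> (n\<^sub>+ - n\<^sub>-) / 2n\<close>, the exponential factors of the
  integrand are absorbed into the argument, so \<open>J(z;sg,lam)\<close> is a constant times one
  Mellin-Barnes integral \<open>K(u)\<close> of \<open>\<Prod> \<Gamma>(s - lam l)\<close>, which is entire in \<open>u\<close> once the
  contour is bent to the left, and which solves \<open>\<Prod> (d/du + n lam l) K = (-n)\<^bsup>n\<^esup> e\<^bsup>nu\<^esup> K\<close>
  because \<open>s \<mapsto> s + 1\<close> shifts the product of Gamma functions. Put \<open>y = e\<^bsup>u\<^esup>\<close> and
  \<open>v(y) = y\<^bsup>(n-1)/2\<^esup> K\<close>. It remains to expand \<open>v\<close> in the half plane \<open>Re y \<ge> 0\<close> and to see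
  that the expansion determines the solution.

  By Gauss's multiplication formula \<open>\<Prod> \<Gamma>(s - lam l)\<close> is asymptotically a constant times
  \<open>n\<^bsup>-ns\<^esup> \<Gamma>(ns - (n-1)/2)\<close>. On the positive axis this compares \<open>v\<close> with the case
  \<open>n = 1\<close>, the Cahen-Mellin integral of \<open>e\<^bsup>-y\<^esup>\<close>, but it
  yields only the leading term of \<open>v\<close> and of its derivatives. The full expansion, uniformly in the half
  plane, follows from the differential equation: the difference of \<open>v\<close> and a truncated formal
  solution satisfies the equation up to a small residual. In the scaled derivatives the equation is,
  up to \<open>O(|y|\<^bsup>-2\<^esup>)\<close>, a linear system \<open>x' = n U x\<close> with \<open>U\<close> unitary, so \<open>|x|\<close>
  cannot grow backwards along a segment of length \<open>L\<close> faster than \<open>e\<^bsup>nL\<^esup>\<close>. Since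
  \<open>e\<^bsup>-ny\<^esup>\<close> is the most rapidly decaying solution, integrating from the far end of the
  real axis back to \<open>y\<close> loses nothing. The same estimate shows that a solution that is
  \<open>o(e\<^bsup>-ny\<^esup>)\<close> vanishes, which is the uniqueness of \<open>J(z;lam;xi)\<close>.
\<close>

section \<open>Products of Gamma functions\<close>

text \<open>Three obstacles shape the argument. When all signs agree, |Im u| = \<pi>/2 for every x >
  0 and the integrand decays on vertical lines only like a power of |s|, so continuation and
  differentiation cannot be read off the original contour; on a hyperbola opening to the left both
  become routine. The factor y^((n-1)/2) is the one that removes the (n-1)-st derivative from the
  equation: only then is the perturbation of the unitary system O(|y|^-2), hence integrable along a
  ray. Finally, an asymptotic formula known on the axis alone cannot be differentiated, so the
  derivatives that enter the Gronwall argument are computed directly from their own integrals. That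
  argument asks for one sequence of points tending to infinity; at y = N/n with N a natural number,
  the comparison integral equals e^(-N) exactly and elementary bounds for factorials control the
  error. The sector of half-width \<pi>/n in the definition of \<open>J_root\<close>, once rotated,
  lies in Re y \<ge> 0 because n \<ge> 2.\<close>

lemma sum_inverse_square_shift_le:
  fixes x :: real
  assumes "x \<ge> 1"
  shows "(\<Sum>j<m. 1 / (x + real j)\<^sup>2) \<le> 2 / x"
proof -
  have "(\<Sum>j<m. 1 / (x + real j)\<^sup>2) \<le> 2 / x - 2 / (x + real m)"
  proof (induction m)
    case (Suc m)
    define y where "y = x + real m"
    have y: "y \<ge> 1" using assms by (simp add: y_def)
    have "1 / y\<^sup>2 \<le> 2 / y - 2 / (y + 1)"
      using y by (simp add: divide_simps power2_eq_square)
    then show ?case using Suc by (simp add: y_def add_ac)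
  qed auto
  moreover have "2 / (x + real m) \<ge> 0" using assms by simp
  ultimately show ?thesis by linarith
qed

text \<open>With \<open>M\<close> the supremum of |a_k|, summing increments from k to infinity gives
  |a_k - 1| \<le> 2DM/x. Since x \<ge> 4D this yields M \<le> 1 + M/2, so M \<le> 2. Applied to
  values at s, s+1, s+2, ..., it turns a limit at infinity and a bound for consecutive ratios into a
  rate at the starting point.\<close>

lemma small_ratio_sequence_close_to_limit:
  fixes a :: "nat \<Rightarrow> complex" and x D :: real
  assumes lim: "a \<longlonglongrightarrow> 1" and x: "x \<ge> 1" and D: "D \<ge> 0" "x \<ge> 4 * D"
    and rec: "\<And>k. norm (a (Suc k) - a k) \<le> D / (x + real k)\<^sup>2 * norm (a k)"
  shows "norm (a 0 - 1) \<le> 4 * D / x"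
proof -
  have bdd: "bdd_above (range (\<lambda>k. norm (a k)))"
    using lim[THEN convergentI, THEN convergent_imp_Bseq] by (auto simp: Bseq_def bdd_above_def)
  define M where "M = (SUP k. norm (a k))"
  have M: "norm (a k) \<le> M" for k unfolding M_def by (rule cSUP_upper[OF _ bdd]) simp
  have M0: "M \<ge> 0" using M[of 0] norm_ge_zero order_trans by blast
  have diff: "norm (a (k + m) - a k) \<le> D * M * (2 / x)" for k m
  proof -
    have "norm (a (k + m) - a k) \<le> (\<Sum>j<m. D / (x + real j)\<^sup>2 * M)"
    proof (induction m)
      case (Suc m)
      have "norm (a (k + Suc m) - a k) \<le> norm (a (Suc (k + m)) - a (k + m)) + norm (a (k + m) - a k)"
        using norm_triangle_ineq[of "a (Suc (k + m)) - a (k + m)" "a (k + m) - a k"] by simp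
      also have "norm (a (Suc (k + m)) - a (k + m)) \<le> D / (x + real (k + m))\<^sup>2 * norm (a (k + m))"
        by (rule rec)
      also have "\<dots> \<le> D / (x + real m)\<^sup>2 * M"
        using x D M by (intro mult_mono divide_left_mono power_mono) (auto intro!: mult_pos_pos)
      finally show ?case using Suc by simp
    qed auto
    also have "\<dots> = D * M * (\<Sum>j<m. 1 / (x + real j)\<^sup>2)"
      by (simp add: sum_distrib_left sum_distrib_right mult_ac)
    also have "\<dots> \<le> D * M * (2 / x)"
      using sum_inverse_square_shift_le[OF x] M0 D by (intro mult_left_mono) auto
    finally show ?thesis .
  qed
  have close: "norm (a k - 1) \<le> D * M * (2 / x)" for k
  proof -
    have "(\<lambda>m. norm (a (k + m) - a k)) \<longlonglongrightarrow> norm (1 - a k)"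
      using LIMSEQ_ignore_initial_segment[OF lim, of k] by (intro tendsto_intros) (simp add: add.commute)
    then have "norm (1 - a k) \<le> D * M * (2 / x)"
      by (rule LIMSEQ_le_const2) (use diff in auto)
    then show ?thesis by (simp add: norm_minus_commute)
  qed
  have "M \<le> 1 + D * M * (2 / x)"
    unfolding M_def
  proof (rule cSUP_least)
    fix k
    have "norm (a k) \<le> norm (a k - 1) + norm (1::complex)" using norm_triangle_ineq[of "a k - 1" 1] by simp
    then show "norm (a k) \<le> 1 + D * (SUP k. norm (a k)) * (2 / x)" using close[of k] by (simp add: M_def)
  qed auto
  moreover have "D * M * (2 / x) \<le> M / 2"
  proof -
    have "2 * D / x \<le> 1 / 2" using D x by (simp add: divide_simps)
    from mult_right_mono[OF this M0] show ?thesis by (simp add: mult_ac)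
  qed
  ultimately have "M \<le> 2" by simp
  then have "D * M * (2 / x) \<le> D * 2 * (2 / x)" using D x by (intro mult_right_mono mult_left_mono) auto
  then show ?thesis using close[of 0] by simp
qed

lemma norm_exp_minus_linear_le: "norm (exp z - 1 - z) \<le> (norm z)\<^sup>2 * exp (norm (z::complex))"
  using Taylor_exp_field[of z 1] by (simp add: algebra_simps power2_eq_square)

text \<open>The linear terms of 1 - lam w and (1 + w)^lam cancel, which leaves O(w^2). With w = 1/t
  the expression is the ratio of consecutive values of Gamma(t - lam) t^lam / Gamma(t).\<close>

lemma power_correction_bound:
  fixes lam w :: complex and L :: real
  assumes L: "norm lam \<le> L" "L \<ge> 1" and w: "norm w < 1 / 2"
  shows "norm ((1 - lam * w) * exp (lam * Ln (1 + w)) - 1)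
           \<le> (2 * L + 2 * L\<^sup>2 + (1 + L) * (4 * L\<^sup>2 * exp L)) * (norm w)\<^sup>2"
proof -
  define e where "e = lam * Ln (1 + w)"
  have "norm (Ln (1 + w) - w) \<le> (norm w)\<^sup>2 / (1 - norm w)" using w by (intro Ln_approx_linear) auto
  also have "\<dots> \<le> (norm w)\<^sup>2 / (1 / 2)" using w by (intro divide_left_mono) auto
  finally have ln1: "norm (Ln (1 + w) - w) \<le> 2 * (norm w)\<^sup>2" by simp
  have "norm (Ln (1 + w)) \<le> 2 * norm w" using w by (intro norm_Ln_le) auto
  then have ne: "norm e \<le> 2 * L * norm w"
    unfolding e_def norm_mult using L mult_mono[of "norm lam" L "norm (Ln (1 + w))" "2 * norm w"] by (simp add: mult_ac)
  also have "\<dots> \<le> L" using w L mult_left_mono[of "norm w" "1/2" "2 * L"] by simp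
  finally have ne': "norm e \<le> L" .
  have "norm (e - lam * w) = norm lam * norm (Ln (1 + w) - w)"
    by (simp add: e_def norm_mult[symmetric] algebra_simps)
  also have "\<dots> \<le> L * (2 * (norm w)\<^sup>2)" using L ln1 by (intro mult_mono) auto
  finally have e1: "norm (e - lam * w) \<le> 2 * L * (norm w)\<^sup>2" by simp
  have "norm (exp e - 1 - e) \<le> (norm e)\<^sup>2 * exp (norm e)" by (rule norm_exp_minus_linear_le)
  also have "\<dots> \<le> (2 * L * norm w)\<^sup>2 * exp L" using ne ne' by (intro mult_mono power_mono) auto
  finally have e2: "norm (exp e - 1 - e) \<le> 4 * L\<^sup>2 * exp L * (norm w)\<^sup>2" by (simp add: power_mult_distrib mult_ac)
  have nlw: "norm (lam * w) \<le> L * norm w" using L by (simp add: norm_mult mult_right_mono)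
  have "norm (lam * w * e) \<le> (L * norm w) * (2 * L * norm w)"
    unfolding norm_mult[of "lam * w"] using nlw ne L by (intro mult_mono) auto
  then have e3: "norm (lam * w * e) \<le> 2 * L\<^sup>2 * (norm w)\<^sup>2" by (simp add: power2_eq_square mult_ac)
  have "norm (1 - lam * w) \<le> 1 + L"
    using norm_triangle_ineq4[of 1 "lam * w"] order_trans[OF nlw mult_left_le[of "norm w" L]] w L by simp
  then have e4: "norm ((1 - lam * w) * (exp e - 1 - e)) \<le> (1 + L) * (4 * L\<^sup>2 * exp L * (norm w)\<^sup>2)"
    unfolding norm_mult using e2 L by (intro mult_mono) auto
  have "(1 - lam * w) * exp e - 1 = (e - lam * w) - lam * w * e + (1 - lam * w) * (exp e - 1 - e)"
    by (simp add: algebra_simps)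
  also have "norm \<dots> \<le> 2 * L * (norm w)\<^sup>2 + 2 * L\<^sup>2 * (norm w)\<^sup>2 + (1 + L) * (4 * L\<^sup>2 * exp L * (norm w)\<^sup>2)"
    by (intro norm_triangle_le norm_triangle_le_diff add_mono e1 e3 e4)
  finally show ?thesis by (simp add: e_def algebra_simps)
qed

text \<open>Gauss's limit formula, solved for Gamma(z + k) = (z)_k Gamma(z). The normalisation k!
  k^(z-1) allows quotients with different z to be formed at once.\<close>

lemma Gamma_shift_asymp:
  fixes z :: complex
  assumes z: "z \<notin> \<int>\<^sub>\<le>\<^sub>0"
  shows "(\<lambda>k. Gamma (z + of_nat k) / (fact k * exp ((z - 1) * of_real (ln (real k))))) \<longlonglongrightarrow> 1"
proof -
  have G0: "Gamma z \<noteq> 0" using z by (simp add: Gamma_eq_zero_iff)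
  have 1: "(\<lambda>k. of_nat k / (z + of_nat k)) \<longlonglongrightarrow> 1"
  proof -
    have "(\<lambda>k. inverse (z / of_nat k + 1)) \<longlonglongrightarrow> inverse (0 + 1)"
      by (intro tendsto_intros lim_const_over_n) auto
    moreover have "eventually (\<lambda>k. inverse (z / of_nat k + 1) = of_nat k / (z + of_nat k)) sequentially"
      using eventually_gt_at_top[of 0]
      by eventually_elim (simp add: field_simps)
    ultimately show ?thesis by (simp add: filterlim_cong)
  qed
  have "(\<lambda>k. Gamma z * (of_nat k / (z + of_nat k)) / Gamma_series z k) \<longlonglongrightarrow> Gamma z * 1 / Gamma z"
    by (intro tendsto_intros 1 Gamma_series_LIMSEQ G0)
  moreover have "eventually (\<lambda>k. Gamma z * (of_nat k / (z + of_nat k)) / Gamma_series z k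
      = Gamma (z + of_nat k) / (fact k * exp ((z - 1) * of_real (ln (real k))))) sequentially"
    using eventually_gt_at_top[of 0]
  proof eventually_elim
    case (elim k)
    have zk: "z + of_nat k \<noteq> 0" 
    proof
      assume "z + of_nat k = 0"
      then have "z = - of_nat k" by (rule eq_neg_iff_add_eq_0[THEN iffD2])
      then show False using z minus_of_nat_in_nonpos_Ints[of k] by simp
    qed
    have e: "exp (of_real (ln (real k))) = (of_nat k :: complex)"
      using elim by (simp only: exp_of_real exp_ln of_nat_0_less_iff of_real_of_nat_eq)
    have "Gamma (z + of_nat k) = pochhammer z k * Gamma z"
      using pochhammer_Gamma[OF z, of k] G0 by simp
    moreover have "exp ((z - 1) * of_real (ln (real k))) = exp (z * of_real (ln (real k))) / of_nat k"
      using e by (simp add: left_diff_distrib exp_diff)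
    moreover have "Gamma_series z k = fact k * exp (z * of_real (ln (real k))) / (pochhammer z k * (z + of_nat k))"
      by (simp add: Gamma_series_def pochhammer_Suc)
    moreover have "pochhammer z k \<noteq> 0" using z pochhammer_eq_0_imp_nonpos_Int by blast
    ultimately show ?case using elim zk by (simp only:) (simp add: divide_simps)
  qed
  ultimately show ?thesis using G0 by (simp add: filterlim_cong)
qed

text \<open>In the right half plane the arguments of s and of 1 + 1/s are below \<pi>/2 in modulus,
  so no branch jump occurs.\<close>

lemma Ln_add_1:
  assumes "Re s > 0"
  shows "Ln (s + 1) = Ln s + Ln (1 + 1 / s)"
proof -
  have s0: "s \<noteq> 0" using assms by auto
  have w: "Re (1 + 1 / s) > 0"
    using assms by (simp add: Re_divide add_pos_nonneg)
  then have w0: "1 + 1 / s \<noteq> 0" by (metis less_irrefl zero_complex.sel(1))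
  have "Ln (s * (1 + 1 / s)) = Ln s + Ln (1 + 1 / s)"
    using w w0 s0 Re_Ln_pos_lt_imp[OF assms] Re_Ln_pos_lt_imp[OF w]
    by (intro Ln_times_simple) (auto simp: abs_less_iff)
  then show ?thesis using s0 by (simp add: distrib_left)
qed

lemma Gamma_quotient_tendsto:
  assumes s: "Re s > 0" and z: "s - lam \<notin> \<int>\<^sub>\<le>\<^sub>0"
  shows "(\<lambda>k. Gamma (s + of_nat k - lam) * exp (lam * Ln (s + of_nat k)) / Gamma (s + of_nat k)) \<longlonglongrightarrow> 1"
proof -
  have s': "s \<notin> \<int>\<^sub>\<le>\<^sub>0" using s by (auto elim!: nonpos_Ints_cases)
  have ln: "(\<lambda>k. exp (lam * Ln (1 + s / of_nat k))) \<longlonglongrightarrow> exp (lam * Ln (1 + 0))"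
    by (intro tendsto_intros lim_const_over_n) auto
  have "(\<lambda>k. Gamma (s - lam + of_nat k) / (fact k * exp ((s - lam - 1) * of_real (ln (real k))))
       / (Gamma (s + of_nat k) / (fact k * exp ((s - 1) * of_real (ln (real k)))))
       * exp (lam * Ln (1 + s / of_nat k))) \<longlonglongrightarrow> 1 / 1 * exp (lam * Ln (1 + 0))"
    by (intro tendsto_mult tendsto_divide Gamma_shift_asymp z s' ln) auto
  moreover have "eventually (\<lambda>k. Gamma (s - lam + of_nat k) / (fact k * exp ((s - lam - 1) * of_real (ln (real k))))
       / (Gamma (s + of_nat k) / (fact k * exp ((s - 1) * of_real (ln (real k)))))
       * exp (lam * Ln (1 + s / of_nat k))
     = Gamma (s + of_nat k - lam) * exp (lam * Ln (s + of_nat k)) / Gamma (s + of_nat k)) sequentially"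
    using eventually_gt_at_top[of 0]
  proof eventually_elim
    case (elim k)
    have w: "Re (1 + s / of_nat k) > 0" using s elim by (simp add: add_pos_nonneg)
    then have w0: "1 + s / of_nat k \<noteq> 0" by (metis less_irrefl zero_complex.sel(1))
    have "Ln (of_real (real k) * (1 + s / of_nat k)) = of_real (ln (real k)) + Ln (1 + s / of_nat k)"
      using elim w0 by (subst Ln_times_of_real) auto
    moreover have "of_real (real k) * (1 + s / of_nat k) = s + of_nat k"
      using elim by (simp add: field_simps)
    ultimately have L: "Ln (s + of_nat k) = of_real (ln (real k)) + Ln (1 + s / of_nat k)" by simp
    have "exp ((s - lam - 1) * of_real (ln (real k))) * exp (lam * of_real (ln (real k)))
        = exp ((s - 1) * of_real (ln (real k)))"
      by (simp add: exp_add[symmetric] algebra_simps)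
    then have e: "exp ((s - 1) * of_real (ln (real k))) = exp ((s - lam - 1) * of_real (ln (real k))) * exp (lam * of_real (ln (real k)))" by simp
    have c: "s - lam + of_nat k = s + of_nat k - lam" by simp
    show ?case unfolding L distrib_left exp_add e c by (simp add: field_simps)
  qed
  ultimately show ?thesis by (simp add: filterlim_cong)
qed

text \<open>The recursion s -> s + 1 takes the place of a Stirling series: q(s) = Gamma(s - lam)
  s^lam / Gamma(s) tends to 1 along s + k and changes by a factor 1 + O(|s + k|^-2) in each step.
  Uniformity for |lam| \<le> L is needed in the vertical bound, where the shift varies over a
  bounded set.\<close>

lemma Gamma_quotient_asymp:
  fixes L :: real
  assumes "L \<ge> 1"
  shows "\<exists>C\<ge>0. \<exists>R\<ge>1. \<forall>lam s. norm lam \<le> L \<longrightarrow> Re s > 0 \<longrightarrow> norm s \<ge> R \<longrightarrow>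
      norm (Gamma (s - lam) * exp (lam * Ln s) / Gamma s - 1) \<le> C / norm s"
proof -
  define E where "E = 2 * L + 2 * L\<^sup>2 + (1 + L) * (4 * L\<^sup>2 * exp L)"
  define D where "D = 2 * E"
  have D: "D \<ge> 0" using assms by (simp add: D_def E_def)
  \<comment> \<open>The bound 4D is demanded by the lemma on sequences; 3L keeps s + k - lam off the
    poles of Gamma and makes |s + k| \<ge> 3, so that |1/t| < 1/2.\<close>
  have "norm (Gamma (s - lam) * exp (lam * Ln s) / Gamma s - 1) \<le> (4 * D) / norm s"
    if lam: "norm lam \<le> L" and s: "Re s > 0" and ns: "norm s \<ge> max (4 * D) (3 * L)" for lam s
  proof -
    define q where "q s = Gamma (s - lam) * exp (lam * Ln s) / Gamma s" for s
    have np: "s + of_nat k - lam \<notin> \<int>\<^sub>\<le>\<^sub>0" for k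
    proof
      assume "s + of_nat k - lam \<in> \<int>\<^sub>\<le>\<^sub>0"
      then obtain m where "s + of_nat k - lam = of_int m" "m \<le> 0"
        by (auto elim!: nonpos_Ints_cases)
      then have "Im (s + of_nat k - lam) = 0" "Re (s + of_nat k - lam) \<le> 0" by simp_all
      then have "Im s = Im lam" "Re s \<le> Re lam" by auto
      then have "norm s \<le> \<bar>Re lam\<bar> + \<bar>Im lam\<bar>" using s cmod_le[of s] by simp
      also have "\<dots> \<le> 2 * L" using abs_Re_le_cmod[of lam] abs_Im_le_cmod[of lam] lam by linarith
      finally show False using ns assms by simp
    qed
    have sk: "s + of_nat k \<notin> \<int>\<^sub>\<le>\<^sub>0" for k
      using s by (auto elim!: nonpos_Ints_cases dest!: arg_cong[where f = Re])
    \<comment> \<open>For Re s > 0 the cross term in |s + k|^2 is nonnegative. Passing from |s + k|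
      to |s| + k costs the factor 2 that distinguishes \<open>D\<close> from
      \<open>E\<close>.\<close>
    have nsk: "(norm s + real k)\<^sup>2 \<le> 2 * (norm (s + of_nat k))\<^sup>2" for k
    proof -
      have "(norm (s + of_nat k))\<^sup>2 \<ge> (norm s)\<^sup>2 + (real k)\<^sup>2"
        using s by (simp only: cmod_power2) (simp add: power2_eq_square algebra_simps)
      moreover have "(norm s + real k)\<^sup>2 \<le> 2 * ((norm s)\<^sup>2 + (real k)\<^sup>2)"
        using sum_squares_bound[of "norm s" "real k"] by (simp add: power2_sum)
      ultimately show ?thesis by simp
    qed
    have "norm (q (s + of_nat 0) - 1) \<le> 4 * D / norm s"
    proof (rule small_ratio_sequence_close_to_limit)
      show "(\<lambda>k. q (s + of_nat k)) \<longlonglongrightarrow> 1"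
        unfolding q_def using Gamma_quotient_tendsto[OF s] np[of 0] by simp
      show "norm s \<ge> 1" "D \<ge> 0" "norm s \<ge> 4 * D" using ns assms D by auto
      fix k
      define t where "t = s + of_nat k"
      have t: "Re t > 0" using s by (simp add: t_def)
      have t0: "t \<noteq> 0" using t by auto
      have "norm s \<le> norm t"
        using s by (auto simp: t_def norm_complex_def intro!: real_sqrt_le_mono power_mono add_mono)
      then have nt: "norm t \<ge> 3" using ns assms by simp
      have w: "norm (1 / t) < 1 / 2" using nt by (simp add: norm_divide divide_simps)
      have G: "Gamma (t - lam + 1) = (t - lam) * Gamma (t - lam)" "Gamma (t + 1) = t * Gamma t"
        using np[of k] sk[of k] by (auto intro!: Gamma_plus1 simp: t_def)
      have "q (t + 1) = Gamma (t - lam + 1) * exp (lam * Ln (t + 1)) / Gamma (t + 1)"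
        by (simp add: q_def algebra_simps)
      also have "\<dots> = q t * ((1 - lam * (1 / t)) * exp (lam * Ln (1 + 1 / t)))"
        unfolding G Ln_add_1[OF t] q_def using t0 by (simp add: distrib_left exp_add) (simp add: field_simps)
      finally have "q (t + 1) - q t = q t * ((1 - lam * (1 / t)) * exp (lam * Ln (1 + 1 / t)) - 1)"
        by (simp add: algebra_simps)
      then have "norm (q (t + 1) - q t) = norm ((1 - lam * (1 / t)) * exp (lam * Ln (1 + 1 / t)) - 1) * norm (q t)"
        by (simp add: norm_mult)
      also have "\<dots> \<le> D / 2 * (norm (1 / t))\<^sup>2 * norm (q t)"
        using power_correction_bound[OF lam assms w] by (intro mult_right_mono) (simp_all add: D_def E_def[symmetric])
      also have "D / 2 * (norm (1 / t))\<^sup>2 \<le> D / (norm s + real k)\<^sup>2"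
      proof -
        have "0 < norm s + real k" using s by (intro add_pos_nonneg) auto
        then have "D / (2 * (norm t)\<^sup>2) \<le> D / (norm s + real k)\<^sup>2"
          using nsk[of k] D t0 unfolding t_def[symmetric] by (intro divide_left_mono mult_pos_pos zero_less_power) simp_all
        then show ?thesis by (simp only: norm_divide norm_one power_divide power_one) simp
      qed
      finally show "norm (q (s + of_nat (Suc k)) - q (s + of_nat k)) \<le> D / (norm s + real k)\<^sup>2 * norm (q (s + of_nat k))"
        by (simp add: t_def add_ac mult_right_mono)
    qed
    then show ?thesis by (simp add: q_def)
  qed
  then show ?thesis using D assms
    by (intro exI[of _ "4 * D"] conjI exI[of _ "max (4 * D) (3 * L)"]) auto
qed

text \<open>At z = 1/2 + iy the point 1 - z is the conjugate of z, so the reflection formula gives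
  |Gamma(z)|^2 = \<pi> / cosh(\<pi> y). The exponential decay in vertical direction is always
  derived from this line.\<close>

lemma norm_Gamma_half:
  "norm (Gamma (Complex (1/2) y)) \<le> sqrt (2 * pi) * exp (- pi * \<bar>y\<bar> / 2)"
proof -
  define z where "z = Complex (1/2) y"
  have c: "1 - z = cnj z" by (simp add: z_def complex_eq_iff)
  have "norm (Gamma z) ^ 2 = norm (Gamma z * Gamma (1 - z))"
    unfolding c cnj_Gamma[symmetric] by (simp add: norm_mult power2_eq_square)
  also have "\<dots> = pi / norm (sin (of_real pi * z))"
    by (simp add: Gamma_reflection_complex norm_divide)
  also have "of_real pi * z = of_real pi / 2 + \<i> * of_real (pi * y)"
    by (simp add: z_def complex_eq_iff)
  also have "sin (of_real pi / 2 + \<i> * of_real (pi * y)) = cos (\<i> * of_real (pi * y))"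
    by (simp add: sin_add)
  also have "cos (\<i> * of_real (pi * y)) = of_real (cosh (pi * y))"
    unfolding cosh_def cos_exp_eq
    by (simp add: exp_of_real[symmetric] scaleR_conv_of_real minus_mult_left[symmetric] mult.assoc[symmetric])
  also have "norm (of_real (cosh (pi * y)) :: complex) = cosh (pi * y)"
    unfolding norm_of_real by (simp add: cosh_real_nonneg)
  also have "pi / cosh (pi * y) \<le> 2 * pi * exp (- pi * \<bar>y\<bar>)"
  proof -
    have "exp (pi * \<bar>y\<bar>) \<le> 2 * cosh (pi * y)"
      by (cases "y \<ge> 0") (auto simp: cosh_def)
    then have "1 \<le> 2 * cosh (pi * y) * exp (- (pi * \<bar>y\<bar>))"
      by (simp add: exp_minus field_simps)
    then have "pi * 1 \<le> pi * (2 * cosh (pi * y) * exp (- (pi * \<bar>y\<bar>)))"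
      by (intro mult_left_mono) auto
    then show ?thesis using cosh_real_pos[of "pi * y"] by (simp add: pos_divide_le_eq mult_ac)
  qed
  also have "\<dots> = (sqrt (2 * pi) * exp (- pi * \<bar>y\<bar> / 2))\<^sup>2"
    unfolding power_mult_distrib exp_of_nat_mult[symmetric] by simp
  finally show ?thesis unfolding z_def by (rule power2_le_imp_le) simp
qed

section \<open>Stirling's formula for factorials and Gauss's multiplication formula\<close>

text \<open>By the midpoint and trapezoidal bounds for the logarithm, \<open>L\<close> = ln
  \<open>T\<close> decreases and \<open>L\<close> - 1/(4k) increases, so \<open>T\<close> has a
  positive limit. The quotient T(k)^2 / T(2k) has the same limit, and the duplication formula for
  factorials turns it into the limit formula for Gamma(1/2) = sqrt \<pi>.\<close>

lemma Stirling_fact: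
  "(\<lambda>k. fact k * exp (real k) / (real k ^ k * sqrt (real k))) \<longlonglongrightarrow> sqrt (2 * pi)"
proof -
  define L where "L k = ln (fact k) + real k - (real k + 1 / 2) * ln (real k)" for k
  define T where "T k = fact k * exp (real k) / (real k ^ k * sqrt (real k))" for k
  have step: "L k - L (Suc k) = (real k + 1 / 2) * (ln (real k + 1) - ln (real k)) - 1" if "k > 0" for k
  proof -
    have "ln (fact (Suc k) :: real) = ln (real k + 1) + ln (fact k)"
      by (simp add: ln_mult add.commute)
    then show ?thesis by (simp add: L_def algebra_simps)
  qed
  have dec: "L (Suc k) \<le> L k" if "k > 0" for k
  proof -
    have "2 * (real k + 1 - real k) / (real k + (real k + 1)) \<le> ln (real k + 1) - ln (real k)"
      using that by (intro ln_inverse_approx_ge) auto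
    then have "(real k + 1 / 2) * (2 / (2 * real k + 1)) \<le> (real k + 1 / 2) * (ln (real k + 1) - ln (real k))"
      by (intro mult_left_mono) auto
    also have "(real k + 1 / 2) * (2 / (2 * real k + 1)) = 1" by (simp add: field_simps)
    finally show ?thesis using step[OF that] by simp
  qed
  have inc: "L k - 1 / (4 * real k) \<le> L (Suc k) - 1 / (4 * real (Suc k))" if "k > 0" for k
  proof -
    have "ln (real k + 1) - ln (real k) \<le> 1 * (inverse (real k) + inverse (real k + 1)) / 2"
      using that by (intro ln_inverse_approx_le) auto
    then have "(real k + 1 / 2) * (ln (real k + 1) - ln (real k)) \<le> (real k + 1 / 2) * ((inverse (real k) + inverse (real k + 1)) / 2)"
      by (intro mult_left_mono) auto
    also have "\<dots> = 1 + (1 / (4 * real k) - 1 / (4 * real (Suc k)))"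
      using that by (simp add: divide_simps) (simp add: algebra_simps)
    finally show ?thesis using step[OF that] by simp
  qed
  have "decseq (\<lambda>k. L (Suc k))" by (intro decseq_SucI dec) simp
  moreover have "L 1 - 1 / 4 \<le> L (Suc k)" for k
  proof -
    have "L 1 - 1 / 4 \<le> L (Suc k) - 1 / (4 * real (Suc k))"
    proof (induction k)
      case (Suc k) then show ?case using inc[of "Suc k"] by linarith
    qed simp
    also have "\<dots> \<le> L (Suc k)" by simp
    finally show ?thesis .
  qed
  ultimately obtain l where "(\<lambda>k. L (Suc k)) \<longlonglongrightarrow> l"
    using decseq_convergent[of "\<lambda>k. L (Suc k)" "L 1 - 1 / 4"] by blast
  then have "L \<longlonglongrightarrow> l" by (simp only: filterlim_sequentially_Suc)
  then have "(\<lambda>k. exp (L k)) \<longlonglongrightarrow> exp l" by (intro tendsto_intros)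
  moreover have "eventually (\<lambda>k. exp (L k) = T k) sequentially"
    using eventually_gt_at_top[of 0]
  proof eventually_elim
    case (elim k)
    have "exp ((real k + 1 / 2) * ln (real k)) = real k ^ k * sqrt (real k)"
      using elim by (simp add: distrib_right exp_add exp_of_nat_mult powr_half_sqrt[symmetric] powr_def)
    then show ?case using elim by (simp add: L_def T_def exp_add exp_diff)
  qed
  ultimately have T: "T \<longlonglongrightarrow> exp l" by (simp add: filterlim_cong)
  have T2: "(\<lambda>k. T (2 * k)) \<longlonglongrightarrow> exp l"
    by (rule filterlim_compose[OF T]) (simp add: filterlim_subseq strict_mono_def)
  have half: "(1/2::real) \<notin> \<int>\<^sub>\<le>\<^sub>0" by (auto elim!: nonpos_Ints_cases)
  have "(\<lambda>k. sqrt 2 * (Gamma_series (1/2) k * (1 + (1 / 2) / real k))) \<longlonglongrightarrow> sqrt 2 * (Gamma (1/2) * (1 + 0))"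
    by (intro tendsto_intros Gamma_series_LIMSEQ lim_const_over_n)
  moreover have "eventually (\<lambda>k. sqrt 2 * (Gamma_series (1/2) k * (1 + (1 / 2) / real k)) = (T k)\<^sup>2 / T (2 * k)) sequentially"
    using eventually_gt_at_top[of 0]
  proof eventually_elim
    case (elim k)
    define p where "p = pochhammer (1/2 :: real) k"
    have p: "p > 0" unfolding p_def by (intro pochhammer_pos) simp
    have "Gamma_series (1/2) k * (1 + (1 / 2) / real k) = fact k * sqrt (real k) / (p * (1/2 + real k)) * ((1/2 + real k) / real k)"
      using elim by (simp add: Gamma_series_def pochhammer_Suc p_def powr_half_sqrt[symmetric] powr_def add_divide_distrib)
    also have "\<dots> = fact k * (sqrt (real k) / real k) / p"
    proof -
      define c where "c = 1 / 2 + real k"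
      have "c > 0" by (simp add: c_def add_pos_nonneg)
      then show ?thesis unfolding c_def[symmetric] by simp
    qed
    also have "sqrt (real k) / real k = 1 / sqrt (real k)" by (simp only: sqrt_divide_self_eq of_nat_0_le_iff inverse_eq_divide)
    finally have 1: "sqrt 2 * (Gamma_series (1/2) k * (1 + (1 / 2) / real k)) = sqrt 2 * fact k / (p * sqrt (real k))" by simp
    have "(T k)\<^sup>2 / T (2 * k) = (fact k)\<^sup>2 * (exp (real k))\<^sup>2 / ((real k ^ k)\<^sup>2 * real k) * (real (2*k) ^ (2 * k) * sqrt (real (2 * k))) / (fact (2 * k) * exp (real (2 * k)))"
      unfolding T_def by (simp add: power_divide power_mult_distrib)
    also have "exp (real (2 * k)) = (exp (real k))\<^sup>2" by (simp add: exp_double)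
    also have "real (2*k) ^ (2 * k) = 2 ^ (2 * k) * (real k ^ k)\<^sup>2" by (simp add: power_mult_distrib power_mult[symmetric] mult.commute)
    also have "fact (2 * k) = (2 ^ (2 * k) * p * fact k :: real)" by (simp add: fact_double p_def)
    also have "sqrt (real (2 * k)) = sqrt 2 * sqrt (real k)" by (simp add: real_sqrt_mult)
    also have "(fact k)\<^sup>2 * (exp (real k))\<^sup>2 / ((real k ^ k)\<^sup>2 * real k) * (2 ^ (2 * k) * (real k ^ k)\<^sup>2 * (sqrt 2 * sqrt (real k))) / (2 ^ (2 * k) * p * fact k * (exp (real k))\<^sup>2)
       = sqrt 2 * fact k / p * (sqrt (real k) / real k)"
      using elim p by (simp add: power2_eq_square mult_ac)
    also have "sqrt (real k) / real k = 1 / sqrt (real k)" by (simp only: sqrt_divide_self_eq of_nat_0_le_iff inverse_eq_divide)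
    finally show ?case using 1 by simp
  qed
  ultimately have "(\<lambda>k. (T k)\<^sup>2 / T (2 * k)) \<longlonglongrightarrow> sqrt 2 * (Gamma (1 / 2) * (1 + 0))"
    by (rule Lim_transform_eventually)
  then have "(\<lambda>k. (T k)\<^sup>2 / T (2 * k)) \<longlonglongrightarrow> sqrt 2 * sqrt pi" by (simp add: Gamma_one_half_real)
  moreover have "(\<lambda>k. (T k)\<^sup>2 / T (2 * k)) \<longlonglongrightarrow> (exp l)\<^sup>2 / exp l"
    by (intro tendsto_intros T T2) simp
  ultimately have "(exp l)\<^sup>2 / exp l = sqrt 2 * sqrt pi" by (rule LIMSEQ_unique[rotated])
  then have "exp l = sqrt (2 * pi)" by (simp add: power2_eq_square real_sqrt_mult)
  then show ?thesis using T unfolding T_def by simp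
qed

text \<open>The shift s -> s + 1/n moves every factor of the product to the next one and replaces
  Gamma(s) by Gamma(s + 1) = s Gamma(s); the other two factors of the quotient \<open>H\<close>
  cancel this. So \<open>H\<close> has period 1/n, hence period 1, and equals its limit along s + j,
  which involves only factorials.\<close>

theorem Gamma_multiplication:
  fixes s :: complex
  assumes n: "n > 0" and s: "Re s > 0"
  shows "(\<Prod>k<n. Gamma (s + of_nat k / of_nat n)) * exp (of_nat n * s * of_real (ln (real n))) / Gamma (of_nat n * s)
           = of_real (sqrt (2 * pi) ^ (n - 1) * sqrt (real n))"
proof -
  define H where "H s = (\<Prod>k<n. Gamma (s + of_nat k / of_nat n)) * exp (of_nat n * s * of_real (ln (real n))) / Gamma (of_nat n * s)" for s :: complex
  have np: "z \<notin> \<int>\<^sub>\<le>\<^sub>0" if "Re z > 0" for z :: complex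
    using that by (auto elim!: nonpos_Ints_cases)
  have H1: "H (s + 1 / of_nat n) = H s" if s: "Re s > 0" for s
  proof -
    have s0: "s \<noteq> 0" using s by auto
    have G0: "Gamma s \<noteq> 0" using np[OF s] by (simp add: Gamma_eq_zero_iff)
    define f where "f k = Gamma (s + of_nat k / of_nat n)" for k
    have "f 0 * (\<Prod>k<n. f (Suc k)) = (\<Prod>k<n. f k) * f n"
      by (metis prod.lessThan_Suc prod.lessThan_Suc_shift)
    moreover have "f n = s * Gamma s" using n Gamma_plus1[OF np[OF s]] by (simp add: f_def)
    moreover have "f 0 = Gamma s" by (simp add: f_def)
    ultimately have "(\<Prod>k<n. f (Suc k)) = (\<Prod>k<n. f k) * s" using G0 by (simp add: mult_ac)
    then have P: "(\<Prod>k<n. Gamma (s + 1 / of_nat n + of_nat k / of_nat n)) = (\<Prod>k<n. Gamma (s + of_nat k / of_nat n)) * s"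
      by (simp add: f_def add_divide_distrib add_ac)
    have e: "exp (of_nat n * (s + 1 / of_nat n) * of_real (ln (real n))) = exp (of_nat n * s * of_real (ln (real n))) * of_nat n"
      using n by (simp add: distrib_left distrib_right exp_add exp_of_real)
    have G: "Gamma (of_nat n * (s + 1 / of_nat n)) = of_nat n * s * Gamma (of_nat n * s)"
      using n s Gamma_plus1[of "of_nat n * s"] np[of "of_nat n * s"] by (simp add: distrib_left)
    show ?thesis unfolding H_def P e G using n s0 by simp
  qed
  have Hj: "H (s + of_nat j / of_nat n) = H s" for j
  proof (induction j)
    case (Suc j)
    have "H (s + of_nat j / of_nat n + 1 / of_nat n) = H (s + of_nat j / of_nat n)"
      using s by (intro H1) (simp add: add_pos_nonneg)
    then show ?case using Suc by (simp add: add_divide_distrib add_ac)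
  qed simp
  have HJ: "H (s + of_nat j) = H s" for j using Hj[of "n * j"] n by simp
  define T where "T k = fact k * exp (real k) / (real k ^ k * sqrt (real k))" for k
  \<comment> \<open>What is left once all n + 1 Gamma values are normalised by factorials: j!^n /
    (nj)! with powers of n and j, arranged so that Stirling's formula gives the limit. The factors
    e^(nj) cancel.\<close>
  define m where "m j = T j ^ n / T (n * j) * sqrt (real n)" for j
  have T: "T \<longlonglongrightarrow> sqrt (2 * pi)" using Stirling_fact by (simp add: T_def[abs_def])
  have sub: "filterlim (\<lambda>j. n * j) sequentially sequentially"
    using n by (simp add: filterlim_subseq strict_mono_def)
  have m: "m \<longlonglongrightarrow> sqrt (2 * pi) ^ n / sqrt (2 * pi) * sqrt (real n)"
    unfolding m_def by (intro tendsto_intros T filterlim_compose[OF T sub]) simp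
  define u where "u k j = Gamma (s + of_nat k / of_nat n + of_nat j) / (fact j * exp ((s + of_nat k / of_nat n - 1) * of_real (ln (real j))))" for k j
  define v where "v j = Gamma (of_nat n * s + of_nat j) / (fact j * exp ((of_nat n * s - 1) * of_real (ln (real j))))" for j
  have u: "u k \<longlonglongrightarrow> 1" for k unfolding u_def
    using s by (intro Gamma_shift_asymp np) (simp add: add_pos_nonneg)
  have v: "v \<longlonglongrightarrow> 1" unfolding v_def using s n by (intro Gamma_shift_asymp np) simp
  have "(\<lambda>j. (\<Prod>k<n. u k j) / v (n * j) * of_real (m j)) \<longlonglongrightarrow> (\<Prod>k<n. 1) / 1 * of_real (sqrt (2 * pi) ^ n / sqrt (2 * pi) * sqrt (real n))"
    by (intro tendsto_intros tendsto_prod u filterlim_compose[OF v sub] m) simp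
  moreover have "eventually (\<lambda>j. (\<Prod>k<n. u k j) / v (n * j) * of_real (m j) = H s) sequentially"
    using eventually_gt_at_top[of 0]
  proof eventually_elim
    case (elim j)
    define lj ln' where "lj = complex_of_real (ln (real j))" and "ln' = complex_of_real (ln (real n))"
    have lnj: "complex_of_real (ln (real (n * j))) = ln' + lj" using elim n by (simp add: lj_def ln'_def ln_mult)
    have sumk: "(\<Sum>k<n. of_nat k / of_nat n :: complex) = (of_nat n - 1) / 2"
    proof -
      have "(\<Sum>k<n. of_nat k :: complex) = of_nat n * (of_nat n - 1) / 2"
        by (induction n) (auto simp: field_simps)
      then show ?thesis using n by (simp add: sum_divide_distrib[symmetric])
    qed
    have "(\<Prod>k<n. exp ((s + of_nat k / of_nat n - 1) * lj)) = exp (\<Sum>k<n. (s + of_nat k / of_nat n - 1) * lj)"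
      by (simp add: exp_sum)
    also have "(\<Sum>k<n. (s + of_nat k / of_nat n - 1) * lj) = (of_nat n * s + (of_nat n - 1) / 2 - of_nat n) * lj"
      unfolding sum_distrib_right[symmetric] sum_subtractf sum.distrib sumk by simp
    finally have pe: "(\<Prod>k<n. exp ((s + of_nat k / of_nat n - 1) * lj)) = exp ((of_nat n * s + (of_nat n - 1) / 2 - of_nat n) * lj)" .
    define P where "P = (\<Prod>k<n. Gamma (s + of_nat k / of_nat n + of_nat j))"
    have pu: "(\<Prod>k<n. u k j) = P / (fact j ^ n * exp ((of_nat n * s + (of_nat n - 1) / 2 - of_nat n) * lj))"
      unfolding u_def prod_dividef prod.distrib lj_def[symmetric] pe P_def by simp
    have vv: "v (n * j) = Gamma (of_nat n * s + of_nat (n * j)) / (fact (n * j) * exp ((of_nat n * s - 1) * (ln' + lj)))"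
      unfolding v_def lnj ..
    have mm: "complex_of_real (m j) = fact j ^ n * exp (of_nat (n * j) * ln') * of_nat n * exp (- ((of_nat n - 1) / 2) * lj) / fact (n * j)"
    proof -
      have lnr: "ln (real (n * j)) = ln (real n) + ln (real j)" using n elim by (simp add: ln_mult)
      have e1: "sqrt (real j) = exp (ln (real j) / 2)" "sqrt (real n) = exp (ln (real n) / 2)"
        "real j ^ j = exp (real j * ln (real j))" "real (n * j) ^ (n * j) = exp (real (n * j) * (ln (real n) + ln (real j)))"
        "sqrt (real (n * j)) = exp ((ln (real n) + ln (real j)) / 2)"
        using n elim by (auto simp only: powr_half_sqrt[symmetric] powr_def exp_of_nat_mult lnr[symmetric] exp_ln of_nat_0_less_iff nat_0_less_mult_iff of_nat_0_le_iff) auto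
      have "m j = fact j ^ n / fact (n * j) * (exp (real j) ^ n / (real j ^ j) ^ n / sqrt (real j) ^ n * real (n * j) ^ (n * j) * sqrt (real (n * j)) / exp (real (n * j)) * sqrt (real n))"
        by (simp add: m_def T_def power_divide power_mult_distrib mult_ac)
      also have "(exp (real j) ^ n / (real j ^ j) ^ n / sqrt (real j) ^ n * real (n * j) ^ (n * j) * sqrt (real (n * j)) / exp (real (n * j)) * sqrt (real n))
        = exp (real (n * j) * ln (real n) + ln (real n) + - ((real n - 1) / 2) * ln (real j))"
        unfolding e1 exp_of_nat_mult[symmetric] exp_add[symmetric] exp_diff[symmetric]
        by (simp add: algebra_simps diff_divide_distrib add_divide_distrib)
      finally have "m j = fact j ^ n / fact (n * j) * exp (real (n * j) * ln (real n) + ln (real n) + - ((real n - 1) / 2) * ln (real j))" .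
      then have "complex_of_real (m j) = fact j ^ n / fact (n * j) * exp (of_nat (n * j) * ln' + ln' + - ((of_nat n - 1) / 2) * lj)"
        by (simp add: lj_def ln'_def exp_of_real[symmetric])
      moreover have "exp ln' = of_nat n" using n by (simp add: ln'_def exp_of_real)
      ultimately show ?thesis by (simp only: exp_add times_divide_eq_left times_divide_eq_right) (simp add: mult_ac)
    qed
    \<comment> \<open>The powers of n and j balance because the shifts k/n sum to (n - 1)/2.\<close>
    have E: "exp ((of_nat n * s + (of_nat n - 1) / 2 - of_nat n) * lj) * exp (of_nat n * (s + of_nat j) * ln') * exp ((of_nat n - 1) / 2 * lj)
       = exp ((of_nat n * s - 1) * (ln' + lj)) * exp (of_nat (n * j) * ln') * exp ln'"
      unfolding exp_add[symmetric] by (rule arg_cong[where f = exp]) (simp add: field_simps)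
    have eln: "exp ln' = of_nat n" using n by (simp add: ln'_def exp_of_real)
    have "H s = P * exp (of_nat n * (s + of_nat j) * ln') / Gamma (of_nat n * s + of_nat (n * j))"
      unfolding HJ[of j, symmetric] by (simp add: H_def P_def ln'_def add_ac distrib_left)
    also have "exp (of_nat n * (s + of_nat j) * ln') = exp ((of_nat n * s - 1) * (ln' + lj)) * exp (of_nat (n * j) * ln') * of_nat n / exp ((of_nat n * s + (of_nat n - 1) / 2 - of_nat n) * lj) / exp ((of_nat n - 1) / 2 * lj)"
      using E unfolding eln by (simp add: field_simps)
    finally show ?case unfolding pu vv mm mult_minus_left exp_minus by (simp add: field_simps)
  qed
  ultimately have "(\<lambda>_::nat. H s) \<longlonglongrightarrow> (\<Prod>k<n. 1) / 1 * of_real (sqrt (2 * pi) ^ n / sqrt (2 * pi) * sqrt (real n))"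
    by (simp add: filterlim_cong)
  then have "H s = of_real (sqrt (2 * pi) ^ n / sqrt (2 * pi) * sqrt (real n))"
    by (simp add: LIMSEQ_const_iff)
  moreover have "sqrt (2 * pi) ^ n / sqrt (2 * pi) = sqrt (2 * pi) ^ (n - 1)"
    using n by (cases n) auto
  ultimately show ?thesis by (simp add: H_def)
qed

lemma norm_prod_minus_1_le:
  fixes x :: "'a \<Rightarrow> complex"
  assumes "finite A" "\<And>i. i \<in> A \<Longrightarrow> norm (x i - 1) \<le> e" "0 \<le> e" "e \<le> 1"
  shows "norm (prod x A - 1) \<le> real (card A) * 2 ^ card A * e"
  using assms(1,2)
proof (induction A rule: finite_induct)
  case (insert a A)
  have "norm (prod x A) \<le> (\<Prod>i\<in>A. 2)"
    unfolding prod_norm[symmetric]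
  proof (rule prod_mono)
    fix i assume "i \<in> A"
    then show "0 \<le> norm (x i) \<and> norm (x i) \<le> 2"
      using norm_triangle_ineq[of "x i - 1" 1] insert.prems[of i] assms(4) by simp
  qed
  then have P: "norm (prod x A) \<le> 2 ^ card A" by simp
  have "prod x (insert a A) - 1 = prod x A * (x a - 1) + (prod x A - 1)"
    using insert by (simp add: algebra_simps)
  also have "norm \<dots> \<le> 2 ^ card A * e + real (card A) * 2 ^ card A * e"
    using insert P by (intro norm_triangle_mono) (auto simp: norm_mult intro!: mult_mono)
  also have "\<dots> \<le> real (Suc (card A)) * 2 ^ Suc (card A) * e"
    using assms(3) by (simp add: algebra_simps)
  finally show ?case using insert by simp
qed (use assms in auto)

lemma prod_Gamma_quotient_asymp:
  fixes lam :: "'a \<Rightarrow> complex"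
  assumes A: "finite A"
  shows "\<exists>C\<ge>0. \<exists>R\<ge>1. \<forall>s. Re s > 0 \<longrightarrow> norm s \<ge> R \<longrightarrow>
     norm ((\<Prod>l\<in>A. Gamma (s - lam l)) * exp ((\<Sum>l\<in>A. lam l) * Ln s) / Gamma s ^ card A - 1) \<le> C / norm s"
proof -
  define L where "L = 1 + (\<Sum>l\<in>A. norm (lam l))"
  have L: "L \<ge> 1" "norm (lam l) \<le> L" if "l \<in> A" for l
    unfolding L_def using member_le_sum[OF that, of "\<lambda>l. norm (lam l)"] A
    by (auto intro!: sum_nonneg add_increasing)
  have L1: "L \<ge> 1" by (simp add: L_def sum_nonneg)
  from Gamma_quotient_asymp[OF L1] obtain C R where C: "C \<ge> 0" "R \<ge> 1"
    and CR: "\<And>lam s. norm lam \<le> L \<Longrightarrow> Re s > 0 \<Longrightarrow> norm s \<ge> R \<Longrightarrow>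
      norm (Gamma (s - lam) * exp (lam * Ln s) / Gamma s - 1) \<le> C / norm s" by blast
  have "norm ((\<Prod>l\<in>A. Gamma (s - lam l)) * exp ((\<Sum>l\<in>A. lam l) * Ln s) / Gamma s ^ card A - 1)
       \<le> (real (card A) * 2 ^ card A * C) / norm s" if s: "Re s > 0" "norm s \<ge> max R C" for s
  proof -
    have "norm ((\<Prod>l\<in>A. Gamma (s - lam l) * exp (lam l * Ln s) / Gamma s) - 1) \<le> real (card A) * 2 ^ card A * (C / norm s)"
      using s C A L CR by (intro norm_prod_minus_1_le) (auto simp: divide_simps)
    also have "(\<Prod>l\<in>A. Gamma (s - lam l) * exp (lam l * Ln s) / Gamma s) = (\<Prod>l\<in>A. Gamma (s - lam l)) * exp ((\<Sum>l\<in>A. lam l) * Ln s) / Gamma s ^ card A"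
      using A by (simp add: prod_dividef prod.distrib exp_sum sum_distrib_right)
    finally show ?thesis by simp
  qed
  then show ?thesis using C
    by (intro exI[of _ "real (card A) * 2 ^ card A * C"] conjI exI[of _ "max R C"]) auto
qed

lemma quotient_minus_1_bound:
  fixes x y :: complex
  assumes "norm (x - 1) \<le> a" "norm (y - 1) \<le> b" "b \<le> 1 / 2"
  shows "norm (x / y - 1) \<le> 2 * (a + b)"
proof -
  have "norm (1::complex) \<le> norm y + norm (y - 1)"
    using norm_triangle_ineq4[of y "y - 1"] by simp
  then have y: "norm y \<ge> 1 / 2" using assms by simp
  then have "y \<noteq> 0" by auto
  then have "norm (x / y - 1) = norm ((x - 1) - (y - 1)) / norm y" by (simp add: norm_divide[symmetric] diff_divide_distrib)
  also have "\<dots> \<le> (a + b) / (1 / 2)"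
    using y assms norm_triangle_ineq4[of "x - 1" "y - 1"] order_trans[OF norm_ge_zero assms(1)] order_trans[OF norm_ge_zero assms(2)]
    by (intro frac_le) auto
  finally show ?thesis by simp
qed

text \<open>Both products, over Gamma(s - lam_l) and over Gamma(s - mu_k), are asymptotic to
  Gamma(s)^n, because each family of shifts sums to 0. The \<open>mu\<close> are the shifts of the
  multiplication formula after centring, and for them the product is an explicit multiple of n^(-ns)
  Gamma(ns - a); the centring is the origin of \<open>a\<close> = (n - 1)/2.\<close>

lemma prod_Gamma_asymp:
  fixes lam :: "nat \<Rightarrow> complex"
  assumes n: "n > 0" and sum0: "(\<Sum>l=1..n. lam l) = 0"
  defines "a \<equiv> (of_nat n - 1) / 2 :: complex"
  shows "\<exists>C\<ge>0. \<exists>R\<ge>1. \<forall>s. Re s \<ge> R \<longrightarrow>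
     norm ((\<Prod>l=1..n. Gamma (s - lam l)) * exp (of_nat n * s * of_real (ln (real n))) / Gamma (of_nat n * s - a)
        - of_real (sqrt (2 * pi) ^ (n - 1) * sqrt (real n) * real n powr ((real n - 1) / 2))) \<le> C / norm s"
proof -
  define mu where "mu k = a / of_nat n - of_nat k / of_nat n" for k
  have sumk: "(\<Sum>k<n. of_nat k / of_nat n) = a"
  proof -
    have "(\<Sum>k<n. of_nat k :: complex) = of_nat n * (of_nat n - 1) / 2"
      by (induction n) (auto simp: field_simps)
    then show ?thesis using n by (simp add: sum_divide_distrib[symmetric] a_def)
  qed
  have summu: "(\<Sum>k<n. mu k) = 0"
    unfolding mu_def sum_subtractf sumk using n by simp
  define c where "c = sqrt (2 * pi) ^ (n - 1) * sqrt (real n) * real n powr ((real n - 1) / 2)"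
  have c0: "c \<ge> 0" by (simp add: c_def)
  obtain C1 R1 where 1: "C1 \<ge> 0" "R1 \<ge> 1" "\<And>s. Re s > 0 \<Longrightarrow> norm s \<ge> R1 \<Longrightarrow>
     norm ((\<Prod>l=1..n. Gamma (s - lam l)) * exp ((\<Sum>l=1..n. lam l) * Ln s) / Gamma s ^ card {1..n} - 1) \<le> C1 / norm s"
    using prod_Gamma_quotient_asymp[of "{1..n}" lam] by blast
  obtain C2 R2 where 2: "C2 \<ge> 0" "R2 \<ge> 1" "\<And>s. Re s > 0 \<Longrightarrow> norm s \<ge> R2 \<Longrightarrow>
     norm ((\<Prod>l<n. Gamma (s - mu l)) * exp ((\<Sum>l<n. mu l) * Ln s) / Gamma s ^ card {..<n} - 1) \<le> C2 / norm s"
    using prod_Gamma_quotient_asymp[of "{..<n}" mu] by blast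
  have "norm ((\<Prod>l=1..n. Gamma (s - lam l)) * exp (of_nat n * s * of_real (ln (real n))) / Gamma (of_nat n * s - a)
        - of_real c) \<le> (c * (2 * (C1 + C2))) / norm s" if s: "Re s \<ge> max (max R1 R2) (max (2 * C2) (real n))" for s
  proof -
    have ns: "norm s \<ge> max (max R1 R2) (max (2 * C2) (real n))" "Re s > 0"
      using complex_Re_le_cmod[of s] s n by auto
    have npi: "z \<notin> \<int>\<^sub>\<le>\<^sub>0" if "Re z > 0" for z :: complex
      using that by (auto elim!: nonpos_Ints_cases)
    have G0: "Gamma s \<noteq> 0" using npi[OF ns(2)] by (simp add: Gamma_eq_zero_iff)
    define X Y where "X = (\<Prod>l=1..n. Gamma (s - lam l)) / Gamma s ^ n" and "Y = (\<Prod>l<n. Gamma (s - mu l)) / Gamma s ^ n"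
    have X: "norm (X - 1) \<le> C1 / norm s" using 1(3)[of s] ns sum0 by (simp add: X_def)
    have Y: "norm (Y - 1) \<le> C2 / norm s" using 2(3)[of s] ns summu by (simp add: Y_def)
    have "C2 / norm s \<le> 1 / 2" using ns 2 by (simp add: divide_simps)
    from quotient_minus_1_bound[OF X Y this]
    have XY: "norm (X / Y - 1) \<le> 2 * (C1 + C2) / norm s" by (simp add: add_divide_distrib)
    \<comment> \<open>The point at which the multiplication formula has the arguments s - mu_k and
      the denominator Gamma(ns - a).\<close>
    define s' where "s' = s - a / of_nat n"
    have "Re a / real n \<le> 1 / 2" using n by (simp add: a_def divide_simps)
    moreover have "Re s \<ge> 1" using s 1(2) by simp
    ultimately have s': "Re s' > 0"
      unfolding s'_def by (simp only: minus_complex.sel Re_divide_of_nat)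
    have ns': "of_nat n * s' = of_nat n * s - a" using n by (simp add: s'_def algebra_simps)
    have smu: "s' + of_nat k / of_nat n = s - mu k" for k by (simp add: s'_def mu_def)
    have Gn: "Gamma (of_nat n * s - a) \<noteq> 0"
    proof -
      have "Re (of_nat n * s') > 0" using s' n by simp
      from npi[OF this] show ?thesis unfolding ns' by (simp add: Gamma_eq_zero_iff)
    qed
    have M: "(\<Prod>k<n. Gamma (s - mu k)) * exp ((of_nat n * s - a) * of_real (ln (real n))) / Gamma (of_nat n * s - a)
        = of_real (sqrt (2 * pi) ^ (n - 1) * sqrt (real n))"
      using Gamma_multiplication[OF n s'] unfolding ns' smu .
    have rp: "of_real (real n powr ((real n - 1) / 2)) = exp (a * of_real (ln (real n)))"
      using n by (simp add: powr_def a_def exp_of_real[symmetric])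
    have cc: "complex_of_real c = (\<Prod>k<n. Gamma (s - mu k)) * exp (of_nat n * s * of_real (ln (real n))) / Gamma (of_nat n * s - a)"
      unfolding c_def of_real_mult[of _ "real n powr _"] M[symmetric] rp by (simp add: exp_add[symmetric] algebra_simps)
    have "of_real c \<noteq> (0::complex)" using n by (simp add: c_def)
    then have P0: "(\<Prod>k<n. Gamma (s - mu k)) \<noteq> 0" unfolding cc by auto
    have "(\<Prod>l=1..n. Gamma (s - lam l)) * exp (of_nat n * s * of_real (ln (real n))) / Gamma (of_nat n * s - a) = of_real c * (X / Y)"
      unfolding cc X_def Y_def using P0 G0 by simp
    then have "norm ((\<Prod>l=1..n. Gamma (s - lam l)) * exp (of_nat n * s * of_real (ln (real n))) / Gamma (of_nat n * s - a) - of_real c)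
       = norm (of_real c * (X / Y - 1))" by (simp only:) (simp add: right_diff_distrib)
    also have "\<dots> = c * norm (X / Y - 1)" using c0 unfolding norm_mult by simp
    also have "\<dots> \<le> c * (2 * (C1 + C2) / norm s)" using XY c0 by (intro mult_left_mono)
    finally show ?thesis by simp
  qed
  then show ?thesis unfolding c_def[symmetric] using 1 2 c0
    by (intro exI[of _ "c * (2 * (C1 + C2))"] conjI exI[of _ "max (max R1 R2) (max (2 * C2) (real n))"]) auto
qed

section \<open>Decay of Gamma upwards, downwards and to the left\<close>

text \<open>The point s - lam is moved right by \<open>N\<close> unit steps to within a bounded
  distance of the line Re = 1/2, where the modulus is known. Every step multiplies Gamma by a factor
  of modulus at least e^A once |Im s| is large; this gives e^(A (Re s - b)) with \<open>A\<close> at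
  choice, uniformly on the half plane left of b.\<close>

lemma Gamma_vertical_bound:
  fixes lam :: complex and b A :: real
  assumes A: "A \<ge> 0"
  shows "\<exists>C\<ge>0. \<exists>Y\<ge>1. \<forall>s. Re s \<le> b \<longrightarrow> \<bar>Im s\<bar> \<ge> Y \<longrightarrow>
     norm (Gamma (s - lam)) \<le> C * \<bar>Im s\<bar> powr (b - 1 / 2 - Re lam) * exp (- pi * \<bar>Im s\<bar> / 2) * exp (A * (Re s - b))"
proof -
  define L where "L = 3 + \<bar>b\<bar> + norm lam"
  define p where "p = b - 1 / 2 - Re lam"
  have "L \<ge> 1" by (simp add: L_def)
  from Gamma_quotient_asymp[OF this] obtain C R where C: "C \<ge> 0" "R \<ge> 1"
    and CR: "\<And>lam s. norm lam \<le> L \<Longrightarrow> Re s > 0 \<Longrightarrow> norm s \<ge> R \<Longrightarrow>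
      norm (Gamma (s - lam) * exp (lam * Ln s) / Gamma s - 1) \<le> C / norm s" by blast
  define K where "K = (1 + C) * sqrt (2 * pi) * (2 powr \<bar>p\<bar> * exp (pi * L)) * exp A"
  have "norm (Gamma (s - lam)) \<le> K * \<bar>Im s\<bar> powr p * exp (- pi * \<bar>Im s\<bar> / 2) * exp (A * (Re s - b))"
    if s: "Re s \<le> b" "\<bar>Im s\<bar> \<ge> max (R + 1) (norm lam + exp A)" for s
  proof -
    define y where "y = Im s"
    define N where "N = nat \<lfloor>b - Re s\<rfloor>"
    have N: "real N \<le> b - Re s" "b - Re s < real N + 1" using s by (auto simp: N_def)
    define x where "x = Re s + real N"
    define h where "h = Complex (1/2) y"
    \<comment> \<open>Chosen so that h - m = s - lam + N. As x lies in (b - 1, b], the norm of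
      \<open>m\<close> stays below \<open>L\<close>, and - Re m is at most the exponent
      \<open>p\<close>.\<close>
    define m where "m = Complex (1 / 2 - x) 0 + lam"
    have x: "b - 1 < x" "x \<le> b" using N by (auto simp: x_def)
    have hm: "h - m = s - lam + of_nat N" by (simp add: h_def m_def x_def y_def complex_eq_iff)
    have "norm m \<le> \<bar>1 / 2 - x\<bar> + norm lam"
      unfolding m_def using norm_triangle_ineq[of "Complex (1 / 2 - x) 0" lam] by (simp add: norm_complex_def)
    also have "\<dots> \<le> L" using x by (simp add: L_def)
    finally have mL: "norm m \<le> L" .
    have yh: "\<bar>y\<bar> \<le> norm h" using abs_Im_le_cmod[of h] by (simp add: h_def)
    have y1: "\<bar>y\<bar> \<ge> 1" using s C by (simp add: y_def)
    have "norm h \<le> 1 / 2 + \<bar>y\<bar>" using cmod_le[of h] by (simp add: h_def)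
    then have hy: "norm h \<le> 2 * \<bar>y\<bar>" using y1 by simp
    have hp: "norm h > 0" "h \<noteq> 0" using yh y1 by auto
    have npi: "h \<notin> \<int>\<^sub>\<le>\<^sub>0" by (auto simp: h_def elim!: nonpos_Ints_cases dest!: arg_cong[where f = Re])
    then have G0: "Gamma h \<noteq> 0" by (simp add: Gamma_eq_zero_iff)
    have "norm (Gamma (h - m) * exp (m * Ln h) / Gamma h - 1) \<le> C / norm h"
      using s yh mL by (intro CR) (auto simp: h_def y_def)
    also have "\<dots> \<le> C" using yh y1 C hp by (simp add: divide_le_eq mult_left_mono[of 1 "norm h" C, simplified])
    finally have "norm (Gamma (h - m) * exp (m * Ln h) / Gamma h) \<le> 1 + C"
      using norm_triangle_ineq[of "Gamma (h - m) * exp (m * Ln h) / Gamma h - 1" 1] by simp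
    then have "norm (Gamma (h - m)) * norm (exp (m * Ln h)) \<le> (1 + C) * norm (Gamma h)"
      using G0 by (simp add: norm_mult norm_divide divide_le_eq)
    then have "norm (Gamma (h - m)) \<le> (1 + C) * norm (Gamma h) * norm (exp (- (m * Ln h)))"
      unfolding exp_minus norm_inverse by (simp only: divide_inverse[symmetric] pos_le_divide_eq zero_less_norm_iff exp_not_eq_zero not_False_eq_True)
    also have "\<dots> \<le> (1 + C) * (sqrt (2 * pi) * exp (- pi * \<bar>y\<bar> / 2)) * (2 powr \<bar>p\<bar> * \<bar>y\<bar> powr p * exp (pi * L))"
    proof (intro mult_mono)
      show "norm (Gamma h) \<le> sqrt (2 * pi) * exp (- pi * \<bar>y\<bar> / 2)" unfolding h_def by (rule norm_Gamma_half)
      have "norm (exp (- (m * Ln h))) = exp (- Re m * ln (norm h)) * exp (Im m * Im (Ln h))"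
        using hp by (simp add: exp_add[symmetric] algebra_simps)
      moreover have "exp (- Re m * ln (norm h)) \<le> 2 powr \<bar>p\<bar> * \<bar>y\<bar> powr p"
      proof -
        have "- Re m \<le> p" using x by (simp add: m_def p_def)
        moreover have "ln (norm h) \<ge> 0" using yh y1 by simp
        ultimately have "- Re m * ln (norm h) \<le> p * ln (norm h)" by (rule mult_right_mono)
        then have "exp (- Re m * ln (norm h)) \<le> exp (p * ln (norm h))" by simp
        also have "\<dots> = norm h powr p" using hp by (simp add: powr_def)
        also have "\<dots> \<le> 2 powr \<bar>p\<bar> * \<bar>y\<bar> powr p"
        proof (cases "p \<ge> 0")
          case True
          then have "norm h powr p \<le> (2 * \<bar>y\<bar>) powr p" using hy by (intro powr_mono2) auto
          then show ?thesis using True y1 by (simp add: powr_mult)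
        next
          case False
          then have "norm h powr p \<le> \<bar>y\<bar> powr p" using yh y1 by (intro powr_mono2') auto
          also have "\<dots> = 1 * \<bar>y\<bar> powr p" by simp
          also have "\<dots> \<le> 2 powr \<bar>p\<bar> * \<bar>y\<bar> powr p" by (intro mult_right_mono) (auto intro: ge_one_powr_ge_zero)
          finally show ?thesis .
        qed
        finally show ?thesis .
      qed
      moreover have "Im m * Im (Ln h) \<le> pi * L"
      proof -
        have "Im m * Im (Ln h) \<le> \<bar>Im m\<bar> * \<bar>Im (Ln h)\<bar>" by (simp add: abs_mult[symmetric])
        also have "\<dots> \<le> L * pi"
          using mL abs_Im_le_cmod[of m] Im_Ln_le_pi[OF hp(2)] mpi_less_Im_Ln[OF hp(2)] by (intro mult_mono) auto
        finally show ?thesis by (simp add: mult.commute)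
      qed
      ultimately show "norm (exp (- (m * Ln h))) \<le> 2 powr \<bar>p\<bar> * \<bar>y\<bar> powr p * exp (pi * L)"
        by (simp only:) (intro mult_mono, auto)
    qed (use C in auto)
    finally have B: "norm (Gamma (h - m)) \<le> (1 + C) * (sqrt (2 * pi) * exp (- pi * \<bar>y\<bar> / 2)) * (2 powr \<bar>p\<bar> * \<bar>y\<bar> powr p * exp (pi * L))" .
    have im: "exp A \<le> \<bar>Im (s - lam)\<bar>" using s abs_Im_le_cmod[of lam]
      by (simp only: minus_complex.sel max.bounded_iff) linarith
    then have "Im (s - lam) \<noteq> 0" by (smt (verit) exp_gt_zero)
    then have npi': "s - lam \<notin> \<int>\<^sub>\<le>\<^sub>0" by (auto elim!: nonpos_Ints_cases dest!: arg_cong[where f = Im])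
    then have G0': "Gamma (s - lam) \<noteq> 0" by (simp add: Gamma_eq_zero_iff)
    have "Gamma (h - m) = pochhammer (s - lam) N * Gamma (s - lam)"
      unfolding hm using pochhammer_Gamma[OF npi', of N] G0' by simp
    moreover have "exp A ^ N \<le> norm (pochhammer (s - lam) N)"
    proof -
      have "(\<Prod>i<N. exp A) \<le> (\<Prod>i<N. norm (s - lam + of_nat i))"
      proof (intro prod_mono conjI)
        fix i
        show "exp A \<le> norm (s - lam + of_nat i)"
          using im abs_Im_le_cmod[of "s - lam + of_nat i"] by simp
      qed auto
      then show ?thesis by (simp add: pochhammer_prod prod_norm atLeast0LessThan)
    qed
    ultimately have "exp A ^ N * norm (Gamma (s - lam)) \<le> norm (Gamma (h - m))"
      by (simp add: norm_mult mult_right_mono)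
    moreover have "exp (A * (b - Re s)) \<le> exp A * exp A ^ N"
    proof -
      have "A * (b - Re s) \<le> A * (real N + 1)" using N A by (intro mult_left_mono) auto
      then have "exp (A * (b - Re s)) \<le> exp (A * (real N + 1))" by simp
      also have "\<dots> = exp A * exp A ^ N" by (simp add: exp_add exp_of_nat_mult[symmetric] algebra_simps)
      finally show ?thesis .
    qed
    ultimately have "exp (A * (b - Re s)) * norm (Gamma (s - lam)) \<le> exp A * norm (Gamma (h - m))"
      by (smt (verit, best) exp_ge_zero mult.assoc mult_left_mono mult_right_mono norm_ge_zero)
    then have "norm (Gamma (s - lam)) \<le> exp A * norm (Gamma (h - m)) / exp (A * (b - Re s))"
      by (simp add: field_simps)
    also have "\<dots> = exp A * norm (Gamma (h - m)) * exp (A * (Re s - b))"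
      by (simp add: divide_inverse exp_minus[symmetric] algebra_simps)
    also have "\<dots> \<le> exp A * ((1 + C) * (sqrt (2 * pi) * exp (- pi * \<bar>y\<bar> / 2)) * (2 powr \<bar>p\<bar> * \<bar>y\<bar> powr p * exp (pi * L))) * exp (A * (Re s - b))"
      using B by (intro mult_right_mono mult_left_mono) auto
    finally show ?thesis by (simp add: K_def y_def mult_ac)
  qed
  moreover have "K \<ge> 0" using C by (simp add: K_def)
  ultimately show ?thesis unfolding p_def[symmetric] using C
    by (intro exI[of _ K] conjI exI[of _ "max (R + 1) (norm lam + exp A)"]) auto
qed

section \<open>Mellin-Barnes integrals\<close>

definition gamma_prod :: "nat \<Rightarrow> (nat \<Rightarrow> complex) \<Rightarrow> complex \<Rightarrow> complex" where
  "gamma_prod n lam s = (\<Prod>l=1..n. Gamma (s - lam l))"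

text \<open>A common upper bound for |Re lam_l| + |Im lam_l|. Subtracting naturals moves a pole to
  the left, so Re p + |Im p| stays below it for every pole p.\<close>

definition pole_radius :: "nat \<Rightarrow> (nat \<Rightarrow> complex) \<Rightarrow> real" where
  "pole_radius n lam = (\<Sum>l=1..n. \<bar>Re (lam l)\<bar> + \<bar>Im (lam l)\<bar>)"

definition poles :: "nat \<Rightarrow> (nat \<Rightarrow> complex) \<Rightarrow> complex set" where
  "poles n lam = {lam l - of_nat k | l k. l \<in> {1..n}}"

text \<open>The outside of a wedge that opens to the left and contains all poles. It is open,
  starlike about a real point, stable under shifts to the right, and contains the far ends of every
  vertical line.\<close>

definition right_region :: "nat \<Rightarrow> (nat \<Rightarrow> complex) \<Rightarrow> complex set" where
  "right_region n lam = {s. Re s > pole_radius n lam - \<bar>Im s\<bar>}"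

text \<open>One branch of a hyperbola with vertex \<open>pole_radius\<close> + 1. Since Re s behaves
  like -|Im s|, the factor e^(-nsu) grows at most exponentially along it, while the Gamma product
  decays factorially.\<close>

definition hyper :: "nat \<Rightarrow> (nat \<Rightarrow> complex) \<Rightarrow> real \<Rightarrow> complex" where
  "hyper n lam t = Complex (pole_radius n lam + 2 - sqrt (1 + t\<^sup>2)) t"

definition hyper' :: "real \<Rightarrow> complex" where
  "hyper' t = Complex (- t / sqrt (1 + t\<^sup>2)) 1"

text \<open>The variable \<open>u\<close> is the logarithm of the argument after rotation; the
  weight \<open>P\<close> collects the polynomials in s that differentiation in \<open>u\<close>
  produces.\<close>

definition mellin_kernel :: "nat \<Rightarrow> (nat \<Rightarrow> complex) \<Rightarrow> (complex \<Rightarrow> complex) \<Rightarrow> complex \<Rightarrow> complex \<Rightarrow> complex" where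
  "mellin_kernel n lam P u s = P s * gamma_prod n lam s * exp (- (of_nat n * s * u))"

text \<open>By Liouville's theorem these are the polynomials of degree at most \<open>d\<close>,
  given in the form in which the estimates use them.\<close>

definition poly_growth :: "nat \<Rightarrow> (complex \<Rightarrow> complex) \<Rightarrow> bool" where
  "poly_growth d P \<longleftrightarrow> P holomorphic_on UNIV \<and> (\<exists>C\<ge>0. \<forall>s. norm (P s) \<le> C * (1 + norm s) ^ d)"

lemma pole_radius_nonneg: "pole_radius n lam \<ge> 0"
  by (simp add: pole_radius_def sum_nonneg)

lemma pole_radius_ge: "l \<in> {1..n} \<Longrightarrow> \<bar>Re (lam l)\<bar> + \<bar>Im (lam l)\<bar> \<le> pole_radius n lam"
  unfolding pole_radius_def by (rule member_le_sum) auto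

lemma poles_left: "p \<in> poles n lam \<Longrightarrow> Re p + \<bar>Im p\<bar> \<le> pole_radius n lam"
proof -
  assume "p \<in> poles n lam"
  then obtain l k where l: "l \<in> {1..n}" and p: "p = lam l - of_nat k" by (auto simp: poles_def)
  have "Re p \<le> \<bar>Re (lam l)\<bar>" "Im p = Im (lam l)" by (auto simp: p)
  then show "Re p + \<bar>Im p\<bar> \<le> pole_radius n lam" using pole_radius_ge[OF l, of lam] by simp
qed

lemma right_region_poles: "right_region n lam \<inter> poles n lam = {}"
  using poles_left by (force simp: right_region_def)

lemma open_right_region: "open (right_region n lam)"
  unfolding right_region_def by (intro open_Collect_less continuous_intros)

lemma starlike_right_region: "starlike (right_region n lam)"
  unfolding starlike_def
proof (intro bexI ballI)
  define R where "R = pole_radius n lam"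
  show c: "of_real (R + 1) \<in> right_region n lam" by (simp add: right_region_def R_def)
  fix z assume z: "z \<in> right_region n lam"
  show "closed_segment (of_real (R + 1)) z \<subseteq> right_region n lam"
  proof
    fix w assume "w \<in> closed_segment (of_real (R + 1)) z"
    then obtain v where v: "0 \<le> v" "v \<le> 1" and w: "w = (1 - v) *\<^sub>R of_real (R + 1) + v *\<^sub>R z"
      by (auto simp: closed_segment_def)
    have rw: "Re w = (1 - v) * (R + 1) + v * Re z" "\<bar>Im w\<bar> = v * \<bar>Im z\<bar>"
      using v by (auto simp: w abs_mult)
    have "v * (R - \<bar>Im z\<bar>) \<le> v * Re z" using v z by (intro mult_left_mono) (auto simp: right_region_def R_def)
    moreover have "v < 1 \<or> v * (R - \<bar>Im z\<bar>) < v * Re z"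
      using v z by (cases "v < 1") (auto simp: right_region_def R_def)
    ultimately show "w \<in> right_region n lam"
      using v unfolding right_region_def mem_Collect_eq rw R_def[symmetric] by (auto simp: algebra_simps)
  qed
qed

lemma nonpos_Int_iff_pole: "s - lam l \<in> \<int>\<^sub>\<le>\<^sub>0 \<longleftrightarrow> (\<exists>k. s = lam l - of_nat k)"
proof
  assume "s - lam l \<in> \<int>\<^sub>\<le>\<^sub>0"
  then obtain k where "s - lam l = - of_nat k" by (elim nonpos_Ints_cases') 
  then show "\<exists>k. s = lam l - of_nat k" by (intro exI[of _ k]) (simp add: algebra_simps)
next
  assume "\<exists>k. s = lam l - of_nat k"
  then show "s - lam l \<in> \<int>\<^sub>\<le>\<^sub>0" by auto
qed

lemma not_pole: "s \<notin> poles n lam \<Longrightarrow> l \<in> {1..n} \<Longrightarrow> s - lam l \<notin> \<int>\<^sub>\<le>\<^sub>0"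
  unfolding nonpos_Int_iff_pole poles_def by auto

lemma holomorphic_gamma_prod: "A \<inter> poles n lam = {} \<Longrightarrow> gamma_prod n lam holomorphic_on A"
  unfolding gamma_prod_def[abs_def]
  by (intro holomorphic_on_prod holomorphic_Gamma' holomorphic_intros) (use not_pole in blast)

lemma holomorphic_mellin_kernel:
  "A \<inter> poles n lam = {} \<Longrightarrow> P holomorphic_on UNIV \<Longrightarrow> mellin_kernel n lam P u holomorphic_on A"
  unfolding mellin_kernel_def[abs_def]
  by (intro holomorphic_intros holomorphic_gamma_prod) (auto intro: holomorphic_on_subset)

text \<open>One primitive on the starlike region stands in for every deformation of contour there:
  integrals become differences of end values, and only the behaviour at the far ends has to be
  compared.\<close>

lemma mellin_primitive_exists:
  assumes "P holomorphic_on UNIV"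
  shows "\<exists>G. \<forall>s\<in>right_region n lam. (G has_field_derivative mellin_kernel n lam P u s) (at s)"
proof (rule holomorphic_starlike_primitive[OF _ starlike_right_region open_right_region finite.emptyI])
  have h: "mellin_kernel n lam P u holomorphic_on right_region n lam"
    using right_region_poles assms by (rule holomorphic_mellin_kernel)
  then show "continuous_on (right_region n lam) (mellin_kernel n lam P u)"
    by (rule holomorphic_on_imp_continuous_on)
  show "\<And>x. x \<in> right_region n lam - {} \<Longrightarrow> mellin_kernel n lam P u field_differentiable at x"
    using h open_right_region by (auto simp: holomorphic_on_open field_differentiable_def)
qed

text \<open>As the lam_l sum to 0, their real parts drop out of the exponent of |Im s|, which
  becomes n(b - 1/2). This is the quantity behind the condition on \<sigma> in
  \<open>J_contour\<close>.\<close>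

lemma gamma_prod_bound:
  fixes b A :: real
  assumes n: "n > 0" and sum0: "(\<Sum>l=1..n. lam l) = 0" and A: "A \<ge> 0"
  shows "\<exists>C\<ge>0. \<exists>Y\<ge>1. \<forall>s. Re s \<le> b \<longrightarrow> \<bar>Im s\<bar> \<ge> Y \<longrightarrow>
     norm (gamma_prod n lam s) \<le> C * \<bar>Im s\<bar> powr (real n * (b - 1 / 2)) * exp (- real n * pi * \<bar>Im s\<bar> / 2) * exp (A * (Re s - b))"
proof -
  have "\<forall>l. \<exists>C Y. C \<ge> 0 \<and> Y \<ge> 1 \<and> (\<forall>s. Re s \<le> b \<longrightarrow> \<bar>Im s\<bar> \<ge> Y \<longrightarrow>
     norm (Gamma (s - lam l)) \<le> C * \<bar>Im s\<bar> powr (b - 1 / 2 - Re (lam l)) * exp (- pi * \<bar>Im s\<bar> / 2) * exp (A * (Re s - b)))"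
    using Gamma_vertical_bound[OF A] by blast
  then obtain Cf Yf where CY: "\<And>l. Cf l \<ge> 0" "\<And>l. Yf l \<ge> 1"
    and bd: "\<And>l s. Re s \<le> b \<Longrightarrow> \<bar>Im s\<bar> \<ge> Yf l \<Longrightarrow>
     norm (Gamma (s - lam l)) \<le> Cf l * \<bar>Im s\<bar> powr (b - 1 / 2 - Re (lam l)) * exp (- pi * \<bar>Im s\<bar> / 2) * exp (A * (Re s - b))"
    by metis
  define Y where "Y = (\<Sum>l=1..n. Yf l)"
  have Yl: "Yf l \<le> Y" if "l \<in> {1..n}" for l
    unfolding Y_def using that CY(2) by (intro member_le_sum) (auto intro: order_trans[OF zero_le_one])
  have Y1: "Y \<ge> 1" using Yl[of 1] CY(2)[of 1] n by simp
  have "norm (gamma_prod n lam s) \<le> (\<Prod>l=1..n. Cf l) * \<bar>Im s\<bar> powr (real n * (b - 1 / 2)) * exp (- real n * pi * \<bar>Im s\<bar> / 2) * exp (A * (Re s - b))"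
    if s: "Re s \<le> b" "\<bar>Im s\<bar> \<ge> Y" for s
  proof -
    have "norm (gamma_prod n lam s) \<le> (\<Prod>l=1..n. Cf l * \<bar>Im s\<bar> powr (b - 1 / 2 - Re (lam l)) * exp (- pi * \<bar>Im s\<bar> / 2) * exp (A * (Re s - b)))"
      unfolding gamma_prod_def prod_norm[symmetric]
    proof (intro prod_mono conjI norm_ge_zero)
      fix l assume "l \<in> {1..n}"
      then have "\<bar>Im s\<bar> \<ge> Yf l" using Yl s(2) order_trans by blast
      then show "norm (Gamma (s - lam l)) \<le> Cf l * \<bar>Im s\<bar> powr (b - 1 / 2 - Re (lam l)) * exp (- pi * \<bar>Im s\<bar> / 2) * exp (A * (Re s - b))"
        by (rule bd[OF s(1)])
    qed
    also have "\<dots> = (\<Prod>l=1..n. Cf l) * \<bar>Im s\<bar> powr (\<Sum>l=1..n. b - 1 / 2 - Re (lam l)) * exp (- pi * \<bar>Im s\<bar> / 2) ^ n * exp (A * (Re s - b)) ^ n"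
      using s Y1 by (simp add: prod.distrib powr_sum)
    also have "(\<Sum>l=1..n. b - 1 / 2 - Re (lam l)) = real n * (b - 1 / 2)"
      using arg_cong[OF sum0, of Re] by (simp add: sum_subtractf)
    also have "exp (- pi * \<bar>Im s\<bar> / 2) ^ n = exp (- real n * pi * \<bar>Im s\<bar> / 2)"
      by (simp add: exp_of_nat_mult[symmetric])
    also have "(\<Prod>l=1..n. Cf l) * \<bar>Im s\<bar> powr (real n * (b - 1 / 2)) * exp (- real n * pi * \<bar>Im s\<bar> / 2) * exp (A * (Re s - b)) ^ n
      \<le> (\<Prod>l=1..n. Cf l) * \<bar>Im s\<bar> powr (real n * (b - 1 / 2)) * exp (- real n * pi * \<bar>Im s\<bar> / 2) * exp (A * (Re s - b)) ^ 1"
      using n s A CY by (intro mult_left_mono power_decreasing mult_nonneg_nonneg prod_nonneg) (auto simp: mult_nonneg_nonpos)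
    finally show ?thesis by simp
  qed
  then show ?thesis using Y1 CY by (intro exI[of _ "\<Prod>l=1..n. Cf l"] conjI exI[of _ Y] prod_nonneg) auto
qed

text \<open>The weight also grows as Re s tends to minus infinity. Bounding 1 + x by e^x, this
  growth is paid for by taking the rate A + d in the bound of the Gamma product.\<close>

lemma poly_gamma_prod_bound:
  fixes b A :: real
  assumes n: "n > 0" and sum0: "(\<Sum>l=1..n. lam l) = 0" and A: "A \<ge> 0" and P: "poly_growth d P"
  shows "\<exists>C\<ge>0. \<exists>Y\<ge>1. \<forall>s. Re s \<le> b \<longrightarrow> \<bar>Im s\<bar> \<ge> Y \<longrightarrow>
     norm (P s * gamma_prod n lam s)
       \<le> C * \<bar>Im s\<bar> powr (real n * (b - 1 / 2) + real d) * exp (- real n * pi * \<bar>Im s\<bar> / 2) * exp (A * (Re s - b))"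
proof -
  obtain B where B: "B \<ge> 0" "\<And>s. norm (P s) \<le> B * (1 + norm s) ^ d"
    using P by (auto simp: poly_growth_def)
  obtain C Y where C: "C \<ge> 0" "Y \<ge> 1" and
    bd: "\<And>s. Re s \<le> b \<Longrightarrow> \<bar>Im s\<bar> \<ge> Y \<Longrightarrow>
     norm (gamma_prod n lam s) \<le> C * \<bar>Im s\<bar> powr (real n * (b - 1 / 2)) * exp (- real n * pi * \<bar>Im s\<bar> / 2) * exp ((A + real d) * (Re s - b))"
    using gamma_prod_bound[OF n sum0, of "A + real d" b] A by (auto simp del: exp_gt_zero)
  have "norm (P s * gamma_prod n lam s)
       \<le> (B * (2 + \<bar>b\<bar>) ^ d * C) * \<bar>Im s\<bar> powr (real n * (b - 1 / 2) + real d) * exp (- real n * pi * \<bar>Im s\<bar> / 2) * exp (A * (Re s - b))"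
    if s: "Re s \<le> b" "\<bar>Im s\<bar> \<ge> Y" for s
  proof -
    define x y where "x = b - Re s" and "y = \<bar>Im s\<bar>"
    have x: "x \<ge> 0" and y: "y \<ge> 1" using s C by (auto simp: x_def y_def)
    have "norm s \<le> \<bar>Re s\<bar> + \<bar>Im s\<bar>" by (rule cmod_le)
    also have "\<dots> \<le> \<bar>b\<bar> + x + y" using x by (auto simp: x_def y_def)
    finally have "1 + norm s \<le> 1 + \<bar>b\<bar> + x + y" by simp
    also have "\<dots> \<le> (2 + \<bar>b\<bar>) * (1 + x) * y"
    proof -
      have "(1 + \<bar>b\<bar>) * 1 \<le> (1 + \<bar>b\<bar>) * y" using y by (intro mult_left_mono) auto
      moreover have "x * 1 \<le> (x * (2 + \<bar>b\<bar>)) * y" using x y by (intro mult_mono) (auto simp: distrib_left)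
      ultimately show ?thesis by (simp add: algebra_simps)
    qed
    also have "\<dots> \<le> (2 + \<bar>b\<bar>) * exp x * y" using x y by (intro mult_right_mono mult_left_mono) (auto simp: exp_ge_add_one_self)
    finally have "(1 + norm s) ^ d \<le> ((2 + \<bar>b\<bar>) * exp x * y) ^ d" by (intro power_mono) auto
    then have "norm (P s) \<le> B * ((2 + \<bar>b\<bar>) * exp x * y) ^ d"
      using B(2)[of s] B(1) by (meson mult_left_mono order_trans)
    also have "\<dots> = B * (2 + \<bar>b\<bar>) ^ d * (exp (real d * x) * y powr real d)"
      using y by (simp add: power_mult_distrib exp_of_nat_mult powr_realpow)
    finally have "norm (P s) * norm (gamma_prod n lam s) \<le> (B * (2 + \<bar>b\<bar>) ^ d * (exp (real d * x) * y powr real d)) *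
      (C * y powr (real n * (b - 1 / 2)) * exp (- real n * pi * y / 2) * exp ((A + real d) * (Re s - b)))"
      unfolding y_def using bd[OF s] B(1) by (intro mult_mono) auto
    also have "exp ((A + real d) * (Re s - b)) = exp (A * (Re s - b)) / exp (real d * x)"
      by (simp add: x_def exp_diff[symmetric] algebra_simps)
    finally show ?thesis by (simp add: norm_mult powr_add y_def mult_ac)
  qed
  moreover have "B * (2 + \<bar>b\<bar>) ^ d * C \<ge> 0" using B C by (intro mult_nonneg_nonneg) auto
  ultimately show ?thesis using C
    by (intro exI[of _ "B * (2 + \<bar>b\<bar>) ^ d * C"] conjI exI[of _ Y]) auto
qed

lemma norm_exp_mellin: "norm (exp (- (of_nat n * s * u))) = exp (- real n * (Re s * Re u - Im s * Im u))"
  by (simp add: algebra_simps)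

lemma hyper_mem: "hyper n lam t \<in> right_region n lam"
proof -
  have "sqrt (1 + t\<^sup>2) \<le> 1 + \<bar>t\<bar>"
    by (rule real_le_lsqrt) (auto simp: power2_eq_square algebra_simps)
  then show ?thesis by (simp add: right_region_def hyper_def)
qed

lemma hyper_deriv: "(hyper n lam has_vector_derivative hyper' t) (at t within A)"
proof -
  have p: "1 + t\<^sup>2 > 0" by (simp add: add_pos_nonneg)
  have "((\<lambda>t. complex_of_real (pole_radius n lam + 2 - sqrt (1 + t\<^sup>2)) + \<i> * of_real t) has_vector_derivative
     of_real (- t / sqrt (1 + t\<^sup>2)) + \<i> * of_real 1) (at t within A)"
    using p by (intro has_vector_derivative_add has_vector_derivative_mult_right has_vector_derivative_of_real)
      (auto intro!: derivative_eq_intros simp: field_simps)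
  moreover have "hyper n lam = (\<lambda>t. complex_of_real (pole_radius n lam + 2 - sqrt (1 + t\<^sup>2)) + \<i> * of_real t)"
    by (auto simp: hyper_def complex_eq_iff)
  moreover have "hyper' t = of_real (- t / sqrt (1 + t\<^sup>2)) + \<i> * of_real 1"
    by (simp add: hyper'_def complex_eq_iff)
  ultimately show ?thesis by (simp only:)
qed

lemma continuous_hyper: "continuous_on A (hyper n lam)"
  by (intro continuous_at_imp_continuous_on ballI has_vector_derivative_continuous[OF hyper_deriv])

lemma continuous_hyper': "continuous_on A hyper'"
proof -
  have eq: "hyper' = (\<lambda>t. of_real (- t / sqrt (1 + t\<^sup>2)) + \<i>)" by (auto simp: hyper'_def complex_eq_iff)
  have nz: "sqrt (1 + t\<^sup>2) \<noteq> 0" for t :: real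
    using add_pos_nonneg[of 1 "t\<^sup>2"] by simp
  have "continuous_on A (\<lambda>t. complex_of_real (- t / sqrt (1 + t\<^sup>2)) + \<i>)"
    by (intro continuous_intros) (use nz in auto)
  then show ?thesis unfolding eq .
qed

lemma norm_hyper': "norm (hyper' t) \<le> 2"
proof -
  have "\<bar>t\<bar> \<le> sqrt (1 + t\<^sup>2)" by (rule real_le_rsqrt) simp
  moreover have "sqrt (1 + t\<^sup>2) > 0" by (simp add: add_pos_nonneg)
  ultimately have "\<bar>- t / sqrt (1 + t\<^sup>2)\<bar> \<le> 1" by (simp add: abs_divide divide_le_eq_1)
  then show ?thesis using cmod_le[of "hyper' t"] by (simp add: hyper'_def)
qed

text \<open>Along the hyperbola, the factorial decay of the Gamma function to the left beats every exponential.\<close>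

lemma mellin_kernel_hyper_bound:
  assumes n: "n > 0" and sum0: "(\<Sum>l=1..n. lam l) = 0" and P: "poly_growth d P"
  shows "\<exists>C\<ge>0. \<exists>T\<ge>1. \<forall>u s. norm u \<le> U \<longrightarrow> \<bar>Im s\<bar> \<ge> T \<longrightarrow> \<bar>Re s - Re (hyper n lam (Im s))\<bar> \<le> 1 \<longrightarrow>
     norm (mellin_kernel n lam P u s) \<le> C * exp (- \<bar>Im s\<bar>)"
proof -
  define b where "b = pole_radius n lam + 3"
  define q where "q = real n * (b - 1 / 2) + real d"
  \<comment> \<open>The rate pays for three things in terms of y = |Im s|: 2n|U| for e^(-nsu), where
    |s| \<le> b + 3 + 2y; |q| for the power of |Im s|; and 1 for the e^(-y) that is to
    remain.\<close>
  define A where "A = 2 * real n * \<bar>U\<bar> + \<bar>q\<bar> + 1"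
  have A: "A \<ge> 0" by (simp add: A_def)
  obtain C Y where C: "C \<ge> 0" "Y \<ge> 1" and
    bd: "\<And>s. Re s \<le> b \<Longrightarrow> \<bar>Im s\<bar> \<ge> Y \<Longrightarrow> norm (P s * gamma_prod n lam s)
       \<le> C * \<bar>Im s\<bar> powr q * exp (- real n * pi * \<bar>Im s\<bar> / 2) * exp (A * (Re s - b))"
    unfolding q_def using poly_gamma_prod_bound[OF n sum0 A P, of b] by blast
  define D where "D = C * exp (real n * \<bar>U\<bar> * (b + 3))"
  have "norm (mellin_kernel n lam P u s) \<le> D * exp (- \<bar>Im s\<bar>)"
    if u: "norm u \<le> U" and s: "\<bar>Im s\<bar> \<ge> Y" "\<bar>Re s - Re (hyper n lam (Im s))\<bar> \<le> 1" for u s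
  proof -
    define y where "y = \<bar>Im s\<bar>"
    have y: "y \<ge> 1" using s C by (simp add: y_def)
    define r where "r = sqrt (1 + (Im s)\<^sup>2)"
    have r: "y \<le> r" "r \<le> 1 + y"
      unfolding r_def y_def by (auto intro!: real_le_rsqrt real_le_lsqrt simp: power2_eq_square algebra_simps)
    have res: "Re s \<le> b - r" "b - 2 - r \<le> Re s" using s(2) by (auto simp: hyper_def r_def b_def)
    have b0: "b \<ge> 3" using pole_radius_nonneg[of n lam] by (simp add: b_def)
    have "\<bar>Re s\<bar> \<le> b + 3 + y" using res r y b0 by linarith
    then have ns: "norm s \<le> b + 3 + 2 * y" using cmod_le[of s] by (simp add: y_def)
    have "norm (exp (- (of_nat n * s * u))) \<le> exp (norm (of_nat n * s * u))"
      using norm_exp[of "- (of_nat n * s * u)"] by simp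
    also have "\<dots> \<le> exp (real n * (b + 3 + 2 * y) * \<bar>U\<bar>)"
      unfolding norm_mult exp_le_cancel_iff norm_of_nat using u ns y b0 by (intro mult_mono) auto
    finally have e1: "norm (exp (- (of_nat n * s * u))) \<le> exp (real n * (b + 3 + 2 * y) * \<bar>U\<bar>)" .
    have "\<bar>Im s\<bar> powr q \<le> exp (\<bar>q\<bar> * y)"
    proof -
      have "\<bar>Im s\<bar> powr q = exp (q * ln y)" using y by (simp add: powr_def y_def)
      also have "q * ln y \<le> \<bar>q\<bar> * y"
        using y ln_le_minus_one[of y] ln_ge_zero[of y] by (intro mult_mono) auto
      finally show ?thesis by simp
    qed
    moreover have "exp (- real n * pi * \<bar>Im s\<bar> / 2) \<le> 1" by simp
    moreover have "exp (A * (Re s - b)) \<le> exp (A * (- y))"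
      unfolding exp_le_cancel_iff using A res(1) r(1) by (intro mult_left_mono) auto
    ultimately have "C * \<bar>Im s\<bar> powr q * exp (- real n * pi * \<bar>Im s\<bar> / 2) * exp (A * (Re s - b))
        \<le> C * exp (\<bar>q\<bar> * y) * 1 * exp (A * (- y))"
      using C by (intro mult_mono mult_nonneg_nonneg) auto
    moreover have "Re s \<le> b" using res(1) r(1) y by linarith
    ultimately have "norm (P s * gamma_prod n lam s) \<le> C * exp (\<bar>q\<bar> * y) * 1 * exp (A * (- y))"
      using bd[of s] s(1) by linarith
    then have "norm (P s * gamma_prod n lam s) * norm (exp (- (of_nat n * s * u))) \<le> (C * exp (\<bar>q\<bar> * y) * 1 * exp (A * (- y))) * exp (real n * (b + 3 + 2 * y) * \<bar>U\<bar>)"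
      using e1 C by (intro mult_mono) auto
    also have "\<dots> = C * exp (\<bar>q\<bar> * y + A * (- y) + real n * (b + 3 + 2 * y) * \<bar>U\<bar>)"
      by (simp add: mult_exp_exp mult.assoc algebra_simps)
    also have "\<bar>q\<bar> * y + A * (- y) + real n * (b + 3 + 2 * y) * \<bar>U\<bar> = real n * \<bar>U\<bar> * (b + 3) + - y"
      by (simp add: A_def algebra_simps)
    finally show ?thesis by (simp only: mellin_kernel_def norm_mult D_def exp_add y_def mult_ac)
  qed
  then show ?thesis using C by (intro exI[of _ D] conjI exI[of _ Y]) (auto simp: D_def)
qed

section \<open>The integral along the hyperbola as an entire function of \<open>u\<close>\<close>

definition hyper_int :: "nat \<Rightarrow> (nat \<Rightarrow> complex) \<Rightarrow> (complex \<Rightarrow> complex) \<Rightarrow> real \<Rightarrow> complex \<Rightarrow> complex" where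
  "hyper_int n lam P Y u = integral {-Y..Y} (\<lambda>t. mellin_kernel n lam P u (hyper n lam t) * hyper' t)"

definition mellin_barnes :: "nat \<Rightarrow> (nat \<Rightarrow> complex) \<Rightarrow> (complex \<Rightarrow> complex) \<Rightarrow> complex \<Rightarrow> complex" where
  "mellin_barnes n lam P u = lim (\<lambda>N. hyper_int n lam P (real N) u) / (2 * of_real pi * \<i>)"

lemma continuous_mellin_hyper:
  assumes "P holomorphic_on UNIV"
  shows "continuous_on A (\<lambda>t. mellin_kernel n lam P u (hyper n lam t) * hyper' t)"
proof -
  have "continuous_on (right_region n lam) (mellin_kernel n lam P u)"
    using right_region_poles assms by (intro holomorphic_on_imp_continuous_on holomorphic_mellin_kernel)
  then have "continuous_on A (\<lambda>t. mellin_kernel n lam P u (hyper n lam t))"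
    by (rule continuous_on_compose2[OF _ continuous_hyper]) (use hyper_mem in auto)
  then show ?thesis by (intro continuous_on_mult continuous_hyper')
qed

lemma mellin_path_integral:
  assumes G: "\<And>s. s \<in> right_region n lam \<Longrightarrow> (G has_field_derivative mellin_kernel n lam P u s) (at s)"
    and p: "\<And>t. t \<in> {a..b} \<Longrightarrow> p t \<in> right_region n lam"
    and p': "\<And>t. t \<in> {a..b} \<Longrightarrow> (p has_vector_derivative p' t) (at t within {a..b})"
    and "a \<le> b"
  shows "((\<lambda>t. mellin_kernel n lam P u (p t) * p' t) has_integral (G (p b) - G (p a))) {a..b}"
proof -
  have "((\<lambda>t. G (p t)) has_vector_derivative mellin_kernel n lam P u (p t) * p' t) (at t within {a..b})" if "t \<in> {a..b}" for t
    using field_vector_diff_chain_within[OF p'[OF that] has_field_derivative_at_within[OF G[OF p[OF that]]]]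
    by (simp add: o_def mult.commute)
  from fundamental_theorem_of_calculus[OF assms(4) this] show ?thesis by simp
qed

lemma hyper_int_primitive:
  assumes G: "\<And>s. s \<in> right_region n lam \<Longrightarrow> (G has_field_derivative mellin_kernel n lam P u s) (at s)"
    and Y: "Y \<ge> 0"
  shows "hyper_int n lam P Y u = G (hyper n lam Y) - G (hyper n lam (-Y))"
  unfolding hyper_int_def using Y
  by (intro integral_unique mellin_path_integral[OF G] hyper_mem hyper_deriv) auto

lemma exp_minus_of_nat_tendsto_0: "(\<lambda>N. exp (- real N)) \<longlonglongrightarrow> 0"
  by real_asymp

lemma mult_exp_minus_tendsto_0: "((\<lambda>Y. C * exp (- Y)) \<longlongrightarrow> (0::real)) at_top"
  by real_asymp

text \<open>\<open>C\<close> and \<open>T\<close> depend on \<open>U\<close> but not on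
  \<open>u\<close>, so convergence is locally uniform, as differentiation of the limit requires. The
  definition takes the limit along naturals; here all real truncations are covered.\<close>

lemma mellin_barnes_limit:
  assumes n: "n > 0" and sum0: "(\<Sum>l=1..n. lam l) = 0" and P: "poly_growth d P"
  shows "\<exists>C\<ge>0. \<exists>T\<ge>1. \<forall>u Y. norm u \<le> U \<longrightarrow> Y \<ge> T \<longrightarrow>
    norm (hyper_int n lam P Y u - 2 * of_real pi * \<i> * mellin_barnes n lam P u) \<le> C * exp (- Y)"
proof -
  have hol: "P holomorphic_on UNIV" using P by (simp add: poly_growth_def)
  obtain C T where C: "C \<ge> 0" "T \<ge> 1" and
    bd: "\<And>u s. norm u \<le> U \<Longrightarrow> \<bar>Im s\<bar> \<ge> T \<Longrightarrow> \<bar>Re s - Re (hyper n lam (Im s))\<bar> \<le> 1 \<Longrightarrow>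
     norm (mellin_kernel n lam P u s) \<le> C * exp (- \<bar>Im s\<bar>)"
    using mellin_kernel_hyper_bound[OF n sum0 P, of U] by blast
  have diff: "norm (hyper_int n lam P Z u - hyper_int n lam P Y u) \<le> 4 * C * exp (- Y)"
    if u: "norm u \<le> U" and YZ: "T \<le> Y" "Y \<le> Z" for u Y Z
  proof -
    define F where "F t = mellin_kernel n lam P u (hyper n lam t) * hyper' t" for t
    have int: "F integrable_on {a..b}" for a b
      unfolding F_def by (intro integrable_continuous_real continuous_mellin_hyper hol)
    have "integral {-Z..Z} F = integral {-Z..-Y} F + integral {-Y..Z} F"
      using YZ C by (intro Henstock_Kurzweil_Integration.integral_combine[symmetric] int) auto
    also have "integral {-Y..Z} F = integral {-Y..Y} F + integral {Y..Z} F"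
      using YZ C by (intro Henstock_Kurzweil_Integration.integral_combine[symmetric] int) auto
    finally have "hyper_int n lam P Z u - hyper_int n lam P Y u = integral {-Z..-Y} F + integral {Y..Z} F"
      by (simp add: hyper_int_def F_def[abs_def])
    moreover have bF: "norm (F t) \<le> 2 * C * exp (- \<bar>t\<bar>)" if "\<bar>t\<bar> \<ge> T" for t
    proof -
      have "norm (mellin_kernel n lam P u (hyper n lam t)) \<le> C * exp (- \<bar>t\<bar>)"
        using bd[OF u, of "hyper n lam t"] that by (simp add: hyper_def)
      then have "norm (F t) \<le> C * exp (- \<bar>t\<bar>) * 2"
        unfolding F_def norm_mult using norm_hyper'[of t] C by (intro mult_mono) auto
      then show ?thesis by simp
    qed
    have i1: "((\<lambda>t. 2 * C * exp (- t)) has_integral (2 * C * (exp (- Y) - exp (- Z)))) {Y..Z}"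
    proof -
      have "((\<lambda>t. 2 * C * exp (- t)) has_integral (- (2 * C * exp (- Z)) - - (2 * C * exp (- Y)))) {Y..Z}"
        using YZ by (intro fundamental_theorem_of_calculus)
         (auto intro!: derivative_eq_intros simp: has_real_derivative_iff_has_vector_derivative[symmetric])
      then show ?thesis by (simp add: algebra_simps)
    qed
    have i2: "((\<lambda>t. 2 * C * exp t) has_integral (2 * C * (exp (- Y) - exp (- Z)))) {-Z..-Y}"
    proof -
      have "((\<lambda>t. 2 * C * exp t) has_integral ((2 * C * exp (- Y)) - (2 * C * exp (- Z)))) {-Z..-Y}"
        using YZ by (intro fundamental_theorem_of_calculus)
         (auto intro!: derivative_eq_intros simp: has_real_derivative_iff_has_vector_derivative[symmetric])
      then show ?thesis by (simp add: algebra_simps)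
    qed
    have "norm (integral {Y..Z} F) \<le> 2 * C * (exp (- Y) - exp (- Z))"
    proof -
      have "norm (F t) \<le> 2 * C * exp (- t)" if "t \<in> {Y..Z}" for t
        using bF[of t] that YZ C by auto
      from integral_norm_bound_integral[OF int has_integral_integrable[OF i1] this] show ?thesis
        unfolding integral_unique[OF i1] .
    qed
    moreover have "norm (integral {-Z..-Y} F) \<le> 2 * C * (exp (- Y) - exp (- Z))"
    proof -
      have "norm (F t) \<le> 2 * C * exp t" if "t \<in> {-Z..-Y}" for t
        using bF[of t] that YZ C by auto
      from integral_norm_bound_integral[OF int has_integral_integrable[OF i2] this] show ?thesis
        unfolding integral_unique[OF i2] .
    qed
    moreover have "C * exp (- Z) \<ge> 0" using C by simp
    ultimately show ?thesis using norm_triangle_ineq[of "integral {-Z..-Y} F" "integral {Y..Z} F"]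
      by (simp add: right_diff_distrib)
  qed
  have "norm (hyper_int n lam P Y u - 2 * of_real pi * \<i> * mellin_barnes n lam P u) \<le> 4 * C * exp (- Y)"
    if u: "norm u \<le> U" and Y: "Y \<ge> T" for u Y
  proof -
    have ex0: "(\<lambda>N. 4 * C * exp (- real N)) \<longlonglongrightarrow> 4 * C * 0"
      by (intro tendsto_mult tendsto_const exp_minus_of_nat_tendsto_0)
    have "Cauchy (\<lambda>N. hyper_int n lam P (real N) u)"
    proof (rule metric_CauchyI)
      fix e :: real assume "e > 0"
      then have "eventually (\<lambda>N. 4 * C * exp (- real N) < e) sequentially"
        using order_tendstoD(2)[OF ex0] by simp
      then obtain N0 where N0: "\<And>N. N \<ge> N0 \<Longrightarrow> 4 * C * exp (- real N) < e" by (auto simp: eventually_sequentially)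
      define M where "M = max N0 (nat \<lceil>T\<rceil>)"
      have lt: "dist (hyper_int n lam P (real p) u) (hyper_int n lam P (real q) u) < e" if "M \<le> p" "p \<le> q" for p q
      proof -
        have "T \<le> real p" using that by (simp add: M_def)
        then have "norm (hyper_int n lam P (real q) u - hyper_int n lam P (real p) u) \<le> 4 * C * exp (- real p)"
          using that by (intro diff[OF u]) auto
        also have "\<dots> < e" using that by (intro N0) (simp add: M_def)
        finally show ?thesis by (simp add: dist_norm norm_minus_commute)
      qed
      show "\<exists>M. \<forall>p\<ge>M. \<forall>q\<ge>M. dist (hyper_int n lam P (real p) u) (hyper_int n lam P (real q) u) < e"
      proof (intro exI allI impI)
        fix p q assume "M \<le> p" "M \<le> q"
        then show "dist (hyper_int n lam P (real p) u) (hyper_int n lam P (real q) u) < e"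
          using lt[of p q] lt[of q p] by (cases "p \<le> q") (auto simp: dist_commute)
      qed
    qed
    then have "convergent (\<lambda>N. hyper_int n lam P (real N) u)" by (rule Cauchy_convergent)
    then have "(\<lambda>N. hyper_int n lam P (real N) u) \<longlonglongrightarrow> 2 * of_real pi * \<i> * mellin_barnes n lam P u"
      by (simp add: convergent_LIMSEQ_iff mellin_barnes_def)
    then have "(\<lambda>N. norm (hyper_int n lam P (real N) u - hyper_int n lam P Y u)) \<longlonglongrightarrow> norm (2 * of_real pi * \<i> * mellin_barnes n lam P u - hyper_int n lam P Y u)"
      by (intro tendsto_intros)
    moreover have "eventually (\<lambda>N. norm (hyper_int n lam P (real N) u - hyper_int n lam P Y u) \<le> 4 * C * exp (- Y)) sequentially"
      using eventually_ge_at_top[of "nat \<lceil>Y\<rceil>"]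
      by eventually_elim (use diff[OF u Y] in \<open>auto simp: nat_le_iff ceiling_le_iff\<close>)
    ultimately have "norm (2 * of_real pi * \<i> * mellin_barnes n lam P u - hyper_int n lam P Y u) \<le> 4 * C * exp (- Y)"
      by (intro tendsto_upperbound) auto
    then show ?thesis by (simp add: norm_minus_commute)
  qed
  then show ?thesis using C by (intro exI[of _ "4 * C"] conjI exI[of _ T]) auto
qed

lemma tendsto_hyper_int:
  assumes "n > 0" "(\<Sum>l=1..n. lam l) = 0" "poly_growth d P"
  shows "((\<lambda>Y. hyper_int n lam P Y u) \<longlongrightarrow> 2 * of_real pi * \<i> * mellin_barnes n lam P u) at_top"
proof -
  obtain C T where *: "\<And>Y. Y \<ge> T \<Longrightarrow>
    norm (hyper_int n lam P Y u - 2 * of_real pi * \<i> * mellin_barnes n lam P u) \<le> C * exp (- Y)"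
    using mellin_barnes_limit[OF assms, of "norm u"] order_refl by metis
  have "((\<lambda>Y. hyper_int n lam P Y u - 2 * of_real pi * \<i> * mellin_barnes n lam P u) \<longlongrightarrow> 0) at_top"
  proof (rule Lim_null_comparison[OF _ mult_exp_minus_tendsto_0[of C]])
    show "eventually (\<lambda>Y. norm (hyper_int n lam P Y u - 2 * of_real pi * \<i> * mellin_barnes n lam P u) \<le> C * exp (- Y)) at_top"
      using eventually_ge_at_top[of T] by eventually_elim (rule *)
  qed
  then show ?thesis by (simp add: LIM_zero_iff)
qed

lemma poly_growth_mult:
  assumes "poly_growth d P"
  shows "poly_growth (Suc d) (\<lambda>s. (a * s + b) * P s)"
proof -
  obtain C where C: "C \<ge> 0" "\<And>s. norm (P s) \<le> C * (1 + norm s) ^ d"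
    using assms by (auto simp: poly_growth_def)
  have "norm ((a * s + b) * P s) \<le> (norm a + norm b) * C * (1 + norm s) ^ Suc d" for s
  proof -
    have "norm (a * s + b) \<le> norm a * norm s + norm b" by (metis norm_mult norm_triangle_ineq)
    also have "\<dots> \<le> (norm a + norm b) * (1 + norm s)" by (simp add: algebra_simps)
    finally have "norm ((a * s + b) * P s) \<le> ((norm a + norm b) * (1 + norm s)) * (C * (1 + norm s) ^ d)"
      unfolding norm_mult using C by (intro mult_mono) auto
    then show ?thesis by (simp add: mult_ac)
  qed
  then show ?thesis using assms C unfolding poly_growth_def
    by (auto intro!: holomorphic_intros exI[of _ "(norm a + norm b) * C"])
qed

lemma poly_growth_1: "poly_growth 0 (\<lambda>_. 1)"
  unfolding poly_growth_def by (auto intro!: exI[of _ 1])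

lemma hyper_int_deriv:
  assumes "P holomorphic_on UNIV" "Y \<ge> 0"
  shows "(hyper_int n lam P Y has_field_derivative hyper_int n lam (\<lambda>s. - of_nat n * s * P s) Y u) (at u)"
proof -
  have h: "continuous_on UNIV (hyper n lam)" "continuous_on UNIV hyper'"
    by (rule continuous_hyper continuous_hyper')+
  have c: "continuous_on UNIV (\<lambda>t. P (hyper n lam t) * gamma_prod n lam (hyper n lam t))"
  proof -
    have "continuous_on (right_region n lam) (\<lambda>s. P s * gamma_prod n lam s)"
      using assms(1) by (intro holomorphic_on_imp_continuous_on holomorphic_on_mult holomorphic_gamma_prod right_region_poles)
        (auto intro: holomorphic_on_subset)
    then show ?thesis by (rule continuous_on_compose2[OF _ h(1)]) (use hyper_mem in auto)
  qed
  have "((\<lambda>u. integral (cbox (-Y) Y) (\<lambda>t. mellin_kernel n lam P u (hyper n lam t) * hyper' t)) has_field_derivative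
     integral (cbox (-Y) Y) (\<lambda>t. mellin_kernel n lam (\<lambda>s. - of_nat n * s * P s) u (hyper n lam t) * hyper' t)) (at u within UNIV)"
  proof (rule leibniz_rule_field_derivative[where U = UNIV])
    show "((\<lambda>u. mellin_kernel n lam P u (hyper n lam t) * hyper' t) has_field_derivative
        mellin_kernel n lam (\<lambda>s. - of_nat n * s * P s) u (hyper n lam t) * hyper' t) (at u within UNIV)" for u t
      unfolding mellin_kernel_def by (auto intro!: derivative_eq_intros simp: algebra_simps)
    show "(\<lambda>t. mellin_kernel n lam P u (hyper n lam t) * hyper' t) integrable_on cbox (- Y) Y" for u
      using assms by (intro integrable_continuous continuous_mellin_hyper)
    show "continuous_on (UNIV \<times> cbox (- Y) Y)
      (\<lambda>(u, t). mellin_kernel n lam (\<lambda>s. - of_nat n * s * P s) u (hyper n lam t) * hyper' t)"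
    proof -
      have "continuous_on (UNIV \<times> cbox (- Y) Y) (\<lambda>x::complex \<times> real. (- of_nat n * hyper n lam (snd x)) * (P (hyper n lam (snd x)) * gamma_prod n lam (hyper n lam (snd x)))
         * exp (- (of_nat n * hyper n lam (snd x) * fst x)) * hyper' (snd x))"
        by (intro continuous_intros continuous_on_compose2[OF c continuous_on_snd[OF continuous_on_id]]
          continuous_on_compose2[OF h(1) continuous_on_snd[OF continuous_on_id]]
          continuous_on_compose2[OF h(2) continuous_on_snd[OF continuous_on_id]]) auto
      then show ?thesis by (simp add: mellin_kernel_def case_prod_unfold mult_ac)
    qed
  qed auto
  then show ?thesis unfolding hyper_int_def[abs_def] by simp
qed

text \<open>Truncated integrals are differentiated under the integral sign; Weierstrass's theorem on
  locally uniform limits of holomorphic functions then passes to the limit.\<close>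

lemma mellin_barnes_deriv:
  assumes n: "n > 0" and sum0: "(\<Sum>l=1..n. lam l) = 0" and P: "poly_growth d P"
  shows "(mellin_barnes n lam P has_field_derivative mellin_barnes n lam (\<lambda>s. - of_nat n * s * P s) u) (at u)"
proof -
  have hol: "P holomorphic_on UNIV" using P by (simp add: poly_growth_def)
  have P': "poly_growth (Suc d) (\<lambda>s. - of_nat n * s * P s)"
    using poly_growth_mult[OF P, of "- of_nat n" 0] by simp
  define M where "M = (\<lambda>u. 2 * of_real pi * \<i> * mellin_barnes n lam P u)"
  have lim: "(\<lambda>N. hyper_int n lam Q (real N) x) \<longlonglongrightarrow> 2 * of_real pi * \<i> * mellin_barnes n lam Q x" if "poly_growth d' Q" for d' Q x
    using tendsto_hyper_int[OF n sum0 that] filterlim_real_sequentially by (rule filterlim_compose)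
  have "\<exists>g'. \<forall>x\<in>UNIV. (M has_field_derivative g' x) (at x) \<and> (\<lambda>N. hyper_int n lam (\<lambda>s. - of_nat n * s * P s) (real N) x) \<longlonglongrightarrow> g' x"
  proof (rule has_complex_derivative_uniform_sequence[OF open_UNIV, where f = "\<lambda>N. hyper_int n lam P (real N)"])
    show "(hyper_int n lam P (real N) has_field_derivative hyper_int n lam (\<lambda>s. - of_nat n * s * P s) (real N) x) (at x)" for N x
      by (intro hyper_int_deriv hol) simp
    fix x :: complex
    obtain C T where *: "\<And>u Y. norm u \<le> norm x + 1 \<Longrightarrow> Y \<ge> T \<Longrightarrow>
      norm (hyper_int n lam P Y u - 2 * of_real pi * \<i> * mellin_barnes n lam P u) \<le> C * exp (- Y)"
      using mellin_barnes_limit[OF n sum0 P, of "norm x + 1"] by blast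
    have "uniform_limit (cball x 1) (\<lambda>N. hyper_int n lam P (real N)) M sequentially"
    proof (rule uniform_limitI)
      fix e :: real assume "e > 0"
      have "(\<lambda>N. C * exp (- real N)) \<longlonglongrightarrow> C * 0"
        by (intro tendsto_mult tendsto_const exp_minus_of_nat_tendsto_0)
      then have "eventually (\<lambda>N. C * exp (- real N) < e) sequentially" using order_tendstoD(2) \<open>e > 0\<close> by simp
      moreover have "eventually (\<lambda>N. real N \<ge> T) sequentially"
        using filterlim_real_sequentially by (simp add: filterlim_at_top)
      ultimately show "eventually (\<lambda>N. \<forall>u\<in>cball x 1. dist (hyper_int n lam P (real N) u) (M u) < e) sequentially"
      proof eventually_elim
        case (elim N)
        show ?case
        proof
          fix u assume "u \<in> cball x 1"
          then have "norm u \<le> norm x + 1" using norm_triangle_ineq[of x "u - x"] by (simp add: dist_norm norm_minus_commute)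
          then show "dist (hyper_int n lam P (real N) u) (M u) < e"
            using *[of u "real N"] elim by (simp add: dist_norm M_def)
        qed
      qed
    qed
    then show "\<exists>d>0. cball x d \<subseteq> UNIV \<and> uniform_limit (cball x d) (\<lambda>N. hyper_int n lam P (real N)) M sequentially"
      by (intro exI[of _ 1]) auto
  qed
  then obtain g' where g': "(M has_field_derivative g') (at u)"
    "(\<lambda>N. hyper_int n lam (\<lambda>s. - of_nat n * s * P s) (real N) u) \<longlonglongrightarrow> g'" by blast
  have "g' = 2 * of_real pi * \<i> * mellin_barnes n lam (\<lambda>s. - of_nat n * s * P s) u"
    using g'(2) lim[OF P'] LIMSEQ_unique by blast
  with g'(1) have "((\<lambda>u. M u / (2 * of_real pi * \<i>)) has_field_derivative mellin_barnes n lam (\<lambda>s. - of_nat n * s * P s) u) (at u)"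
    by (auto intro!: derivative_eq_intros)
  then show ?thesis by (simp add: M_def)
qed

lemma gamma_prod_shift:
  assumes "s \<notin> poles n lam"
  shows "gamma_prod n lam (s + 1) = (\<Prod>l=1..n. s - lam l) * gamma_prod n lam s"
  unfolding gamma_prod_def prod.distrib[symmetric]
proof (rule prod.cong)
  fix l assume "l \<in> {1..n}"
  from Gamma_plus1[OF not_pole[OF assms this]] show "Gamma (s + 1 - lam l) = (s - lam l) * Gamma (s - lam l)"
    by (simp add: algebra_simps)
qed auto

lemma poly_growth_prod: "poly_growth n (\<lambda>s. \<Prod>l=1..n. s - lam l)"
proof (induction n)
  case 0 then show ?case using poly_growth_1 by simp
next
  case (Suc n)
  from poly_growth_mult[OF this, of 1 "- lam (Suc n)"] show ?case by (simp add: mult.commute)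
qed

text \<open>The functional equation of Gamma turns the weight into the shift s -> s + 1, so e^(nu)
  G(s + 1) is a primitive of the weighted kernel. A shift to the right meets no poles, and the end
  contributions G(hyper + 1) - G(hyper) tend to 0; the strip of width 1 in
  \<open>mellin_kernel_hyper_bound\<close> is made for this step.\<close>

lemma mellin_barnes_shift:
  assumes n: "n > 0" and sum0: "(\<Sum>l=1..n. lam l) = 0"
  shows "mellin_barnes n lam (\<lambda>s. \<Prod>l=1..n. s - lam l) u = exp (of_nat n * u) * mellin_barnes n lam (\<lambda>_. 1) u"
proof -
  define S where "S = right_region n lam"
  obtain G where G: "\<And>s. s \<in> S \<Longrightarrow> (G has_field_derivative mellin_kernel n lam (\<lambda>_. 1) u s) (at s)"
    using mellin_primitive_exists[of "\<lambda>_. 1" n lam u] by (auto simp: S_def)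
  have S1: "s + of_real r \<in> S" if "s \<in> S" "r \<ge> 0" for s r using that by (simp add: S_def right_region_def)
  define H where "H s = exp (of_nat n * u) * G (s + 1)" for s
  have H: "(H has_field_derivative mellin_kernel n lam (\<lambda>s. \<Prod>l=1..n. s - lam l) u s) (at s)" if "s \<in> S" for s
  proof -
    have "((\<lambda>s. exp (of_nat n * u) * G (s + 1)) has_field_derivative exp (of_nat n * u) * (mellin_kernel n lam (\<lambda>_. 1) u (s + 1) * 1)) (at s)"
      using S1[OF that, of 1] by (intro DERIV_cmult DERIV_chain2[of G] G) (auto intro!: derivative_eq_intros)
    moreover have "exp (of_nat n * u) * (mellin_kernel n lam (\<lambda>_. 1) u (s + 1) * 1) = mellin_kernel n lam (\<lambda>s. \<Prod>l=1..n. s - lam l) u s"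
    proof -
      have "s \<notin> poles n lam" using that right_region_poles by (auto simp: S_def)
      moreover have "exp (of_nat n * u) * exp (- (of_nat n * (s + 1) * u)) = exp (- (of_nat n * s * u))"
        unfolding mult_exp_exp by (rule arg_cong[where f = exp]) (simp add: algebra_simps)
      ultimately show ?thesis unfolding mellin_kernel_def by (simp add: gamma_prod_shift mult_ac)
    qed
    ultimately show ?thesis by (simp add: H_def[abs_def])
  qed
  obtain C T where C: "C \<ge> 0" "T \<ge> 1" and
    bd: "\<And>s. \<bar>Im s\<bar> \<ge> T \<Longrightarrow> \<bar>Re s - Re (hyper n lam (Im s))\<bar> \<le> 1 \<Longrightarrow>
     norm (mellin_kernel n lam (\<lambda>_. 1) u s) \<le> C * exp (- \<bar>Im s\<bar>)"
    using mellin_kernel_hyper_bound[OF n sum0 poly_growth_1, of "norm u"] by blast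
  have step: "norm (G (hyper n lam t + 1) - G (hyper n lam t)) \<le> C * exp (- \<bar>t\<bar>)" if t: "\<bar>t\<bar> \<ge> T" for t
  proof -
    let ?L = "closed_segment (hyper n lam t) (hyper n lam t + 1)"
    have L: "\<exists>r. 0 \<le> r \<and> r \<le> 1 \<and> s = hyper n lam t + of_real r" if "s \<in> ?L" for s
      using that by (auto simp: closed_segment_def scaleR_conv_of_real algebra_simps)
    have "norm (G (hyper n lam t + 1) - G (hyper n lam t)) \<le> C * exp (- \<bar>t\<bar>) * norm (hyper n lam t + 1 - hyper n lam t)"
    proof (rule field_differentiable_bound[where S = ?L])
      fix s assume "s \<in> ?L"
      then obtain r where r: "0 \<le> r" "r \<le> 1" "s = hyper n lam t + of_real r" using L by blast
      then have "s \<in> S" using S1[of "hyper n lam t" r] hyper_mem[of n lam t] by (simp add: S_def)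
      then show "(G has_field_derivative mellin_kernel n lam (\<lambda>_. 1) u s) (at s within ?L)"
        by (rule has_field_derivative_at_within[OF G])
      have "Im s = t" using r by (simp add: hyper_def)
      then show "norm (mellin_kernel n lam (\<lambda>_. 1) u s) \<le> C * exp (- \<bar>t\<bar>)"
        using bd[of s] r t by simp
    qed auto
    then show ?thesis by simp
  qed
  note e0 = mult_exp_minus_tendsto_0[of C]
  have d1: "((\<lambda>Y. G (hyper n lam Y + 1) - G (hyper n lam Y)) \<longlongrightarrow> 0) at_top"
  proof (rule Lim_null_comparison[OF eventually_mono[OF eventually_ge_at_top[of T]] e0])
    fix Y assume "T \<le> Y"
    then show "norm (G (hyper n lam Y + 1) - G (hyper n lam Y)) \<le> C * exp (- Y)" using step[of Y] C by simp
  qed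
  have d2: "((\<lambda>Y. G (hyper n lam (-Y) + 1) - G (hyper n lam (-Y))) \<longlongrightarrow> 0) at_top"
  proof (rule Lim_null_comparison[OF eventually_mono[OF eventually_ge_at_top[of T]] e0])
    fix Y assume "T \<le> Y"
    then show "norm (G (hyper n lam (-Y) + 1) - G (hyper n lam (-Y))) \<le> C * exp (- Y)" using step[of "-Y"] C by simp
  qed
  have "((\<lambda>Y. exp (of_nat n * u) * (hyper_int n lam (\<lambda>_. 1) Y u + (G (hyper n lam Y + 1) - G (hyper n lam Y)) - (G (hyper n lam (-Y) + 1) - G (hyper n lam (-Y)))))
      \<longlongrightarrow> exp (of_nat n * u) * (2 * of_real pi * \<i> * mellin_barnes n lam (\<lambda>_. 1) u + 0 - 0)) at_top"
    by (intro tendsto_intros d1 d2 tendsto_hyper_int[OF n sum0 poly_growth_1])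
  moreover have "eventually (\<lambda>Y. exp (of_nat n * u) * (hyper_int n lam (\<lambda>_. 1) Y u + (G (hyper n lam Y + 1) - G (hyper n lam Y)) - (G (hyper n lam (-Y) + 1) - G (hyper n lam (-Y))))
      = hyper_int n lam (\<lambda>s. \<Prod>l=1..n. s - lam l) Y u) at_top"
    using eventually_ge_at_top[of 0]
  proof eventually_elim
    case (elim Y)
    have "hyper_int n lam (\<lambda>_. 1) Y u = G (hyper n lam Y) - G (hyper n lam (-Y))"
      by (rule hyper_int_primitive) (use G elim in \<open>simp_all add: S_def\<close>)
    moreover have "hyper_int n lam (\<lambda>s. \<Prod>l=1..n. s - lam l) Y u = H (hyper n lam Y) - H (hyper n lam (-Y))"
      by (rule hyper_int_primitive) (use H elim in \<open>simp_all add: S_def\<close>)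
    ultimately show ?case
      by (simp only: H_def) (simp add: algebra_simps)
  qed
  ultimately have "((\<lambda>Y. hyper_int n lam (\<lambda>s. \<Prod>l=1..n. s - lam l) Y u) \<longlongrightarrow> exp (of_nat n * u) * (2 * of_real pi * \<i> * mellin_barnes n lam (\<lambda>_. 1) u + 0 - 0)) at_top"
    by (rule Lim_transform_eventually)
  moreover have "((\<lambda>Y. hyper_int n lam (\<lambda>s. \<Prod>l=1..n. s - lam l) Y u) \<longlongrightarrow> 2 * of_real pi * \<i> * mellin_barnes n lam (\<lambda>s. \<Prod>l=1..n. s - lam l) u) at_top"
    by (rule tendsto_hyper_int[OF n sum0 poly_growth_prod])
  ultimately have "2 * of_real pi * \<i> * mellin_barnes n lam (\<lambda>s. \<Prod>l=1..n. s - lam l) u = exp (of_nat n * u) * (2 * of_real pi * \<i> * mellin_barnes n lam (\<lambda>_. 1) u + 0 - 0)"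
    by (intro tendsto_unique[OF _ _ _]) auto
  then show ?thesis by simp
qed

section \<open>Straightening the hyperbola to vertical lines\<close>

text \<open>The decay e^(-n\<pi>|Im s|/2) of the Gamma product competes with the growth e^(n|Im
  u||Im s|) of the exponential; \<open>e\<close> is the net rate. The bound must hold on all of Re s
  \<le> b, so the leftward rate n|Re u| is spent on e^(-n Re s Re u).\<close>

lemma mellin_kernel_left_bound:
  fixes b :: real and u :: complex
  assumes n: "n > 0" and sum0: "(\<Sum>l=1..n. lam l) = 0" and P: "poly_growth d P"
  defines "q \<equiv> real n * (b - 1 / 2) + real d" and "e \<equiv> real n * (pi / 2 - \<bar>Im u\<bar>)"
  shows "\<exists>D\<ge>0. \<exists>T\<ge>1. \<forall>s. Re s \<le> b \<longrightarrow> \<bar>Im s\<bar> \<ge> T \<longrightarrow>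
     norm (mellin_kernel n lam P u s) \<le> D * \<bar>Im s\<bar> powr q * exp (- e * \<bar>Im s\<bar>)"
proof -
  define A where "A = real n * \<bar>Re u\<bar>"
  obtain C T where C: "C \<ge> 0" "T \<ge> 1" and
    bd: "\<And>s. Re s \<le> b \<Longrightarrow> \<bar>Im s\<bar> \<ge> T \<Longrightarrow> norm (P s * gamma_prod n lam s)
       \<le> C * \<bar>Im s\<bar> powr q * exp (- real n * pi * \<bar>Im s\<bar> / 2) * exp (A * (Re s - b))"
    unfolding q_def using poly_gamma_prod_bound[OF n sum0 _ P, of A b] by (auto simp: A_def)
  define D where "D = C * exp (A * \<bar>b\<bar>)"
  have kb: "norm (mellin_kernel n lam P u s) \<le> D * \<bar>Im s\<bar> powr q * exp (- e * \<bar>Im s\<bar>)"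
    if s: "Re s \<le> b" "\<bar>Im s\<bar> \<ge> T" for s
  proof -
    have "A * (Re s - b) + - real n * (Re s * Re u - Im s * Im u) \<le> A * \<bar>b\<bar> + real n * \<bar>Im u\<bar> * \<bar>Im s\<bar>"
    proof -
      have "Im s * Im u \<le> \<bar>Im u\<bar> * \<bar>Im s\<bar>" by (metis abs_ge_self abs_mult mult.commute)
      moreover have "\<bar>Re u\<bar> * (Re s - b) - Re s * Re u \<le> \<bar>Re u\<bar> * \<bar>b\<bar>"
      proof (cases "Re u \<ge> 0")
        case True
        then have "- (Re u * b) \<le> Re u * \<bar>b\<bar>" using mult_left_mono[of "-b" "\<bar>b\<bar>" "Re u"] by simp
        then show ?thesis using True by (simp add: algebra_simps)
      next
        case False
        have "- Re u * (2 * Re s - b) \<le> - Re u * \<bar>b\<bar>" using False s by (intro mult_left_mono) auto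
        then show ?thesis using False by (simp add: algebra_simps)
      qed
      ultimately have "real n * (\<bar>Re u\<bar> * (Re s - b) - Re s * Re u + Im s * Im u) \<le> real n * (\<bar>Re u\<bar> * \<bar>b\<bar> + \<bar>Im u\<bar> * \<bar>Im s\<bar>)"
        by (intro mult_left_mono) auto
      then show ?thesis by (simp add: A_def algebra_simps)
    qed
    then have E: "exp (A * (Re s - b)) * exp (- real n * (Re s * Re u - Im s * Im u)) \<le> exp (A * \<bar>b\<bar>) * exp (real n * \<bar>Im u\<bar> * \<bar>Im s\<bar>)"
      unfolding exp_add[symmetric] by simp
    have "norm (mellin_kernel n lam P u s) = norm (P s * gamma_prod n lam s) * exp (- real n * (Re s * Re u - Im s * Im u))"
      unfolding mellin_kernel_def norm_mult[of "P s * gamma_prod n lam s"] norm_exp_mellin ..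
    also have "\<dots> \<le> (C * \<bar>Im s\<bar> powr q * exp (- real n * pi * \<bar>Im s\<bar> / 2) * exp (A * (Re s - b))) * exp (- real n * (Re s * Re u - Im s * Im u))"
      using bd[OF s] by (intro mult_right_mono) auto
    also have "\<dots> \<le> (C * \<bar>Im s\<bar> powr q * exp (- real n * pi * \<bar>Im s\<bar> / 2)) * (exp (A * \<bar>b\<bar>) * exp (real n * \<bar>Im u\<bar> * \<bar>Im s\<bar>))"
      unfolding mult.assoc[of _ "exp (A * (Re s - b))"] using E C by (intro mult_left_mono) auto
    also have "\<dots> = D * \<bar>Im s\<bar> powr q * (exp (- real n * pi * \<bar>Im s\<bar> / 2) * exp (real n * \<bar>Im u\<bar> * \<bar>Im s\<bar>))"
      by (simp add: D_def mult_ac)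
    also have "exp (- real n * pi * \<bar>Im s\<bar> / 2) * exp (real n * \<bar>Im u\<bar> * \<bar>Im s\<bar>) = exp (- e * \<bar>Im s\<bar>)"
      unfolding exp_add[symmetric] by (simp add: e_def algebra_simps)
    finally show ?thesis .
  qed
  moreover have "D \<ge> 0" using C by (simp add: D_def)
  ultimately show ?thesis using C(2) by (intro exI[of _ D] conjI exI[of _ T]) auto
qed

text \<open>The far ends of the hyperbola and of the vertical line are joined by horizontal segments
  in \<open>right_region\<close>. Their length is O(|t|), so at |Im u| = \<pi>/2 the exponent of |t|
  has to lie below -1. The conclusion is phrased with the primitive and not as an integral over Re s
  = b, since that line may pass through poles or to the left of some.\<close>

lemma mellin_barnes_vertical:
  assumes n: "n > 0" and sum0: "(\<Sum>l=1..n. lam l) = 0" and P: "poly_growth d P"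
    and u: "\<bar>Im u\<bar> < pi / 2 \<or> (\<bar>Im u\<bar> = pi / 2 \<and> real n * (b - 1 / 2) + real d < -1)"
    and G: "\<And>s. s \<in> right_region n lam \<Longrightarrow> (G has_field_derivative mellin_kernel n lam P u s) (at s)"
  shows "((\<lambda>Y. G (Complex b Y) - G (Complex b (-Y))) \<longlongrightarrow> 2 * of_real pi * \<i> * mellin_barnes n lam P u) at_top"
proof -
  define R where "R = pole_radius n lam"
  define q where "q = real n * (b - 1 / 2) + real d"
  define e where "e = real n * (pi / 2 - \<bar>Im u\<bar>)"
  obtain D T where D: "D \<ge> 0" "T \<ge> 1" and
    kb: "\<And>s. Re s \<le> b \<Longrightarrow> \<bar>Im s\<bar> \<ge> T \<Longrightarrow> norm (mellin_kernel n lam P u s) \<le> D * \<bar>Im s\<bar> powr q * exp (- e * \<bar>Im s\<bar>)"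
    unfolding q_def e_def using mellin_kernel_left_bound[OF n sum0 P, of b u] by blast
  define T' where "T' = max T (R + 2 - b + \<bar>b\<bar> + 1)"
  have step: "norm (G (Complex b t) - G (hyper n lam t)) \<le> D * \<bar>t\<bar> powr q * exp (- e * \<bar>t\<bar>) * (\<bar>b\<bar> + 1 + \<bar>t\<bar>)" if t: "\<bar>t\<bar> \<ge> T'" for t
  proof -
    let ?h = "hyper n lam t"
    let ?L = "closed_segment ?h (Complex b t)"
    have sq: "\<bar>t\<bar> \<le> sqrt (1 + t\<^sup>2)" "sqrt (1 + t\<^sup>2) \<le> 1 + \<bar>t\<bar>"
      by (auto intro!: real_le_rsqrt real_le_lsqrt simp: power2_eq_square algebra_simps)
    have R0: "R \<ge> 0" by (simp add: R_def pole_radius_nonneg)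
    have "R + 2 - b + \<bar>b\<bar> + 1 \<le> \<bar>t\<bar>" using t by (simp add: T'_def)
    moreover have "Re ?h = R + 2 - sqrt (1 + t\<^sup>2)" by (simp add: hyper_def R_def)
    ultimately have rb: "Re ?h \<le> b" using sq(1) by linarith
    have L: "Im s = t \<and> Re ?h \<le> Re s \<and> Re s \<le> b" if "s \<in> ?L" for s
    proof -
      have "\<exists>v. s = (1 - v) *\<^sub>R ?h + v *\<^sub>R Complex b t \<and> 0 \<le> v \<and> v \<le> 1"
        using that by (simp only: mem_Collect_eq closed_segment_def)
      then obtain v where v: "s = (1 - v) *\<^sub>R ?h + v *\<^sub>R Complex b t" "0 \<le> v" "v \<le> 1" by (elim exE conjE)
      have i: "Im s = t" unfolding v(1) by (simp add: hyper_def algebra_simps)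
      have "Re s = (1 - v) * Re ?h + v * b" unfolding v(1) by simp
      moreover have "(1 - v) * Re ?h \<le> (1 - v) * b" "v * Re ?h \<le> v * b" using v rb by (auto intro!: mult_left_mono)
      ultimately show ?thesis using i by (simp add: algebra_simps)
    qed
    have "norm (G (Complex b t) - G ?h) \<le> D * \<bar>t\<bar> powr q * exp (- e * \<bar>t\<bar>) * norm (Complex b t - ?h)"
    proof (rule field_differentiable_bound[where S = ?L])
      fix s assume s: "s \<in> ?L"
      have "s \<in> right_region n lam" using L[OF s] hyper_mem[of n lam t] by (simp add: right_region_def hyper_def)
      then show "(G has_field_derivative mellin_kernel n lam P u s) (at s within ?L)"
        by (rule has_field_derivative_at_within[OF G])
      show "norm (mellin_kernel n lam P u s) \<le> D * \<bar>t\<bar> powr q * exp (- e * \<bar>t\<bar>)"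
        using kb[of s] L[OF s] t by (simp add: T'_def)
    qed auto
    also have "norm (Complex b t - ?h) \<le> \<bar>b\<bar> + 1 + \<bar>t\<bar>"
    proof -
      have "Complex b t - ?h = of_real (b - Re ?h)" by (simp add: complex_eq_iff hyper_def)
      then have "norm (Complex b t - ?h) = b - Re ?h" using rb by (simp only: norm_of_real)
      also have "\<dots> \<le> \<bar>b\<bar> + 1 + \<bar>t\<bar>" using sq R0 by (simp add: hyper_def R_def)
      finally show ?thesis .
    qed
    finally show ?thesis using D by (simp add: mult_left_mono)
  qed
  have lim0: "((\<lambda>t. D * t powr q * exp (- e * t) * (\<bar>b\<bar> + 1 + t)) \<longlongrightarrow> 0) at_top"
  proof (cases "\<bar>Im u\<bar> < pi / 2")
    case True
    then have "e > 0" using n by (simp add: e_def)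
    then show ?thesis by real_asymp
  next
    case False
    then have "q < -1" "e = 0" using u by (auto simp: q_def e_def)
    have "((\<lambda>t. D * t powr q * (\<bar>b\<bar> + 1 + t)) \<longlongrightarrow> 0) at_top"
      using \<open>q < -1\<close> by real_asymp
    then show ?thesis using \<open>e = 0\<close> by simp
  qed
  have d1: "((\<lambda>Y. G (Complex b Y) - G (hyper n lam Y)) \<longlongrightarrow> 0) at_top"
  proof (rule Lim_null_comparison[OF eventually_mono[OF eventually_ge_at_top[of "max T' 0"]] lim0])
    fix Y assume "max T' 0 \<le> Y"
    then show "norm (G (Complex b Y) - G (hyper n lam Y)) \<le> D * Y powr q * exp (- e * Y) * (\<bar>b\<bar> + 1 + Y)"
      using step[of Y] by simp
  qed
  have d2: "((\<lambda>Y. G (Complex b (-Y)) - G (hyper n lam (-Y))) \<longlongrightarrow> 0) at_top"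
  proof (rule Lim_null_comparison[OF eventually_mono[OF eventually_ge_at_top[of "max T' 0"]] lim0])
    fix Y assume "max T' 0 \<le> Y"
    then show "norm (G (Complex b (-Y)) - G (hyper n lam (-Y))) \<le> D * Y powr q * exp (- e * Y) * (\<bar>b\<bar> + 1 + Y)"
      using step[of "-Y"] by simp
  qed
  have "((\<lambda>Y. hyper_int n lam P Y u + (G (Complex b Y) - G (hyper n lam Y)) - (G (Complex b (-Y)) - G (hyper n lam (-Y)))) \<longlongrightarrow> 2 * of_real pi * \<i> * mellin_barnes n lam P u + 0 - 0) at_top"
    by (intro tendsto_intros d1 d2 tendsto_hyper_int[OF n sum0 P])
  moreover have "eventually (\<lambda>Y. hyper_int n lam P Y u + (G (Complex b Y) - G (hyper n lam Y)) - (G (Complex b (-Y)) - G (hyper n lam (-Y))) = G (Complex b Y) - G (Complex b (-Y))) at_top"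
    using eventually_ge_at_top[of 0] by eventually_elim (simp add: hyper_int_primitive[OF G])
  ultimately have "((\<lambda>Y. G (Complex b Y) - G (Complex b (-Y))) \<longlongrightarrow> 2 * of_real pi * \<i> * mellin_barnes n lam P u + 0 - 0) at_top"
    by (rule Lim_transform_eventually)
  then show ?thesis by simp
qed

section \<open>The contours of the Bessel kernel\<close>

text \<open>The integral over the whole line asks for both ends to go to infinity independently. For
  q < -1 each tail beyond \<open>B\<close> is at most the integral \<open>E B\<close> of its
  majorant, so a symmetric limit is enough.\<close>

lemma has_integral_UNIV_of_symmetric_limit:
  fixes h :: "real \<Rightarrow> complex"
  assumes I: "\<And>Y. Y \<ge> T \<Longrightarrow> (h has_integral I Y) {-Y..Y}"
    and lim: "(I \<longlongrightarrow> L) at_top"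
    and tail: "\<And>t. \<bar>t\<bar> \<ge> T \<Longrightarrow> norm (h t) \<le> D * \<bar>t\<bar> powr q"
    and q: "q < -1" and D: "D \<ge> 0" and T: "T > 0"
  shows "(h has_integral L) UNIV"
proof -
  define E where "E B = D * (- (B powr (q + 1)) / (q + 1))" for B
  have int: "h integrable_on {a..b}" for a b
    by (rule integrable_on_subinterval[OF has_integral_integrable[OF I[of "max T (max \<bar>a\<bar> \<bar>b\<bar>)"]]]) auto
  have tl: "norm (integral {B..b} g) \<le> E B"
    if g: "g integrable_on {B..b}" "\<And>t. t \<ge> T \<Longrightarrow> norm (g t) \<le> D * t powr q" and B: "T \<le> B" for g :: "real \<Rightarrow> complex" and B b
  proof -
    have pos: "((\<lambda>x. D * x powr q) has_integral E B) {B..}"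
      unfolding E_def using has_integral_powr_to_inf[OF q, of B] T B by (intro has_integral_mult_right) simp
    have i: "(\<lambda>x. D * x powr q) integrable_on {B..b}"
      using T B by (intro integrable_continuous_real continuous_intros) auto
    have "norm (integral {B..b} g) \<le> integral {B..b} (\<lambda>x. D * x powr q)"
      using B by (intro integral_norm_bound_integral g i) auto
    also have "\<dots> \<le> integral {B..} (\<lambda>x. D * x powr q)"
      using D by (intro integral_subset_le i has_integral_integrable[OF pos]) auto
    also have "\<dots> = E B" using pos by (rule integral_unique)
    finally show ?thesis .
  qed
  show ?thesis
    unfolding has_integral_alt'[of h L UNIV]
  proof (intro conjI allI impI)
    show "(\<lambda>x. if x \<in> UNIV then h x else 0) integrable_on cbox a b" for a b using int by simp
    fix e :: real assume e: "e > 0"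
    have "((\<lambda>Y. norm (I Y - L) + 2 * E Y) \<longlongrightarrow> norm (L - L) + 2 * 0) at_top"
    proof (intro tendsto_add tendsto_norm tendsto_diff tendsto_mult tendsto_const lim)
      show "(E \<longlongrightarrow> 0) at_top" unfolding E_def[abs_def] using q by real_asymp
    qed
    then have "eventually (\<lambda>Y. norm (I Y - L) + 2 * E Y < e) at_top"
      using order_tendstoD(2) e by simp
    then obtain B where B: "B \<ge> T" "norm (I B - L) + 2 * E B < e"
      using eventually_happens'[OF trivial_limit_at_top_linorder eventually_conj[OF eventually_ge_at_top[of T]]] by blast
    show "\<exists>B>0. \<forall>a b. ball 0 B \<subseteq> cbox a b \<longrightarrow> norm (integral (cbox a b) (\<lambda>x. if x \<in> UNIV then h x else 0) - L) < e"
    proof (intro exI[of _ B] conjI allI impI)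
      show "B > 0" using B T by simp
      fix a b :: real assume "ball 0 B \<subseteq> cbox a b"
      then have "{-B<..<B} \<subseteq> {a..b}" by (simp add: ball_eq_greaterThanLessThan)
      then have ab: "a \<le> -B" "B \<le> b" using \<open>B > 0\<close> by (auto simp: greaterThanLessThan_subseteq_atLeastAtMost_iff)
      have "integral {a..b} h = integral {a..-B} h + integral {-B..b} h"
        using ab \<open>B > 0\<close> by (intro Henstock_Kurzweil_Integration.integral_combine[symmetric] int) auto
      also have "integral {-B..b} h = integral {-B..B} h + integral {B..b} h"
        using ab \<open>B > 0\<close> by (intro Henstock_Kurzweil_Integration.integral_combine[symmetric] int) auto
      also have "integral {-B..B} h = I B" using I[OF B(1)] by (rule integral_unique)
      also have "integral {a..-B} h = integral {B..-a} (\<lambda>t. h (-t))"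
        using Henstock_Kurzweil_Integration.integral_reflect_real[of "-a" B "\<lambda>t. h (-t)"] by simp
      finally have "integral {a..b} h - L = (I B - L) + integral {B..-a} (\<lambda>t. h (-t)) + integral {B..b} h" by simp
      also have "norm \<dots> \<le> norm (I B - L) + E B + E B"
      proof (intro norm_triangle_mono order_refl)
        have tp: "norm (h t) \<le> D * t powr q" "norm (h (-t)) \<le> D * t powr q" if "t \<ge> T" for t
          using tail[of t] tail[of "-t"] that T by auto
        show "norm (integral {B..b} h) \<le> E B" by (intro tl int B(1) tp)
        have "(\<lambda>t. h (-t)) integrable_on {- (-B)..-a}" 
          using int[of a "-B"] Henstock_Kurzweil_Integration.integrable_reflect_real[where f = h and a = a and b = "-B"] by blast
        then show "norm (integral {B..-a} (\<lambda>t. h (-t))) \<le> E B" by (intro tl B(1) tp) auto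
      qed
      finally show "norm (integral (cbox a b) (\<lambda>x. if x \<in> UNIV then h x else 0) - L) < e" using B(2) by simp
    qed
  qed
qed

section \<open>Closing a contour and its winding numbers\<close>

text \<open>The analytic half of \<open>J_contour\<close>. Completing such a curve by three sides of
  a large rectangle on the right gives a closed path, and lying to the left of the curve becomes a
  vanishing winding number.\<close>

locale vertical_end_path =
  fixes \<gamma> :: "real \<Rightarrow> complex" and \<sigma> T :: real
  assumes T: "T > 0"
    and pC1: "\<gamma> piecewise_C1_differentiable_on {-T..T}"
    and tail: "\<And>t. T \<le> \<bar>t\<bar> \<Longrightarrow> \<gamma> t = Complex \<sigma> t"
begin

lemma line_C1: "(\<lambda>t. Complex \<sigma> t) piecewise_C1_differentiable_on A"
proof -
  have "(\<lambda>t. Complex \<sigma> t) = (\<lambda>t. of_real \<sigma> + \<i> * of_real t)" by (auto simp: complex_eq_iff)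
  moreover have "((\<lambda>t. of_real \<sigma> + \<i> * of_real t) has_vector_derivative 0 + \<i> * of_real 1) (at t)" for t
    by (intro has_vector_derivative_add has_vector_derivative_const has_vector_derivative_mult_right has_vector_derivative_of_real) auto
  then have "(\<lambda>t. of_real \<sigma> + \<i> * of_real t :: complex) C1_differentiable_on A"
    unfolding C1_differentiable_on_def by (intro exI[of _ "\<lambda>_. 0 + \<i> * of_real 1"]) auto
  ultimately show ?thesis by (metis C1_differentiable_imp_piecewise)
qed

lemma pC1_large:
  assumes "Y \<ge> T"
  shows "\<gamma> piecewise_C1_differentiable_on {-Y..Y}"
proof -
  have "(\<lambda>t. if t \<le> T then \<gamma> t else Complex \<sigma> t) piecewise_C1_differentiable_on {-T..Y}"
    using T assms tail[of T] by (intro piecewise_C1_differentiable_cases pC1 line_C1) auto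
  moreover have "(\<lambda>t. if t \<le> T then \<gamma> t else Complex \<sigma> t) = \<gamma>" using tail T by fastforce
  ultimately have 1: "\<gamma> piecewise_C1_differentiable_on {-T..Y}" by simp
  have "(\<lambda>t. if t \<le> -T then Complex \<sigma> t else \<gamma> t) piecewise_C1_differentiable_on {-Y..Y}"
    using T assms tail[of "-T"] by (intro piecewise_C1_differentiable_cases 1 line_C1) auto
  moreover have "(\<lambda>t. if t \<le> -T then Complex \<sigma> t else \<gamma> t) = \<gamma>" using tail T by fastforce
  ultimately show ?thesis by simp
qed

lemma range_eq: "range \<gamma> = \<gamma> ` {-T..T} \<union> {z. Re z = \<sigma> \<and> T \<le> \<bar>Im z\<bar>}"
proof (intro equalityI subsetI)
  fix z assume "z \<in> range \<gamma>"
  then obtain t where z: "z = \<gamma> t" by auto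
  show "z \<in> \<gamma> ` {-T..T} \<union> {z. Re z = \<sigma> \<and> T \<le> \<bar>Im z\<bar>}"
  proof (cases "T \<le> \<bar>t\<bar>")
    case True then show ?thesis using tail by (simp add: z)
  next
    case False
    then have "-T \<le> t" "t \<le> T" by linarith+
    then have "t \<in> {-T..T}" by simp
    then have "\<gamma> t \<in> \<gamma> ` {-T..T}" by (rule imageI)
    then show ?thesis unfolding z by (rule UnI1)
  qed
next
  fix z assume "z \<in> \<gamma> ` {-T..T} \<union> {z. Re z = \<sigma> \<and> T \<le> \<bar>Im z\<bar>}"
  moreover have "z = \<gamma> (Im z)" if "Re z = \<sigma>" "T \<le> \<bar>Im z\<bar>"
    using tail[OF that(2)] that by (simp add: complex_eq_iff)
  ultimately show "z \<in> range \<gamma>" by auto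
qed

lemma compact_middle: "compact (\<gamma> ` {-T..T})"
  using pC1 by (intro compact_continuous_image) (auto simp: piecewise_C1_differentiable_on_def)

lemma closed_range: "closed (range \<gamma>)"
proof -
  have "closed {z. Re z = \<sigma> \<and> T \<le> \<bar>Im z\<bar>}"
    by (intro closed_Collect_conj closed_Collect_eq closed_Collect_le continuous_intros)
  then show ?thesis unfolding range_eq using compact_middle compact_imp_closed by blast
qed

lemma Re_bounded_below: "\<exists>m. \<forall>t. m \<le> Re (\<gamma> t)"
proof -
  obtain B where B: "\<And>z. z \<in> \<gamma> ` {-T..T} \<Longrightarrow> norm z \<le> B"
    using compact_imp_bounded[OF compact_middle] by (auto simp: bounded_iff)
  have "min (-B) \<sigma> \<le> Re (\<gamma> t)" for t
  proof (cases "T \<le> \<bar>t\<bar>")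
    case True then show ?thesis by (simp add: tail)
  next
    case False
    then have "t \<in> {-T..T}" by auto
    then have "\<gamma> t \<in> \<gamma> ` {-T..T}" by (rule imageI)
    then have "norm (\<gamma> t) \<le> B" by (rule B)
    then show ?thesis using abs_Re_le_cmod[of "\<gamma> t"] by linarith
  qed
  then show ?thesis by blast
qed

definition middle :: "real \<Rightarrow> real \<Rightarrow> complex" where
  "middle Y = \<gamma> \<circ> (\<lambda>x. (2 * Y) *\<^sub>R x + (- Y))"

text \<open>Half height and right edge are governed by the same Y, so for Y \<ge> \<sigma> all
  points have modulus at least |Y| and the path leaves every bounded set.\<close>

definition closing :: "real \<Rightarrow> real \<Rightarrow> complex" where
  "closing Y = linepath (Complex \<sigma> Y) (Complex Y Y) +++ linepath (Complex Y Y) (Complex Y (-Y))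
     +++ linepath (Complex Y (-Y)) (Complex \<sigma> (-Y))"

lemma middle_ends: "Y \<ge> T \<Longrightarrow> pathstart (middle Y) = Complex \<sigma> (-Y) \<and> pathfinish (middle Y) = Complex \<sigma> Y"
  using tail[of "-Y"] tail[of Y] T by (simp add: middle_def pathstart_def pathfinish_def)

lemma affine_image: "Y > 0 \<Longrightarrow> (\<lambda>x. (2 * Y) * x + (- Y)) ` {0..1} = {-Y..Y::real}"
  by (subst image_affinity_atLeastAtMost) auto

lemma valid_middle: "Y \<ge> T \<Longrightarrow> valid_path (middle Y)"
  unfolding middle_def valid_path_def using T affine_image[of Y]
  by (intro piecewise_C1_differentiable_affine) (simp add: pC1_large)

lemma middle_image: "path_image (middle Y) \<subseteq> range \<gamma>"
  by (auto simp: middle_def path_image_def)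

lemma closing_ends: "pathstart (closing Y) = Complex \<sigma> Y" "pathfinish (closing Y) = Complex \<sigma> (-Y)"
  by (simp_all add: closing_def)

lemma valid_closing: "valid_path (closing Y)"
  by (simp add: closing_def)

lemma closing_image:
  assumes "Y \<ge> \<sigma>"
  shows "path_image (closing Y) \<subseteq> {z. Re z \<ge> \<sigma> \<and> (\<bar>Im z\<bar> = \<bar>Y\<bar> \<or> Re z = Y)}"
proof -
  have c: "convex {z. Re z \<ge> \<sigma> \<and> Im z = r}" "convex {z. Re z = Y}" for r
  proof -
    have "{z. Re z \<ge> \<sigma> \<and> Im z = r} = {z. Re z \<ge> \<sigma>} \<inter> ({z. Im z \<ge> r} \<inter> {z. Im z \<le> r})" "{z. Re z = Y} = {z. Re z \<ge> Y} \<inter> {z. Re z \<le> Y}"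
      by auto
    then show "convex {z. Re z \<ge> \<sigma> \<and> Im z = r}" "convex {z. Re z = Y}"
      by (auto intro!: convex_Int convex_halfspace_Re_ge convex_halfspace_Re_le convex_halfspace_Im_ge convex_halfspace_Im_le)
  qed
  have "closed_segment (Complex \<sigma> Y) (Complex Y Y) \<subseteq> {z. Re z \<ge> \<sigma> \<and> Im z = Y}"
    using assms by (intro closed_segment_subset c) auto
  moreover have "closed_segment (Complex Y (-Y)) (Complex \<sigma> (-Y)) \<subseteq> {z. Re z \<ge> \<sigma> \<and> Im z = -Y}"
    using assms by (intro closed_segment_subset c) auto
  moreover have "closed_segment (Complex Y Y) (Complex Y (-Y)) \<subseteq> {z. Re z = Y}"
    by (intro closed_segment_subset c) auto
  moreover have "path_image (closing Y) \<subseteq> closed_segment (Complex \<sigma> Y) (Complex Y Y) \<union>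
      (closed_segment (Complex Y Y) (Complex Y (-Y)) \<union> closed_segment (Complex Y (-Y)) (Complex \<sigma> (-Y)))"
    unfolding closing_def
    by (rule order_trans[OF path_image_join_subset], intro Un_mono order_refl order_trans[OF path_image_join_subset]) simp_all
  ultimately have "path_image (closing Y) \<subseteq> {z. Re z \<ge> \<sigma> \<and> Im z = Y} \<union> ({z. Re z = Y} \<union> {z. Re z \<ge> \<sigma> \<and> Im z = -Y})"
    by blast
  also have "\<dots> \<subseteq> {z. Re z \<ge> \<sigma> \<and> (\<bar>Im z\<bar> = \<bar>Y\<bar> \<or> Re z = Y)}" using assms by auto
  finally show ?thesis .
qed

text \<open>A point on the left is joined to a far left point \<open>w\<close> by a path
  \<open>g\<close> missing the curve; \<open>g\<close> is compact, so for large Y it also misses the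
  closing part. The winding number is constant along \<open>g\<close> and vanishes at
  \<open>w\<close>, which lies outside a half plane containing the closed path. The threshold for Y
  depends on \<open>p\<close>.\<close>

lemma winding_number_left:
  assumes "left_of_contour \<gamma> p"
  shows "eventually (\<lambda>Y. winding_number (middle Y +++ closing Y) p = 0) at_top"
proof -
  obtain m where m: "\<And>t. m \<le> Re (\<gamma> t)" using Re_bounded_below by blast
  obtain a where a: "\<And>w. Re w < a \<Longrightarrow> connected_component (- range \<gamma>) p w"
    using assms by (auto simp: left_of_contour_def)
  define w where "w = complex_of_real (min a (min m \<sigma>) - 1)"
  have "connected_component (- range \<gamma>) p w" by (intro a) (simp add: w_def)
  then have "path_component (- range \<gamma>) p w"
    using closed_range by (simp add: open_path_connected_component open_Compl)
  then obtain g where g: "path g" "path_image g \<subseteq> - range \<gamma>" "pathstart g = p" "pathfinish g = w"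
    by (auto simp: path_component_def)
  obtain B where B: "\<And>z. z \<in> path_image g \<Longrightarrow> norm z \<le> B"
    using compact_imp_bounded[OF compact_path_image[OF g(1)]] by (auto simp: bounded_iff)
  show ?thesis
    using eventually_ge_at_top[of "max T (max (\<bar>\<sigma>\<bar> + 1) (\<bar>B\<bar> + 1))"]
  proof eventually_elim
    case (elim Y)
    let ?C = "middle Y +++ closing Y"
    have j: "pathfinish (middle Y) = pathstart (closing Y)" using middle_ends[of Y] elim by (simp add: closing_ends)
    have v: "valid_path ?C" using valid_middle[of Y] valid_closing j elim by simp
    have cl: "pathfinish ?C = pathstart ?C" using middle_ends[of Y] elim by (simp add: closing_ends)
    have cli: "path_image (closing Y) \<subseteq> {z. Re z \<ge> \<sigma> \<and> (\<bar>Im z\<bar> = \<bar>Y\<bar> \<or> Re z = Y)}"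
      using elim by (intro closing_image) auto
    have img: "path_image ?C \<subseteq> range \<gamma> \<union> path_image (closing Y)"
      using path_image_join_subset[of "middle Y" "closing Y"] middle_image[of Y] by auto
    have "path_image g \<inter> path_image ?C = {}"
    proof (rule ccontr)
      assume "path_image g \<inter> path_image ?C \<noteq> {}"
      then obtain z where z: "z \<in> path_image g" "z \<in> path_image ?C" by auto
      then have "z \<in> path_image (closing Y)" using g(2) img by auto
      then have "\<bar>Im z\<bar> = \<bar>Y\<bar> \<or> Re z = Y" using cli by auto
      then have "norm z \<ge> \<bar>Y\<bar>" using abs_Re_le_cmod[of z] abs_Im_le_cmod[of z] by auto
      moreover have "\<bar>B\<bar> + 1 \<le> Y" using elim by simp
      ultimately show False using B[OF z(1)] by linarith
    qed
    then have "winding_number ?C p = winding_number ?C w"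
      using v cl g connected_path_image[OF g(1)] valid_path_imp_path
      by (intro winding_number_eq[where S = "path_image g"]) (auto intro: pathstart_in_path_image pathfinish_in_path_image)
    also have "\<dots> = 0"
    proof (rule winding_number_zero_outside[where s = "{z. Re z \<ge> min m \<sigma>}"])
      show "convex {z. Re z \<ge> min m \<sigma>}" by (rule convex_halfspace_Re_ge)
      show "w \<notin> {z. Re z \<ge> min m \<sigma>}" by (simp add: w_def)
      have "range \<gamma> \<subseteq> {z. Re z \<ge> min m \<sigma>}" using m by (auto simp: min_le_iff_disj)
      moreover have "path_image (closing Y) \<subseteq> {z. Re z \<ge> min m \<sigma>}"
        by (rule order_trans[OF cli]) (auto simp: min_le_iff_disj)
      ultimately show "path_image ?C \<subseteq> {z. Re z \<ge> min m \<sigma>}" using img by blast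
    qed (use v cl valid_path_imp_path in auto)
    finally show ?case .
  qed
qed

text \<open>Here the bound on Y is the same for all \<open>p\<close>. This settles all but finitely
  many poles, and the eventual statement above covers the rest.\<close>

lemma winding_number_far_left:
  assumes m: "\<And>t. m \<le> Re (\<gamma> t)" and Y: "Y \<ge> max T \<bar>\<sigma>\<bar>" and p: "Re p < min m \<sigma>"
  shows "winding_number (middle Y +++ closing Y) p = 0"
proof (rule winding_number_zero_outside[where s = "{z. Re z \<ge> min m \<sigma>}"])
  have j: "pathfinish (middle Y) = pathstart (closing Y)" using middle_ends[of Y] Y by (simp add: closing_ends)
  have "valid_path (middle Y +++ closing Y)" using valid_middle[of Y] valid_closing j Y by simp
  then show "path (middle Y +++ closing Y)" by (rule valid_path_imp_path)
  show "convex {z. Re z \<ge> min m \<sigma>}" by (rule convex_halfspace_Re_ge)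
  show "pathfinish (middle Y +++ closing Y) = pathstart (middle Y +++ closing Y)" using middle_ends[of Y] Y by (simp add: closing_ends)
  show "p \<notin> {z. Re z \<ge> min m \<sigma>}" using p by (simp add: min_le_iff_disj not_le)
  have "path_image (closing Y) \<subseteq> {z. Re z \<ge> \<sigma> \<and> (\<bar>Im z\<bar> = \<bar>Y\<bar> \<or> Re z = Y)}"
    using Y by (intro closing_image) auto
  also have "\<dots> \<subseteq> {z. Re z \<ge> min m \<sigma>}" by (auto simp: min_le_iff_disj)
  finally have "path_image (closing Y) \<subseteq> {z. Re z \<ge> min m \<sigma>}" .
  moreover have "range \<gamma> \<subseteq> {z. Re z \<ge> min m \<sigma>}" using m by (auto simp: min_le_iff_disj)
  ultimately show "path_image (middle Y +++ closing Y) \<subseteq> {z. Re z \<ge> min m \<sigma>}"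
    using path_image_join_subset[of "middle Y" "closing Y"] middle_image[of Y] by blast
qed

text \<open>Affine substitution between [0,1] and [-Y,Y]; the finitely many parameters where
  \<gamma> may fail to be differentiable do not affect the integral.\<close>

lemma middle_integral:
  assumes Y: "Y \<ge> T" and i: "(f has_contour_integral i) (middle Y)"
  shows "((\<lambda>t. f (\<gamma> t) * vector_derivative \<gamma> (at t)) has_integral i) {-Y..Y}"
proof -
  have Y0: "Y > 0" using Y T by simp
  obtain S where S: "finite S" "\<gamma> C1_differentiable_on ({-Y..Y} - S)"
    using pC1_large[OF Y] by (auto simp: piecewise_C1_differentiable_on_def)
  define F where "F t = f (\<gamma> t) * vector_derivative \<gamma> (at t)" for t
  define h where "h x = f (middle Y x) * vector_derivative (middle Y) (at x)" for x
  have hi: "(h has_integral i) (cbox 0 1)" using i by (simp add: has_contour_integral h_def[abs_def])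
  have "((\<lambda>t. h ((1 / (2 * Y)) *\<^sub>R t + 1 / 2)) has_integral (i /\<^sub>R (1 / (2 * Y)) ^ DIM(real))) (cbox ((0 - 1 / 2) /\<^sub>R (1 / (2 * Y))) ((1 - 1 / 2) /\<^sub>R (1 / (2 * Y))))"
    using Y0 by (intro has_integral_affinity' hi) auto
  then have "((\<lambda>t. h (t / (2 * Y) + 1 / 2)) has_integral ((2 * Y) *\<^sub>R i)) {-Y..Y}"
  proof -
    have "(0 - 1 / 2) /\<^sub>R (1 / (2 * Y)) = -Y" "(1 - 1 / 2) /\<^sub>R (1 / (2 * Y)) = Y"
      "i /\<^sub>R (1 / (2 * Y)) ^ DIM(real) = (2 * Y) *\<^sub>R i" "(1 / (2 * Y)) *\<^sub>R t = t / (2 * Y)" for t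
      using Y0 by simp_all
    then show "?thesis" if "((\<lambda>t. h ((1 / (2 * Y)) *\<^sub>R t + 1 / 2)) has_integral (i /\<^sub>R (1 / (2 * Y)) ^ DIM(real))) (cbox ((0 - 1 / 2) /\<^sub>R (1 / (2 * Y))) ((1 - 1 / 2) /\<^sub>R (1 / (2 * Y))))"
      using that by (simp only: cbox_interval)
  qed
  then have "((\<lambda>t. (1 / (2 * Y)) *\<^sub>R h (t / (2 * Y) + 1 / 2)) has_integral ((1 / (2 * Y)) *\<^sub>R (2 * Y) *\<^sub>R i)) {-Y..Y}"
    by (rule has_integral_cmul)
  then have 1: "((\<lambda>t. (1 / (2 * Y)) *\<^sub>R h (t / (2 * Y) + 1 / 2)) has_integral i) {-Y..Y}"
    using Y0 by simp
  have "(F has_integral i) {-Y..Y}"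
  proof (rule has_integral_spike_finite[OF S(1) _ 1])
    fix t assume t: "t \<in> {-Y..Y} - S"
    define x where "x = t / (2 * Y) + 1 / 2"
    have x: "(2 * Y) *\<^sub>R x + (- Y) = t" using Y0 by (simp add: x_def field_simps)
    have d: "\<gamma> differentiable at ((2 * Y) *\<^sub>R x + (- Y))"
      unfolding x using S(2) t by (simp add: C1_differentiable_on_eq)
    have d2: "((\<lambda>x. (2 * Y) *\<^sub>R x + (- Y)) has_vector_derivative 2 * Y) (at x)"
      by (auto intro!: derivative_eq_intros simp: has_real_derivative_iff_has_vector_derivative[symmetric])
    then have "vector_derivative (middle Y) (at x) = (2 * Y) *\<^sub>R vector_derivative \<gamma> (at t)"
      unfolding middle_def using vector_derivative_chain_at[OF differentiableI_vector[OF d2] d] x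
      by (simp add: vector_derivative_at[OF d2])
    moreover have "middle Y x = \<gamma> t" using x by (simp add: middle_def)
    ultimately show "F t = (1 / (2 * Y)) *\<^sub>R h (t / (2 * Y) + 1 / 2)"
      unfolding x_def[symmetric] h_def F_def using Y0 by simp
  qed
  then show ?thesis unfolding F_def .
qed

end

lemma closed_poles: "closed (poles n lam)"
proof -
  have "poles n lam = (\<Union>l\<in>{1..n}. (\<lambda>s. s - lam l) -` (\<int>\<^sub>\<le>\<^sub>0))"
  proof (intro equalityI subsetI)
    fix s assume "s \<in> poles n lam"
    then obtain l k where "l \<in> {1..n}" "s = lam l - of_nat k" by (auto simp: poles_def)
    then show "s \<in> (\<Union>l\<in>{1..n}. (\<lambda>s. s - lam l) -` (\<int>\<^sub>\<le>\<^sub>0))" by (intro UN_I[of l]) auto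
  next
    fix s assume "s \<in> (\<Union>l\<in>{1..n}. (\<lambda>s. s - lam l) -` (\<int>\<^sub>\<le>\<^sub>0))"
    then show "s \<in> poles n lam" by (auto simp: poles_def nonpos_Int_iff_pole vimage_def)
  qed
  moreover have "closed ((\<lambda>s. s - lam l) -` (\<int>\<^sub>\<le>\<^sub>0))" for l
    by (intro closed_vimage closed_nonpos_Ints continuous_intros)
  ultimately show ?thesis by (simp add: closed_UN)
qed

lemma left_of_contour_not_range: "left_of_contour \<gamma> p \<Longrightarrow> p \<notin> range \<gamma>"
proof -
  assume "left_of_contour \<gamma> p"
  then obtain a where "\<And>w. Re w < a \<Longrightarrow> connected_component (- range \<gamma>) p w" by (auto simp: left_of_contour_def)
  from this[of "of_real (a - 1)"] have "connected_component (- range \<gamma>) p (of_real (a - 1))" by simp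
  then show ?thesis using connected_component_in by blast
qed

text \<open>The closed path winds around no pole, so Cauchy's theorem makes the integral over the
  middle part opposite to the one over the closing part. For large Y the closing part lies in
  \<open>right_region\<close>, where the primitive evaluates it; the limit of G(\<sigma> + iY) -
  G(\<sigma> - iY) is known from \<open>mellin_barnes_vertical\<close>.\<close>

lemma contour_mellin_integral:
  assumes n: "n > 0" and sum0: "(\<Sum>l=1..n. lam l) = 0" and \<gamma>: "J_contour n lam \<gamma>" and u: "\<bar>Im u\<bar> \<le> pi / 2"
  shows "((\<lambda>t. mellin_kernel n lam (\<lambda>_. 1) u (\<gamma> t) * vector_derivative \<gamma> (at t)) has_integral
           2 * of_real pi * \<i> * mellin_barnes n lam (\<lambda>_. 1) u) UNIV"
proof -
  define f where "f = mellin_kernel n lam (\<lambda>_. 1) u"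
  obtain \<sigma> T where T: "0 < T" and \<sigma>: "\<sigma> < 1 / 2 + (Re (\<Sum>l=1..n. lam l) - 1) / real n"
    and pC: "\<gamma> piecewise_C1_differentiable_on {-T..T}" and tail: "\<And>t. T \<le> \<bar>t\<bar> \<Longrightarrow> \<gamma> t = Complex \<sigma> t"
    and left: "\<And>l k::nat. l \<in> {1..n} \<Longrightarrow> left_of_contour \<gamma> (lam l - of_nat k)"
    using \<gamma> unfolding J_contour_def by blast
  interpret vertical_end_path \<gamma> \<sigma> T by unfold_locales (use T pC tail in auto)
  \<comment> \<open>With the lam_l summing to 0, the bound on \<sigma> says precisely that this
    exponent is below -1, as required when |Im u| = \<pi>/2.\<close>
  have q: "real n * (\<sigma> - 1 / 2) < -1" using \<sigma>[unfolded sum0] n by (simp add: field_simps)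
  obtain G where G: "\<And>s. s \<in> right_region n lam \<Longrightarrow> (G has_field_derivative f s) (at s)"
    using mellin_primitive_exists[of "\<lambda>_. 1" n lam u] by (auto simp: f_def)
  have lim: "((\<lambda>Y. G (Complex \<sigma> Y) - G (Complex \<sigma> (-Y))) \<longlongrightarrow> 2 * of_real pi * \<i> * mellin_barnes n lam (\<lambda>_. 1) u) at_top"
    using n sum0 poly_growth_1 u q by (intro mellin_barnes_vertical G[unfolded f_def]) auto
  obtain m where m: "\<And>t. m \<le> Re (\<gamma> t)" using Re_bounded_below by blast
  \<comment> \<open>Poles lam_l - k with k \<ge> K lie left of the whole closed path. The remaining
    pairs are finite in number, so one threshold for Y serves them all.\<close>
  define K where "K = nat \<lceil>pole_radius n lam - min m \<sigma>\<rceil> + 1"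
  have far: "Re (lam l - of_nat k) < min m \<sigma>" if "l \<in> {1..n}" "k \<ge> K" for l k
  proof -
    have "Re (lam l) \<le> pole_radius n lam" using pole_radius_ge[OF that(1), of lam] by linarith
    moreover have "real k \<ge> real K" using that by simp
    moreover have "real K > pole_radius n lam - min m \<sigma>" unfolding K_def by linarith
    ultimately show ?thesis unfolding minus_complex.sel complex_Re_of_nat by linarith
  qed
  have "eventually (\<lambda>Y. \<forall>lk\<in>{1..n} \<times> {..<K}. winding_number (middle Y +++ closing Y) (lam (fst lk) - of_nat (snd lk)) = 0) at_top"
    by (intro eventually_ball_finite ballI winding_number_left left) auto
  then obtain Y0 where Y0: "\<And>Y l k. Y \<ge> Y0 \<Longrightarrow> l \<in> {1..n} \<Longrightarrow> k < K \<Longrightarrow> winding_number (middle Y +++ closing Y) (lam l - of_nat k) = 0"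
    unfolding eventually_at_top_linorder by (metis (no_types, lifting) SigmaI fst_conv lessThan_iff snd_conv)
  define Y1 where "Y1 = max (max Y0 T) (max (\<bar>\<sigma>\<bar>) (pole_radius n lam + \<bar>\<sigma>\<bar> + 1))"
  have I: "((\<lambda>t. f (\<gamma> t) * vector_derivative \<gamma> (at t)) has_integral G (Complex \<sigma> Y) - G (Complex \<sigma> (-Y))) {-Y..Y}"
    if Y: "Y \<ge> Y1" for Y
  proof -
    let ?C = "middle Y +++ closing Y"
    have YT: "Y \<ge> T" "Y \<ge> Y0" "Y \<ge> \<bar>\<sigma>\<bar>" "Y \<ge> pole_radius n lam + \<bar>\<sigma>\<bar> + 1" using Y by (auto simp: Y1_def)
    have j: "pathfinish (middle Y) = pathstart (closing Y)" using middle_ends[of Y] YT by (simp add: closing_ends)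
    have v: "valid_path ?C" using valid_middle[of Y] valid_closing j YT by simp
    have cl: "pathfinish ?C = pathstart ?C" using middle_ends[of Y] YT by (simp add: closing_ends)
    have "path_image (closing Y) \<subseteq> {z. Re z \<ge> \<sigma> \<and> (\<bar>Im z\<bar> = \<bar>Y\<bar> \<or> Re z = Y)}"
      using YT by (intro closing_image) auto
    also have "\<dots> \<subseteq> right_region n lam"
    proof
      fix z assume "z \<in> {z. Re z \<ge> \<sigma> \<and> (\<bar>Im z\<bar> = \<bar>Y\<bar> \<or> Re z = Y)}"
      then have "Re z \<ge> \<sigma>" "\<bar>Im z\<bar> = \<bar>Y\<bar> \<or> Re z = Y" by auto
      then have "Re z > pole_radius n lam - \<bar>Im z\<bar>" using YT by linarith
      then show "z \<in> right_region n lam" by (simp add: right_region_def)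
    qed
    finally have clr: "path_image (closing Y) \<subseteq> right_region n lam" .
    have "(f has_contour_integral 0) ?C"
    proof (rule Cauchy_theorem_global[where S = "- poles n lam"])
      show "open (- poles n lam)" using closed_poles by (simp add: open_Compl)
      show "f holomorphic_on - poles n lam" unfolding f_def by (rule holomorphic_mellin_kernel) auto
      have "range \<gamma> \<inter> poles n lam = {}"
      proof -
        have "p \<notin> range \<gamma>" if pp: "p \<in> poles n lam" for p
        proof -
          obtain l k where "l \<in> {1..n}" "p = lam l - of_nat k" using pp unfolding poles_def by blast
          then show ?thesis using left_of_contour_not_range[OF left] by simp
        qed
        then show ?thesis by blast
      qed
      then show "path_image ?C \<subseteq> - poles n lam"
        using path_image_join_subset[of "middle Y" "closing Y"] middle_image[of Y] clr right_region_poles[of n lam] by blast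
      fix w assume "w \<notin> - poles n lam"
      then obtain l k where l: "l \<in> {1..n}" and w: "w = lam l - of_nat k" by (auto simp: poles_def)
      show "winding_number ?C w = 0"
      proof (cases "k < K")
        case True then show ?thesis using Y0[OF YT(2) l] w by simp
      next
        case False then show ?thesis unfolding w using YT far[OF l, of k] by (intro winding_number_far_left[OF m]) auto
      qed
    qed (use v cl in auto)
    moreover have c2: "(f has_contour_integral G (pathfinish (closing Y)) - G (pathstart (closing Y))) (closing Y)"
      by (rule contour_integral_primitive[OF has_field_derivative_at_within[OF G] valid_closing clr])
    ultimately have "f contour_integrable_on middle Y"
      using contour_integrable_joinD1[of f "middle Y" "closing Y"] valid_middle[OF YT(1)] by (auto simp: contour_integrable_on_def)
    then have c1: "(f has_contour_integral contour_integral (middle Y) f) (middle Y)" by (simp add: has_contour_integral_integral)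
    have "contour_integral (middle Y) f + (G (pathfinish (closing Y)) - G (pathstart (closing Y))) = 0"
      using has_contour_integral_join[OF c1 c2 valid_middle[OF YT(1)] valid_closing] \<open>(f has_contour_integral 0) ?C\<close>
        has_contour_integral_unique by blast
    then have "contour_integral (middle Y) f = G (Complex \<sigma> Y) - G (Complex \<sigma> (-Y))"
      by (simp add: closing_ends algebra_simps)
    with middle_integral[OF YT(1) c1] show ?thesis by simp
  qed
  obtain D T' where D: "D \<ge> 0" "T' \<ge> 1" and
    kb: "\<And>s. Re s \<le> \<sigma> \<Longrightarrow> \<bar>Im s\<bar> \<ge> T' \<Longrightarrow> norm (f s) \<le> D * \<bar>Im s\<bar> powr (real n * (\<sigma> - 1 / 2) + real 0) * exp (- (real n * (pi / 2 - \<bar>Im u\<bar>)) * \<bar>Im s\<bar>)"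
    unfolding f_def using mellin_kernel_left_bound[OF n sum0 poly_growth_1, of \<sigma> u] by blast
  have vd: "vector_derivative \<gamma> (at t) = \<i>" if "\<bar>t\<bar> > T" for t
  proof (rule vector_derivative_at)
    have "((\<lambda>t. of_real \<sigma> + \<i> * of_real t) has_vector_derivative 0 + \<i> * of_real 1) (at t)"
      by (intro has_vector_derivative_add has_vector_derivative_const has_vector_derivative_mult_right has_vector_derivative_of_real) auto
    then have d: "((\<lambda>t. of_real \<sigma> + \<i> * of_real t) has_vector_derivative \<i>) (at t)" by simp
    have op: "open {t::real. \<bar>t\<bar> > T}" by (intro open_Collect_less continuous_intros)
    show "(\<gamma> has_vector_derivative \<i>) (at t)"
      by (rule has_vector_derivative_transform_within_open[OF d op]) (use that tail in \<open>auto simp: complex_eq_iff\<close>)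
  qed
  have "((\<lambda>t. f (\<gamma> t) * vector_derivative \<gamma> (at t)) has_integral 2 * of_real pi * \<i> * mellin_barnes n lam (\<lambda>_. 1) u) UNIV"
  proof (rule has_integral_UNIV_of_symmetric_limit[OF I lim _ q D(1)])
    show "max Y1 (max T' (T + 1)) > 0" using D by simp
    fix t assume t: "\<bar>t\<bar> \<ge> max Y1 (max T' (T + 1))"
    have gt: "\<gamma> t = Complex \<sigma> t" using t by (intro tail) auto
    have "norm (f (Complex \<sigma> t)) \<le> D * \<bar>t\<bar> powr (real n * (\<sigma> - 1 / 2)) * exp (- (real n * (pi / 2 - \<bar>Im u\<bar>)) * \<bar>t\<bar>)"
      using kb[of "Complex \<sigma> t"] t by simp
    also have "\<dots> \<le> D * \<bar>t\<bar> powr (real n * (\<sigma> - 1 / 2)) * 1"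
      using u D by (intro mult_left_mono) (auto simp: mult_nonneg_nonneg)
    finally show "norm (f (\<gamma> t) * vector_derivative \<gamma> (at t)) \<le> D * \<bar>t\<bar> powr (real n * (\<sigma> - 1 / 2))"
      using vd[of t] t by (simp add: gt norm_mult)
  qed simp
  then show ?thesis by (simp add: f_def)
qed

definition bump_contour :: "real \<Rightarrow> real \<Rightarrow> real \<Rightarrow> complex" where
  "bump_contour \<sigma> R t = Complex (\<sigma> + max 0 (R - \<bar>t\<bar>)) t"

text \<open>A contour must exist for the description in \<open>J_pos\<close> to determine a value.
  Re s as a function of Im s is a tent whose sides run parallel to the wedge of poles, one unit
  further right; from each pole a horizontal segment to the left stays clear of it.\<close>

lemma J_contour_exists:
  assumes "n > 0"
  shows "\<exists>\<gamma>. J_contour n lam \<gamma>"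
proof -
  \<comment> \<open>Subtracting 1 makes the required inequality strict; the minimum with 0 makes the
    height \<open>R\<close> of the tent positive.\<close>
  define \<sigma> where "\<sigma> = min 0 (1 / 2 + (Re (\<Sum>l=1..n. lam l) - 1) / real n - 1)"
  define R where "R = pole_radius n lam - \<sigma> + 1"
  define \<gamma> where "\<gamma> = bump_contour \<sigma> R"
  have R: "R > 0" using pole_radius_nonneg[of n lam] by (simp add: R_def \<sigma>_def)
  have line: "(\<lambda>t. of_real (c + d * t) + \<i> * of_real t :: complex) piecewise_C1_differentiable_on A" for c d A
  proof -
    have "((\<lambda>t. of_real (c + d * t) + \<i> * of_real t) has_vector_derivative of_real d + \<i> * of_real 1) (at t)" for t
      by (intro has_vector_derivative_add has_vector_derivative_mult_right has_vector_derivative_of_real)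
        (auto intro!: derivative_eq_intros)
    then have "(\<lambda>t. of_real (c + d * t) + \<i> * of_real t :: complex) C1_differentiable_on A"
      unfolding C1_differentiable_on_def by (intro exI[of _ "\<lambda>_. of_real d + \<i> * of_real 1"]) auto
    then show ?thesis by (rule C1_differentiable_imp_piecewise)
  qed
  have pC: "\<gamma> piecewise_C1_differentiable_on {-(R+1)..R+1}"
  proof -
    define g where "g = (\<lambda>t. if t \<le> 0 then (if t \<le> -R then of_real (\<sigma> + 0 * t) + \<i> * of_real t else of_real ((\<sigma> + R) + 1 * t) + \<i> * of_real t)
        else (if t \<le> R then of_real ((\<sigma> + R) + (-1) * t) + \<i> * of_real t else of_real (\<sigma> + 0 * t) + \<i> * of_real t))"
    have "g piecewise_C1_differentiable_on {-(R+1)..R+1}"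
      unfolding g_def using R by (intro piecewise_C1_differentiable_cases line) auto
    moreover have "\<gamma> = g" using R by (auto simp: \<gamma>_def bump_contour_def g_def complex_eq_iff fun_eq_iff)
    ultimately show ?thesis by simp
  qed
  have left: "left_of_contour \<gamma> (lam l - of_nat k)" if l: "l \<in> {1..n}" for l k
  proof -
    define p where "p = lam l - of_nat k"
    have "p \<in> poles n lam" using l by (auto simp: p_def poles_def)
    then have p: "Re p + \<bar>Im p\<bar> \<le> pole_radius n lam" by (rule poles_left)
    have "connected_component (- range \<gamma>) p w" if w: "Re w < min \<sigma> (Re p)" for w
    proof -
      define q where "q = Complex (Re w) (Im p)"
      have qp: "closed_segment q p \<subseteq> - range \<gamma>"
      proof
        fix z assume "z \<in> closed_segment q p"
        moreover have "closed_segment q p \<subseteq> {z. Re z \<le> Re p} \<inter> ({z. Im z \<le> Im p} \<inter> {z. Im z \<ge> Im p})"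
          using w by (intro closed_segment_subset convex_Int convex_halfspace_Re_le convex_halfspace_Im_ge convex_halfspace_Im_le) (auto simp: q_def)
        ultimately have z: "Re z \<le> Re p" "Im z = Im p" by force+
        show "z \<in> - range \<gamma>"
        proof
          assume "z \<in> range \<gamma>"
          then obtain t where t: "z = Complex (\<sigma> + max 0 (R - \<bar>t\<bar>)) t" by (auto simp: \<gamma>_def bump_contour_def)
          then have "Re z = \<sigma> + max 0 (R - \<bar>Im p\<bar>)" using z(2) by simp
          then have "Re z \<ge> pole_radius n lam + 1 - \<bar>Im p\<bar>" by (simp add: R_def)
          then show False using z p by linarith
        qed
      qed
      have wq: "closed_segment w q \<subseteq> - range \<gamma>"
      proof
        fix z assume "z \<in> closed_segment w q"
        moreover have "closed_segment w q \<subseteq> {z. Re z < \<sigma>}"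
          using w by (intro closed_segment_subset convex_halfspace_Re_lt) (auto simp: q_def)
        ultimately have z: "Re z < \<sigma>" by auto
        show "z \<in> - range \<gamma>" using z by (auto simp: \<gamma>_def bump_contour_def)
      qed
      have "connected_component (- range \<gamma>) p q"
        unfolding connected_component_def using qp by (intro exI[of _ "closed_segment q p"]) auto
      moreover have "connected_component (- range \<gamma>) q w"
        unfolding connected_component_def using wq by (intro exI[of _ "closed_segment w q"]) auto
      ultimately show ?thesis by (rule connected_component_trans)
    qed
    then show ?thesis unfolding left_of_contour_def p_def by blast
  qed
  have "J_contour n lam \<gamma>"
    unfolding J_contour_def
  proof (intro conjI ballI allI left)
    show "inj \<gamma>" by (auto simp: inj_def \<gamma>_def bump_contour_def)
    show "\<exists>\<sigma> T. 0 < T \<and> \<sigma> < 1 / 2 + (Re (\<Sum>l=1..n. lam l) - 1) / real n \<and>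
        \<gamma> piecewise_C1_differentiable_on {-T..T} \<and> (\<forall>t. T \<le> \<bar>t\<bar> \<longrightarrow> \<gamma> t = Complex \<sigma> t)"
      using pC R by (intro exI[of _ \<sigma>] exI[of _ "R + 1"]) (auto simp: \<sigma>_def \<gamma>_def bump_contour_def)
  qed
  then show ?thesis by blast
qed

section \<open>The Bessel kernel as a rotated Mellin-Barnes integral\<close>

definition sign_sum :: "nat \<Rightarrow> (nat \<Rightarrow> int) \<Rightarrow> int" where
  "sign_sum n sg = (\<Sum>l=1..n. sg l)"

definition rotation :: "nat \<Rightarrow> (nat \<Rightarrow> int) \<Rightarrow> real" where
  "rotation n sg = pi * of_int (sign_sum n sg) / (2 * real n)"

definition J_factor :: "nat \<Rightarrow> (nat \<Rightarrow> int) \<Rightarrow> (nat \<Rightarrow> complex) \<Rightarrow> complex" where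
  "J_factor n sg lam = e2pi (- (\<Sum>l=1..n. of_int (sg l) * lam l) / 4)"

text \<open>The exponential factors of the integrand amount to a rotation of the argument.\<close>

lemma J_integrand_eq:
  assumes "n > 0" "x > 0"
  shows "J_integrand n sg lam x s =
    J_factor n sg lam * mellin_kernel n lam (\<lambda>_. 1) (Complex (ln x) 0 - \<i> * of_real (rotation n sg)) s"
proof -
  have "(\<Prod>l=1..n. e2pi (of_int (sg l) * (s - lam l) / 4)) = exp (\<Sum>l=1..n. 2 * of_real pi * \<i> * (of_int (sg l) * (s - lam l) / 4))"
    by (simp add: e2pi_def exp_sum)
  also have "(\<Sum>l=1..n. 2 * of_real pi * \<i> * (of_int (sg l) * (s - lam l) / 4))
     = 2 * of_real pi * \<i> * (of_int (sign_sum n sg) * s / 4) + 2 * of_real pi * \<i> * (- (\<Sum>l=1..n. of_int (sg l) * lam l) / 4)"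
    unfolding sign_sum_def of_int_sum
    by (simp add: sum_distrib_left sum_distrib_right sum_divide_distrib sum_negf[symmetric] sum.distrib[symmetric] algebra_simps diff_divide_distrib sum_subtractf)
  finally have e: "(\<Prod>l=1..n. e2pi (of_int (sg l) * (s - lam l) / 4)) = exp (2 * of_real pi * \<i> * (of_int (sign_sum n sg) * s / 4)) * J_factor n sg lam"
    by (simp only: exp_add J_factor_def e2pi_def)
  have "of_real x powr (- (of_nat n * s)) = exp (- (of_nat n * s) * of_real (ln x))"
    using assms by (simp add: powr_def Ln_of_real)
  moreover have "exp (2 * of_real pi * \<i> * (of_int (sign_sum n sg) * s / 4)) * exp (- (of_nat n * s) * of_real (ln x))
     = exp (- (of_nat n * s * (Complex (ln x) 0 - \<i> * of_real (rotation n sg))))"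
    unfolding exp_add[symmetric] using assms
    by (intro arg_cong[where f = exp]) (simp add: rotation_def Complex_eq field_simps)
  ultimately show ?thesis
    unfolding J_integrand_def prod.distrib e mellin_kernel_def gamma_prod_def by (simp add: mult_ac)
qed

text \<open>The bound is attained when all signs agree; that is the case for which the power decay
  in \<open>mellin_barnes_vertical\<close> was prepared.\<close>

lemma abs_rotation_le:
  assumes "n > 0" "\<forall>l\<in>{1..n}. sg l \<in> {1, -1}"
  shows "\<bar>rotation n sg\<bar> \<le> pi / 2"
proof -
  have "\<bar>sign_sum n sg\<bar> \<le> (\<Sum>l=1..n. \<bar>sg l\<bar>)" unfolding sign_sum_def by (rule sum_abs)
  also have "\<dots> = (\<Sum>l=1..n. 1)"
  proof (rule sum.cong)
    fix l assume "l \<in> {1..n}"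
    then have "sg l \<in> {1, -1}" using assms(2) by blast
    then show "\<bar>sg l\<bar> = 1" by auto
  qed simp
  finally have "\<bar>real_of_int (sign_sum n sg)\<bar> \<le> real n" by simp
  then have "pi * \<bar>real_of_int (sign_sum n sg)\<bar> / (2 * real n) \<le> pi * real n / (2 * real n)"
    using assms by (intro divide_right_mono mult_left_mono) auto
  then show ?thesis using assms by (simp add: rotation_def abs_mult)
qed

lemma J_pos_eq:
  assumes n: "n > 0" and sg: "\<forall>l\<in>{1..n}. sg l \<in> {1, -1}" and sum0: "(\<Sum>l=1..n. lam l) = 0" and x: "x > 0"
  shows "J_pos n sg lam x = J_factor n sg lam * mellin_barnes n lam (\<lambda>_. 1) (Complex (ln x) 0 - \<i> * of_real (rotation n sg))"
  unfolding J_pos_def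
proof (rule the_equality)
  define u where "u = Complex (ln x) 0 - \<i> * of_real (rotation n sg)"
  have u: "\<bar>Im u\<bar> \<le> pi / 2" using abs_rotation_le[OF n sg] by (simp add: u_def)
  have *: "((\<lambda>t. J_integrand n sg lam x (\<gamma> t) * vector_derivative \<gamma> (at t)) has_integral
      2 * of_real pi * \<i> * (J_factor n sg lam * mellin_barnes n lam (\<lambda>_. 1) u)) UNIV" if "J_contour n lam \<gamma>" for \<gamma>
    using has_integral_mult_right[OF contour_mellin_integral[OF n sum0 that u], of "J_factor n sg lam"]
    unfolding J_integrand_eq[OF n x] u_def[symmetric] by (simp add: mult_ac)
  then show "\<forall>\<gamma>. J_contour n lam \<gamma> \<longrightarrow> ((\<lambda>t. J_integrand n sg lam x (\<gamma> t) * vector_derivative \<gamma> (at t)) has_integral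
      2 * of_real pi * \<i> * (J_factor n sg lam * mellin_barnes n lam (\<lambda>_. 1) (Complex (ln x) 0 - \<i> * of_real (rotation n sg)))) UNIV"
    unfolding u_def by blast
  fix v assume v: "\<forall>\<gamma>. J_contour n lam \<gamma> \<longrightarrow> ((\<lambda>t. J_integrand n sg lam x (\<gamma> t) * vector_derivative \<gamma> (at t)) has_integral (2 * of_real pi * \<i> * v)) UNIV"
  obtain \<gamma> where \<gamma>: "J_contour n lam \<gamma>" using J_contour_exists[OF n] by blast
  have "2 * of_real pi * \<i> * v = 2 * of_real pi * \<i> * (J_factor n sg lam * mellin_barnes n lam (\<lambda>_. 1) u)"
    using v \<gamma> *[OF \<gamma>] has_integral_unique by blast
  then show "v = J_factor n sg lam * mellin_barnes n lam (\<lambda>_. 1) (Complex (ln x) 0 - \<i> * of_real (rotation n sg))"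
    by (simp add: u_def)
qed

lemma holomorphic_mellin_barnes:
  assumes "n > 0" "(\<Sum>l=1..n. lam l) = 0" "poly_growth d P"
  shows "mellin_barnes n lam P holomorphic_on A"
  unfolding holomorphic_on_def field_differentiable_def
  using mellin_barnes_deriv[OF assms] has_field_derivative_at_within by blast

text \<open>Identity theorem, as the end point of the ray is a limit point of it. It gives
  uniqueness of the analytic continuation, and later the vanishing of a solution that is 0 on a
  ray.\<close>

lemma entire_eq_if_eq_on_ray:
  assumes f: "f holomorphic_on UNIV" and g: "g holomorphic_on UNIV" and eq: "\<And>r. r \<ge> c \<Longrightarrow> f (of_real r) = g (of_real r)"
  shows "f = g"
proof
  fix z
  have "complex_of_real c islimpt of_real ` {c..}"
  proof (rule islimptI)
    fix T :: "complex set" assume "of_real c \<in> T" "open T"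
    then obtain e where e: "e > 0" "ball (of_real c) e \<subseteq> T" by (auto simp: open_contains_ball)
    then have "complex_of_real (c + e / 2) \<in> T" by (intro subsetD[OF e(2)]) (simp add: dist_norm)
    moreover have "complex_of_real (c + e / 2) \<noteq> of_real c" using e by (simp only: of_real_eq_iff)
    moreover have "complex_of_real (c + e / 2) \<in> of_real ` {c..}" using e by (intro imageI) simp
    ultimately show "\<exists>y\<in>of_real ` {c..}. y \<in> T \<and> y \<noteq> complex_of_real c" by blast
  qed
  then have "f z - g z = 0"
    using analytic_continuation[of "\<lambda>z. f z - g z" UNIV "of_real ` {c..}" "of_real c" z] f g eq
    by (auto intro!: holomorphic_intros)
  then show "f z = g z" by simp
qed

lemma J_fun_eq:
  assumes n: "n > 0" and sg: "\<forall>l\<in>{1..n}. sg l \<in> {1, -1}" and sum0: "(\<Sum>l=1..n. lam l) = 0"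
  shows "J_fun n sg lam = (\<lambda>z. J_factor n sg lam * mellin_barnes n lam (\<lambda>_. 1) (z - \<i> * of_real (rotation n sg)))"
  unfolding J_fun_def
proof (rule the_equality)
  define F where "F = (\<lambda>z. J_factor n sg lam * mellin_barnes n lam (\<lambda>_. 1) (z - \<i> * of_real (rotation n sg)))"
  have "(\<lambda>z. mellin_barnes n lam (\<lambda>_. 1) (z - \<i> * of_real (rotation n sg))) holomorphic_on UNIV"
    by (rule holomorphic_on_compose_gen[unfolded o_def, where t = UNIV, OF _ holomorphic_mellin_barnes[OF n sum0 poly_growth_1]])
      (auto intro!: holomorphic_intros)
  then have F: "F holomorphic_on UNIV" unfolding F_def by (intro holomorphic_intros)
  have Fx: "F (cov_polar x 0) = J_pos n sg lam x" if "x > 0" for x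
    by (simp add: F_def J_pos_eq[OF n sg sum0 that] cov_polar_def)
  show "F holomorphic_on UNIV \<and> (\<forall>x>0. F (cov_polar x 0) = J_pos n sg lam x)" using F Fx by blast
  fix F' assume F': "F' holomorphic_on UNIV \<and> (\<forall>x>0. F' (cov_polar x 0) = J_pos n sg lam x)"
  show "F' = F"
  proof (rule entire_eq_if_eq_on_ray[where c = 0])
    fix r :: real
    have "cov_polar (exp r) 0 = of_real r" by (simp add: cov_polar_def complex_of_real_def)
    then show "F' (of_real r) = F (of_real r)" using F' Fx[of "exp r"] by (metis exp_gt_zero)
  qed (use F F' in auto)
qed

section \<open>The Bessel equation in Euler form\<close>

text \<open>The Stirling number of the second kind in explicit form: with \<theta> = z d/dz, the
  power \<theta>^N is the sum of S(N,j) z^j (d/dz)^j. The term r = 0 is kept because 0^0 = 1 matters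
  at N = 0.\<close>

definition stirling2 :: "nat \<Rightarrow> nat \<Rightarrow> complex" where
  "stirling2 N j = (\<Sum>r\<le>j. (-1) ^ (j - r) * of_nat r ^ N / (fact r * fact (j - r)))"

lemma stirling2_0: "stirling2 0 j = (if j = 0 then 1 else 0)"
proof -
  have "stirling2 0 j * fact j = (\<Sum>r\<le>j. of_nat (j choose r) * 1 ^ r * (-1) ^ (j - r))"
    unfolding stirling2_def sum_distrib_right
    by (intro sum.cong) (auto simp: binomial_fact)
  also have "\<dots> = (1 + (-1)) ^ j" by (rule binomial_ring[symmetric])
  also have "\<dots> = (if j = 0 then 1 else 0)" by (simp add: power_0_left)
  finally show ?thesis using fact_nonzero[of j] by (auto split: if_splits)
qed

lemma stirling2_Suc: "stirling2 (Suc N) j = of_nat j * stirling2 N j + (if j = 0 then 0 else stirling2 N (j - 1))"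
proof (cases j)
  case 0 then show ?thesis by (simp add: stirling2_def)
next
  case (Suc i)
  have "stirling2 (Suc N) j - of_nat j * stirling2 N j = (\<Sum>r\<le>Suc i. (of_nat r - of_nat (Suc i)) * ((-1) ^ (Suc i - r) * of_nat r ^ N / (fact r * fact (Suc i - r))))"
    unfolding stirling2_def Suc sum_distrib_left sum_subtractf[symmetric]
  proof (intro sum.cong refl)
    fix r
    have "(-1) ^ (Suc i - r) * of_nat r ^ Suc N / (fact r * fact (Suc i - r)) = (of_nat r * ((-1) ^ (Suc i - r) * of_nat r ^ N / (fact r * fact (Suc i - r))) :: complex)"
      by simp
    then show "(-1) ^ (Suc i - r) * of_nat r ^ Suc N / (fact r * fact (Suc i - r)) - of_nat (Suc i) * ((-1) ^ (Suc i - r) * of_nat r ^ N / (fact r * fact (Suc i - r)))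
      = ((of_nat r - of_nat (Suc i)) * ((-1) ^ (Suc i - r) * of_nat r ^ N / (fact r * fact (Suc i - r))) :: complex)"
      by (simp only: left_diff_distrib)
  qed
  \<comment> \<open>The term r = i + 1 vanishes; in the others r - (i + 1) cancels one factor of the
    factorial of i + 1 - r.\<close>
  also have "\<dots> = (\<Sum>r\<le>i. (of_nat r - of_nat (Suc i)) * ((-1) ^ (Suc i - r) * of_nat r ^ N / (fact r * fact (Suc i - r))))"
    by simp
  also have "\<dots> = stirling2 N i"
    unfolding stirling2_def
  proof (intro sum.cong refl)
    fix r assume "r \<in> {..i}"
    then obtain d where d: "i = r + d" using le_Suc_ex by auto
    have "(of_nat r - of_nat (Suc i) :: complex) = - of_nat (Suc d)" by (simp add: d)
    moreover have "Suc i - r = Suc d" "i - r = d" by (auto simp: d)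
    moreover have "fact (Suc d) = (of_nat (Suc d) * fact d :: complex)" by simp
    moreover have "(of_nat (Suc d) :: complex) \<noteq> 0" by (rule of_nat_neq_0)
    ultimately show "(of_nat r - of_nat (Suc i)) * ((-1) ^ (Suc i - r) * of_nat r ^ N / (fact r * fact (Suc i - r)))
        = (-1) ^ (i - r) * of_nat r ^ N / (fact r * fact (i - r) :: complex)"
      by (simp del: of_nat_Suc fact_Suc)
  qed
  finally show ?thesis using Suc by (simp add: algebra_simps)
qed

lemma stirling2_eq_0: "N < j \<Longrightarrow> stirling2 N j = 0"
proof (induction N arbitrary: j)
  case 0 then show ?case by (simp add: stirling2_0)
next
  case (Suc N) then show ?case by (simp add: stirling2_Suc)
qed

text \<open>This identifies the numbers in the definition of V_(n,j) as Stirling numbers; the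
  separate clause for j = 0 is the value S(m,0).\<close>

lemma bessel_A_eq: "bessel_A j m = stirling2 (m + j) j"
proof (cases "j = 0")
  case True then show ?thesis by (simp add: bessel_A_def stirling2_def power_0_left)
next
  case False
  have "{..j} = insert 0 {1..j}" by auto
  then show ?thesis using False by (simp add: bessel_A_def stirling2_def power_0_left)
qed

lemma elem_sym_eq_0: "k < m \<Longrightarrow> elem_sym k m lam = 0"
proof -
  assume "k < m"
  have "\<not> (S \<subseteq> {1..k} \<and> card S = m)" for S
    using card_mono[of "{1..k}" S] \<open>k < m\<close> by auto
  then have "{S. S \<subseteq> {1..k} \<and> card S = m} = {}" by blast
  then show ?thesis by (simp only: elem_sym_def) simp
qed

lemma elem_sym_Suc:
  "elem_sym (Suc k) m lam = elem_sym k m lam + (if m = 0 then 0 else lam (Suc k) * elem_sym k (m - 1) lam)"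
proof -
  define A where "A m = {S. S \<subseteq> {1..k} \<and> card S = m}" for m
  have finA: "finite (A m)" for m by (rule finite_subset[of _ "Pow {1..k}"]) (auto simp: A_def)
  have fS: "finite S" "Suc k \<notin> S" if "S \<in> A m" for S m using that finite_subset[of S "{1..k}"] by (auto simp: A_def)
  have e: "elem_sym k m lam = (\<Sum>S\<in>A m. \<Prod>l\<in>S. lam l)" for m by (simp add: elem_sym_def A_def)
  show ?thesis
  proof (cases m)
    case 0
    have "S \<subseteq> {1..i} \<and> card S = 0 \<longleftrightarrow> S = {}" for i :: nat and S using finite_subset[of S "{1..i}"] by auto
    then have "{S. S \<subseteq> {1..i} \<and> card S = 0} = {{}}" for i :: nat by (simp only: singleton_conv)
    then show ?thesis unfolding 0 elem_sym_def by simp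
  next
    case (Suc i)
    have U: "{S. S \<subseteq> {1..Suc k} \<and> card S = Suc i} = A (Suc i) \<union> insert (Suc k) ` A i"
    proof (intro equalityI subsetI)
      fix S assume "S \<in> {S. S \<subseteq> {1..Suc k} \<and> card S = Suc i}"
      then have S: "S \<subseteq> {1..Suc k}" "card S = Suc i" by auto
      show "S \<in> A (Suc i) \<union> insert (Suc k) ` A i"
      proof (cases "Suc k \<in> S")
        case True
        then have "S = insert (Suc k) (S - {Suc k})" "S - {Suc k} \<in> A i"
          using S by (auto simp: A_def)
        then show ?thesis by blast
      next
        case False
        then have "S \<in> A (Suc i)" using S by (auto simp: A_def le_Suc_eq)
        then show ?thesis by simp
      qed
    next
      fix S assume "S \<in> A (Suc i) \<union> insert (Suc k) ` A i"
      then consider "S \<in> A (Suc i)" | S' where "S' \<in> A i" "S = insert (Suc k) S'" by blast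
      then show "S \<in> {S. S \<subseteq> {1..Suc k} \<and> card S = Suc i}"
      proof cases
        case 1 then show ?thesis by (auto simp: A_def)
      next
        case 2 then show ?thesis using fS[of S' i] by (auto simp: A_def)
      qed
    qed
    have d: "A (Suc i) \<inter> insert (Suc k) ` A i = {}" using fS by auto
    have inj: "inj_on (insert (Suc k)) (A i)" 
    proof (rule inj_onI)
      fix S S' assume "S \<in> A i" "S' \<in> A i" "insert (Suc k) S = insert (Suc k) S'"
      then show "S = S'" using fS(2)[of S i] fS(2)[of S' i] by (simp add: insert_ident)
    qed
    have "elem_sym (Suc k) m lam = (\<Sum>S\<in>A (Suc i). \<Prod>l\<in>S. lam l) + (\<Sum>S\<in>insert (Suc k) ` A i. \<Prod>l\<in>S. lam l)"
      unfolding elem_sym_def[of "Suc k"] Suc U using finA d by (intro sum.union_disjoint) auto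
    also have "(\<Sum>S\<in>insert (Suc k) ` A i. \<Prod>l\<in>S. lam l) = (\<Sum>S\<in>A i. lam (Suc k) * (\<Prod>l\<in>S. lam l))"
      unfolding sum.reindex[OF inj] o_def using fS by (intro sum.cong) auto
    finally show ?thesis by (simp add: Suc e sum_distrib_left)
  qed
qed

text \<open>Coefficients of the product of \<theta> + mu_l, l \<le> k, in the operators z^j
  (d/dz)^j. The recursion is \<theta> z^j (d/dz)^j = j z^j (d/dz)^j + z^(j+1) (d/dz)^(j+1).\<close>

fun euler_coeff :: "(nat \<Rightarrow> complex) \<Rightarrow> nat \<Rightarrow> nat \<Rightarrow> complex" where
  "euler_coeff mu 0 j = (if j = 0 then 1 else 0)"
| "euler_coeff mu (Suc k) j = (of_nat j + mu (Suc k)) * euler_coeff mu k j + (if j = 0 then 0 else euler_coeff mu k (j - 1))"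

lemma euler_coeff_eq_0: "k < j \<Longrightarrow> euler_coeff mu k j = 0"
  by (induction k arbitrary: j) auto

lemma euler_coeff_top: "euler_coeff mu k k = 1"
  by (induction k) (auto simp: euler_coeff_eq_0)

text \<open>For k + 1 = n this is n(n - 1)/2 plus the sum of the indices. Its vanishing for the
  twisted indices is what the Gronwall argument lives on.\<close>

lemma euler_coeff_subtop: "euler_coeff mu (Suc k) k = (\<Sum>i\<le>k. of_nat i + mu (Suc i))"
proof (induction k)
  case (Suc k)
  have "euler_coeff mu (Suc (Suc k)) (Suc k) = (of_nat (Suc k) + mu (Suc (Suc k))) * euler_coeff mu (Suc k) (Suc k) + euler_coeff mu (Suc k) k"
    by simp
  then show ?case unfolding Suc.IH euler_coeff_top by simp
qed auto

text \<open>Expanding the product in powers of \<theta> gives elementary symmetric polynomials, and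
  each power of \<theta> gives Stirling numbers; the induction runs both recursions at once.\<close>

lemma euler_coeff_elem_sym:
  "euler_coeff (\<lambda>l. c * lam l) k j = (\<Sum>m\<le>k. stirling2 (k - m) j * c ^ m * elem_sym k m lam)"
proof (induction k arbitrary: j)
  case 0
  have "elem_sym 0 0 lam = 1"
  proof -
    have "{S. S \<subseteq> {1..0::nat} \<and> card S = 0} = {{}}" by auto
    then show ?thesis by (simp only: elem_sym_def) simp
  qed
  then show ?case by (simp add: stirling2_0)
next
  case (Suc k)
  have "(\<Sum>m\<le>Suc k. stirling2 (Suc k - m) j * c ^ m * elem_sym (Suc k) m lam)
     = (\<Sum>m\<le>Suc k. stirling2 (Suc k - m) j * c ^ m * elem_sym k m lam)
       + (\<Sum>m\<le>Suc k. stirling2 (Suc k - m) j * c ^ m * (if m = 0 then 0 else lam (Suc k) * elem_sym k (m - 1) lam))"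
    unfolding elem_sym_Suc[of k] sum.distrib[symmetric] by (simp add: distrib_left)
  also have "(\<Sum>m\<le>Suc k. stirling2 (Suc k - m) j * c ^ m * elem_sym k m lam) = (\<Sum>m\<le>k. stirling2 (Suc (k - m)) j * c ^ m * elem_sym k m lam)"
    by (simp add: elem_sym_eq_0 Suc_diff_le)
  also have "\<dots> = of_nat j * euler_coeff (\<lambda>l. c * lam l) k j + (if j = 0 then 0 else euler_coeff (\<lambda>l. c * lam l) k (j - 1))"
    unfolding stirling2_Suc Suc.IH by (simp add: sum_distrib_left sum.distrib[symmetric] algebra_simps)
  also have "(\<Sum>m\<le>Suc k. stirling2 (Suc k - m) j * c ^ m * (if m = 0 then 0 else lam (Suc k) * elem_sym k (m - 1) lam))
     = (\<Sum>m\<le>k. stirling2 (k - m) j * c ^ Suc m * (lam (Suc k) * elem_sym k m lam))"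
    by (subst sum.atMost_Suc_shift) simp
  also have "\<dots> = c * lam (Suc k) * euler_coeff (\<lambda>l. c * lam l) k j"
    unfolding Suc.IH sum_distrib_left by (intro sum.cong) auto
  finally show ?case by (simp add: algebra_simps)
qed

text \<open>Hence the Bessel equation factors: it says that the product of the operators \<theta> +
  n lam_l multiplies w by \<epsilon> (in)^n z^n.\<close>

lemma bessel_V_eq:
  assumes "j \<le> n"
  shows "bessel_V n j lam = euler_coeff (\<lambda>l. of_nat n * lam l) n j"
proof -
  have "bessel_V n j lam = (\<Sum>m\<in>{0..n-j}. stirling2 (n - m) j * of_nat n ^ m * elem_sym n m lam)"
    unfolding bessel_V_def bessel_A_eq using assms by (intro sum.cong) auto
  also have "\<dots> = (\<Sum>m\<le>n. stirling2 (n - m) j * of_nat n ^ m * elem_sym n m lam)"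
    by (intro sum.mono_neutral_left) (use assms in \<open>auto intro!: stirling2_eq_0\<close>)
  finally show ?thesis by (simp add: euler_coeff_elem_sym)
qed

text \<open>In the coordinate u = log z of the cover, \<theta> is simply d/du.\<close>

fun euler_op :: "(nat \<Rightarrow> complex) \<Rightarrow> nat \<Rightarrow> (complex \<Rightarrow> complex) \<Rightarrow> complex \<Rightarrow> complex" where
  "euler_op mu 0 f = f"
| "euler_op mu (Suc k) f = (\<lambda>u. deriv (euler_op mu k f) u + mu (Suc k) * euler_op mu k f u)"

lemma holomorphic_cov_deriv_power:
  "f holomorphic_on UNIV \<Longrightarrow> (cov_deriv ^^ j) f holomorphic_on UNIV"
proof (induction j)
  case (Suc j)
  then show ?case by (auto simp: cov_deriv_def cov_proj_def intro!: holomorphic_intros)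
qed auto

lemma holomorphic_euler_op: "f holomorphic_on UNIV \<Longrightarrow> euler_op mu k f holomorphic_on UNIV"
  by (induction k) (auto intro!: holomorphic_intros)

lemma entire_deriv: "f holomorphic_on UNIV \<Longrightarrow> (f has_field_derivative deriv f u) (at u)"
  by (rule holomorphic_derivI) auto

lemma euler_op_eq:
  assumes f: "f holomorphic_on UNIV"
  shows "euler_op mu k f u = (\<Sum>j\<le>k. euler_coeff mu k j * exp u ^ j * (cov_deriv ^^ j) f u)"
proof (induction k arbitrary: u)
  case (Suc k)
  define t where "t j u = exp u ^ j * (cov_deriv ^^ j) f u" for j u
  have t: "(t j has_field_derivative of_nat j * t j u + t (Suc j) u) (at u)" for j u
  proof -
    have e: "deriv ((cov_deriv ^^ j) f) u = exp u * (cov_deriv ^^ Suc j) f u"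
      by (simp add: cov_deriv_def cov_proj_def)
    have "((\<lambda>u. exp (of_nat j * u) * (cov_deriv ^^ j) f u) has_field_derivative
      exp (of_nat j * u) * deriv ((cov_deriv ^^ j) f) u + (exp (of_nat j * u) * of_nat j) * (cov_deriv ^^ j) f u) (at u)"
      by (auto intro!: derivative_eq_intros entire_deriv holomorphic_cov_deriv_power f)
    then show ?thesis unfolding e t_def[abs_def] exp_of_nat_mult by (simp add: algebra_simps)
  qed
  have IH: "euler_op mu k f = (\<lambda>u. \<Sum>j\<le>k. euler_coeff mu k j * t j u)"
    using Suc by (auto simp: t_def mult_ac)
  have "deriv (euler_op mu k f) u = (\<Sum>j\<le>k. euler_coeff mu k j * (of_nat j * t j u + t (Suc j) u))"
    unfolding IH by (intro DERIV_imp_deriv DERIV_sum DERIV_cmult t)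
  then have "euler_op mu (Suc k) f u = (\<Sum>j\<le>k. (of_nat j + mu (Suc k)) * euler_coeff mu k j * t j u) + (\<Sum>j\<le>k. euler_coeff mu k j * t (Suc j) u)"
    by (simp add: IH sum_distrib_left sum.distrib[symmetric] algebra_simps)
  also have "(\<Sum>j\<le>k. (of_nat j + mu (Suc k)) * euler_coeff mu k j * t j u) = (\<Sum>j\<le>Suc k. (of_nat j + mu (Suc k)) * euler_coeff mu k j * t j u)"
    by (simp add: euler_coeff_eq_0)
  also have "(\<Sum>j\<le>k. euler_coeff mu k j * t (Suc j) u) = (\<Sum>j\<le>Suc k. (if j = 0 then 0 else euler_coeff mu k (j - 1)) * t j u)"
    by (subst sum.atMost_Suc_shift) simp
  finally show ?case by (simp add: t_def sum.distrib[symmetric] algebra_simps)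
qed simp

lemma bessel_solution_iff:
  assumes "n > 0"
  shows "bessel_solution n lam \<epsilon> w \<longleftrightarrow> w holomorphic_on UNIV \<and>
    (\<forall>z. euler_op (\<lambda>l. of_nat n * lam l) n w z = \<epsilon> * (\<i> * of_nat n) ^ n * exp (of_nat n * z) * w z)"
proof -
  have "(\<Sum>j=1..n. bessel_V n j lam * cov_proj z ^ j * (cov_deriv ^^ j) w z)
          + (bessel_V n 0 lam - \<epsilon> * (\<i> * of_nat n) ^ n * cov_proj z ^ n) * w z
       = euler_op (\<lambda>l. of_nat n * lam l) n w z - \<epsilon> * (\<i> * of_nat n) ^ n * exp (of_nat n * z) * w z"
    if "w holomorphic_on UNIV" for z
  proof -
    have "{..n} = insert 0 {1..n}" by auto
    then have "euler_op (\<lambda>l. of_nat n * lam l) n w z = bessel_V n 0 lam * w z + (\<Sum>j=1..n. bessel_V n j lam * cov_proj z ^ j * (cov_deriv ^^ j) w z)"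
      unfolding euler_op_eq[OF that] by (simp add: bessel_V_eq cov_proj_def)
    then show ?thesis by (simp only: cov_proj_def exp_of_nat_mult) (simp add: algebra_simps)
  qed
  then show ?thesis unfolding bessel_solution_def by auto
qed

section \<open>Formal solutions and their recursion\<close>

text \<open>The operator \<theta> + \<mu> maps e^w w^p to e^w (w^(p+1) + (p + \<mu>) w^p). After k
  factors applied to e^w w^(-m), this is the coefficient of e^w w^(k-j-m); the second summand of the
  recursion comes from p = k - (j - 1) - m.\<close>

fun laurent_coeff :: "(nat \<Rightarrow> complex) \<Rightarrow> nat \<Rightarrow> nat \<Rightarrow> complex \<Rightarrow> complex" where
  "laurent_coeff mu 0 j m = (if j = 0 then 1 else 0)"
| "laurent_coeff mu (Suc k) j m = laurent_coeff mu k j m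
     + (if j = 0 then 0 else (of_nat k - of_nat (j - 1) - m + mu (Suc k)) * laurent_coeff mu k (j - 1) m)"

lemma laurent_coeff_eq_0: "k < j \<Longrightarrow> laurent_coeff mu k j m = 0"
  by (induction k arbitrary: j) auto

lemma laurent_coeff_0: "laurent_coeff mu k 0 m = 1"
  by (induction k) auto

lemma laurent_coeff_1: "laurent_coeff mu k (Suc 0) m = (\<Sum>i<k. of_nat i - m + mu (Suc i))"
  by (induction k) (auto simp: laurent_coeff_0 algebra_simps)

lemma sum_of_nat_lessThan: "(\<Sum>i<n. of_nat i :: complex) = of_nat n * (of_nat n - 1) / 2"
  by (induction n) (auto simp: field_simps)

text \<open>The assumption on the indices cancels 0 + 1 + ... + (n - 1). The value 0 at m = 0 is the
  indicial equation, and -nm is nonzero for m > 0, so each new coefficient can be solved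
  for.\<close>

lemma laurent_coeff_1':
  assumes "(\<Sum>l=1..n. mu l) = - (of_nat n * (of_nat n - 1) / 2)"
  shows "laurent_coeff mu n (Suc 0) m = - of_nat n * m"
proof -
  have "(\<Sum>i<n. mu (Suc i)) = (\<Sum>l=1..n. mu l)"
    by (simp add: sum.shift_bounds_Suc_ivl[symmetric] atLeast0LessThan[symmetric] atLeastLessThanSuc_atLeastAtMost)
  then show ?thesis unfolding laurent_coeff_1 sum.distrib sum_subtractf sum_of_nat_lessThan assms by simp
qed

text \<open>The coefficients \<open>\<beta>\<^sub>m\<close> of the formal solution \<open>e\<^bsup>w\<^esup> \<Sum> \<beta>\<^sub>m w\<^bsup>-m\<^esup>\<close>
  of \<open>\<Prod>(\<theta> + \<mu>\<^sub>l) f = w\<^bsup>n\<^esup> f\<close>, where \<open>\<theta> = w d/dw\<close>.\<close>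

fun formal_beta :: "nat \<Rightarrow> (nat \<Rightarrow> complex) \<Rightarrow> nat \<Rightarrow> complex" where
  "formal_beta n mu m = (if m = 0 then 1 else
     (\<Sum>j=2..min n (m + 1). laurent_coeff mu n j (of_nat (m + 1 - j)) * formal_beta n mu (m + 1 - j)) / (of_nat n * of_nat m))"

declare formal_beta.simps [simp del]

lemma recursion_split:
  fixes g :: "nat \<Rightarrow> complex"
  assumes "n > 0" "m > 0"
  shows "(\<Sum>j=1..min n (m + 1). g j) = g 1 + (\<Sum>j=2..min n (m + 1). g j)"
proof -
  have "{1..min n (m + 1)} = insert 1 {2..min n (m + 1)}" using assms by auto
  then show ?thesis by simp
qed

text \<open>This is the coefficient of e^w w^(n-N) in the equation; j = 0 is absent since it cancels
  against w^n f. The newest coefficient, of index N - 1, enters through j = 1, hence the offset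
  between \<open>N\<close> and \<open>m\<close>.\<close>

lemma formal_beta_recursion:
  assumes n: "n > 0" and mu: "(\<Sum>l=1..n. mu l) = - (of_nat n * (of_nat n - 1) / 2)" and N: "N > 0"
  shows "(\<Sum>j=1..min n N. laurent_coeff mu n j (of_nat (N - j)) * formal_beta n mu (N - j)) = 0"
proof (cases "N = 1")
  case True
  then have "min n N = 1" using n by simp
  then show ?thesis using laurent_coeff_1'[OF mu, of 0] True by simp
next
  case False
  then obtain m where m: "N = m + 1" "m > 0" using N by (cases N) auto
  have "formal_beta n mu m * (of_nat n * of_nat m) = (\<Sum>j=2..min n (m + 1). laurent_coeff mu n j (of_nat (m + 1 - j)) * formal_beta n mu (m + 1 - j))"
    using m n by (subst formal_beta.simps) simp
  then show ?thesis unfolding m(1) recursion_split[OF n m(2)] using laurent_coeff_1'[OF mu] by (simp add: mult_ac)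
qed

text \<open>Replacing e^w by e^(az) is the substitution w = az, which divides the m-th coefficient
  by a^m.\<close>

lemma formal_beta_unique:
  assumes n: "n > 0" and mu: "(\<Sum>l=1..n. mu l) = - (of_nat n * (of_nat n - 1) / 2)"
    and a: "a \<noteq> 0" and b0: "b 0 = 1"
    and rec: "\<And>N. N > 0 \<Longrightarrow> (\<Sum>j=1..min n N. a ^ (n - j) * laurent_coeff mu n j (of_nat (N - j)) * b (N - j)) = 0"
  shows "b m = formal_beta n mu m / a ^ m"
proof (induction m rule: less_induct)
  case (less m)
  show ?case
  proof (cases "m = 0")
    case True then show ?thesis using b0 by (simp add: formal_beta.simps)
  next
    case False
    have "0 = (\<Sum>j=1..min n (m + 1). a ^ (n - j) * laurent_coeff mu n j (of_nat (m + 1 - j)) * b (m + 1 - j))"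
      using rec[of "m + 1"] by simp
    also have "\<dots> = a ^ (n - 1) * (- of_nat n * of_nat m) * b m + (\<Sum>j=2..min n (m + 1). a ^ (n - j) * laurent_coeff mu n j (of_nat (m + 1 - j)) * b (m + 1 - j))"
      using False n laurent_coeff_1'[OF mu] by (subst recursion_split) auto
    also have "(\<Sum>j=2..min n (m + 1). a ^ (n - j) * laurent_coeff mu n j (of_nat (m + 1 - j)) * b (m + 1 - j))
       = (\<Sum>j=2..min n (m + 1). a ^ (n - 1) / a ^ m * (laurent_coeff mu n j (of_nat (m + 1 - j)) * formal_beta n mu (m + 1 - j)))"
    proof (rule sum.cong)
      fix j assume j: "j \<in> {2..min n (m + 1)}"
      then have "b (m + 1 - j) = formal_beta n mu (m + 1 - j) / a ^ (m + 1 - j)" by (intro less) auto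
      moreover have "a ^ (n - 1) = a ^ (n - j) * a ^ (j - 1)" "a ^ m = a ^ (m + 1 - j) * a ^ (j - 1)"
        using j by (auto simp: power_add[symmetric])
      ultimately show "a ^ (n - j) * laurent_coeff mu n j (of_nat (m + 1 - j)) * b (m + 1 - j)
          = a ^ (n - 1) / a ^ m * (laurent_coeff mu n j (of_nat (m + 1 - j)) * formal_beta n mu (m + 1 - j))"
        using a by simp
    qed simp
    also have "\<dots> = a ^ (n - 1) / a ^ m * (\<Sum>j=2..min n (m + 1). laurent_coeff mu n j (of_nat (m + 1 - j)) * formal_beta n mu (m + 1 - j))"
      by (simp add: sum_distrib_left)
    also have "(\<Sum>j=2..min n (m + 1). laurent_coeff mu n j (of_nat (m + 1 - j)) * formal_beta n mu (m + 1 - j)) = formal_beta n mu m * (of_nat n * of_nat m)"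
      using False n by (subst (2) formal_beta.simps) simp
    finally have "a ^ (n - 1) * (of_nat n * of_nat m) * b m = a ^ (n - 1) * (of_nat n * of_nat m) * (formal_beta n mu m / a ^ m)"
      by (simp add: algebra_simps)
    moreover have "a ^ (n - 1) * (of_nat n * of_nat m) \<noteq> 0" using a n False by simp
    ultimately show ?thesis by (rule mult_left_cancel[THEN iffD1, rotated])
  qed
qed

section \<open>The Bessel equation for formal Laurent series\<close>

lemma formal_deriv_nth:
  "fls_nth (formal_deriv a \<rho> f) i = a * fls_nth f i + (\<rho> - of_int (i - 1)) * fls_nth f (i - 1)"
  by (simp only: formal_deriv_def fls_X_power_times_conv_shift(1) mult.assoc fls_X_times_conv_shift(1))
    (simp add: left_diff_distrib right_diff_distrib)

lemma formal_deriv_X_inv: "formal_deriv a \<rho> (fls_X_inv * f) = f + fls_X_inv * formal_deriv a \<rho> f"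
  by (intro fls_eqI) (simp add: formal_deriv_nth fls_X_inv_times_conv_shift(1) algebra_simps)

lemma formal_deriv_cmult: "formal_deriv a \<rho> (fls_const c * f) = fls_const c * formal_deriv a \<rho> f"
  by (intro fls_eqI) (simp add: formal_deriv_nth algebra_simps)

lemma formal_deriv_sum: "formal_deriv a \<rho> (\<Sum>j\<in>A. f j) = (\<Sum>j\<in>A. formal_deriv a \<rho> (f j))"
  by (intro fls_eqI) (simp add: formal_deriv_nth fls_nth_sum sum_distrib_left sum.distrib[symmetric])

text \<open>Counterpart of \<open>euler_op\<close>: multiplication by \<open>fls_X_inv\<close> is
  multiplication by z, so \<theta> becomes \<open>fls_X_inv\<close> times
  \<open>formal_deriv\<close>.\<close>

fun formal_euler_op :: "complex \<Rightarrow> complex \<Rightarrow> (nat \<Rightarrow> complex) \<Rightarrow> nat \<Rightarrow> complex fls \<Rightarrow> complex fls" where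
  "formal_euler_op a \<rho> mu 0 f = f"
| "formal_euler_op a \<rho> mu (Suc k) f = fls_X_inv * formal_deriv a \<rho> (formal_euler_op a \<rho> mu k f) + fls_const (mu (Suc k)) * formal_euler_op a \<rho> mu k f"

lemma formal_euler_op_eq:
  "formal_euler_op a \<rho> mu k f = (\<Sum>j\<le>k. fls_const (euler_coeff mu k j) * fls_X_inv ^ j * (formal_deriv a \<rho> ^^ j) f)"
proof (induction k)
  case (Suc k)
  define t where "t j = fls_X_inv ^ j * (formal_deriv a \<rho> ^^ j) f" for j
  have fd: "formal_deriv a \<rho> (fls_X_inv ^ j * g) = of_nat j * fls_X_inv ^ (j - 1) * g + fls_X_inv ^ j * formal_deriv a \<rho> g" for j g
  proof (induction j)
    case (Suc j)
    have "formal_deriv a \<rho> (fls_X_inv ^ Suc j * g) = fls_X_inv ^ j * g + fls_X_inv * formal_deriv a \<rho> (fls_X_inv ^ j * g)"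
      by (simp only: power_Suc mult.assoc formal_deriv_X_inv)
    then show ?case unfolding Suc by (cases j) (simp_all add: algebra_simps)
  qed simp
  have t: "fls_X_inv * formal_deriv a \<rho> (t j) = of_nat j * t j + t (Suc j)" for j
    unfolding t_def fd by (cases j) (simp_all add: algebra_simps)
  have IH: "formal_euler_op a \<rho> mu k f = (\<Sum>j\<le>k. fls_const (euler_coeff mu k j) * t j)"
    using Suc by (simp add: t_def mult.assoc)
  have nc: "(of_nat j :: complex fls) = fls_const (of_nat j)" for j by (simp add: fls_of_nat)
  have "formal_euler_op a \<rho> mu (Suc k) f = (\<Sum>j\<le>k. fls_const (euler_coeff mu k j) * (of_nat j * t j + t (Suc j))) + fls_const (mu (Suc k)) * (\<Sum>j\<le>k. fls_const (euler_coeff mu k j) * t j)"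
    by (simp add: IH formal_deriv_sum formal_deriv_cmult sum_distrib_left mult.left_commute[of fls_X_inv] t)
  also have "\<dots> = (\<Sum>j\<le>k. fls_const ((of_nat j + mu (Suc k)) * euler_coeff mu k j) * t j) + (\<Sum>j\<le>k. fls_const (euler_coeff mu k j) * t (Suc j))"
  proof -
    have "fls_const ((of_nat j + mu (Suc k)) * c) = (of_nat j + fls_const (mu (Suc k))) * fls_const c" for j c
      unfolding nc by (simp only: fls_plus_const fls_const_mult_const)
    then have "fls_const c * (of_nat j * t j + t (Suc j)) + fls_const (mu (Suc k)) * (fls_const c * t j)
       = fls_const ((of_nat j + mu (Suc k)) * c) * t j + fls_const c * t (Suc j)" for j c
      by (simp only:) (simp only: algebra_simps)
    then show ?thesis unfolding sum_distrib_left[of "fls_const (mu (Suc k))"] sum.distrib[symmetric] by (simp only:)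
  qed
  also have "(\<Sum>j\<le>k. fls_const ((of_nat j + mu (Suc k)) * euler_coeff mu k j) * t j) = (\<Sum>j\<le>Suc k. fls_const ((of_nat j + mu (Suc k)) * euler_coeff mu k j) * t j)"
    by (simp add: euler_coeff_eq_0)
  also have "(\<Sum>j\<le>k. fls_const (euler_coeff mu k j) * t (Suc j)) = (\<Sum>j\<le>Suc k. fls_const (if j = 0 then 0 else euler_coeff mu k (j - 1)) * t j)"
    by (subst sum.atMost_Suc_shift) simp
  finally have "formal_euler_op a \<rho> mu (Suc k) f = (\<Sum>j\<le>Suc k. fls_const ((of_nat j + mu (Suc k)) * euler_coeff mu k j) * t j)
     + (\<Sum>j\<le>Suc k. fls_const (if j = 0 then 0 else euler_coeff mu k (j - 1)) * t j)" .
  then show ?case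
    unfolding sum.distrib[symmetric] distrib_right[symmetric] fls_plus_const euler_coeff.simps(2)[symmetric]
    by (simp only: t_def mult.assoc)
qed simp

text \<open>The factor z^\<rho> adds \<rho> to every index and e^(az) supplies the powers of
  \<open>a\<close>; otherwise the coefficients are those for e^w w^(-m), with m = i + k - j the
  index of the coefficient of \<open>f\<close> involved.\<close>

lemma formal_euler_op_nth:
  "fls_nth (formal_euler_op a \<rho> mu k f) i =
     (\<Sum>j\<le>k. a ^ (k - j) * laurent_coeff (\<lambda>l. mu l + \<rho>) k j (of_int (i + int (k - j))) * fls_nth f (i + int (k - j)))"
proof (induction k arbitrary: i)
  case (Suc k)
  define L where "L = laurent_coeff (\<lambda>l. mu l + \<rho>)"
  have "fls_nth (formal_euler_op a \<rho> mu (Suc k) f) i = a * fls_nth (formal_euler_op a \<rho> mu k f) (i + 1)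
      + (\<rho> - of_int i + mu (Suc k)) * fls_nth (formal_euler_op a \<rho> mu k f) i"
    by (simp add: fls_X_inv_times_conv_shift(1) formal_deriv_nth algebra_simps)
  also have "a * fls_nth (formal_euler_op a \<rho> mu k f) (i + 1) = (\<Sum>j\<le>k. a ^ (Suc k - j) * L k j (of_int (i + int (Suc k - j))) * fls_nth f (i + int (Suc k - j)))"
    unfolding Suc sum_distrib_left L_def by (intro sum.cong) (auto simp: Suc_diff_le algebra_simps)
  also have "\<dots> = (\<Sum>j\<le>Suc k. a ^ (Suc k - j) * L k j (of_int (i + int (Suc k - j))) * fls_nth f (i + int (Suc k - j)))"
    by (simp add: L_def laurent_coeff_eq_0)
  also have "(\<rho> - of_int i + mu (Suc k)) * fls_nth (formal_euler_op a \<rho> mu k f) i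
     = (\<Sum>j\<le>Suc k. a ^ (Suc k - j) * (if j = 0 then 0 else (of_nat k - of_nat (j - 1) - of_int (i + int (Suc k - j)) + (mu (Suc k) + \<rho>)) * L k (j - 1) (of_int (i + int (Suc k - j)))) * fls_nth f (i + int (Suc k - j)))"
  proof -
    have "(\<Sum>j\<le>Suc k. a ^ (Suc k - j) * (if j = 0 then 0 else (of_nat k - of_nat (j - 1) - of_int (i + int (Suc k - j)) + (mu (Suc k) + \<rho>)) * L k (j - 1) (of_int (i + int (Suc k - j)))) * fls_nth f (i + int (Suc k - j)))
      = (\<Sum>j\<le>k. a ^ (k - j) * ((of_nat k - of_nat j - of_int (i + int (k - j)) + (mu (Suc k) + \<rho>)) * L k j (of_int (i + int (k - j)))) * fls_nth f (i + int (k - j)))"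
      by (subst sum.atMost_Suc_shift) simp
    also have "\<dots> = (\<Sum>j\<le>k. (\<rho> - of_int i + mu (Suc k)) * (a ^ (k - j) * L k j (of_int (i + int (k - j))) * fls_nth f (i + int (k - j))))"
      by (intro sum.cong) (auto simp: of_nat_diff algebra_simps)
    finally show ?thesis unfolding Suc L_def by (simp add: sum_distrib_left)
  qed
  finally have "fls_nth (formal_euler_op a \<rho> mu (Suc k) f) i
    = (\<Sum>j\<le>Suc k. a ^ (Suc k - j) * L k j (of_int (i + int (Suc k - j))) * fls_nth f (i + int (Suc k - j)))
     + (\<Sum>j\<le>Suc k. a ^ (Suc k - j) * (if j = 0 then 0 else (of_nat k - of_nat (j - 1) - of_int (i + int (Suc k - j)) + (mu (Suc k) + \<rho>)) * L k (j - 1) (of_int (i + int (Suc k - j)))) * fls_nth f (i + int (Suc k - j)))" .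
  then show ?case unfolding sum.distrib[symmetric] L_def laurent_coeff.simps(2)
    by (simp only: distrib_left distrib_right)
qed auto

text \<open>In each coefficient equation the term j = 0 carries a^n, and this cancels the term with
  the sign of the equation, because (in\<xi>)^n = \<xi>^n (in)^n. What is left is the recursion,
  whose solution with B_0 = 1 is unique.\<close>

theorem bessel_B_eq:
  assumes n: "n > 0" and sum0: "(\<Sum>l=1..n. lam l) = 0"
  shows "bessel_B n lam \<xi> m = formal_beta n (\<lambda>l. of_nat n * lam l - (of_nat n - 1) / 2) m / (\<i> * of_nat n * cov_proj \<xi>) ^ m"
proof -
  define a where "a = \<i> * of_nat n * cov_proj \<xi>"
  define \<rho> :: complex where "\<rho> = - (of_nat n - 1) / 2"
  define mu where "mu = (\<lambda>l. of_nat n * lam l + \<rho>)"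
  have mu': "mu = (\<lambda>l. of_nat n * lam l - (of_nat n - 1) / 2)" by (simp add: mu_def \<rho>_def field_simps)
  have a0: "a \<noteq> 0" using n by (simp add: a_def cov_proj_def)
  have summu: "(\<Sum>l=1..n. mu l) = - (of_nat n * (of_nat n - 1) / 2)"
    unfolding mu_def sum.distrib sum_distrib_left[symmetric] sum0 by (simp add: \<rho>_def field_simps)
  have iff: "formal_bessel_solution n lam (cov_proj \<xi> ^ n) a \<rho> (fps_to_fls (Abs_fps b)) \<longleftrightarrow>
     (\<forall>N>0. (\<Sum>j=1..min n N. a ^ (n - j) * laurent_coeff mu n j (of_nat (N - j)) * b (N - j)) = 0)" for b
  proof -
    define f where "f = fps_to_fls (Abs_fps b)"
    have fn: "fls_nth f i = (if i < 0 then 0 else b (nat i))" for i by (simp add: f_def)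
    have a_n: "cov_proj \<xi> ^ n * (\<i> * of_nat n) ^ n = a ^ n" by (simp add: a_def power_mult_distrib mult_ac)
    have "{..n} = insert 0 {1..n}" by auto
    then have "(\<Sum>j=1..n. fls_const (bessel_V n j lam) * fls_X_inv ^ j * (formal_deriv a \<rho> ^^ j) f)
       + (fls_const (bessel_V n 0 lam) - fls_const (cov_proj \<xi> ^ n * (\<i> * of_nat n) ^ n) * fls_X_inv ^ n) * f
       = formal_euler_op a \<rho> (\<lambda>l. of_nat n * lam l) n f - fls_const (a ^ n) * (fls_X_inv ^ n * f)"
      unfolding formal_euler_op_eq a_n by (simp add: bessel_V_eq algebra_simps)
    then have "formal_bessel_solution n lam (cov_proj \<xi> ^ n) a \<rho> f \<longleftrightarrow>
       (\<forall>i. fls_nth (formal_euler_op a \<rho> (\<lambda>l. of_nat n * lam l) n f - fls_const (a ^ n) * (fls_X_inv ^ n * f)) i = 0)"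
      unfolding formal_bessel_solution_def by (simp add: fls_eq_iff)
    also have "\<dots> \<longleftrightarrow> (\<forall>i. (\<Sum>j=1..n. a ^ (n - j) * laurent_coeff mu n j (of_int (i - int j)) * fls_nth f (i - int j)) = 0)"
    proof -
      have eq: "fls_nth (formal_euler_op a \<rho> (\<lambda>l. of_nat n * lam l) n f - fls_const (a ^ n) * (fls_X_inv ^ n * f)) i
          = (\<Sum>j=1..n. a ^ (n - j) * laurent_coeff mu n j (of_int ((i + int n) - int j)) * fls_nth f ((i + int n) - int j))" for i
      proof -
        have "fls_nth (fls_X_inv ^ n * f) i = fls_nth f (i + int n)"
          by (simp add: fls_X_inv_power_times_conv_shift(1))
        moreover have "fls_nth (formal_euler_op a \<rho> (\<lambda>l. of_nat n * lam l) n f) i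
          = a ^ n * fls_nth f (i + int n) + (\<Sum>j=1..n. a ^ (n - j) * laurent_coeff mu n j (of_int (i + int (n - j))) * fls_nth f (i + int (n - j)))"
          unfolding formal_euler_op_nth mu_def[symmetric] \<open>{..n} = insert 0 {1..n}\<close> by (simp add: laurent_coeff_0)
        moreover have "(\<Sum>j=1..n. a ^ (n - j) * laurent_coeff mu n j (of_int (i + int (n - j))) * fls_nth f (i + int (n - j)))
           = (\<Sum>j=1..n. a ^ (n - j) * laurent_coeff mu n j (of_int ((i + int n) - int j)) * fls_nth f ((i + int n) - int j))"
          by (intro sum.cong) (auto simp: of_nat_diff algebra_simps)
        ultimately show ?thesis by simp
      qed
      show ?thesis
      proof (intro iffI allI)
        fix i assume "\<forall>i. fls_nth (formal_euler_op a \<rho> (\<lambda>l. of_nat n * lam l) n f - fls_const (a ^ n) * (fls_X_inv ^ n * f)) i = 0"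
        from this[rule_format, of "i - int n"]
        show "(\<Sum>j=1..n. a ^ (n - j) * laurent_coeff mu n j (of_int (i - int j)) * fls_nth f (i - int j)) = 0"
          unfolding eq by simp
      next
        fix i assume "\<forall>i. (\<Sum>j=1..n. a ^ (n - j) * laurent_coeff mu n j (of_int (i - int j)) * fls_nth f (i - int j)) = 0"
        then show "fls_nth (formal_euler_op a \<rho> (\<lambda>l. of_nat n * lam l) n f - fls_const (a ^ n) * (fls_X_inv ^ n * f)) i = 0"
          unfolding eq by blast
      qed
    qed
    \<comment> \<open>Coefficients of \<open>f\<close> at negative indices vanish. This cuts the
      sums off at j \<le> N and makes the equations of index at most 0 trivial.\<close>
    also have "\<dots> \<longleftrightarrow> (\<forall>N>0. (\<Sum>j=1..min n N. a ^ (n - j) * laurent_coeff mu n j (of_nat (N - j)) * b (N - j)) = 0)"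
    proof -
      have pos: "(\<Sum>j=1..n. a ^ (n - j) * laurent_coeff mu n j (of_int (int N - int j)) * fls_nth f (int N - int j))
         = (\<Sum>j=1..min n N. a ^ (n - j) * laurent_coeff mu n j (of_nat (N - j)) * b (N - j))" for N
      proof -
        have "(\<Sum>j=1..n. a ^ (n - j) * laurent_coeff mu n j (of_int (int N - int j)) * fls_nth f (int N - int j))
           = (\<Sum>j=1..min n N. a ^ (n - j) * laurent_coeff mu n j (of_int (int N - int j)) * fls_nth f (int N - int j))"
          by (intro sum.mono_neutral_right) (auto simp: fn)
        also have "\<dots> = (\<Sum>j=1..min n N. a ^ (n - j) * laurent_coeff mu n j (of_nat (N - j)) * b (N - j))"
          by (intro sum.cong) (auto simp: fn of_nat_diff nat_diff_distrib)
        finally show ?thesis .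
      qed
      have neg: "(\<Sum>j=1..n. a ^ (n - j) * laurent_coeff mu n j (of_int (i - int j)) * fls_nth f (i - int j)) = 0" if "i \<le> 0" for i
        using that by (intro sum.neutral) (auto simp: fn)
      show ?thesis
      proof (intro iffI allI impI)
        fix N :: nat assume "\<forall>i. (\<Sum>j=1..n. a ^ (n - j) * laurent_coeff mu n j (of_int (i - int j)) * fls_nth f (i - int j)) = 0"
        then show "(\<Sum>j=1..min n N. a ^ (n - j) * laurent_coeff mu n j (of_nat (N - j)) * b (N - j)) = 0"
          using pos[of N] by metis
      next
        fix i assume *: "\<forall>N>0. (\<Sum>j=1..min n N. a ^ (n - j) * laurent_coeff mu n j (of_nat (N - j)) * b (N - j)) = 0"
        show "(\<Sum>j=1..n. a ^ (n - j) * laurent_coeff mu n j (of_int (i - int j)) * fls_nth f (i - int j)) = 0"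
        proof (cases "i \<le> 0")
          case True then show ?thesis by (rule neg)
        next
          case False
          then obtain N where N: "i = int N" "N > 0" by (metis not_le zero_less_imp_eq_int)
          then show ?thesis using * pos[of N] by simp
        qed
      qed
    qed
    finally show ?thesis by (simp add: f_def)
  qed
  have "bessel_B n lam \<xi> = (\<lambda>m. formal_beta n mu m / a ^ m)"
    unfolding bessel_B_def a_def[symmetric] \<rho>_def[symmetric]
  proof (rule the_equality)
    have "(\<Sum>j=1..min n N. a ^ (n - j) * laurent_coeff mu n j (of_nat (N - j)) * (formal_beta n mu (N - j) / a ^ (N - j))) = 0" if N: "N > 0" for N
    proof -
      have "(\<Sum>j=1..min n N. a ^ (n - j) * laurent_coeff mu n j (of_nat (N - j)) * (formal_beta n mu (N - j) / a ^ (N - j)))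
        = (\<Sum>j=1..min n N. a ^ n / a ^ N * (laurent_coeff mu n j (of_nat (N - j)) * formal_beta n mu (N - j)))"
      proof (rule sum.cong)
        fix j assume j: "j \<in> {1..min n N}"
        have "a ^ n = a ^ (n - j) * a ^ j" "a ^ N = a ^ (N - j) * a ^ j" using j by (auto simp: power_add[symmetric])
        then show "a ^ (n - j) * laurent_coeff mu n j (of_nat (N - j)) * (formal_beta n mu (N - j) / a ^ (N - j))
          = a ^ n / a ^ N * (laurent_coeff mu n j (of_nat (N - j)) * formal_beta n mu (N - j))" using a0 by simp
      qed simp
      then show ?thesis unfolding sum_distrib_left[symmetric] formal_beta_recursion[OF n summu N] by simp
    qed
    then show "formal_beta n mu 0 / a ^ 0 = 1 \<and> formal_bessel_solution n lam (cov_proj \<xi> ^ n) a \<rho> (fps_to_fls (Abs_fps (\<lambda>m. formal_beta n mu m / a ^ m)))"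
      unfolding iff by (simp add: formal_beta.simps)
    fix b assume b: "b 0 = 1 \<and> formal_bessel_solution n lam (cov_proj \<xi> ^ n) a \<rho> (fps_to_fls (Abs_fps b))"
    show "b = (\<lambda>m. formal_beta n mu m / a ^ m)"
    proof
      fix m show "b m = formal_beta n mu m / a ^ m"
        using b unfolding iff by (intro formal_beta_unique[OF n summu a0]) auto
    qed
  qed
  then show ?thesis by (simp add: mu' a_def)
qed

section \<open>Leading asymptotics on the positive axis\<close>

lemma mellin_barnes_lincomb:
  assumes n: "n > 0" and sum0: "(\<Sum>l=1..n. lam l) = 0"
    and P: "poly_growth d P" and Q: "poly_growth d' Q" and R: "poly_growth d'' (\<lambda>s. a * P s + b * Q s)"
  shows "mellin_barnes n lam (\<lambda>s. a * P s + b * Q s) u = a * mellin_barnes n lam P u + b * mellin_barnes n lam Q u"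
proof -
  have hol: "P holomorphic_on UNIV" "Q holomorphic_on UNIV" using P Q by (auto simp: poly_growth_def)
  have "hyper_int n lam (\<lambda>s. a * P s + b * Q s) Y u = a * hyper_int n lam P Y u + b * hyper_int n lam Q Y u" for Y
  proof -
    have i: "(\<lambda>t. mellin_kernel n lam P u (hyper n lam t) * hyper' t) integrable_on {-Y..Y}"
      "(\<lambda>t. mellin_kernel n lam Q u (hyper n lam t) * hyper' t) integrable_on {-Y..Y}"
      by (intro integrable_continuous_real continuous_mellin_hyper hol)+
    have "hyper_int n lam (\<lambda>s. a * P s + b * Q s) Y u = integral {-Y..Y} (\<lambda>t. a * (mellin_kernel n lam P u (hyper n lam t) * hyper' t) + b * (mellin_kernel n lam Q u (hyper n lam t) * hyper' t))"
      unfolding hyper_int_def mellin_kernel_def by (simp add: algebra_simps)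
    also have "\<dots> = a * hyper_int n lam P Y u + b * hyper_int n lam Q Y u"
      unfolding hyper_int_def using i
      by (subst Henstock_Kurzweil_Integration.integral_add) (auto intro: integrable_on_mult_right)
    finally show ?thesis .
  qed
  then have "((\<lambda>Y. hyper_int n lam (\<lambda>s. a * P s + b * Q s) Y u) \<longlongrightarrow>
     a * (2 * of_real pi * \<i> * mellin_barnes n lam P u) + b * (2 * of_real pi * \<i> * mellin_barnes n lam Q u)) at_top"
    by (simp only:) (intro tendsto_intros tendsto_hyper_int[OF n sum0 P] tendsto_hyper_int[OF n sum0 Q])
  from tendsto_unique[OF _ tendsto_hyper_int[OF n sum0 R] this]
  have "2 * of_real pi * \<i> * mellin_barnes n lam (\<lambda>s. a * P s + b * Q s) u
     = 2 * of_real pi * \<i> * (a * mellin_barnes n lam P u + b * mellin_barnes n lam Q u)"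
    by (simp add: algebra_simps)
  then show ?thesis by simp
qed

lemma mellin_barnes_exp_deriv:
  assumes n: "n > 0" and sum0: "(\<Sum>l=1..n. lam l) = 0" and P: "poly_growth d P"
  shows "((\<lambda>u. exp (b * u) * mellin_barnes n lam P u) has_field_derivative
           exp (b * u) * mellin_barnes n lam (\<lambda>s. (b - of_nat n * s) * P s) u) (at u)"
proof -
  have P': "poly_growth (Suc d) (\<lambda>s. - of_nat n * s * P s)" "poly_growth (Suc d) (\<lambda>s. (b - of_nat n * s) * P s)"
    using poly_growth_mult[OF P, of "- of_nat n" 0] poly_growth_mult[OF P, of "- of_nat n" b] by simp_all
  have "(\<lambda>s. (b - of_nat n * s) * P s) = (\<lambda>s. b * P s + 1 * (- of_nat n * s * P s))"
    by (auto simp: algebra_simps)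
  then have e: "mellin_barnes n lam (\<lambda>s. (b - of_nat n * s) * P s) u = b * mellin_barnes n lam P u + mellin_barnes n lam (\<lambda>s. - of_nat n * s * P s) u"
    using mellin_barnes_lincomb[OF n sum0 P P'(1), of "Suc d" b 1 u] P'(2) by (simp only: mult_1)
  show ?thesis unfolding e
    by (rule derivative_eq_intros mellin_barnes_deriv[OF n sum0 P] refl)+ (simp add: algebra_simps)
qed

lemma mellin_barnes_euler_op:
  assumes n: "n > 0" and sum0: "(\<Sum>l=1..n. lam l) = 0"
  shows "euler_op (\<lambda>l. of_nat n * lam l) k (mellin_barnes n lam (\<lambda>_. 1)) = mellin_barnes n lam (\<lambda>s. \<Prod>l=1..k. - of_nat n * (s - lam l))
    \<and> poly_growth k (\<lambda>s. \<Prod>l=1..k. - of_nat n * (s - lam l))"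
proof (induction k)
  case 0 then show ?case by (simp add: poly_growth_1)
next
  case (Suc k)
  define P where "P s = (\<Prod>l=1..k. - of_nat n * (s - lam l))" for s
  have P: "poly_growth k P" and E: "euler_op (\<lambda>l. of_nat n * lam l) k (mellin_barnes n lam (\<lambda>_. 1)) = mellin_barnes n lam P"
    using Suc by (simp_all add: P_def[abs_def])
  have c: "(\<lambda>s. \<Prod>l=1..Suc k. - of_nat n * (s - lam l)) = (\<lambda>s. (- of_nat n * s + of_nat n * lam (Suc k)) * P s)"
    by (auto simp: P_def algebra_simps)
  have g: "poly_growth (Suc k) (\<lambda>s. (- of_nat n * s + of_nat n * lam (Suc k)) * P s)" by (rule poly_growth_mult[OF P])
  have P': "poly_growth (Suc k) (\<lambda>s. - of_nat n * s * P s)"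
    using poly_growth_mult[OF P, of "- of_nat n" 0] by simp
  have "(\<lambda>s. (- of_nat n * s + of_nat n * lam (Suc k)) * P s) = (\<lambda>s. of_nat n * lam (Suc k) * P s + 1 * (- of_nat n * s * P s))"
    by (auto simp: algebra_simps)
  then have "mellin_barnes n lam (\<lambda>s. (- of_nat n * s + of_nat n * lam (Suc k)) * P s) u
     = of_nat n * lam (Suc k) * mellin_barnes n lam P u + mellin_barnes n lam (\<lambda>s. - of_nat n * s * P s) u" for u
    using mellin_barnes_lincomb[OF n sum0 P P', of "Suc k" "of_nat n * lam (Suc k)" 1 u] g by (simp only: mult_1)
  moreover have "deriv (mellin_barnes n lam P) u = mellin_barnes n lam (\<lambda>s. - of_nat n * s * P s) u" for u
    by (rule DERIV_imp_deriv mellin_barnes_deriv[OF n sum0 P])+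
  ultimately show ?case unfolding c using g by (auto simp: E fun_eq_iff)
qed

text \<open>Each operator \<theta> + n lam_l multiplies the weight by -n(s - lam_l); all n of them
  together give the weight that the unit shift of the contour converts into the factor
  e^(nu).\<close>

theorem mellin_barnes_ode:
  assumes n: "n > 0" and sum0: "(\<Sum>l=1..n. lam l) = 0"
  shows "euler_op (\<lambda>l. of_nat n * lam l) n (mellin_barnes n lam (\<lambda>_. 1)) u
    = (- of_nat n) ^ n * exp (of_nat n * u) * mellin_barnes n lam (\<lambda>_. 1) u"
proof -
  \<comment> \<open>The zero summand brings the weight into the shape of the lemma on linear
    combinations.\<close>
  have c: "(\<lambda>s. \<Prod>l=1..n. - of_nat n * (s - lam l)) = (\<lambda>s. (- of_nat n) ^ n * (\<Prod>l=1..n. s - lam l) + 0 * 1)"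
    unfolding prod.distrib by simp
  have "poly_growth n (\<lambda>s. \<Prod>l=1..n. - of_nat n * (s - lam l))"
    using mellin_barnes_euler_op[OF n sum0, of n] by blast
  then have "mellin_barnes n lam (\<lambda>s. (- of_nat n) ^ n * (\<Prod>l=1..n. s - lam l) + 0 * 1) u
     = (- of_nat n) ^ n * mellin_barnes n lam (\<lambda>s. \<Prod>l=1..n. s - lam l) u + 0 * mellin_barnes n lam (\<lambda>_. 1) u"
    unfolding c by (intro mellin_barnes_lincomb[OF n sum0 poly_growth_prod poly_growth_1])
  then show ?thesis using mellin_barnes_euler_op[OF n sum0, of n] unfolding c mellin_barnes_shift[OF n sum0] by simp
qed

section \<open>Concentration of Gamma near the real axis, and the case n = 1\<close>

text \<open>In the product formula the factors with k < 2N have N + k \<le> 3N, so each exceeds its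
  value at y = 0 by at least sqrt(1 + v) with v = y^2 / (9N^2). All 2N of them give (1 + v)^N, which
  is at least 1 + Nv by Bernoulli's inequality. The bound integrates over y to O(sqrt N) times (N -
  1)!.\<close>

lemma norm_Gamma_nat_plus_imaginary:
  assumes N: "N > 0"
  shows "norm (Gamma (Complex (real N) y)) \<le> fact (N - 1) / (1 + y\<^sup>2 / (9 * real N))"
proof -
  define z where "z = Complex (real N) y"
  define v where "v = y\<^sup>2 / (9 * (real N)\<^sup>2)"
  have v: "v \<ge> 0" by (simp add: v_def)
  have bd: "norm (Gamma_series z m) * (1 + y\<^sup>2 / (9 * real N)) \<le> Gamma_series (real N) m" if m: "m \<ge> 2 * N" "m > 0" for m
  proof -
    have p1: "norm (pochhammer z (m + 1)) = (\<Prod>k\<le>m. norm (z + of_nat k))"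
      by (simp add: pochhammer_Suc_prod prod_norm atLeast0AtMost)
    have p2: "pochhammer (real N) (m + 1) = (\<Prod>k\<le>m. real N + real k)"
      by (simp add: pochhammer_Suc_prod atLeast0AtMost)
    have f: "(real N + real k) * (if k < 2 * N then sqrt (1 + v) else 1) \<le> norm (z + of_nat k)" for k
    proof -
      have nz: "norm (z + of_nat k) = sqrt ((real N + real k)\<^sup>2 + y\<^sup>2)" by (simp add: z_def cmod_def)
      show ?thesis
      proof (cases "k < 2 * N")
        case True
        have "(real N + real k)\<^sup>2 \<le> (3 * real N)\<^sup>2" using True by (intro power_mono) auto
        then have "(real N + real k)\<^sup>2 * v \<le> (9 * (real N)\<^sup>2) * v" using v by (intro mult_right_mono) (auto simp: power_mult_distrib)
        also have "\<dots> = y\<^sup>2" using N by (simp add: v_def)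
        finally have "(real N + real k)\<^sup>2 * (1 + v) \<le> (real N + real k)\<^sup>2 + y\<^sup>2" by (simp add: algebra_simps)
        then have "sqrt ((real N + real k)\<^sup>2 * (1 + v)) \<le> norm (z + of_nat k)" unfolding nz by simp
        then show ?thesis using True by (simp add: real_sqrt_mult)
      next
        case False then show ?thesis unfolding nz by (auto intro!: real_le_rsqrt)
      qed
    qed
    have "(\<Prod>k\<le>m. (real N + real k) * (if k < 2 * N then sqrt (1 + v) else 1)) \<le> (\<Prod>k\<le>m. norm (z + of_nat k))"
      using f v by (intro prod_mono) auto
    also have "(\<Prod>k\<le>m. (real N + real k) * (if k < 2 * N then sqrt (1 + v) else 1)) = pochhammer (real N) (m + 1) * (\<Prod>k\<le>m. (if k < 2 * N then sqrt (1 + v) else 1))"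
      by (simp only: prod.distrib p2)
    also have "(\<Prod>k\<le>m. (if k < 2 * N then sqrt (1 + v) else 1)) = (\<Prod>k<2*N. sqrt (1 + v))"
      using m by (intro prod.mono_neutral_cong_right) auto
    also have "\<dots> = (1 + v) ^ N" using v by (simp add: power_mult)
    finally have 1: "pochhammer (real N) (m + 1) * (1 + v) ^ N \<le> norm (pochhammer z (m + 1))" by (simp only: p1)
    have "1 + real N * v \<le> (1 + v) ^ N" using Bernoulli_inequality[of v N] v by simp
    moreover have "real N * v = y\<^sup>2 / (9 * real N)" using N by (simp add: v_def power2_eq_square)
    ultimately have "pochhammer (real N) (m + 1) * (1 + y\<^sup>2 / (9 * real N)) \<le> pochhammer (real N) (m + 1) * (1 + v) ^ N"
      using N by (intro mult_left_mono) (auto intro!: pochhammer_nonneg)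
    with 1 have 2: "pochhammer (real N) (m + 1) * (1 + y\<^sup>2 / (9 * real N)) \<le> norm (pochhammer z (m + 1))" by simp
    have pp: "pochhammer (real N) (m + 1) > 0" using N by (intro pochhammer_pos) simp
    have "1 + y\<^sup>2 / (9 * real N) > 0" by (simp add: add_pos_nonneg)
    then have pz: "norm (pochhammer z (m + 1)) > 0" using 2 pp by (smt (verit) mult_pos_pos)
    have "norm (exp (z * of_real (ln (real m)))) = exp (real N * ln (real m))" by (simp add: z_def)
    then have "norm (Gamma_series z m) = fact m * exp (real N * ln (real m)) / norm (pochhammer z (m + 1))"
      by (simp add: Gamma_series_def norm_mult norm_divide)
    then have "norm (Gamma_series z m) * (1 + y\<^sup>2 / (9 * real N)) = fact m * exp (real N * ln (real m)) * ((1 + y\<^sup>2 / (9 * real N)) / norm (pochhammer z (m + 1)))" by simp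
    also have "\<dots> \<le> fact m * exp (real N * ln (real m)) * (1 / pochhammer (real N) (m + 1))"
      using 2 pp pz by (intro mult_left_mono) (auto simp: divide_simps mult.commute)
    finally show ?thesis by (simp add: Gamma_series_def)
  qed
  have "(\<lambda>m. norm (Gamma_series z m) * (1 + y\<^sup>2 / (9 * real N))) \<longlonglongrightarrow> norm (Gamma z) * (1 + y\<^sup>2 / (9 * real N))"
    by (intro tendsto_intros Gamma_series_LIMSEQ)
  moreover have "Gamma_series (real N) \<longlonglongrightarrow> Gamma (real N)" by (rule Gamma_series_LIMSEQ)
  ultimately have "norm (Gamma z) * (1 + y\<^sup>2 / (9 * real N)) \<le> Gamma (real N)"
    by (rule LIMSEQ_le) (use bd in \<open>auto intro!: exI[of _ "2 * N + 1"]\<close>)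
  moreover have "Gamma (real N) = fact (N - 1)" using N Gamma_fact[of "N - 1", where ?'a = real] by (simp add: of_nat_diff)
  moreover have "1 + y\<^sup>2 / (9 * real N) > 0" by (simp add: add_pos_nonneg)
  ultimately show ?thesis by (simp add: z_def pos_le_divide_eq)
qed

text \<open>An elementary bound that loses a factor of order sqrt N against Stirling's formula; the
  factor O(1/N) gained in the comparison of Gamma products leaves room for this.\<close>

lemma fact_exp_bound:
  assumes N: "N > 0"
  shows "fact (N - 1) * exp (real N) \<le> exp 1 * real N ^ N"
proof -
  have "fact N * exp (real N) \<le> exp 1 * real N ^ (N + 1)"
    using assms
  proof (induction N rule: nat_induct_non_zero)
    case (Suc N)
    have "exp 1 * real N ^ (N + 1) \<le> real (Suc N) ^ (N + 1)"
    proof -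
      have "1 / (real N + 1) \<le> ln (1 + 1 / real N)"
      proof -
        have "ln (real N / (real N + 1)) \<le> real N / (real N + 1) - 1" using Suc by (intro ln_le_minus_one) auto
        also have "\<dots> = - (1 / (real N + 1))" by (simp add: field_simps)
        finally have "1 / (real N + 1) \<le> - ln (real N / (real N + 1))" by simp
        also have "- ln (real N / (real N + 1)) = ln (1 + 1 / real N)"
          using Suc by (simp add: ln_div field_simps)
        finally show ?thesis .
      qed
      then have "1 \<le> (real N + 1) * ln (1 + 1 / real N)" by (simp add: field_simps)
      then have "exp 1 \<le> exp (real (N + 1) * ln (1 + 1 / real N))" by (simp add: add.commute)
      also have "\<dots> = (1 + 1 / real N) ^ (N + 1)" by (subst exp_of_nat_mult) (simp add: add_pos_nonneg)
      finally have "exp 1 * real N ^ (N + 1) \<le> (1 + 1 / real N) ^ (N + 1) * real N ^ (N + 1)" by (intro mult_right_mono) auto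
      also have "\<dots> = ((1 + 1 / real N) * real N) ^ (N + 1)" by (simp only: power_mult_distrib)
      also have "(1 + 1 / real N) * real N = real (Suc N)" using Suc by (simp add: field_simps)
      finally show ?thesis .
    qed
    then have "(real (Suc N) * exp 1) * (exp 1 * real N ^ (N + 1)) \<le> (real (Suc N) * exp 1) * real (Suc N) ^ (N + 1)"
      by (intro mult_left_mono) auto
    moreover have "fact (Suc N) * exp (real (Suc N)) = (real (Suc N) * exp 1) * (fact N * exp (real N))"
      by (simp add: exp_add algebra_simps)
    moreover have "(real (Suc N) * exp 1) * (fact N * exp (real N)) \<le> (real (Suc N) * exp 1) * (exp 1 * real N ^ (N + 1))"
      using Suc by (intro mult_left_mono) auto
    ultimately show ?case by (simp add: mult_ac)
  qed simp
  moreover have "fact N = real N * fact (N - 1)" using N by (simp add: fact_reduce)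
  ultimately have "real N * (fact (N - 1) * exp (real N)) \<le> real N * (exp 1 * real N ^ N)" by (simp add: mult_ac)
  then show ?thesis using N by simp
qed

lemma integral_arctan_bound:
  fixes F :: "real \<Rightarrow> complex"
  assumes F: "F integrable_on {-Y..Y}" and bd: "\<And>t. norm (F t) \<le> B / (1 + (c * t)\<^sup>2)" and B: "B \<ge> 0" and c: "c > 0" and Y: "Y \<ge> 0"
  shows "norm (integral {-Y..Y} F) \<le> B * pi / c"
proof -
  have i: "((\<lambda>t. B / (1 + (c * t)\<^sup>2)) has_integral (B / c * arctan (c * Y) - B / c * arctan (c * (-Y)))) {-Y..Y}"
    using Y c by (intro fundamental_theorem_of_calculus)
      (auto intro!: derivative_eq_intros simp: has_real_derivative_iff_has_vector_derivative[symmetric] add_nonneg_eq_0_iff divide_simps)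
  have "norm (integral {-Y..Y} F) \<le> integral {-Y..Y} (\<lambda>t. B / (1 + (c * t)\<^sup>2))"
    using bd by (intro integral_norm_bound_integral F has_integral_integrable[OF i])
  also have "\<dots> = B / c * (arctan (c * Y) - arctan (c * (-Y)))"
    unfolding integral_unique[OF i] by (simp add: algebra_simps)
  also have "\<dots> \<le> B / c * pi"
    using B c arctan_ubound[of "c * Y"] arctan_lbound[of "c * (-Y)"] by (intro mult_left_mono) auto
  finally show ?thesis by simp
qed

text \<open>The differential equation determines the integral up to a constant, found by letting u =
  r tend to minus infinity: moving the line past the pole at 0 to Re s = -1/2 leaves the residue 1
  and an integral of size O(e^(r/2)).\<close>

lemma Cahen_Mellin: "mellin_barnes 1 (\<lambda>_. 0) (\<lambda>_. 1) u = exp (- exp u)"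
proof -
  let ?K = "mellin_barnes 1 (\<lambda>_. 0) (\<lambda>_. 1)"
  let ?S = "right_region 1 (\<lambda>_. 0)"
  have sum0: "(\<Sum>l=1..1::nat. (\<lambda>_. 0::complex) l) = 0" by simp
  have d: "(?K has_field_derivative - exp u * ?K u) (at u)" for u
  proof -
    have "(?K has_field_derivative deriv ?K u) (at u)"
      by (intro entire_deriv holomorphic_mellin_barnes[OF _ sum0 poly_growth_1]) simp
    moreover have "deriv ?K u = - exp u * ?K u"
      using mellin_barnes_ode[of 1 "\<lambda>_. 0" u] by simp
    ultimately show ?thesis by simp
  qed
  have "((\<lambda>u. ?K u * exp (exp u)) has_field_derivative 0) (at u within UNIV)" for u
    by (rule derivative_eq_intros d refl)+ (simp add: algebra_simps)
  then have "\<exists>C. \<forall>u\<in>UNIV. ?K u * exp (exp u) = C" by (intro has_field_derivative_zero_constant) auto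
  then obtain C where C: "\<And>u. ?K u * exp (exp u) = C" by auto
  have pr: "pole_radius (Suc 0) (\<lambda>_. 0) = 0" by (simp add: pole_radius_def)
  have bound: "norm (2 * of_real pi * \<i> * ?K (of_real r) - 2 * of_real pi * \<i>) \<le> exp (r / 2) * (2 * sqrt (2 * pi)) * pi" for r :: real
  proof -
    define u where "u = complex_of_real r"
    define f where "f = mellin_kernel 1 (\<lambda>_. 0) (\<lambda>_. 1) u"
    have fs: "f s = Gamma s * exp (- (s * u))" for s by (simp add: f_def mellin_kernel_def gamma_prod_def)
    obtain G where G: "\<And>s. s \<in> ?S \<Longrightarrow> (G has_field_derivative f s) (at s)"
      using mellin_primitive_exists[of "\<lambda>_. 1" 1 "\<lambda>_. 0" u] by (auto simp: f_def)
    have lim: "((\<lambda>Y. G (Complex (-1/2) Y) - G (Complex (-1/2) (-Y))) \<longlongrightarrow> 2 * of_real pi * \<i> * ?K u) at_top"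
      using sum0 by (intro mellin_barnes_vertical[OF _ _ poly_growth_1 _ G[unfolded f_def]]) (auto simp: u_def)
    have ev: "norm (G (Complex (-1/2) Y) - G (Complex (-1/2) (-Y)) - 2 * of_real pi * \<i>) \<le> exp (r / 2) * (2 * sqrt (2 * pi)) * pi" if Y: "Y \<ge> 1" for Y
    proof -
      define a1 a2 a3 a4 where "a1 = Complex (-1/2) (-Y)" and "a2 = Complex (1/2) (-Y)" and "a3 = Complex (1/2) Y" and "a4 = Complex (-1/2) Y"
      have rp: "rectpath a1 a3 = linepath a1 a2 +++ linepath a2 a3 +++ linepath a3 a4 +++ linepath a4 a1"
        by (simp add: rectpath_def Let_def a1_def a2_def a3_def a4_def)
      \<comment> \<open>Near 0 the kernel is F(s)/s with F(0) = 1, so Cauchy's integral formula on a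
        rectangle acts as the residue theorem.\<close>
      define F where "F s = Gamma (s + 1) * exp (- (s * u))" for s
      have np: "s \<notin> \<int>\<^sub>\<le>\<^sub>0" if "s \<noteq> 0" "Re s > -1" for s
      proof
        assume "s \<in> \<int>\<^sub>\<le>\<^sub>0"
        then obtain k where k: "s = of_int k" "k \<le> 0" by (auto elim: nonpos_Ints_cases)
        then have "real_of_int k > -1" using that by simp
        then have "k = 0" using k by linarith
        then show False using k that by simp
      qed
      have fF: "f s = F s / (s - 0)" if "s \<noteq> 0" "Re s > -1" for s
        using Gamma_plus1[OF np[OF that]] that by (simp add: fs F_def)
      have img: "path_image (rectpath a1 a3) \<subseteq> {s. Re s > -1} - {0}"
        using Y by (subst path_image_rectpath) (auto simp: a1_def a3_def)
      have holF: "F holomorphic_on {s. Re s > -1}"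
        unfolding F_def
      proof (intro holomorphic_intros)
        fix s assume "s \<in> {s. Re s > -1}"
        then have "Re (s + 1) > 0" by simp
        then show "s + 1 \<notin> \<int>\<^sub>\<le>\<^sub>0" by (auto elim!: nonpos_Ints_cases dest!: arg_cong[where f = Re])
      qed
      have "((\<lambda>w. F w / (w - 0)) has_contour_integral (of_real (2 * pi) * \<i> * winding_number (rectpath a1 a3) 0 * F 0)) (rectpath a1 a3)"
      proof (rule Cauchy_integral_formula_convex_simple[OF convex_halfspace_Re_gt holF])
        have "open {s. Re s > -1}" by (intro open_Collect_less continuous_intros)
        then show "0 \<in> interior {s. Re s > -1}" by (simp add: interior_open)
      qed (use img in \<open>auto simp: rp\<close>)
      moreover have "winding_number (rectpath a1 a3) 0 = 1"
        by (rule winding_number_rectpath) (use Y in \<open>auto simp: a1_def a3_def in_box_complex_iff\<close>)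
      moreover have "F 0 = 1" by (simp add: F_def)
      ultimately have "((\<lambda>w. F w / (w - 0)) has_contour_integral 2 * of_real pi * \<i>) (rectpath a1 a3)" by simp
      then have T: "(f has_contour_integral 2 * of_real pi * \<i>) (rectpath a1 a3)"
      proof (rule has_contour_integral_eq)
        fix x assume "x \<in> path_image (rectpath a1 a3)"
        then have "x \<noteq> 0" "Re x > -1" using img by auto
        then show "F x / (x - 0) = f x" using fF by simp
      qed
      \<comment> \<open>Three convex pieces of \<open>right_region\<close>, one each for the right,
        upper and lower side of the rectangle. The left side crosses the real axis beyond the pole
        and is integrated directly.\<close>
      have seg: "closed_segment x y \<subseteq> ?S" if "x \<in> {s. Re s > 0} \<and> y \<in> {s. Re s > 0} \<or> x \<in> {s. Re s > - (3/4)} \<inter> {s. Im s > 3/4} \<and> y \<in> {s. Re s > - (3/4)} \<inter> {s. Im s > 3/4}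
          \<or> x \<in> {s. Re s > - (3/4)} \<inter> {s. Im s < - (3/4)} \<and> y \<in> {s. Re s > - (3/4)} \<inter> {s. Im s < - (3/4)}" for x y
        using that
      proof (elim disjE conjE)
        assume "x \<in> {s. Re s > 0}" "y \<in> {s. Re s > 0}"
        then have "closed_segment x y \<subseteq> {s. Re s > 0}" by (intro closed_segment_subset convex_halfspace_Re_gt)
        also have "\<dots> \<subseteq> ?S" by (auto simp: right_region_def pr)
        finally show ?thesis .
      next
        assume "x \<in> {s. Re s > - (3/4)} \<inter> {s. Im s > 3/4}" "y \<in> {s. Re s > - (3/4)} \<inter> {s. Im s > 3/4}"
        then have "closed_segment x y \<subseteq> {s. Re s > - (3/4)} \<inter> {s. Im s > 3/4}"
          by (intro closed_segment_subset convex_Int convex_halfspace_Re_gt convex_halfspace_Im_gt)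
        also have "\<dots> \<subseteq> ?S" by (auto simp: right_region_def pr)
        finally show ?thesis .
      next
        assume "x \<in> {s. Re s > - (3/4)} \<inter> {s. Im s < - (3/4)}" "y \<in> {s. Re s > - (3/4)} \<inter> {s. Im s < - (3/4)}"
        then have "closed_segment x y \<subseteq> {s. Re s > - (3/4)} \<inter> {s. Im s < - (3/4)}"
          by (intro closed_segment_subset convex_Int convex_halfspace_Re_gt convex_halfspace_Im_lt)
        also have "\<dots> \<subseteq> ?S" by (auto simp: right_region_def pr)
        finally show ?thesis .
      qed
      have prim: "(f has_contour_integral G y - G x) (linepath x y)" if "closed_segment x y \<subseteq> ?S" for x y
        using contour_integral_primitive[OF has_field_derivative_at_within[OF G], of ?S "linepath x y"] that by simp
      have p12: "(f has_contour_integral G a2 - G a1) (linepath a1 a2)"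
        by (rule prim, rule seg) (use Y in \<open>auto simp: a1_def a2_def\<close>)
      have p23: "(f has_contour_integral G a3 - G a2) (linepath a2 a3)"
        by (rule prim, rule seg) (auto simp: a2_def a3_def)
      have p34: "(f has_contour_integral G a4 - G a3) (linepath a3 a4)"
        by (rule prim, rule seg) (use Y in \<open>auto simp: a3_def a4_def\<close>)
      have cf: "continuous_on {s. Re s > -1 \<and> s \<noteq> 0} f"
        unfolding fs[abs_def] using np by (intro continuous_intros) auto
      have "f contour_integrable_on linepath a1 a4"
      proof (rule contour_integrable_continuous_linepath, rule continuous_on_subset[OF cf])
        have "closed_segment a1 a4 \<subseteq> {s. Re s \<le> -1/2} \<inter> {s. Re s \<ge> -1/2}"
          by (intro closed_segment_subset convex_Int convex_halfspace_Re_le convex_halfspace_Re_ge) (auto simp: a1_def a4_def)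
        then show "closed_segment a1 a4 \<subseteq> {s. Re s > -1 \<and> s \<noteq> 0}" by force
      qed
      then obtain J where J: "(f has_contour_integral J) (linepath a1 a4)" by (auto simp: contour_integrable_on_def)
      then have p41: "(f has_contour_integral - J) (linepath a4 a1)"
        using has_contour_integral_reversepath[OF _ J] by simp
      have "(f has_contour_integral (G a2 - G a1) + ((G a3 - G a2) + ((G a4 - G a3) + (- J)))) (rectpath a1 a3)"
        unfolding rp by (intro has_contour_integral_join p12 p23 p34 p41) auto
      from has_contour_integral_unique[OF this T] have e: "G a4 - G a1 - 2 * of_real pi * \<i> = J" by (simp add: algebra_simps)
      have J': "((\<lambda>x. f (Complex (-1/2) x)) has_integral (-\<i> * J)) {-Y..Y}"
        using J Y by (subst (asm) has_contour_integral_linepath_same_Re_iff[where c = "-1/2" and a = "-Y" and b = Y]) (auto simp: a1_def a4_def)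
      have "norm (integral {-Y..Y} (\<lambda>x. f (Complex (-1/2) x))) \<le> (exp (r / 2) * (2 * sqrt (2 * pi))) * pi / 1"
      proof (rule integral_arctan_bound[OF has_integral_integrable[OF J']])
        fix t
        define s where "s = Complex (-1/2) t"
        have s1: "s + 1 = Complex (1/2) t" by (simp add: s_def complex_eq_iff)
        have "s \<notin> \<int>\<^sub>\<le>\<^sub>0" by (rule np) (auto simp: s_def complex_eq_iff)
        then have "norm s * norm (Gamma s) \<le> sqrt (2 * pi) * exp (- pi * \<bar>t\<bar> / 2)"
          using norm_Gamma_half[of t] Gamma_plus1[of s] unfolding s1 by (simp add: norm_mult)
        moreover have "norm s \<ge> 1 / 2" using abs_Re_le_cmod[of s] by (simp add: s_def)
        ultimately have "1 / 2 * norm (Gamma s) \<le> sqrt (2 * pi) * exp (- pi * \<bar>t\<bar> / 2)"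
          by (meson mult_right_mono norm_ge_zero order_trans)
        \<comment> \<open>A majorant of the shape that the arctangent bound accepts; the constant
          3/2 comes from \<pi> > 3.\<close>
        moreover have "exp (- pi * \<bar>t\<bar> / 2) \<le> 1 / (1 + t\<^sup>2)"
        proof -
          have "3 * \<bar>t\<bar> / 2 \<le> pi * \<bar>t\<bar> / 2" using pi_gt3 by (intro divide_right_mono mult_right_mono) auto
          then have "exp (3 * \<bar>t\<bar> / 2) \<le> exp (pi * \<bar>t\<bar> / 2)" by simp
          moreover have "1 + 3 * \<bar>t\<bar> / 2 + (3 * \<bar>t\<bar> / 2)\<^sup>2 / 2 \<le> exp (3 * \<bar>t\<bar> / 2)" by (rule exp_lower_Taylor_quadratic) simp
          moreover have "1 + t\<^sup>2 \<le> 1 + 3 * \<bar>t\<bar> / 2 + (3 * \<bar>t\<bar> / 2)\<^sup>2 / 2" 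
          proof -
            have "t\<^sup>2 \<le> 9 * t\<^sup>2 / 8" "0 \<le> 3 * \<bar>t\<bar> / 2" by auto
            moreover have "(3 * \<bar>t\<bar> / 2)\<^sup>2 / 2 = 9 * t\<^sup>2 / 8" by (simp add: power_mult_distrib power_divide)
            ultimately show ?thesis by linarith
          qed
          ultimately have "1 + t\<^sup>2 \<le> exp (pi * \<bar>t\<bar> / 2)" by linarith
          then have "inverse (exp (pi * \<bar>t\<bar> / 2)) \<le> inverse (1 + t\<^sup>2)" by (intro le_imp_inverse_le) (auto simp: add_pos_nonneg)
          then show ?thesis by (simp add: exp_minus inverse_eq_divide)
        qed
        then have "sqrt (2 * pi) * exp (- pi * \<bar>t\<bar> / 2) \<le> sqrt (2 * pi) * (1 / (1 + t\<^sup>2))" by (intro mult_left_mono) auto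
        ultimately have g: "norm (Gamma s) \<le> 2 * sqrt (2 * pi) / (1 + t\<^sup>2)" by simp
        have "norm (f s) = norm (Gamma s) * exp (r / 2)" by (simp add: fs norm_mult s_def u_def)
        also have "\<dots> \<le> 2 * sqrt (2 * pi) / (1 + t\<^sup>2) * exp (r / 2)" using g by (intro mult_right_mono) auto
        finally show "norm (f (Complex (-1/2) t)) \<le> (exp (r / 2) * (2 * sqrt (2 * pi))) / (1 + (1 * t)\<^sup>2)" by (simp add: s_def mult_ac)
      qed (use Y in auto)
      then have "norm J \<le> exp (r / 2) * (2 * sqrt (2 * pi)) * pi"
        unfolding integral_unique[OF J'] by (simp add: norm_mult)
      then show ?thesis unfolding e[symmetric] a1_def a4_def .
    qed
    have "((\<lambda>Y. norm (G (Complex (-1/2) Y) - G (Complex (-1/2) (-Y)) - 2 * of_real pi * \<i>)) \<longlongrightarrow> norm (2 * of_real pi * \<i> * ?K u - 2 * of_real pi * \<i>)) at_top"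
      by (intro tendsto_intros lim)
    then show ?thesis unfolding u_def[symmetric]
      by (rule tendsto_upperbound) (use ev in \<open>auto intro!: eventually_mono[OF eventually_ge_at_top[of 1]]\<close>)
  qed
  have "((\<lambda>r. 2 * of_real pi * \<i> * ?K (of_real r) - 2 * of_real pi * \<i>) \<longlongrightarrow> 0) at_bot"
  proof (rule Lim_null_comparison)
    show "eventually (\<lambda>r. norm (2 * of_real pi * \<i> * ?K (of_real r) - 2 * of_real pi * \<i>) \<le> exp (r / 2) * (2 * sqrt (2 * pi)) * pi) at_bot"
      using bound by simp
    show "((\<lambda>r. exp (r / 2) * (2 * sqrt (2 * pi)) * pi) \<longlongrightarrow> 0) at_bot" by real_asymp
  qed
  moreover have "((\<lambda>r. 2 * of_real pi * \<i> * ?K (of_real r) - 2 * of_real pi * \<i>) \<longlongrightarrow> 2 * of_real pi * \<i> * (C * exp (- 0)) - 2 * of_real pi * \<i>) at_bot"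
  proof -
    have "?K (of_real r) = C * exp (- of_real (exp r))" for r :: real
      unfolding C[of "of_real r", symmetric] by (simp add: exp_minus exp_of_real)
    moreover have "((\<lambda>r. 2 * of_real pi * \<i> * (C * exp (- complex_of_real (exp r))) - 2 * of_real pi * \<i>) \<longlongrightarrow> 2 * of_real pi * \<i> * (C * exp (- of_real 0)) - 2 * of_real pi * \<i>) at_bot"
      by (intro tendsto_intros exp_at_bot)
    ultimately show ?thesis by (simp only: of_real_0)
  qed
  ultimately have "2 * of_real pi * \<i> * (C * exp (- 0)) - 2 * of_real pi * \<i> = 0"
    by (intro tendsto_unique[OF trivial_limit_at_bot_linorder])
  then have "C = 1" by simp
  then show ?thesis using C[of u] by (simp add: exp_minus field_simps)
qed

text \<open>A line beyond \<open>pole_radius\<close> lies entirely in \<open>right_region\<close>,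
  so here the differences of the primitive are integrals over the line itself.\<close>

lemma mellin_barnes_real_line:
  assumes n: "n > 0" and sum0: "(\<Sum>l=1..n. lam l) = 0" and P: "poly_growth d P" and b: "b > pole_radius n lam"
    and u: "Im u = 0"
  shows "((\<lambda>Y. integral {-Y..Y} (\<lambda>t. mellin_kernel n lam P u (Complex b t))) \<longlongrightarrow> 2 * of_real pi * mellin_barnes n lam P u) at_top"
    and "(\<lambda>t. mellin_kernel n lam P u (Complex b t)) integrable_on {x..y}"
proof -
  have hol: "P holomorphic_on UNIV" using P by (simp add: poly_growth_def)
  obtain G where G: "\<And>s. s \<in> right_region n lam \<Longrightarrow> (G has_field_derivative mellin_kernel n lam P u s) (at s)"
    using mellin_primitive_exists[OF hol, of n lam u] by auto
  have lim: "((\<lambda>Y. G (Complex b Y) - G (Complex b (-Y))) \<longlongrightarrow> 2 * of_real pi * \<i> * mellin_barnes n lam P u) at_top"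
    using u by (intro mellin_barnes_vertical[OF n sum0 P _ G]) auto
  have vd: "((\<lambda>t. Complex b t) has_vector_derivative \<i>) (at t within A)" for t A
  proof -
    have "((\<lambda>t. of_real b + \<i> * of_real t) has_vector_derivative 0 + \<i> * of_real 1) (at t within A)"
      by (intro has_vector_derivative_add has_vector_derivative_const has_vector_derivative_mult_right has_vector_derivative_of_real) auto
    moreover have "(\<lambda>t. Complex b t) = (\<lambda>t. of_real b + \<i> * of_real t)" by (auto simp: complex_eq_iff)
    ultimately show ?thesis by simp
  qed
  have I: "((\<lambda>t. mellin_kernel n lam P u (Complex b t) * \<i>) has_integral (G (Complex b y) - G (Complex b x))) {x..y}" if "x \<le> y" for x y
    by (rule mellin_path_integral[OF G]) (use that b vd in \<open>auto simp: right_region_def\<close>)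
  have I': "((\<lambda>t. mellin_kernel n lam P u (Complex b t)) has_integral (-\<i> * (G (Complex b y) - G (Complex b x)))) {x..y}" if "x \<le> y" for x y
    using has_integral_mult_right[OF I[OF that], of "-\<i>"] by (simp add: mult.assoc[symmetric] mult.commute)
  show "(\<lambda>t. mellin_kernel n lam P u (Complex b t)) integrable_on {x..y}"
    using I'[of x y] by (cases "x \<le> y") auto
  have "((\<lambda>Y. -\<i> * (G (Complex b Y) - G (Complex b (-Y)))) \<longlongrightarrow> -\<i> * (2 * of_real pi * \<i> * mellin_barnes n lam P u)) at_top"
    by (intro tendsto_intros lim)
  moreover have "eventually (\<lambda>Y. -\<i> * (G (Complex b Y) - G (Complex b (-Y))) = integral {-Y..Y} (\<lambda>t. mellin_kernel n lam P u (Complex b t))) at_top"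
    using eventually_ge_at_top[of 0]
  proof eventually_elim
    case (elim Y) then show ?case using integral_unique[OF I'[of "-Y" Y]] by simp
  qed
  ultimately have "((\<lambda>Y. integral {-Y..Y} (\<lambda>t. mellin_kernel n lam P u (Complex b t))) \<longlongrightarrow> -\<i> * (2 * of_real pi * \<i> * mellin_barnes n lam P u)) at_top"
    by (rule Lim_transform_eventually)
  then show "((\<lambda>Y. integral {-Y..Y} (\<lambda>t. mellin_kernel n lam P u (Complex b t))) \<longlongrightarrow> 2 * of_real pi * mellin_barnes n lam P u) at_top"
    by (simp add: algebra_simps)
qed

section \<open>Comparison with the case n = 1 on the positive axis\<close>

definition twisted_mellin :: "nat \<Rightarrow> (nat \<Rightarrow> complex) \<Rightarrow> complex \<Rightarrow> complex" where
  "twisted_mellin n lam u = exp ((of_nat n - 1) / 2 * u) * mellin_barnes n lam (\<lambda>_. 1) u"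

lemma twisted_mellin_cov_deriv:
  assumes n: "n > 0" and sum0: "(\<Sum>l=1..n. lam l) = 0"
  defines "a \<equiv> (of_nat n - 1) / 2 :: complex"
  shows "(cov_deriv ^^ k) (twisted_mellin n lam) = (\<lambda>u. exp ((a - of_nat k) * u) * mellin_barnes n lam (\<lambda>s. \<Prod>i<k. a - of_nat i - of_nat n * s) u)
    \<and> poly_growth k (\<lambda>s. \<Prod>i<k. a - of_nat i - of_nat n * s)"
proof (induction k)
  case 0 then show ?case by (simp add: poly_growth_1 twisted_mellin_def[abs_def] a_def)
next
  case (Suc k)
  define P where "P s = (\<Prod>i<k. a - of_nat i - of_nat n * s)" for s
  have P: "poly_growth k P" using Suc by (simp add: P_def[abs_def])
  have E: "(cov_deriv ^^ k) (twisted_mellin n lam) = (\<lambda>u. exp ((a - of_nat k) * u) * mellin_barnes n lam P u)"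
    using Suc by (simp add: P_def[abs_def])
  have c: "(\<lambda>s. \<Prod>i<Suc k. a - of_nat i - of_nat n * s) = (\<lambda>s. ((a - of_nat k) - of_nat n * s) * P s)"
    by (auto simp: P_def)
  have g: "poly_growth (Suc k) (\<lambda>s. ((a - of_nat k) - of_nat n * s) * P s)"
    using poly_growth_mult[OF P, of "- of_nat n" "a - of_nat k"] by simp
  have "(cov_deriv ^^ Suc k) (twisted_mellin n lam) u = exp ((a - of_nat (Suc k)) * u) * mellin_barnes n lam (\<lambda>s. ((a - of_nat k) - of_nat n * s) * P s) u" for u
  proof -
    have "deriv (\<lambda>u. exp ((a - of_nat k) * u) * mellin_barnes n lam P u) u = exp ((a - of_nat k) * u) * mellin_barnes n lam (\<lambda>s. ((a - of_nat k) - of_nat n * s) * P s) u"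
      by (rule DERIV_imp_deriv mellin_barnes_exp_deriv[OF n sum0 P])+
    moreover have "exp ((a - of_nat (Suc k)) * u) = exp ((a - of_nat k) * u) / exp u"
      unfolding exp_diff[symmetric] by (rule arg_cong[where f = exp]) (simp add: algebra_simps)
    ultimately show ?thesis by (simp add: E cov_deriv_def cov_proj_def)
  qed
  then show ?case unfolding c using g by blast
qed

definition leading_const :: "nat \<Rightarrow> real" where
  "leading_const n = (2 * pi) powr ((real n - 1) / 2) / sqrt (real n)"

text \<open>For y = N/n the line Re s = b is placed so that ns - a + k has real part N, close to the
  saddle point. Up to sign the weight of the k-th derivative is the Pochhammer symbol (ns - a)_k,
  which raises Gamma(ns - a) to Gamma(ns - a + k). The main term is the Cahen-Mellin integral at N,
  that is e^(-N). The error O(1/b) of the Gamma product is integrated against a function of mass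
  O(sqrt N e^(-N)).\<close>

lemma twisted_mellin_real_asymp:
  assumes n: "n > 0" and sum0: "(\<Sum>l=1..n. lam l) = 0"
  shows "(\<lambda>N. exp (of_nat N) * (cov_deriv ^^ k) (twisted_mellin n lam) (of_real (ln (real N / real n))))
    \<longlonglongrightarrow> of_real (leading_const n) * (- of_nat n) ^ k"
proof -
  define a where "a = (real n - 1) / 2"
  have ca: "complex_of_real a = (of_nat n - 1) / 2" by (simp add: a_def)
  define P where "P s = (\<Prod>i<k. of_real a - of_nat i - of_nat n * s)" for s :: complex
  have P: "poly_growth k P" and D: "\<And>u. (cov_deriv ^^ k) (twisted_mellin n lam) u = exp ((of_real a - of_nat k) * u) * mellin_barnes n lam P u"
    using twisted_mellin_cov_deriv[OF n sum0, of k] by (simp_all add: P_def[abs_def] ca)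
  define c1 where "c1 = sqrt (2 * pi) ^ (n - 1) * sqrt (real n) * real n powr a"
  have c1: "leading_const n = c1 * real n powr (- a) / real n"
  proof -
    have "sqrt (2 * pi) ^ (n - 1) = (2 * pi) powr ((real n - 1) / 2)"
      using n by (simp add: powr_half_sqrt[symmetric] powr_realpow[symmetric] powr_powr of_nat_diff)
    moreover have "real n powr a * real n powr (- a) = 1" using n by (simp add: powr_add[symmetric])
    moreover have "sqrt (real n) / real n = 1 / sqrt (real n)" by (simp only: sqrt_divide_self_eq of_nat_0_le_iff inverse_eq_divide)
    moreover have "c1 * real n powr (- a) / real n = sqrt (2 * pi) ^ (n - 1) * (sqrt (real n) / real n) * (real n powr a * real n powr (- a))"
      by (simp add: c1_def)
    ultimately show ?thesis unfolding leading_const_def by simp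
  qed
  obtain C R where C: "C \<ge> 0" "R \<ge> 1" and
    r: "\<And>s. Re s \<ge> R \<Longrightarrow> norm ((\<Prod>l=1..n. Gamma (s - lam l)) * exp (of_nat n * s * of_real (ln (real n))) / Gamma (of_nat n * s - of_real a) - of_real c1) \<le> C / norm s"
    using prod_Gamma_asymp[OF n sum0] unfolding ca[symmetric] c1_def a_def by blast
  define B where "B = real n powr (real k - a) * (exp 1 * C * 3)"
  \<comment> \<open>The condition on \<open>N\<close> gives N - k \<ge> N/2 and then b \<ge> N/(2n)
    > R + \<open>pole_radius\<close>, as both the Gamma asymptotics and the vertical line
    demand.\<close>
  have main: "norm (exp (of_nat N) * (cov_deriv ^^ k) (twisted_mellin n lam) (of_real (ln (real N / real n))) - of_real (leading_const n) * (- of_nat n) ^ k) \<le> B * sqrt (real N) / real N"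
    if N: "real N \<ge> 2 * real k + 1 + 2 * real n * (R + pole_radius n lam)" for N
  proof -
    have R0: "R + pole_radius n lam \<ge> 1" using C pole_radius_nonneg[of n lam] by linarith
    have nR: "2 * real n * (R + pole_radius n lam) \<ge> 2 * real n" using R0 n by simp
    have "real N \<ge> 2 * real k + 1" using N nR by linarith
    then have N0: "N > 0" "N > k" and Nk: "real N / 2 \<le> real N - real k" by linarith+
    define b where "b = (real N + a - real k) / real n"
    have a0: "a \<ge> 0" using n by (simp add: a_def)
    have b2: "b \<ge> real N / (2 * real n)" 
    proof -
      have "(real N / 2) / real n \<le> (real N + a - real k) / real n" using Nk a0 by (intro divide_right_mono) auto
      then show ?thesis by (simp add: b_def)
    qed
    have "real N / (2 * real n) > R + pole_radius n lam" using N n by (simp add: field_simps)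
    then have b: "b > R + pole_radius n lam" using b2 by simp
    have bR: "b \<ge> R" "b > pole_radius n lam" "b > 0" using b C pole_radius_nonneg[of n lam] by linarith+
    define u where "u = complex_of_real (ln (real N / real n))"
    define lN where "lN = complex_of_real (ln (real N))"
    have ul: "of_real (ln (real n)) + u = lN" using n N0 by (simp add: u_def lN_def ln_div)
    define \<phi> where "\<phi> t = Gamma (Complex (real N) (real n * t)) * exp (- (Complex (real N) (real n * t) * lN))" for t
    define \<rho> where "\<rho> t = (\<Prod>l=1..n. Gamma (Complex b t - lam l)) * exp (of_nat n * Complex b t * of_real (ln (real n))) / Gamma (of_nat n * Complex b t - of_real a) - of_real c1" for t
    define A where "A = (-1) ^ k * exp ((of_nat k - of_real a) * lN)"
    have \<rho>b: "norm (\<rho> t) \<le> C / b" for t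
    proof -
      have "norm (\<rho> t) \<le> C / norm (Complex b t)" unfolding \<rho>_def using bR by (intro r) simp
      also have "\<dots> \<le> C / b"
      proof -
        have "b \<le> norm (Complex b t)" using abs_Re_le_cmod[of "Complex b t"] by simp
        then show ?thesis using C bR(3) by (intro divide_left_mono mult_pos_pos) auto
      qed
      finally show ?thesis .
    qed
    have nb: "real n * b = real N + a - real k" using n by (simp add: b_def)
    have nS: "of_nat n * Complex b t = Complex (real N) (real n * t) + of_real a - of_nat k" for t
      by (simp add: complex_eq_iff nb)
    have ker: "mellin_kernel n lam P u (Complex b t) = A * (\<phi> t * (of_real c1 + \<rho> t))" for t
    proof -
      define S where "S = Complex b t"
      define w where "w = of_nat n * S - of_real a"
      have w: "w = Complex (real N) (real n * t) - of_nat k" by (simp add: w_def S_def nS)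
      have "Re w > 0" using N0 by (simp add: w)
      then have np: "w \<notin> \<int>\<^sub>\<le>\<^sub>0" by (auto elim!: nonpos_Ints_cases)
      then have G0: "Gamma w \<noteq> 0" by (simp add: Gamma_eq_zero_iff)
      have "P S = (\<Prod>i<k. (-1) * (w + of_nat i))" unfolding P_def by (intro prod.cong) (auto simp: w_def)
      also have "\<dots> = (-1) ^ k * pochhammer w k" by (simp only: prod.distrib pochhammer_prod atLeast0LessThan) simp
      also have "pochhammer w k = Gamma (Complex (real N) (real n * t)) / Gamma w"
        using pochhammer_Gamma[OF np, of k] by (simp add: w)
      finally have PS: "P S = (-1) ^ k * (Gamma (Complex (real N) (real n * t)) / Gamma w)" .
      have "gamma_prod n lam S * exp (of_nat n * S * of_real (ln (real n))) / Gamma w = of_real c1 + \<rho> t"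
        by (simp add: \<rho>_def S_def w_def gamma_prod_def)
      then have GP: "gamma_prod n lam S = (of_real c1 + \<rho> t) * Gamma w * exp (- (of_nat n * S * of_real (ln (real n))))"
        using G0 by (auto simp: exp_minus field_simps)
      have "exp (- (of_nat n * S * of_real (ln (real n)))) * exp (- (of_nat n * S * u)) = exp (- (Complex (real N) (real n * t) * lN)) * exp ((of_nat k - of_real a) * lN)"
        unfolding ul[symmetric] exp_add[symmetric] S_def nS by (rule arg_cong[where f = exp]) (simp add: algebra_simps)
      then show ?thesis
        unfolding mellin_kernel_def S_def[symmetric] PS GP A_def \<phi>_def using G0 by (simp add: mult_ac)
    qed
    have phi_ker: "\<phi> t = mellin_kernel 1 (\<lambda>_. 0) (\<lambda>_. 1) lN (Complex (real N) (real n * t))" for t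
      by (simp add: \<phi>_def mellin_kernel_def gamma_prod_def)
    have s1: "(\<Sum>l=1..1::nat. (\<lambda>_. 0::complex) l) = 0" by simp
    have pr1: "pole_radius (Suc 0) (\<lambda>_. 0) = 0" by (simp add: pole_radius_def)
    have N1: "pole_radius 1 (\<lambda>_. 0) < real N" using N0 by (simp add: pr1)
    have ImlN: "Im lN = 0" by (simp add: lN_def)
    define \<Psi> where "\<Psi> \<tau> = mellin_kernel 1 (\<lambda>_. 0) (\<lambda>_. 1) lN (Complex (real N) \<tau>)" for \<tau>
    have \<Psi>_int: "\<Psi> integrable_on {x..y}" for x y
      unfolding \<Psi>_def by (rule mellin_barnes_real_line(2)[OF _ s1 poly_growth_1 N1 ImlN]) simp
    \<comment> \<open>The substitution by nt produces the factor 1/n that enters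
      \<open>leading_const\<close>.\<close>
    have \<phi>_has: "(\<phi> has_integral (integral {-(real n * Y)..real n * Y} \<Psi> / of_nat n)) {-Y..Y}" for Y
    proof -
      have "((\<lambda>t. \<Psi> (real n *\<^sub>R t + 0)) has_integral (integral {-(real n * Y)..real n * Y} \<Psi> /\<^sub>R real n ^ DIM(real)))
         (cbox ((- (real n * Y) - 0) /\<^sub>R real n) ((real n * Y - 0) /\<^sub>R real n))"
        by (rule has_integral_affinity') (use n \<Psi>_int in \<open>auto simp: has_integral_integral\<close>)
      moreover have "(- (real n * Y) - 0) /\<^sub>R real n = -Y" "(real n * Y - 0) /\<^sub>R real n = Y" using n by simp_all
      moreover have "(\<lambda>t. \<Psi> (real n *\<^sub>R t + 0)) = \<phi>" by (auto simp: phi_ker \<Psi>_def)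
      moreover have "I /\<^sub>R real n ^ DIM(real) = I / of_nat n" for I :: complex
        by (simp add: scaleR_conv_of_real divide_inverse mult.commute)
      ultimately show ?thesis by (simp only: cbox_interval)
    qed
    have "((\<lambda>Y. integral {-Y..Y} \<Psi>) \<longlongrightarrow> 2 * of_real pi * mellin_barnes 1 (\<lambda>_. 0) (\<lambda>_. 1) lN) at_top"
      unfolding \<Psi>_def by (rule mellin_barnes_real_line(1)[OF _ s1 poly_growth_1 N1 ImlN]) simp
    moreover have "mellin_barnes 1 (\<lambda>_. 0) (\<lambda>_. 1) lN = exp (- of_nat N)"
      unfolding Cahen_Mellin using N0 by (simp add: lN_def exp_of_real)
    moreover have "filterlim (\<lambda>Y. real n * Y) at_top at_top"
      using n by (intro filterlim_tendsto_pos_mult_at_top[OF tendsto_const]) (auto simp: filterlim_ident)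
    ultimately have "((\<lambda>Y. integral {-(real n * Y)..real n * Y} \<Psi>) \<longlongrightarrow> 2 * of_real pi * exp (- of_nat N)) at_top"
      using filterlim_compose by fastforce
    then have \<phi>_lim: "((\<lambda>Y. integral {-Y..Y} \<phi>) \<longlongrightarrow> 2 * of_real pi * exp (- of_nat N) / of_nat n) at_top"
      unfolding integral_unique[OF \<phi>_has] using n by (intro tendsto_intros) auto
    have A0: "A \<noteq> 0" by (simp add: A_def)
    have k_int: "(\<lambda>t. mellin_kernel n lam P u (Complex b t)) integrable_on {x..y}" for x y
      by (rule mellin_barnes_real_line(2)[OF n sum0 P bR(2)]) (simp add: u_def)
    have k_lim: "((\<lambda>Y. integral {-Y..Y} (\<lambda>t. mellin_kernel n lam P u (Complex b t))) \<longlongrightarrow> 2 * of_real pi * mellin_barnes n lam P u) at_top"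
      by (rule mellin_barnes_real_line(1)[OF n sum0 P bR(2)]) (simp add: u_def)
    have \<phi>\<rho>: "(\<lambda>t. \<phi> t * \<rho> t) = (\<lambda>t. (1 / A) * mellin_kernel n lam P u (Complex b t) - of_real c1 * \<phi> t)"
      unfolding ker using A0 by (auto simp: algebra_simps)
    have \<phi>\<rho>_int: "(\<lambda>t. \<phi> t * \<rho> t) integrable_on {-Y..Y}" for Y
      unfolding \<phi>\<rho> by (intro integrable_diff integrable_on_mult_right k_int has_integral_integrable[OF \<phi>_has])
    have \<phi>\<rho>_eq: "integral {-Y..Y} (\<lambda>t. mellin_kernel n lam P u (Complex b t)) - A * of_real c1 * integral {-Y..Y} \<phi> = A * integral {-Y..Y} (\<lambda>t. \<phi> t * \<rho> t)" for Y
      unfolding \<phi>\<rho> using A0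
      by (subst Henstock_Kurzweil_Integration.integral_diff)
         (auto intro!: integrable_on_mult_right k_int has_integral_integrable[OF \<phi>_has] simp: algebra_simps)
    define E where "E = exp 1 * exp (- real N)"
    have factE: "fact (N - 1) / real N ^ N \<le> E"
    proof -
      have "fact (N - 1) \<le> exp 1 * real N ^ N / exp (real N)"
        using fact_exp_bound[OF N0(1)] by (simp add: pos_le_divide_eq)
      then have "fact (N - 1) / real N ^ N \<le> exp 1 * real N ^ N / exp (real N) / real N ^ N"
        by (intro divide_right_mono) auto
      also have "\<dots> = E" using N0 by (simp add: E_def exp_minus divide_inverse)
      finally show ?thesis .
    qed
    have bd: "norm (integral {-Y..Y} (\<lambda>t. \<phi> t * \<rho> t)) \<le> E * (C / b) * pi / (real n / (3 * sqrt (real N)))" if Y: "Y \<ge> 0" for Y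
    proof (rule integral_arctan_bound[OF \<phi>\<rho>_int])
      fix t
      have "norm (exp (- (Complex (real N) (real n * t) * lN))) = exp (- (real N * ln (real N)))" by (simp add: lN_def)
      also have "\<dots> = 1 / real N ^ N" using N0 by (simp add: exp_minus exp_of_nat_mult inverse_eq_divide)
      finally have "norm (\<phi> t) = norm (Gamma (Complex (real N) (real n * t))) * (1 / real N ^ N)" by (simp add: \<phi>_def norm_mult)
      also have "\<dots> \<le> (fact (N - 1) / (1 + (real n * t)\<^sup>2 / (9 * real N))) * (1 / real N ^ N)"
        by (intro mult_right_mono norm_Gamma_nat_plus_imaginary N0) simp
      also have "\<dots> = (fact (N - 1) / real N ^ N) / (1 + (real n * t)\<^sup>2 / (9 * real N))" by simp
      also have "\<dots> \<le> E / (1 + (real n * t)\<^sup>2 / (9 * real N))"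
        by (intro divide_right_mono factE) (auto simp: add_nonneg_nonneg)
      also have "(real n * t)\<^sup>2 / (9 * real N) = (real n / (3 * sqrt (real N)) * t)\<^sup>2"
        by (simp add: power_mult_distrib power_divide)
      finally have "norm (\<phi> t * \<rho> t) \<le> E / (1 + (real n / (3 * sqrt (real N)) * t)\<^sup>2) * (C / b)"
        unfolding norm_mult using \<rho>b[of t] by (intro mult_mono) (auto simp: E_def add_nonneg_nonneg)
      then show "norm (\<phi> t * \<rho> t) \<le> E * (C / b) / (1 + (real n / (3 * sqrt (real N)) * t)\<^sup>2)" by (simp add: mult_ac)
    qed (use C bR n N0 Y in \<open>auto simp: E_def\<close>)
    have "((\<lambda>Y. norm (integral {-Y..Y} (\<lambda>t. mellin_kernel n lam P u (Complex b t)) - A * of_real c1 * integral {-Y..Y} \<phi>)) \<longlongrightarrow>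
        norm (2 * of_real pi * mellin_barnes n lam P u - A * of_real c1 * (2 * of_real pi * exp (- of_nat N) / of_nat n))) at_top"
      by (intro tendsto_intros k_lim \<phi>_lim)
    then have K: "norm (2 * of_real pi * mellin_barnes n lam P u - A * of_real c1 * (2 * of_real pi * exp (- of_nat N) / of_nat n)) \<le> norm A * (E * (C / b) * pi / (real n / (3 * sqrt (real N))))"
      unfolding \<phi>\<rho>_eq norm_mult[of A]
    proof (rule tendsto_upperbound)
      show "eventually (\<lambda>Y. norm A * norm (integral {-Y..Y} (\<lambda>t. \<phi> t * \<rho> t)) \<le> norm A * (E * (C / b) * pi / (real n / (3 * sqrt (real N))))) at_top"
        using eventually_ge_at_top[of 0] by eventually_elim (intro mult_left_mono bd norm_ge_zero)
    qed simp
    define Q where "Q = exp (of_nat N) * exp ((of_real a - of_nat k) * u) / (2 * of_real pi)"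
    have AQ: "exp ((of_real a - of_nat k) * u) * A = (-1) ^ k * of_real (real n powr (real k - a))"
    proof -
      have "exp ((of_real a - of_nat k) * u) * exp ((of_nat k - of_real a) * lN) = exp ((of_nat k - of_real a) * of_real (ln (real n)))"
        unfolding exp_add[symmetric] ul[symmetric] by (rule arg_cong[where f = exp]) (simp add: algebra_simps)
      also have "\<dots> = of_real (real n powr (real k - a))" using n by (simp add: powr_def exp_of_real[symmetric])
      finally show ?thesis by (simp add: A_def mult_ac)
    qed
    have eN: "exp (of_nat N) * exp (- of_nat N) = (1::complex)" by (simp add: exp_minus)
    have "Q * (2 * of_real pi * mellin_barnes n lam P u - A * of_real c1 * (2 * of_real pi * exp (- of_nat N) / of_nat n))
       = exp (of_nat N) * (cov_deriv ^^ k) (twisted_mellin n lam) u - (exp ((of_real a - of_nat k) * u) * A) * of_real c1 / of_nat n * (exp (of_nat N) * exp (- of_nat N))"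
      unfolding Q_def D by (simp add: field_simps)
    also have "\<dots> = exp (of_nat N) * (cov_deriv ^^ k) (twisted_mellin n lam) u - of_real (leading_const n) * (- of_nat n) ^ k"
    proof -
      have "real n powr (real k - a) = real n powr (- a) * real n ^ k" using n by (simp add: powr_add[symmetric] powr_realpow[symmetric])
      moreover have "(- of_nat n :: complex) ^ k = (-1) ^ k * of_nat n ^ k" by (rule power_minus)
      moreover have "complex_of_real (leading_const n) = of_real c1 * of_real (real n powr (- a)) / of_nat n" by (simp add: c1)
      ultimately show ?thesis unfolding AQ eN by (simp only:) (simp add: mult_ac)
    qed
    finally have "norm (exp (of_nat N) * (cov_deriv ^^ k) (twisted_mellin n lam) u - of_real (leading_const n) * (- of_nat n) ^ k)
      = norm Q * norm (2 * of_real pi * mellin_barnes n lam P u - A * of_real c1 * (2 * of_real pi * exp (- of_nat N) / of_nat n))"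
      by (metis norm_mult)
    also have "\<dots> \<le> norm Q * (norm A * (E * (C / b) * pi / (real n / (3 * sqrt (real N)))))"
      using K by (intro mult_left_mono) auto
    also have "\<dots> = norm (exp ((of_real a - of_nat k) * u) * A) * (exp (real N) * E) * (C / b) * (3 * sqrt (real N)) / (2 * real n)"
      by (simp add: Q_def norm_mult norm_divide field_simps)
    also have "exp (real N) * E = exp 1" by (simp add: E_def exp_minus)
    also have "norm (exp ((of_real a - of_nat k) * u) * A) = real n powr (real k - a)"
      unfolding AQ by (simp add: norm_mult norm_power)
    also have "real n powr (real k - a) * exp 1 * (C / b) * (3 * sqrt (real N)) / (2 * real n)
       \<le> real n powr (real k - a) * exp 1 * (C / (real N / (2 * real n))) * (3 * sqrt (real N)) / (2 * real n)"
      using b2 bR C N0 n by (intro divide_right_mono mult_right_mono mult_left_mono divide_left_mono) auto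
    also have "\<dots> = B * sqrt (real N) / real N" using n N0 by (simp add: B_def field_simps)
    finally show ?thesis by (simp add: u_def)
  qed
  have "(\<lambda>N. B * sqrt (real N) / real N) \<longlonglongrightarrow> 0" by real_asymp
  then have "(\<lambda>N. exp (of_nat N) * (cov_deriv ^^ k) (twisted_mellin n lam) (of_real (ln (real N / real n))) - of_real (leading_const n) * (- of_nat n) ^ k) \<longlonglongrightarrow> 0"
  proof (rule Lim_null_comparison[rotated])
    show "eventually (\<lambda>N. norm (exp (of_nat N) * (cov_deriv ^^ k) (twisted_mellin n lam) (of_real (ln (real N / real n))) - of_real (leading_const n) * (- of_nat n) ^ k) \<le> B * sqrt (real N) / real N) sequentially"
      using eventually_ge_at_top[of "nat \<lceil>2 * real k + 1 + 2 * real n * (R + pole_radius n lam)\<rceil>"]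
      by eventually_elim (rule main, linarith)
  qed
  then show ?thesis by (simp add: LIM_zero_iff)
qed

section \<open>A backward Gronwall inequality\<close>

lemma euler_op_exp:
  assumes f: "f holomorphic_on UNIV"
  shows "euler_op mu k (\<lambda>u. exp (c * u) * f u) = (\<lambda>u. exp (c * u) * euler_op (\<lambda>l. mu l + c) k f u)"
proof (induction k)
  case (Suc k)
  have d: "deriv (\<lambda>u. exp (c * u) * euler_op (\<lambda>l. mu l + c) k f u) u
      = exp (c * u) * deriv (euler_op (\<lambda>l. mu l + c) k f) u + (exp (c * u) * c) * euler_op (\<lambda>l. mu l + c) k f u" for u
    by (rule DERIV_imp_deriv) (auto intro!: derivative_eq_intros entire_deriv holomorphic_euler_op f)
  show ?case by (rule ext) (simp only: euler_op.simps Suc.IH d, simp add: algebra_simps)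
qed simp

lemma euler_op_lincomb:
  assumes f: "f holomorphic_on UNIV" and g: "g holomorphic_on UNIV"
  shows "euler_op mu k (\<lambda>u. a * f u + b * g u) = (\<lambda>u. a * euler_op mu k f u + b * euler_op mu k g u)"
proof (induction k)
  case (Suc k)
  have d: "deriv (\<lambda>u. a * euler_op mu k f u + b * euler_op mu k g u) u
      = a * deriv (euler_op mu k f) u + b * deriv (euler_op mu k g) u" for u
    by (rule DERIV_imp_deriv) (auto intro!: derivative_eq_intros entire_deriv holomorphic_euler_op f g)
  show ?case by (rule ext) (simp only: euler_op.simps Suc.IH d, simp add: algebra_simps)
qed simp

lemma cov_deriv_apply: "cov_deriv w z = deriv w z / cov_proj z"
  by (simp add: cov_deriv_def)

lemma cov_deriv_power_Suc: "(cov_deriv ^^ Suc k) f u = deriv ((cov_deriv ^^ k) f) u / cov_proj u"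
  unfolding funpow.simps o_apply by (rule cov_deriv_apply)

lemma cov_deriv_power_lincomb:
  assumes f: "f holomorphic_on UNIV" and g: "g holomorphic_on UNIV"
  shows "(cov_deriv ^^ k) (\<lambda>u. a * f u + b * g u) = (\<lambda>u. a * (cov_deriv ^^ k) f u + b * (cov_deriv ^^ k) g u)"
proof (induction k)
  case (Suc k)
  have d: "deriv (\<lambda>u. a * (cov_deriv ^^ k) f u + b * (cov_deriv ^^ k) g u) u
      = a * deriv ((cov_deriv ^^ k) f) u + b * deriv ((cov_deriv ^^ k) g) u" for u
    by (rule DERIV_imp_deriv) (auto intro!: derivative_eq_intros entire_deriv holomorphic_cov_deriv_power f g)
  show ?case
  proof
    fix u
    show "(cov_deriv ^^ Suc k) (\<lambda>u. a * f u + b * g u) u = a * (cov_deriv ^^ Suc k) f u + b * (cov_deriv ^^ Suc k) g u"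
      unfolding cov_deriv_power_Suc Suc.IH d by (simp add: add_divide_distrib)
  qed
qed simp

text \<open>The Lyapunov function of the backward Gronwall argument: with the scaled derivatives
  \<open>x\<^sub>j = f\<^bsup>(j)\<^esup> / n\<^bsup>j\<^esup>\<close> the equation is, up to \<open>O(y\<^bsup>-2\<^esup>)\<close>, the linear system
  given by \<open>n\<close> times a unitary matrix.\<close>

definition energy :: "nat \<Rightarrow> (complex \<Rightarrow> complex) \<Rightarrow> complex \<Rightarrow> real" where
  "energy n f u = (\<Sum>j<n. (norm ((cov_deriv ^^ j) f u / of_nat n ^ j))\<^sup>2)"

lemma energy_nonneg: "energy n f u \<ge> 0"
  by (simp add: energy_def sum_nonneg)

lemma norm_le_energy: "n > 0 \<Longrightarrow> (norm (f u))\<^sup>2 \<le> energy n f u"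
  unfolding energy_def using member_le_sum[of 0 "{..<n}" "\<lambda>j. (norm ((cov_deriv ^^ j) f u / of_nat n ^ j))\<^sup>2"] by auto

text \<open>Along the line X_j' = n \<omega> X_(j+1), and the equation gives X_n as X_0 up to sign,
  lower terms and the residual. The lower terms carry |y|^-2 because the coefficient of the (n-1)-st
  derivative vanishes. Summing 2|X_j||X_(j+1)| \<le> |X_j|^2 + |X_(j+1)|^2 cyclically gives the rate
  2n.\<close>

lemma energy_deriv_bound:
  fixes \<omega> y0 :: complex and x :: real
  assumes n: "n \<ge> 2" and mu: "(\<Sum>l=1..n. mu l) = - (of_nat n * (of_nat n - 1) / 2)"
    and f: "f holomorphic_on UNIV"
    and \<omega>: "norm \<omega> = 1"
    and y: "y = y0 + of_real r * \<omega>" "y \<notin> \<real>\<^sub>\<le>\<^sub>0" "norm y \<ge> 1"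
    and err: "norm (euler_op mu n f (Ln y) - (- of_nat n) ^ n * exp (of_nat n * Ln y) * f (Ln y)) \<le> \<epsilon> * norm y ^ n"
  defines "P \<equiv> 2 * real n * (\<Sum>j<n. norm (euler_coeff mu n j)) + real n"
  shows "\<exists>g'. ((\<lambda>r. energy n f (Ln (y0 + of_real r * \<omega>))) has_real_derivative g') (at r) \<and>
     g' \<ge> - (2 * real n + P / (norm y)\<^sup>2) * energy n f (Ln y) - real n * (norm y)\<^sup>2 * \<epsilon>\<^sup>2"
proof -
  define x where "x j r = (cov_deriv ^^ j) f (Ln (y0 + of_real r * \<omega>)) / of_nat n ^ j" for j r
  define X where "X j = x j r" for j
  define X' where "X' j = of_nat n * \<omega> * X (Suc j)" for j
  have y0: "y \<noteq> 0" "norm y > 0" using y(3) by auto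
  have n0: "(of_nat n :: complex) \<noteq> 0" using n by simp
  have ey: "exp (Ln y) = y" using y0 by simp
  have dx: "(x j has_vector_derivative X' j) (at r)" for j
  proof -
    have "((\<lambda>r. y0 + of_real r * \<omega>) has_vector_derivative 0 + of_real 1 * \<omega>) (at r)"
      by (intro has_vector_derivative_add has_vector_derivative_const has_vector_derivative_mult_left has_vector_derivative_of_real) auto
    then have p: "((\<lambda>r. y0 + of_real r * \<omega>) has_vector_derivative \<omega>) (at r)" by simp
    have "((\<lambda>y. (cov_deriv ^^ j) f (Ln y) / of_nat n ^ j) has_field_derivative (deriv ((cov_deriv ^^ j) f) (Ln y) * inverse y) / of_nat n ^ j) (at y)"
      by (intro DERIV_cdivide DERIV_chain2[of "(cov_deriv ^^ j) f"] entire_deriv holomorphic_cov_deriv_power f has_field_derivative_Ln y(2))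
    moreover have "(deriv ((cov_deriv ^^ j) f) (Ln y) * inverse y) / of_nat n ^ j = of_nat n * X (Suc j)"
      using n0 by (simp add: X_def x_def cov_deriv_def cov_proj_def y(1)[symmetric] ey divide_inverse)
    ultimately have "((\<lambda>y. (cov_deriv ^^ j) f (Ln y) / of_nat n ^ j) has_field_derivative of_nat n * X (Suc j)) (at (y0 + of_real r * \<omega>))"
      using y(1) by simp
    from field_vector_diff_chain_at[OF p this] show ?thesis
      by (simp add: x_def[abs_def] o_def X'_def mult_ac)
  qed
  have en: "energy n f (Ln (y0 + of_real r * \<omega>)) = (\<Sum>j<n. (norm (x j r))\<^sup>2)" for r
    by (simp add: energy_def x_def)
  have dn: "((\<lambda>r. (norm (x j r))\<^sup>2) has_real_derivative 2 * (X j \<bullet> X' j)) (at r)" for j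
  proof -
    have "((\<lambda>r. x j r \<bullet> x j r) has_derivative (\<lambda>h. x j r \<bullet> (h *\<^sub>R X' j) + (h *\<^sub>R X' j) \<bullet> x j r)) (at r)"
      using dx[of j] unfolding has_vector_derivative_def by (intro has_derivative_inner)
    moreover have "(\<lambda>h. x j r \<bullet> (h *\<^sub>R X' j) + (h *\<^sub>R X' j) \<bullet> x j r) = (*) (2 * (X j \<bullet> X' j))"
      by (auto simp: fun_eq_iff inner_commute X_def)
    ultimately show ?thesis unfolding power2_norm_eq_inner has_field_derivative_def by simp
  qed
  define g' where "g' = (\<Sum>j<n. 2 * (X j \<bullet> X' j))"
  have dg: "((\<lambda>r. energy n f (Ln (y0 + of_real r * \<omega>))) has_real_derivative g') (at r)"
    unfolding en g'_def by (intro DERIV_sum dn)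
  define e where "e = energy n f (Ln y)"
  have e: "e = (\<Sum>j<n. (norm (X j))\<^sup>2)" by (simp add: e_def y(1) en X_def)
  have e0: "e \<ge> 0" by (simp add: e_def energy_nonneg)
  have Xe: "norm (X j) \<le> sqrt e" if "j < n" for j
  proof (rule real_le_rsqrt)
    show "(norm (X j))\<^sup>2 \<le> e" unfolding e using that by (intro member_le_sum) auto
  qed
  define B where "B = (\<Sum>j<n. norm (euler_coeff mu n j))"
  have Xn: "norm (X n) \<le> norm (X 0) + (B / (norm y)\<^sup>2 * sqrt e + \<epsilon>)"
  proof -
    define c where "c j = euler_coeff mu n j" for j
    define D where "D j = (cov_deriv ^^ j) f (Ln y)" for j
    have DX: "D j = of_nat n ^ j * X j" for j using n0 by (simp add: D_def X_def x_def y(1))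
    obtain m where m: "n = Suc (Suc m)" using n by (metis add_2_eq_Suc le_Suc_ex)
    \<comment> \<open>Here 0 + 1 + ... + (n - 1) cancels against the prescribed sum of the
      indices.\<close>
    have sub: "c (Suc m) = 0"
    proof -
      have "c (Suc m) = (\<Sum>i\<le>Suc m. of_nat i + mu (Suc i))" unfolding c_def m by (rule euler_coeff_subtop)
      also have "\<dots> = (\<Sum>i<n. of_nat i) + (\<Sum>i<n. mu (Suc i))" unfolding m by (simp add: sum.distrib lessThan_Suc_atMost)
      also have "(\<Sum>i<n. mu (Suc i)) = (\<Sum>l=1..n. mu l)"
        by (simp add: sum.shift_bounds_Suc_ivl[symmetric] atLeast0LessThan[symmetric] atLeastLessThanSuc_atLeastAtMost)
      finally show ?thesis unfolding mu sum_of_nat_lessThan by simp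
    qed
    have "euler_op mu n f (Ln y) = (\<Sum>j\<le>n. c j * y ^ j * D j)"
      unfolding euler_op_eq[OF f] ey c_def D_def ..
    also have "\<dots> = (\<Sum>j\<le>m. c j * y ^ j * D j) + y ^ n * D n"
      unfolding m using sub euler_coeff_top[of mu n] by (simp add: c_def m)
    finally have op: "euler_op mu n f (Ln y) = (\<Sum>j\<le>m. c j * y ^ j * D j) + y ^ n * D n" .
    have tri: "norm (a + b - c) \<le> norm a + norm b + norm c" for a b c :: complex
      using norm_triangle_ineq4[of "a + b" c] norm_triangle_ineq[of a b] by linarith
    define er where "er = euler_op mu n f (Ln y) - (- of_nat n) ^ n * exp (of_nat n * Ln y) * f (Ln y)"
    have "y ^ n * D n = (- of_nat n) ^ n * y ^ n * D 0 + er - (\<Sum>j\<le>m. c j * y ^ j * D j)"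
      unfolding er_def op exp_of_nat_mult ey by (simp add: D_def)
    then have "of_nat n ^ n * y ^ n * X n = (- of_nat n) ^ n * y ^ n * X 0 + er - (\<Sum>j\<le>m. c j * y ^ j * (of_nat n ^ j * X j))"
      unfolding DX by (simp add: mult_ac)
    then have "norm (of_nat n ^ n * y ^ n * X n) \<le> norm ((- of_nat n) ^ n * y ^ n * X 0) + norm er + norm (\<Sum>j\<le>m. c j * y ^ j * (of_nat n ^ j * X j))"
      by (simp only: tri)
    then have 1: "real n ^ n * norm y ^ n * norm (X n) \<le> real n ^ n * norm y ^ n * norm (X 0) + norm er + norm (\<Sum>j\<le>m. c j * y ^ j * (of_nat n ^ j * X j))"
      by (simp add: norm_mult norm_power)
    have "norm (\<Sum>j\<le>m. c j * y ^ j * (of_nat n ^ j * X j)) \<le> (\<Sum>j\<le>m. norm (c j) * (real n ^ n * (norm y ^ n / (norm y)\<^sup>2) * sqrt e))"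
    proof (rule sum_norm_le)
      fix j assume j: "j \<in> {..m}"
      have "norm y ^ j \<le> norm y ^ m" using j y(3) by (intro power_increasing) auto
      also have "norm y ^ m = norm y ^ n / (norm y)\<^sup>2" using y0 by (simp add: m power2_eq_square)
      finally have a: "norm y ^ j \<le> norm y ^ n / (norm y)\<^sup>2" .
      have b: "real n ^ j \<le> real n ^ n" using j n by (intro power_increasing) (auto simp: m)
      have "norm (c j * y ^ j * (of_nat n ^ j * X j)) = norm (c j) * (real n ^ j * norm y ^ j * norm (X j))"
        by (simp add: norm_mult norm_power)
      also have "\<dots> \<le> norm (c j) * (real n ^ n * (norm y ^ n / (norm y)\<^sup>2) * sqrt e)"
        using a b Xe[of j] j by (intro mult_left_mono mult_mono) (auto simp: m)
      finally show "norm (c j * y ^ j * (of_nat n ^ j * X j)) \<le> norm (c j) * (real n ^ n * (norm y ^ n / (norm y)\<^sup>2) * sqrt e)" .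
    qed
    also have "\<dots> = (\<Sum>j\<le>m. norm (c j)) * (real n ^ n * (norm y ^ n / (norm y)\<^sup>2) * sqrt e)"
      by (simp only: sum_distrib_right)
    also have "\<dots> \<le> B * (real n ^ n * (norm y ^ n / (norm y)\<^sup>2) * sqrt e)"
      unfolding B_def c_def using e0 by (intro mult_right_mono sum_mono2) (auto simp: m)
    finally have 2: "norm (\<Sum>j\<le>m. c j * y ^ j * (of_nat n ^ j * X j)) \<le> real n ^ n * norm y ^ n * (B / (norm y)\<^sup>2 * sqrt e)"
      by (simp add: mult_ac)
    have \<epsilon>0: "\<epsilon> * norm y ^ n \<ge> 0" using err norm_ge_zero order_trans by blast
    have "norm er \<le> 1 * (\<epsilon> * norm y ^ n)" using err by (simp add: er_def)
    also have "\<dots> \<le> real n ^ n * (\<epsilon> * norm y ^ n)" using \<epsilon>0 n by (intro mult_right_mono) (auto intro: one_le_power)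
    finally have "real n ^ n * norm y ^ n * norm (X n) \<le> real n ^ n * norm y ^ n * (norm (X 0) + (B / (norm y)\<^sup>2 * sqrt e + \<epsilon>))"
      using 1 2 by (simp add: algebra_simps)
    moreover have "real n ^ n * norm y ^ n > 0" using n y0 by simp
    ultimately show ?thesis by (rule mult_left_le_imp_le)
  qed
  have \<epsilon>0: "\<epsilon> \<ge> 0"
  proof -
    have "0 \<le> \<epsilon> * norm y ^ n" using err norm_ge_zero order_trans by blast
    moreover have "norm y ^ n > 0" using y0 by simp
    ultimately show ?thesis by (meson mult_neg_pos not_le)
  qed
  obtain m where m: "n = Suc m" using n by (cases n) auto
  \<comment> \<open>The cyclic successor: at j = m = n - 1 the norm of X_n is replaced by that of
    X_0, and the defect \<open>t\<close> is charged to this index alone.\<close>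
  define Z where "Z j = (if j = m then norm (X 0) else norm (X (Suc j)))" for j
  define t where "t = B / (norm y)\<^sup>2 * sqrt e + \<epsilon>"
  have t0: "t \<ge> 0" unfolding t_def B_def using e0 \<epsilon>0 by (intro add_nonneg_nonneg mult_nonneg_nonneg divide_nonneg_nonneg sum_nonneg) auto
  have inner_lb: "2 * (X j \<bullet> X' j) \<ge> - (real n * ((norm (X j))\<^sup>2 + (Z j)\<^sup>2)) - (if j = m then 2 * real n * norm (X m) * t else 0)" if "j < n" for j
  proof -
    have "- (X j \<bullet> X' j) \<le> norm (X j) * norm (X' j)" using norm_cauchy_schwarz[of "- X j" "X' j"] by simp
    also have "norm (X j) * norm (X' j) = norm (X j) * (real n * norm (X (Suc j)))" by (simp add: X'_def norm_mult \<omega>)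
    also have "\<dots> \<le> norm (X j) * (real n * (Z j + (if j = m then t else 0)))"
    proof (intro mult_left_mono)
      show "norm (X (Suc j)) \<le> Z j + (if j = m then t else 0)" using Xn by (simp add: Z_def t_def m)
    qed auto
    finally have "- (2 * (X j \<bullet> X' j)) \<le> 2 * (norm (X j) * (real n * (Z j + (if j = m then t else 0))))"
      by linarith
    also have "\<dots> = real n * (2 * norm (X j) * Z j) + (if j = m then 2 * real n * norm (X m) * t else 0)"
      by (simp add: algebra_simps)
    finally have 1: "- (2 * (X j \<bullet> X' j)) \<le> real n * (2 * norm (X j) * Z j) + (if j = m then 2 * real n * norm (X m) * t else 0)" .
    have "real n * (2 * norm (X j) * Z j) \<le> real n * ((norm (X j))\<^sup>2 + (Z j)\<^sup>2)"
      by (intro mult_left_mono sum_squares_bound) auto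
    then show ?thesis using 1 by linarith
  qed
  have sumZ: "(\<Sum>j<n. (Z j)\<^sup>2) = e"
  proof -
    have "(\<Sum>j<n. (Z j)\<^sup>2) = (\<Sum>j<m. (norm (X (Suc j)))\<^sup>2) + (norm (X 0))\<^sup>2"
      by (simp add: m Z_def)
    also have "\<dots> = (\<Sum>j<Suc m. (norm (X j))\<^sup>2)" by (subst sum.lessThan_Suc_shift) simp
    finally show ?thesis by (simp add: e m)
  qed
  have "g' \<ge> (\<Sum>j<n. - (real n * ((norm (X j))\<^sup>2 + (Z j)\<^sup>2)) - (if j = m then 2 * real n * norm (X m) * t else 0))"
    unfolding g'_def using inner_lb by (intro sum_mono) auto
  also have "(\<Sum>j<n. - (real n * ((norm (X j))\<^sup>2 + (Z j)\<^sup>2)) - (if j = m then 2 * real n * norm (X m) * t else 0))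
     = - (real n * ((\<Sum>j<n. (norm (X j))\<^sup>2) + (\<Sum>j<n. (Z j)\<^sup>2))) - 2 * real n * norm (X m) * t"
    by (simp add: sum_subtractf sum_negf sum_distrib_left[symmetric] sum.distrib m)
  also have "\<dots> = - (2 * real n * e) - 2 * real n * norm (X m) * t" unfolding sumZ e[symmetric] by simp
  finally have g1: "g' \<ge> - (2 * real n * e) - 2 * real n * norm (X m) * t" .
  have "2 * real n * norm (X m) * t \<le> 2 * real n * sqrt e * t"
    using Xe[of m] t0 by (intro mult_right_mono mult_left_mono) (auto simp: m)
  also have "\<dots> = 2 * real n * B / (norm y)\<^sup>2 * (sqrt e * sqrt e) + real n * (2 * sqrt e * \<epsilon>)"
    by (simp add: t_def algebra_simps)
  finally have 3: "2 * real n * norm (X m) * t \<le> 2 * real n * B / (norm y)\<^sup>2 * (sqrt e * sqrt e) + real n * (2 * sqrt e * \<epsilon>)" .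
  \<comment> \<open>The weight |y| splits the mixed term so that the energy receives the integrable
    factor |y|^-2 and the residual the factor |y|^2.\<close>
  have "2 * (sqrt e / norm y) * (norm y * \<epsilon>) \<le> (sqrt e / norm y)\<^sup>2 + (norm y * \<epsilon>)\<^sup>2" by (rule sum_squares_bound)
  moreover have "2 * (sqrt e / norm y) * (norm y * \<epsilon>) = 2 * sqrt e * \<epsilon>" using y0 by simp
  ultimately have "2 * sqrt e * \<epsilon> \<le> e / (norm y)\<^sup>2 + (norm y)\<^sup>2 * \<epsilon>\<^sup>2"
    using e0 by (simp add: power_divide power_mult_distrib)
  then have "real n * (2 * sqrt e * \<epsilon>) \<le> real n * (e / (norm y)\<^sup>2 + (norm y)\<^sup>2 * \<epsilon>\<^sup>2)"
    by (rule mult_left_mono) simp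
  moreover have "sqrt e * sqrt e = e" using e0 by simp
  ultimately have "2 * real n * norm (X m) * t \<le> 2 * real n * B / (norm y)\<^sup>2 * e + real n * (e / (norm y)\<^sup>2 + (norm y)\<^sup>2 * \<epsilon>\<^sup>2)"
    using 3 by simp
  also have "\<dots> = P / (norm y)\<^sup>2 * e + real n * (norm y)\<^sup>2 * \<epsilon>\<^sup>2"
    unfolding P_def B_def by (simp add: algebra_simps add_divide_distrib)
  finally have "g' \<ge> - (2 * real n + P / (norm y)\<^sup>2) * e - real n * (norm y)\<^sup>2 * \<epsilon>\<^sup>2"
    using g1 by (simp add: algebra_simps)
  then show ?thesis using dg unfolding e_def by blast
qed

text \<open>With the integrating factor \<open>m\<close> and the correction c/(\<rho> + r), which
  absorbs the residual, \<open>h\<close> is nondecreasing. Since |y| \<ge> (\<rho> + r)/2, the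
  perturbation P/|y|^2 is at most 4P/(\<rho> + r)^2, of total integral at most 4P/\<rho> \<le> 2P;
  hence the factor e^(2P).\<close>

lemma energy_gronwall:
  fixes \<omega> y0 :: complex and L :: real
  assumes n: "n \<ge> 2" and mu: "(\<Sum>l=1..n. mu l) = - (of_nat n * (of_nat n - 1) / 2)"
    and f: "f holomorphic_on UNIV" and \<omega>: "norm \<omega> = 1" and L: "L \<ge> 0"
    and \<rho>: "\<rho> \<ge> 2"
    and path: "\<And>r. 0 \<le> r \<Longrightarrow> r \<le> L \<Longrightarrow> y0 + of_real r * \<omega> \<notin> \<real>\<^sub>\<le>\<^sub>0"
      "\<And>r. 0 \<le> r \<Longrightarrow> r \<le> L \<Longrightarrow> norm (y0 + of_real r * \<omega>) \<ge> (\<rho> + r) / 2"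
    and err: "\<And>r. 0 \<le> r \<Longrightarrow> r \<le> L \<Longrightarrow>
      norm (euler_op mu n f (Ln (y0 + of_real r * \<omega>)) - (- of_nat n) ^ n * exp (of_nat n * Ln (y0 + of_real r * \<omega>)) * f (Ln (y0 + of_real r * \<omega>)))
        \<le> \<epsilon> r * norm (y0 + of_real r * \<omega>) ^ n"
    and \<epsilon>: "\<And>r. 0 \<le> r \<Longrightarrow> r \<le> L \<Longrightarrow> real n * (norm (y0 + of_real r * \<omega>))\<^sup>2 * (\<epsilon> r)\<^sup>2 * exp (2 * real n * r) \<le> c / (\<rho> + r)\<^sup>2"
    and c: "c \<ge> 0"
  defines "P \<equiv> 2 * real n * (\<Sum>j<n. norm (euler_coeff mu n j)) + real n"
  shows "energy n f (Ln y0) \<le> exp (2 * P) * (exp (2 * real n * L) * energy n f (Ln (y0 + of_real L * \<omega>)) + c)"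
proof -
  define g where "g r = energy n f (Ln (y0 + of_real r * \<omega>))" for r
  define m where "m r = exp (2 * real n * r - 4 * P / (\<rho> + r))" for r
  define h where "h r = g r * m r - c / (\<rho> + r)" for r
  have P0: "P \<ge> 0" by (simp add: P_def sum_nonneg)
  have "h 0 \<le> h L"
  proof (rule DERIV_nonneg_imp_nondecreasing[OF L])
    fix r assume r: "0 \<le> r" "r \<le> L"
    define y where "y = y0 + of_real r * \<omega>"
    have ny: "norm y \<ge> (\<rho> + r) / 2" unfolding y_def by (rule path(2)[OF r])
    moreover have "1 \<le> (\<rho> + r) / 2" using \<rho> r by simp
    ultimately have ny1: "norm y \<ge> 1" by simp
    obtain g' where g': "(g has_real_derivative g') (at r)"
      and lb: "g' \<ge> - (2 * real n + P / (norm y)\<^sup>2) * g r - real n * (norm y)\<^sup>2 * (\<epsilon> r)\<^sup>2"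
      using energy_deriv_bound[OF n mu f \<omega> y_def path(1)[OF r, folded y_def] ny1 err[OF r, folded y_def]]
      unfolding g_def[abs_def] P_def y_def by blast
    have pos: "\<rho> + r > 0" using \<rho> r by simp
    have dm: "(m has_real_derivative m r * (2 * real n + 4 * P / (\<rho> + r)\<^sup>2)) (at r)"
      unfolding m_def using pos by (auto intro!: derivative_eq_intros simp: power2_eq_square)
    have "(h has_real_derivative (g' * m r + g r * (m r * (2 * real n + 4 * P / (\<rho> + r)\<^sup>2)) + c / (\<rho> + r)\<^sup>2)) (at r)"
      unfolding h_def using pos by (auto intro!: derivative_eq_intros g' dm simp: power2_eq_square)
    moreover have "g' * m r + g r * (m r * (2 * real n + 4 * P / (\<rho> + r)\<^sup>2)) + c / (\<rho> + r)\<^sup>2 \<ge> 0"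
    proof -
      have m0: "m r > 0" by (simp add: m_def)
      have g0: "g r \<ge> 0" by (simp add: g_def energy_nonneg)
      have "((\<rho> + r) / 2)\<^sup>2 \<le> (norm y)\<^sup>2" using ny pos by (intro power_mono) auto
      then have "P / (norm y)\<^sup>2 \<le> P / ((\<rho> + r) / 2)\<^sup>2" using P0 pos by (intro divide_left_mono) (auto intro!: mult_pos_pos)
      then have "P / (norm y)\<^sup>2 \<le> 4 * P / (\<rho> + r)\<^sup>2" by (simp add: power_divide mult.commute)
      then have "(2 * real n + P / (norm y)\<^sup>2) * g r \<le> (2 * real n + 4 * P / (\<rho> + r)\<^sup>2) * g r" using g0 by (intro mult_right_mono) auto
      then have "g' + g r * (2 * real n + 4 * P / (\<rho> + r)\<^sup>2) \<ge> - (real n * (norm y)\<^sup>2 * (\<epsilon> r)\<^sup>2)" using lb by (simp add: algebra_simps)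
      then have "(g' + g r * (2 * real n + 4 * P / (\<rho> + r)\<^sup>2)) * m r \<ge> - (real n * (norm y)\<^sup>2 * (\<epsilon> r)\<^sup>2) * m r"
        using m0 by (intro mult_right_mono) auto
      moreover have "real n * (norm y)\<^sup>2 * (\<epsilon> r)\<^sup>2 * m r \<le> real n * (norm y)\<^sup>2 * (\<epsilon> r)\<^sup>2 * exp (2 * real n * r)"
        unfolding m_def using P0 pos by (intro mult_left_mono) auto
      ultimately show ?thesis using \<epsilon>[OF r] unfolding y_def[symmetric] by (simp add: algebra_simps)
    qed
    ultimately show "\<exists>d. (h has_real_derivative d) (at r) \<and> d \<ge> 0" by blast
  qed
  moreover have "c / (\<rho> + L) \<ge> 0" "c / \<rho> \<le> c" using c \<rho> L by (auto simp: divide_le_eq mult_le_cancel_left1)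
  ultimately have "g 0 * m 0 \<le> g L * m L + c" by (simp add: h_def)
  also have "g L * m L \<le> g L * exp (2 * real n * L)"
    unfolding m_def using P0 \<rho> L by (intro mult_left_mono) (auto simp: g_def energy_nonneg)
  finally have 1: "g 0 * m 0 \<le> g L * exp (2 * real n * L) + c" by simp
  have "exp (2 * P) * m 0 \<ge> 1"
  proof -
    have "4 * P / \<rho> \<le> 4 * P / 2" using P0 \<rho> by (intro divide_left_mono) auto
    then show ?thesis by (simp add: m_def exp_add[symmetric])
  qed
  then have "g 0 * 1 \<le> g 0 * (exp (2 * P) * m 0)" by (intro mult_left_mono) (auto simp: g_def energy_nonneg)
  also have "\<dots> = exp (2 * P) * (g 0 * m 0)" by simp
  also have "\<dots> \<le> exp (2 * P) * (g L * exp (2 * real n * L) + c)" using 1 by (intro mult_left_mono) auto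
  finally show ?thesis by (simp add: g_def mult_ac)
qed

section \<open>The asymptotic expansion\<close>

definition exp_monomial :: "nat \<Rightarrow> complex \<Rightarrow> complex \<Rightarrow> complex" where
  "exp_monomial n c u = exp (- of_nat n * exp u) * exp (c * u)"

lemma exp_monomial_deriv:
  "(exp_monomial n c has_field_derivative - of_nat n * exp_monomial n (c + 1) u + c * exp_monomial n c u) (at u)"
  unfolding exp_monomial_def[abs_def]
  by (auto intro!: derivative_eq_intros simp: exp_add algebra_simps)

lemma holomorphic_exp_monomial: "exp_monomial n c holomorphic_on A"
  unfolding exp_monomial_def[abs_def] by (intro holomorphic_intros)

text \<open>The analytic version of the computation behind \<open>laurent_coeff\<close>, with w =
  -ny and y = e^u.\<close>

lemma exp_monomial_euler_op:
  "euler_op mu k (exp_monomial n (- m)) u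
     = (\<Sum>j\<le>k. (- of_nat n) ^ (k - j) * laurent_coeff mu k j m * exp_monomial n (of_nat k - of_nat j - m) u)"
proof (induction k arbitrary: u)
  case (Suc k)
  define z where "z = - (of_nat n :: complex)"
  define E where "E = exp_monomial n"
  define L where "L = laurent_coeff mu"
  have IH: "euler_op mu k (E (- m)) = (\<lambda>u. \<Sum>j\<le>k. z ^ (k - j) * L k j m * E (of_nat k - of_nat j - m) u)"
    using Suc by (auto simp: z_def E_def L_def)
  have "deriv (euler_op mu k (E (- m))) u = (\<Sum>j\<le>k. z ^ (k - j) * L k j m * (z * E (of_nat k - of_nat j - m + 1) u + (of_nat k - of_nat j - m) * E (of_nat k - of_nat j - m) u))"
    unfolding IH unfolding z_def E_def by (intro DERIV_imp_deriv DERIV_sum DERIV_cmult exp_monomial_deriv)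
  then have "euler_op mu (Suc k) (E (- m)) u = (\<Sum>j\<le>k. z ^ (k - j) * L k j m * (z * E (of_nat k - of_nat j - m + 1) u + (of_nat k - of_nat j - m) * E (of_nat k - of_nat j - m) u))
     + mu (Suc k) * (\<Sum>j\<le>k. z ^ (k - j) * L k j m * E (of_nat k - of_nat j - m) u)"
    unfolding euler_op.simps by (simp only: IH)
  also have "\<dots> = (\<Sum>j\<le>k. z ^ (Suc k - j) * L k j m * E (of_nat (Suc k) - of_nat j - m) u)
     + (\<Sum>j\<le>k. z ^ (k - j) * ((of_nat k - of_nat j - m + mu (Suc k)) * L k j m) * E (of_nat k - of_nat j - m) u)"
    unfolding sum_distrib_left sum.distrib[symmetric]
  proof (intro sum.cong refl)
    fix j assume "j \<in> {..k}"
    then have a: "z ^ (Suc k - j) = z * z ^ (k - j)" by (simp add: Suc_diff_le)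
    have b: "of_nat (Suc k) - of_nat j - m = of_nat k - of_nat j - m + (1 :: complex)" by simp
    show "z ^ (k - j) * L k j m * (z * E (of_nat k - of_nat j - m + 1) u + (of_nat k - of_nat j - m) * E (of_nat k - of_nat j - m) u) + mu (Suc k) * (z ^ (k - j) * L k j m * E (of_nat k - of_nat j - m) u)
      = z ^ (Suc k - j) * L k j m * E (of_nat (Suc k) - of_nat j - m) u + z ^ (k - j) * ((of_nat k - of_nat j - m + mu (Suc k)) * L k j m) * E (of_nat k - of_nat j - m) u"
      unfolding a b by (simp only: distrib_left distrib_right mult_ac add_ac)
  qed
  also have "(\<Sum>j\<le>k. z ^ (Suc k - j) * L k j m * E (of_nat (Suc k) - of_nat j - m) u) = (\<Sum>j\<le>Suc k. z ^ (Suc k - j) * L k j m * E (of_nat (Suc k) - of_nat j - m) u)"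
    by (simp add: L_def laurent_coeff_eq_0)
  also have "(\<Sum>j\<le>k. z ^ (k - j) * ((of_nat k - of_nat j - m + mu (Suc k)) * L k j m) * E (of_nat k - of_nat j - m) u)
     = (\<Sum>j\<le>Suc k. z ^ (Suc k - j) * (if j = 0 then 0 else (of_nat k - of_nat (j - 1) - m + mu (Suc k)) * L k (j - 1) m) * E (of_nat (Suc k) - of_nat j - m) u)"
    by (subst sum.atMost_Suc_shift) simp
  finally have "euler_op mu (Suc k) (E (- m)) u = (\<Sum>j\<le>Suc k. z ^ (Suc k - j) * L k j m * E (of_nat (Suc k) - of_nat j - m) u)
    + (\<Sum>j\<le>Suc k. z ^ (Suc k - j) * (if j = 0 then 0 else (of_nat k - of_nat (j - 1) - m + mu (Suc k)) * L k (j - 1) m) * E (of_nat (Suc k) - of_nat j - m) u)" .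
  then show ?case unfolding sum.distrib[symmetric] L_def laurent_coeff.simps(2) E_def z_def
    by (simp only: distrib_left distrib_right)
qed simp

definition partial_solution :: "nat \<Rightarrow> (nat \<Rightarrow> complex) \<Rightarrow> nat \<Rightarrow> complex \<Rightarrow> complex" where
  "partial_solution n mu M u = (\<Sum>m<M. formal_beta n mu m / (- of_nat n) ^ m * exp_monomial n (- of_nat m) u)"

lemma partial_solution_Suc:
  "partial_solution n mu (Suc M) = (\<lambda>u. 1 * partial_solution n mu M u + formal_beta n mu M / (- of_nat n) ^ M * exp_monomial n (- of_nat M) u)"
  by (auto simp: partial_solution_def)

lemma holomorphic_partial_solution: "partial_solution n mu M holomorphic_on A"
  unfolding partial_solution_def[abs_def] by (intro holomorphic_intros holomorphic_exp_monomial)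

lemma euler_op_partial_solution:
  "euler_op mu k (partial_solution n mu' M) u = (\<Sum>m<M. formal_beta n mu' m / (- of_nat n) ^ m * euler_op mu k (exp_monomial n (- of_nat m)) u)"
proof (induction M arbitrary: u)
  case 0
  have "euler_op mu k (\<lambda>_. 0) = (\<lambda>_. 0)" by (induction k) auto
  then show ?case by (simp add: partial_solution_def[abs_def])
next
  case (Suc M)
  show ?case
    unfolding partial_solution_Suc euler_op_lincomb[OF holomorphic_partial_solution holomorphic_exp_monomial] Suc.IH by simp
qed

lemma norm_exp_monomial: "norm (exp_monomial n (of_int q) u) = norm (exp (- of_nat n * exp u)) * norm (exp u) powi q"
  unfolding exp_monomial_def norm_mult by (simp add: exp_power_int[symmetric] norm_power_int)

text \<open>Sorted by N = m + j, the sums with N \<le> M are complete and vanish by the recursion.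
  The surviving pairs have m + j > M, so for |y| \<ge> 1 each is at most of order |y|^(n-M-1) times
  the exponential.\<close>

lemma partial_solution_residual:
  assumes n: "n > 0" and mu: "(\<Sum>l=1..n. mu l) = - (of_nat n * (of_nat n - 1) / 2)"
  shows "\<exists>C\<ge>0. \<forall>u. norm (exp u) \<ge> 1 \<longrightarrow>
    norm (euler_op mu n (partial_solution n mu M) u - (- of_nat n) ^ n * exp (of_nat n * u) * partial_solution n mu M u)
      \<le> C * norm (exp (- of_nat n * exp u)) * norm (exp u) ^ n / norm (exp u) ^ Suc M"
proof -
  define z where "z = - (of_nat n :: complex)"
  have z: "z \<noteq> 0" using n by (simp add: z_def)
  define be where "be m = formal_beta n mu m / z ^ m" for m
  define K where "K m j = be m * (z ^ (n - j) * laurent_coeff mu n j (of_nat m))" for m j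
  define C where "C = (\<Sum>m<M. \<Sum>j=1..n. norm (K m j))"
  have "norm (euler_op mu n (partial_solution n mu M) u - z ^ n * exp (of_nat n * u) * partial_solution n mu M u)
      \<le> C * norm (exp (- of_nat n * exp u)) * norm (exp u) ^ n / norm (exp u) ^ Suc M" if u: "norm (exp u) \<ge> 1" for u
  proof -
    define E where "E c = exp_monomial n c u" for c
    define T where "T m j = K m j * E (of_nat n - of_nat j - of_nat m)" for m j
    have shift: "exp (of_nat n * u) * E c = E (of_nat n + c)" for c
      by (simp add: E_def exp_monomial_def exp_add algebra_simps)
    have "euler_op mu n (partial_solution n mu M) u - z ^ n * exp (of_nat n * u) * partial_solution n mu M u
       = (\<Sum>m<M. (\<Sum>j\<le>n. T m j) - T m 0)"
    proof -
      have "euler_op mu n (partial_solution n mu M) u = (\<Sum>m<M. \<Sum>j\<le>n. T m j)"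
        unfolding euler_op_partial_solution exp_monomial_euler_op T_def K_def be_def z_def E_def
        by (simp add: sum_distrib_left mult_ac)
      moreover have "z ^ n * exp (of_nat n * u) * partial_solution n mu M u = (\<Sum>m<M. T m 0)"
        unfolding partial_solution_def sum_distrib_left
      proof (intro sum.cong refl)
        fix m
        have "z ^ n * exp (of_nat n * u) * (formal_beta n mu m / (- of_nat n) ^ m * exp_monomial n (- of_nat m) u)
          = be m * z ^ n * (exp (of_nat n * u) * E (- of_nat m))" by (simp add: be_def z_def E_def mult_ac)
        then show "z ^ n * exp (of_nat n * u) * (formal_beta n mu m / (- of_nat n) ^ m * exp_monomial n (- of_nat m) u) = T m 0"
          unfolding shift by (simp add: T_def K_def laurent_coeff_0)
      qed
      ultimately show ?thesis by (simp add: sum_subtractf)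
    qed
    also have "\<dots> = (\<Sum>m<M. \<Sum>j=1..n. T m j)"
    proof (intro sum.cong refl)
      fix m
      have "{..n} = insert 0 {1..n}" by auto
      then show "(\<Sum>j\<le>n. T m j) - T m 0 = (\<Sum>j=1..n. T m j)" by simp
    qed
    also have "\<dots> = (\<Sum>(m, j)\<in>{..<M} \<times> {1..n}. T m j)" by (simp add: sum.cartesian_product)
    also have "\<dots> = (\<Sum>(m, j)\<in>{p\<in>{..<M} \<times> {1..n}. fst p + snd p > M}. T m j) + (\<Sum>(m, j)\<in>{p\<in>{..<M} \<times> {1..n}. fst p + snd p \<le> M}. T m j)"
      by (subst sum.union_disjoint[symmetric]) (auto intro!: sum.cong)
    also have "(\<Sum>(m, j)\<in>{p\<in>{..<M} \<times> {1..n}. fst p + snd p \<le> M}. T m j) = 0"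
    proof -
      have "(\<Sum>(m, j)\<in>{p\<in>{..<M} \<times> {1..n}. fst p + snd p \<le> M}. T m j) = (\<Sum>(N, j)\<in>(SIGMA N:{1..M}. {1..min n N}). T (N - j) j)"
        by (rule sum.reindex_bij_witness[where i = "\<lambda>(N, j). (N - j, j)" and j = "\<lambda>(m, j). (m + j, j)"]) auto
      also have "\<dots> = (\<Sum>N=1..M. \<Sum>j=1..min n N. T (N - j) j)" by (simp add: sum.Sigma)
      also have "\<dots> = (\<Sum>N=1..M. 0)"
      proof (intro sum.cong refl)
        fix N assume "N \<in> {1..M}"
        then have N: "N > 0" by simp
        have "(\<Sum>j=1..min n N. T (N - j) j) = (\<Sum>j=1..min n N. z ^ n / z ^ N * E (of_nat n - of_nat N) * (laurent_coeff mu n j (of_nat (N - j)) * formal_beta n mu (N - j)))"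
        proof (intro sum.cong refl)
          fix j assume j: "j \<in> {1..min n N}"
          have "z ^ n = z ^ (n - j) * z ^ j" "z ^ N = z ^ (N - j) * z ^ j" using j by (auto simp: power_add[symmetric])
          moreover have "of_nat n - of_nat j - of_nat (N - j) = (of_nat n - of_nat N :: complex)" using j by (simp add: of_nat_diff)
          then have "E (of_nat n - of_nat j - of_nat (N - j)) = E (of_nat n - of_nat N)" by (rule arg_cong)
          ultimately show "T (N - j) j = z ^ n / z ^ N * E (of_nat n - of_nat N) * (laurent_coeff mu n j (of_nat (N - j)) * formal_beta n mu (N - j))"
            using z by (simp add: T_def K_def be_def)
        qed
        then show "(\<Sum>j=1..min n N. T (N - j) j) = 0"
          unfolding sum_distrib_left[symmetric] formal_beta_recursion[OF n mu N] by simp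
      qed
      finally show ?thesis by simp
    qed
    finally have e: "euler_op mu n (partial_solution n mu M) u - z ^ n * exp (of_nat n * u) * partial_solution n mu M u
      = (\<Sum>(m, j)\<in>{p\<in>{..<M} \<times> {1..n}. fst p + snd p > M}. T m j)" by simp
    define W where "W = norm (exp (- of_nat n * exp u)) * norm (exp u) ^ n / norm (exp u) ^ Suc M"
    have W0: "W \<ge> 0" by (simp add: W_def)
    have "norm (\<Sum>(m, j)\<in>{p\<in>{..<M} \<times> {1..n}. fst p + snd p > M}. T m j) \<le> (\<Sum>(m, j)\<in>{p\<in>{..<M} \<times> {1..n}. fst p + snd p > M}. norm (K m j) * W)"
    proof (rule sum_norm_le)
      fix p assume "p \<in> {p\<in>{..<M} \<times> {1..n}. fst p + snd p > M}"
      then obtain m j where p: "p = (m, j)" "m < M" "1 \<le> j" "j \<le> n" "m + j > M" by auto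
      have "of_nat n - of_nat j - of_nat m = (of_int (int n - int (m + j)) :: complex)" by simp
      then have "norm (E (of_nat n - of_nat j - of_nat m)) = norm (exp (- of_nat n * exp u)) * norm (exp u) powi (int n - int (m + j))"
        unfolding E_def by (simp only: norm_exp_monomial)
      also have "norm (exp u) powi (int n - int (m + j)) \<le> norm (exp u) powi (int n - int (Suc M))"
        using u p by (intro power_int_increasing) auto
      also have "norm (exp u) powi (int n - int (Suc M)) = norm (exp u) ^ n / norm (exp u) ^ Suc M"
        by (subst power_int_diff) (simp, simp only: power_int_of_nat)
      finally have "norm (E (of_nat n - of_nat j - of_nat m)) \<le> W" by (simp add: W_def mult_left_mono)
      then show "norm (case p of (m, j) \<Rightarrow> T m j) \<le> (case p of (m, j) \<Rightarrow> norm (K m j) * W)"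
        by (simp add: p T_def norm_mult mult_left_mono)
    qed
    also have "\<dots> \<le> (\<Sum>(m, j)\<in>{..<M} \<times> {1..n}. norm (K m j) * W)"
      using W0 by (intro sum_mono2) auto
    also have "\<dots> = C * W" by (simp add: C_def sum.cartesian_product sum_distrib_right case_prod_unfold)
    finally show ?thesis unfolding e by (simp add: W_def)
  qed
  moreover have "C \<ge> 0" by (simp add: C_def sum_nonneg)
  ultimately show ?thesis unfolding z_def by blast
qed

lemma exp_monomial_cov_deriv:
  "cov_deriv (exp_monomial n (- of_nat m)) = (\<lambda>u. - of_nat n * exp_monomial n (- of_nat m) u + (- of_nat m) * exp_monomial n (- of_nat (Suc m)) u)"
proof
  fix u
  have "deriv (exp_monomial n (- of_nat m)) u = - of_nat n * exp_monomial n (- of_nat m + 1) u + (- of_nat m) * exp_monomial n (- of_nat m) u"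
    by (rule DERIV_imp_deriv exp_monomial_deriv)+
  moreover have "exp_monomial n (- of_nat m + 1) u = exp u * exp_monomial n (- of_nat m) u"
    by (simp only: exp_monomial_def distrib_right exp_add) simp
  moreover have "exp_monomial n (- of_nat (Suc m)) u = exp_monomial n (- of_nat m) u / exp u"
  proof -
    have "- of_nat (Suc m) * u = - of_nat m * u - u" by (simp add: algebra_simps)
    then show ?thesis by (simp only: exp_monomial_def exp_diff) simp
  qed
  ultimately show "cov_deriv (exp_monomial n (- of_nat m)) u = - of_nat n * exp_monomial n (- of_nat m) u + (- of_nat m) * exp_monomial n (- of_nat (Suc m)) u"
    by (simp only: cov_deriv_apply cov_proj_def) (simp add: field_simps)
qed

text \<open>At y = N/n the factor e^(-ny) is e^(-N). Differentiation mixes the exponents m and m +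
  1, so the induction on \<open>j\<close> has to range over all \<open>m\<close>.\<close>

lemma exp_monomial_cov_deriv_limit:
  assumes n: "n > 0"
  shows "(\<lambda>N. exp (of_nat N) * (cov_deriv ^^ j) (exp_monomial n (- of_nat m)) (of_real (ln (real N / real n)))) \<longlonglongrightarrow> (if m = 0 then (- of_nat n) ^ j else 0)"
proof (induction j arbitrary: m)
  case 0
  have "(\<lambda>N. (of_nat n / of_nat N :: complex) ^ m) \<longlonglongrightarrow> 0 ^ m"
    by (intro tendsto_power lim_const_over_n)
  then have "(\<lambda>N. (of_nat n / of_nat N :: complex) ^ m) \<longlonglongrightarrow> (if m = 0 then (- of_nat n) ^ 0 else 0)"
    by (simp add: power_0_left split: if_splits)
  moreover have "eventually (\<lambda>N. (of_nat n / of_nat N :: complex) ^ m = exp (of_nat N) * (cov_deriv ^^ 0) (exp_monomial n (- of_nat m)) (of_real (ln (real N / real n)))) sequentially"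
    using eventually_gt_at_top[of 0]
  proof eventually_elim
    case (elim N)
    have e: "exp (complex_of_real (ln (real N / real n))) = of_nat N / of_nat n"
      using elim n by (simp add: exp_of_real)
    have "exp (- of_nat m * complex_of_real (ln (real N / real n))) = (of_nat n / of_nat N) ^ m"
      by (simp only: mult_minus_left exp_minus exp_of_nat_mult e power_divide inverse_divide)
    moreover have "exp (- of_nat n * (of_nat N / of_nat n :: complex)) = exp (- of_nat N)" using n by simp
    ultimately show ?case by (simp add: exp_monomial_def e exp_minus)
  qed
  ultimately show ?case by (rule Lim_transform_eventually)
next
  case (Suc j)
  have e: "(cov_deriv ^^ Suc j) (exp_monomial n (- of_nat m)) u
      = - of_nat n * (cov_deriv ^^ j) (exp_monomial n (- of_nat m)) u + (- of_nat m) * (cov_deriv ^^ j) (exp_monomial n (- of_nat (Suc m))) u" for u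
    unfolding funpow_Suc_right o_apply exp_monomial_cov_deriv
    by (simp only: cov_deriv_power_lincomb[OF holomorphic_exp_monomial holomorphic_exp_monomial])
  have "(\<lambda>N. - of_nat n * (exp (of_nat N) * (cov_deriv ^^ j) (exp_monomial n (- of_nat m)) (of_real (ln (real N / real n))))
      + (- of_nat m) * (exp (of_nat N) * (cov_deriv ^^ j) (exp_monomial n (- of_nat (Suc m))) (of_real (ln (real N / real n)))))
     \<longlonglongrightarrow> - of_nat n * (if m = 0 then (- of_nat n) ^ j else 0) + (- of_nat m) * (if Suc m = 0 then (- of_nat n) ^ j else 0)"
    by (intro tendsto_intros Suc)
  then show ?case unfolding e by (simp add: algebra_simps split: if_splits)
qed

text \<open>Only the term of index 0 contributes to the limit; \<open>Suc M\<close> guarantees that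
  it is present.\<close>

lemma partial_solution_cov_deriv_limit:
  assumes n: "n > 0"
  shows "(\<lambda>N. exp (of_nat N) * (cov_deriv ^^ j) (partial_solution n mu (Suc M)) (of_real (ln (real N / real n)))) \<longlonglongrightarrow> (- of_nat n) ^ j"
proof (induction M)
  case 0
  have "partial_solution n mu (Suc 0) = exp_monomial n (- of_nat 0)"
    by (auto simp: partial_solution_def formal_beta.simps)
  then show ?case using exp_monomial_cov_deriv_limit[OF n, of j 0] by simp
next
  case (Suc M)
  have e: "(cov_deriv ^^ j) (partial_solution n mu (Suc (Suc M))) u
    = 1 * (cov_deriv ^^ j) (partial_solution n mu (Suc M)) u + formal_beta n mu (Suc M) / (- of_nat n) ^ Suc M * (cov_deriv ^^ j) (exp_monomial n (- of_nat (Suc M))) u" for u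
    unfolding partial_solution_Suc[of n mu "Suc M"]
    by (simp only: cov_deriv_power_lincomb[OF holomorphic_partial_solution holomorphic_exp_monomial])
  have "(\<lambda>N. (exp (of_nat N) * (cov_deriv ^^ j) (partial_solution n mu (Suc M)) (of_real (ln (real N / real n))))
      + formal_beta n mu (Suc M) / (- of_nat n) ^ Suc M * (exp (of_nat N) * (cov_deriv ^^ j) (exp_monomial n (- of_nat (Suc M))) (of_real (ln (real N / real n)))))
     \<longlonglongrightarrow> (- of_nat n) ^ j + formal_beta n mu (Suc M) / (- of_nat n) ^ Suc M * (if Suc M = 0 then (- of_nat n) ^ j else 0)"
    by (intro tendsto_intros Suc exp_monomial_cov_deriv_limit n)
  then show ?case unfolding e by (simp add: algebra_simps)
qed

lemma energy_limit_0:
  assumes "\<And>j. j < n \<Longrightarrow> (\<lambda>N. exp (of_nat N) * (cov_deriv ^^ j) f (u N)) \<longlonglongrightarrow> 0"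
  shows "(\<lambda>N. exp (2 * real N) * energy n f (u N)) \<longlonglongrightarrow> 0"
proof -
  have "exp (2 * real N) * energy n f (u N) = (\<Sum>j<n. (norm (exp (of_nat N) * (cov_deriv ^^ j) f (u N) / of_nat n ^ j))\<^sup>2)" for N
  proof -
    have "exp (2 * real N) = (exp (real N))\<^sup>2" by (simp add: exp_double)
    then show ?thesis unfolding energy_def sum_distrib_left by (simp add: norm_mult norm_divide power_mult_distrib power_divide)
  qed
  moreover have "(\<lambda>N. \<Sum>j<n. (norm (exp (of_nat N) * (cov_deriv ^^ j) f (u N) / of_nat n ^ j))\<^sup>2) \<longlonglongrightarrow> (\<Sum>j<n. (norm (0 / of_nat n ^ j :: complex))\<^sup>2)"
    by (intro tendsto_sum tendsto_power tendsto_norm tendsto_divide_zero[THEN tendsto_eq_rhs] assms) auto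
  ultimately show ?thesis by simp
qed

lemma twisted_mellin_ode:
  assumes n: "n > 0" and sum0: "(\<Sum>l=1..n. lam l) = 0"
  shows "euler_op (\<lambda>l. of_nat n * lam l - (of_nat n - 1) / 2) n (twisted_mellin n lam) u
    = (- of_nat n) ^ n * exp (of_nat n * u) * twisted_mellin n lam u"
proof -
  have h: "mellin_barnes n lam (\<lambda>_. 1) holomorphic_on UNIV" by (rule holomorphic_mellin_barnes[OF n sum0 poly_growth_1])
  have "euler_op (\<lambda>l. of_nat n * lam l - (of_nat n - 1) / 2) n (twisted_mellin n lam) u
    = exp ((of_nat n - 1) / 2 * u) * euler_op (\<lambda>l. of_nat n * lam l - (of_nat n - 1) / 2 + (of_nat n - 1) / 2) n (mellin_barnes n lam (\<lambda>_. 1)) u"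
    unfolding twisted_mellin_def[abs_def] euler_op_exp[OF h] ..
  also have "(\<lambda>l. of_nat n * lam l - (of_nat n - 1) / 2 + (of_nat n - 1) / 2) = (\<lambda>l. of_nat n * lam l)"
    by (simp add: fun_eq_iff)
  finally show ?thesis unfolding mellin_barnes_ode[OF n sum0] by (simp only: twisted_mellin_def[of n lam u] mult_ac)
qed

lemma holomorphic_twisted_mellin:
  assumes n: "n > 0" and sum0: "(\<Sum>l=1..n. lam l) = 0"
  shows "twisted_mellin n lam holomorphic_on A"
  unfolding twisted_mellin_def[abs_def]
  by (intro holomorphic_intros holomorphic_mellin_barnes[OF n sum0 poly_growth_1])

lemma sum_twisted_indices:
  assumes sum0: "(\<Sum>l=1..n. lam l) = 0"
  shows "(\<Sum>l=1..n. of_nat n * lam l - (of_nat n - 1) / 2) = - (of_nat n * (of_nat n - 1) / 2 :: complex)"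
  unfolding sum_subtractf sum_distrib_left[symmetric] sum0 by simp

section \<open>Transport from the real axis to the half plane\<close>

text \<open>The length of the segment exceeds its gain in real part by L(1 - Re \<omega>) \<le> L
  (Im \<omega>)^2 = (Im y0)^2 / L, and the size of \<open>X\<close> forces L \<ge> |y0|^2, so the
  excess is at most 1. Thus e^(nr) e^(-n Re y) \<le> e^n e^(-n Re y0) along the path, which keeps
  the accumulated residual at the size wanted at y0. The direction also satisfies |Im \<omega>|
  \<le> 1/2, whence the lower bound for |y|.\<close>

lemma path_to_real_axis:
  fixes y0 :: complex and X :: real
  assumes y0: "Re y0 \<ge> 0" "norm y0 \<ge> 2" and X: "X \<ge> (norm y0)\<^sup>2 + norm y0"
  defines "L \<equiv> norm (of_real X - y0)"
  defines "\<omega> \<equiv> (of_real X - y0) / of_real L"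
  shows "norm \<omega> = 1" "y0 + of_real L * \<omega> = of_real X"
    "\<And>r. 0 \<le> r \<Longrightarrow> r \<le> L \<Longrightarrow> Re (y0 + of_real r * \<omega>) \<ge> 0"
    "\<And>r. 0 \<le> r \<Longrightarrow> r \<le> L \<Longrightarrow> norm (y0 + of_real r * \<omega>) \<ge> (norm y0 + r) / 2"
    "\<And>r. 0 \<le> r \<Longrightarrow> r \<le> L \<Longrightarrow> r - Re (y0 + of_real r * \<omega>) \<le> 1 - Re y0"
proof -
  define \<rho> where "\<rho> = norm y0"
  have \<rho>2: "2 * \<rho> \<le> \<rho>\<^sup>2" using y0(2) by (simp add: \<rho>_def power2_eq_square mult_right_mono)
  have "norm (complex_of_real X) - norm y0 \<le> L" unfolding L_def by (rule norm_triangle_ineq2)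
  then have L: "L \<ge> \<rho>\<^sup>2" using X by (simp add: \<rho>_def)
  have L0: "L > 0" using L \<rho>2 y0(2) by (simp add: \<rho>_def)
  show n\<omega>: "norm \<omega> = 1" using L0 by (simp add: \<omega>_def norm_divide) (simp add: L_def)
  show "y0 + of_real L * \<omega> = of_real X" using L0 by (simp add: \<omega>_def)
  have Re\<omega>: "Re \<omega> = (X - Re y0) / L" and Im\<omega>: "Im \<omega> = - Im y0 / L" by (simp_all add: \<omega>_def)
  have abs: "\<bar>Re y0\<bar> \<le> \<rho>" "\<bar>Im y0\<bar> \<le> \<rho>" unfolding \<rho>_def by (rule abs_Re_le_cmod abs_Im_le_cmod)+
  have "X \<ge> \<rho>" using X by (simp add: \<rho>_def) (smt (verit) zero_le_power2)
  then have Re0: "Re \<omega> \<ge> 0" unfolding Re\<omega> using abs L0 by simp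
  have unit: "(Re \<omega>)\<^sup>2 + (Im \<omega>)\<^sup>2 = 1" using n\<omega> by (simp add: cmod_power2[symmetric])
  have Im_half: "\<bar>Im \<omega>\<bar> \<le> 1 / 2"
  proof -
    have "\<bar>Im \<omega>\<bar> = \<bar>Im y0\<bar> / L" using L0 by (simp add: Im\<omega>)
    also have "\<dots> \<le> 1 / 2" using L0 abs(2) \<rho>2 L by (simp add: divide_le_eq)
    finally show ?thesis .
  qed
  show "Re (y0 + of_real r * \<omega>) \<ge> 0" if "0 \<le> r" "r \<le> L" for r
    using that Re0 y0(1) by simp
  show "norm (y0 + of_real r * \<omega>) \<ge> (norm y0 + r) / 2" if r: "0 \<le> r" "r \<le> L" for r
  proof (rule power2_le_imp_le)
    have "\<bar>Im y0 * Im \<omega>\<bar> \<le> \<rho> * (1 / 2)" unfolding abs_mult using abs(2) Im_half by (intro mult_mono) (auto simp: \<rho>_def)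
    then have "Re y0 * Re \<omega> + Im y0 * Im \<omega> \<ge> - \<rho> / 2" using mult_nonneg_nonneg[OF y0(1) Re0] by linarith
    then have "r * (Re y0 * Re \<omega> + Im y0 * Im \<omega>) \<ge> r * (- \<rho> / 2)" using r by (intro mult_left_mono) auto
    moreover have "(norm (y0 + of_real r * \<omega>))\<^sup>2 = \<rho>\<^sup>2 + 2 * (r * (Re y0 * Re \<omega> + Im y0 * Im \<omega>)) + r\<^sup>2 * ((Re \<omega>)\<^sup>2 + (Im \<omega>)\<^sup>2)"
      unfolding \<rho>_def cmod_power2 by (simp add: power2_eq_square algebra_simps)
    ultimately have "(norm (y0 + of_real r * \<omega>))\<^sup>2 \<ge> \<rho>\<^sup>2 - r * \<rho> + r\<^sup>2" unfolding unit by simp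
    moreover have "(\<rho> - r)\<^sup>2 \<ge> 0" by simp
    ultimately show "((norm y0 + r) / 2)\<^sup>2 \<le> (norm (y0 + of_real r * \<omega>))\<^sup>2"
      unfolding \<rho>_def[symmetric] by (simp add: power2_eq_square field_simps)
  qed simp
  show "r - Re (y0 + of_real r * \<omega>) \<le> 1 - Re y0" if r: "0 \<le> r" "r \<le> L" for r
  proof -
    have Re1: "Re \<omega> \<le> 1" using complex_Re_le_cmod[of \<omega>] n\<omega> by simp
    have "(Im \<omega>)\<^sup>2 = (1 - Re \<omega>) + (1 - Re \<omega>) * Re \<omega>" using unit by (simp add: power2_eq_square algebra_simps)
    then have 1: "1 - Re \<omega> \<le> (Im \<omega>)\<^sup>2" using Re0 Re1 by simp
    have "(Im y0)\<^sup>2 \<le> \<rho>\<^sup>2" using abs(2) by (simp add: abs_le_square_iff[symmetric] \<rho>_def)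
    then have "(Im y0)\<^sup>2 \<le> L" using L by linarith
    then have "L * (Im \<omega>)\<^sup>2 \<le> 1" using L0 by (simp add: Im\<omega> power2_eq_square)
    moreover have "r * (1 - Re \<omega>) \<le> L * (1 - Re \<omega>)" using r Re1 by (intro mult_right_mono) auto
    moreover have "L * (1 - Re \<omega>) \<le> L * (Im \<omega>)\<^sup>2" using 1 L0 by (intro mult_left_mono) auto
    ultimately have "r * (1 - Re \<omega>) \<le> 1" by linarith
    then show ?thesis by (simp add: algebra_simps)
  qed
qed

text \<open>The difference \<open>E\<close> satisfies the equation up to the residual of the
  truncated series and is o(e^(-ny)) with its derivatives along y = N/n. In the backward estimate
  from N/n to y0 the first contribution disappears as N grows, so the residual alone
  decides.\<close>

lemma twisted_mellin_expansion:
  assumes n: "n \<ge> 2" and sum0: "(\<Sum>l=1..n. lam l) = 0"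
  defines "mu \<equiv> \<lambda>l. of_nat n * lam l - (of_nat n - 1) / 2"
  shows "\<exists>C. \<forall>y. Re y \<ge> 0 \<longrightarrow> norm y \<ge> 2 \<longrightarrow>
    norm (twisted_mellin n lam (Ln y) / of_real (leading_const n) - partial_solution n mu M (Ln y)) \<le> C * norm (exp (- of_nat n * y)) / norm y ^ M"
proof -
  have n0: "n > 0" using n by simp
  define v where "v = twisted_mellin n lam"
  \<comment> \<open>One term beyond \<open>M\<close>: of the M + 2 powers of 1/|y| in the residual,
    one is consumed by the factor |y| of the energy estimate, one becomes 1/(\<rho> + r), and M are
    left over.\<close>
  define S where "S = partial_solution n mu (Suc M)"
  define c0 where "c0 = complex_of_real (leading_const n)"
  have c0: "c0 \<noteq> 0" using n by (simp add: c0_def leading_const_def)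
  have mu: "(\<Sum>l=1..n. mu l) = - (of_nat n * (of_nat n - 1) / 2)"
    unfolding mu_def by (rule sum_twisted_indices[OF sum0])
  have hv: "v holomorphic_on UNIV" unfolding v_def by (rule holomorphic_twisted_mellin[OF n0 sum0])
  have hS: "S holomorphic_on UNIV" unfolding S_def by (rule holomorphic_partial_solution)
  define E where "E = (\<lambda>u. 1 / c0 * v u + (-1) * S u)"
  have hE: "E holomorphic_on UNIV" unfolding E_def by (intro holomorphic_intros hv hS)
  define W where "W u = norm (exp (- of_nat n * exp u)) * norm (exp u) ^ n / norm (exp u) ^ Suc (Suc M)" for u :: complex
  obtain C0 where C0: "C0 \<ge> 0" and res: "\<And>u. norm (exp u) \<ge> 1 \<Longrightarrow>
     norm (euler_op mu n S u - (- of_nat n) ^ n * exp (of_nat n * u) * S u) \<le> C0 * W u"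
    using partial_solution_residual[OF n0 mu, of "Suc M"] unfolding S_def[symmetric] W_def
    by (auto simp only: mult.assoc times_divide_eq_right)
  have resE: "norm (euler_op mu n E u - (- of_nat n) ^ n * exp (of_nat n * u) * E u) \<le> C0 * W u" if u: "norm (exp u) \<ge> 1" for u
  proof -
    have "euler_op mu n v u = (- of_nat n) ^ n * exp (of_nat n * u) * v u"
      unfolding v_def mu_def by (rule twisted_mellin_ode[OF n0 sum0])
    then have "euler_op mu n E u - (- of_nat n) ^ n * exp (of_nat n * u) * E u = - (euler_op mu n S u - (- of_nat n) ^ n * exp (of_nat n * u) * S u)"
      unfolding E_def euler_op_lincomb[OF hv hS] by (simp add: algebra_simps)
    then show ?thesis using res[OF u] by (simp only: norm_minus_cancel)
  qed
  have lim: "(\<lambda>N. exp (2 * real N) * energy n E (of_real (ln (real N / real n)))) \<longlonglongrightarrow> 0"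
  proof (rule energy_limit_0)
    fix j assume "j < n"
    have "(\<lambda>N. 1 / c0 * (exp (of_nat N) * (cov_deriv ^^ j) v (of_real (ln (real N / real n)))) + (-1) * (exp (of_nat N) * (cov_deriv ^^ j) S (of_real (ln (real N / real n)))))
      \<longlonglongrightarrow> 1 / c0 * (c0 * (- of_nat n) ^ j) + (-1) * (- of_nat n) ^ j"
      unfolding v_def S_def c0_def
      by (intro tendsto_intros twisted_mellin_real_asymp partial_solution_cov_deriv_limit n0 sum0)
    moreover have "1 / c0 * (c0 * (- of_nat n) ^ j) + (-1) * (- of_nat n) ^ j = 0" using c0 by simp
    ultimately show "(\<lambda>N. exp (of_nat N) * (cov_deriv ^^ j) E (of_real (ln (real N / real n)))) \<longlonglongrightarrow> 0"
      unfolding E_def cov_deriv_power_lincomb[OF hv hS] by (simp add: algebra_simps)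
  qed
  define P where "P = 2 * real n * (\<Sum>j<n. norm (euler_coeff mu n j)) + real n"
  define K where "K = exp P * (2 * sqrt (real n) * C0 * exp (real n) * 2 ^ M)"
  have K0: "K \<ge> 0" using C0 by (simp add: K_def)
  have bd: "norm (E (Ln y0)) \<le> K * (norm (exp (- of_nat n * y0)) / norm y0 ^ M)" if y0: "Re y0 \<ge> 0" "norm y0 \<ge> 2" for y0
  proof -
    define \<rho> where "\<rho> = norm y0"
    have \<rho>: "\<rho> \<ge> 2" using y0 by (simp add: \<rho>_def)
    \<comment> \<open>The square of the bound for sqrt n |y| \<epsilon>(r) e^(nr) without its factor
      1/(\<rho> + r). The 2 and 2^M come from |y| \<ge> (\<rho> + r)/2 \<ge> \<rho>/2, and e^n from
      the excess length of the path.\<close>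
    define c where "c = (2 * sqrt (real n) * C0 * exp (real n) * 2 ^ M * (exp (- real n * Re y0) / \<rho> ^ M))\<^sup>2"
    have c: "c \<ge> 0" by (simp add: c_def)
    have gron: "energy n E (Ln y0) \<le> exp (2 * P) * (exp (2 * real n * \<rho>) * (exp (2 * real N) * energy n E (of_real (ln (real N / real n)))) + c)"
      if N: "real N \<ge> real n * (\<rho>\<^sup>2 + \<rho>)" for N
    proof -
      define X where "X = real N / real n"
      have X: "X \<ge> (norm y0)\<^sup>2 + norm y0" using N n unfolding X_def \<rho>_def by (simp add: field_simps)
      have X0: "X > 0" using X \<rho> unfolding \<rho>_def by (smt (verit) zero_le_power2)
      define L where "L = norm (of_real X - y0)"
      define \<omega> where "\<omega> = (of_real X - y0) / of_real L"
      note path = path_to_real_axis[OF y0 X, folded L_def, folded \<omega>_def, folded \<rho>_def]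
      have L0: "L \<ge> 0" by (simp add: L_def)
      define \<epsilon> where "\<epsilon> r = C0 * exp (- real n * Re (y0 + of_real r * \<omega>)) / norm (y0 + of_real r * \<omega>) ^ Suc (Suc M)" for r
      have pos: "norm (y0 + of_real r * \<omega>) \<ge> 1" if r: "0 \<le> r" "r \<le> L" for r
        by (rule order_trans[OF _ path(4)[OF r]]) (use \<rho> r in simp)
      have "energy n E (Ln y0) \<le> exp (2 * P) * (exp (2 * real n * L) * energy n E (Ln (y0 + of_real L * \<omega>)) + c)"
        unfolding P_def
      proof (rule energy_gronwall[OF n mu hE path(1) L0 \<rho> _ path(4) _ _ c])
        fix r assume r: "0 \<le> r" "r \<le> L"
        define y where "y = y0 + of_real r * \<omega>"
        have y1: "norm y \<ge> 1" and yr: "norm y \<ge> (\<rho> + r) / 2" and yR: "Re y \<ge> 0" and rR: "r - Re y \<le> 1 - Re y0"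
          unfolding y_def using pos[OF r] path(3-5)[OF r] by auto
        have ynz: "y \<noteq> 0" using y1 by auto
        have "y \<notin> \<real>\<^sub>\<le>\<^sub>0"
        proof
          assume "y \<in> \<real>\<^sub>\<le>\<^sub>0"
          then have "Re y \<le> 0" "Im y = 0" by (auto simp: complex_nonpos_Reals_iff)
          then have "y = 0" using yR by (simp add: complex_eq_iff)
          then show False using ynz by simp
        qed
        then show "y0 + of_real r * \<omega> \<notin> \<real>\<^sub>\<le>\<^sub>0" by (simp add: y_def)
        have ey: "exp (Ln y) = y" using ynz by simp
        have ny: "norm (exp (- of_nat n * y)) = exp (- real n * Re y)" by simp
        have "norm (euler_op mu n E (Ln y) - (- of_nat n) ^ n * exp (of_nat n * Ln y) * E (Ln y)) \<le> C0 * W (Ln y)"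
          using resE[of "Ln y"] y1 unfolding ey by blast
        also have "C0 * W (Ln y) = \<epsilon> r * norm y ^ n"
          unfolding W_def ey \<epsilon>_def y_def[symmetric] ny by simp
        finally show "norm (euler_op mu n E (Ln (y0 + of_real r * \<omega>)) - (- of_nat n) ^ n * exp (of_nat n * Ln (y0 + of_real r * \<omega>)) * E (Ln (y0 + of_real r * \<omega>)))
           \<le> \<epsilon> r * norm (y0 + of_real r * \<omega>) ^ n" by (simp add: y_def)
        define q where "q = norm y"
        define h where "h = (\<rho> + r) / 2"
        have h: "h > 0" "h \<ge> \<rho> / 2" using \<rho> r by (auto simp: h_def)
        have qh: "q \<ge> h" using yr by (simp add: q_def h_def)
        have ex: "exp (real n * r) * exp (- real n * Re y) \<le> exp (real n) * exp (- real n * Re y0)"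
        proof -
          have "real n * (r - Re y) \<le> real n * (1 - Re y0)" using rR by (intro mult_left_mono) auto
          then show ?thesis by (simp add: exp_add[symmetric] algebra_simps)
        qed
        have "q * (C0 * exp (- real n * Re y) / q ^ Suc (Suc M)) * exp (real n * r) = C0 * (exp (real n * r) * exp (- real n * Re y)) / q ^ Suc M"
          using y1 by (simp add: q_def)
        also have "\<dots> \<le> C0 * (exp (real n) * exp (- real n * Re y0)) / (h * (\<rho> / 2) ^ M)"
        proof (intro frac_le mult_left_mono ex C0)
          have "h * (\<rho> / 2) ^ M \<le> q * q ^ M" using qh h \<rho> by (intro mult_mono power_mono) auto
          then show "h * (\<rho> / 2) ^ M \<le> q ^ Suc M" by simp
        qed (use C0 h \<rho> in auto)
        also have "\<dots> = 2 * C0 * exp (real n) * 2 ^ M * (exp (- real n * Re y0) / \<rho> ^ M) / (\<rho> + r)"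
          unfolding h_def by (simp add: power_divide field_simps)
        finally have "(q * (C0 * exp (- real n * Re y) / q ^ Suc (Suc M)) * exp (real n * r))\<^sup>2
            \<le> (2 * C0 * exp (real n) * 2 ^ M * (exp (- real n * Re y0) / \<rho> ^ M) / (\<rho> + r))\<^sup>2"
          using C0 by (intro power_mono) (auto simp: q_def)
        then have "real n * (q * (C0 * exp (- real n * Re y) / q ^ Suc (Suc M)) * exp (real n * r))\<^sup>2
            \<le> real n * (2 * C0 * exp (real n) * 2 ^ M * (exp (- real n * Re y0) / \<rho> ^ M) / (\<rho> + r))\<^sup>2"
          by (rule mult_left_mono) simp
        also have "\<dots> = c / (\<rho> + r)\<^sup>2" unfolding c_def by (simp add: power_mult_distrib power_divide)
        also have "real n * (q * (C0 * exp (- real n * Re y) / q ^ Suc (Suc M)) * exp (real n * r))\<^sup>2 = real n * q\<^sup>2 * (\<epsilon> r)\<^sup>2 * exp (2 * real n * r)"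
        proof -
          have "exp (2 * real n * r) = (exp (real n * r))\<^sup>2" using exp_double[of "real n * r"] by (simp add: mult.assoc)
          then show ?thesis unfolding \<epsilon>_def y_def[symmetric] q_def[symmetric] by (simp only: power_mult_distrib mult.assoc)
        qed
        finally show "real n * (norm (y0 + of_real r * \<omega>))\<^sup>2 * (\<epsilon> r)\<^sup>2 * exp (2 * real n * r) \<le> c / (\<rho> + r)\<^sup>2"
          by (simp add: q_def y_def)
      qed
      also have "Ln (y0 + of_real L * \<omega>) = of_real (ln (real N / real n))"
        unfolding path(2) using X0 by (simp add: Ln_of_real X_def[symmetric])
      also have "exp (2 * real n * L) * energy n E (of_real (ln (real N / real n))) \<le> (exp (2 * real n * \<rho>) * exp (2 * real N)) * energy n E (of_real (ln (real N / real n)))"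
      proof (intro mult_right_mono energy_nonneg)
        have "L \<le> X + \<rho>" unfolding L_def \<rho>_def using norm_triangle_ineq4[of "complex_of_real X" y0] X0 by simp
        then have "2 * real n * L \<le> 2 * real n * (X + \<rho>)" by (intro mult_left_mono) auto
        also have "\<dots> = 2 * real n * \<rho> + 2 * real N" using n by (simp add: X_def algebra_simps)
        finally show "exp (2 * real n * L) \<le> exp (2 * real n * \<rho>) * exp (2 * real N)" by (simp add: exp_add[symmetric])
      qed
      finally show ?thesis by (simp add: mult.assoc)
    qed
    \<comment> \<open>Here y0 is fixed and N tends to infinity, so the factor e^(2n\<rho>) from L
      \<le> X + \<rho> does no harm.\<close>
    have "energy n E (Ln y0) \<le> exp (2 * P) * (exp (2 * real n * \<rho>) * 0 + c)"
    proof (rule tendsto_lowerbound)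
      show "(\<lambda>N. exp (2 * P) * (exp (2 * real n * \<rho>) * (exp (2 * real N) * energy n E (of_real (ln (real N / real n)))) + c)) \<longlonglongrightarrow> exp (2 * P) * (exp (2 * real n * \<rho>) * 0 + c)"
        by (intro tendsto_intros lim)
      show "\<forall>\<^sub>F N in sequentially. energy n E (Ln y0) \<le> exp (2 * P) * (exp (2 * real n * \<rho>) * (exp (2 * real N) * energy n E (of_real (ln (real N / real n)))) + c)"
        using eventually_ge_at_top[of "nat \<lceil>real n * (\<rho>\<^sup>2 + \<rho>)\<rceil>"]
      proof eventually_elim
        case (elim N)
        then have "real n * (\<rho>\<^sup>2 + \<rho>) \<le> real N" by linarith
        then show ?case by (rule gron)
      qed
    qed simp
    also have "\<dots> = (K * (exp (- real n * Re y0) / \<rho> ^ M))\<^sup>2"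
    proof -
      have "exp (2 * P) = (exp P)\<^sup>2" by (simp add: exp_double)
      then show ?thesis unfolding K_def c_def by (simp only: power_mult_distrib mult.assoc mult_zero_right add_0)
    qed
    finally have "(norm (E (Ln y0)))\<^sup>2 \<le> (K * (exp (- real n * Re y0) / \<rho> ^ M))\<^sup>2"
      using norm_le_energy[OF n0, of E "Ln y0"] by linarith
    then have "norm (E (Ln y0)) \<le> K * (exp (- real n * Re y0) / \<rho> ^ M)"
      by (rule power2_le_imp_le) (use K0 in \<open>simp add: \<rho>_def\<close>)
    then show ?thesis by (simp add: \<rho>_def)
  qed
  \<comment> \<open>The additional term of \<open>S\<close> is returned to the remainder, where it
    has the admissible order |y|^-M.\<close>
  define b where "b = formal_beta n mu M / (- of_nat n) ^ M"
  have "norm (v (Ln y) / c0 - partial_solution n mu M (Ln y)) \<le> (K + norm b) * norm (exp (- of_nat n * y)) / norm y ^ M"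
    if y: "Re y \<ge> 0" "norm y \<ge> 2" for y
  proof -
    have y0: "y \<noteq> 0" using y by auto
    have "v (Ln y) / c0 - partial_solution n mu M (Ln y) = E (Ln y) + b * exp_monomial n (- of_nat M) (Ln y)"
      unfolding E_def S_def partial_solution_Suc b_def by simp
    then have "norm (v (Ln y) / c0 - partial_solution n mu M (Ln y)) \<le> norm (E (Ln y)) + norm (b * exp_monomial n (- of_nat M) (Ln y))"
      by (simp only: norm_triangle_ineq)
    also have "norm (b * exp_monomial n (- of_nat M) (Ln y)) = norm b * (norm (exp (- of_nat n * y)) / norm y ^ M)"
      using norm_exp_monomial[of n "- int M" "Ln y"] y0 by (simp add: norm_mult power_int_minus divide_inverse)
    finally show ?thesis using bd[OF y] by (simp add: distrib_right add_divide_distrib)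
  qed
  then show ?thesis unfolding v_def c0_def by blast
qed

section \<open>Uniqueness\<close>

text \<open>On the slit plane \<open>cov_deriv\<close> is ordinary differentiation in y, which makes
  Cauchy's inequality applicable.\<close>

lemma cov_deriv_power_Ln:
  assumes f: "f holomorphic_on UNIV" and y: "y \<notin> \<real>\<^sub>\<le>\<^sub>0"
  shows "(cov_deriv ^^ j) f (Ln y) = (deriv ^^ j) (\<lambda>y. f (Ln y)) y"
  using y
proof (induction j arbitrary: y)
  case (Suc j)
  have y0: "y \<noteq> 0" using Suc.prems by auto
  have "((\<lambda>y. (cov_deriv ^^ j) f (Ln y)) has_field_derivative deriv ((cov_deriv ^^ j) f) (Ln y) * inverse y) (at y)"
    by (intro DERIV_chain2[of "(cov_deriv ^^ j) f"] entire_deriv holomorphic_cov_deriv_power f has_field_derivative_Ln Suc.prems)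
  then have "((deriv ^^ j) (\<lambda>y. f (Ln y)) has_field_derivative deriv ((cov_deriv ^^ j) f) (Ln y) * inverse y) (at y)"
    by (rule has_field_derivative_transform_within_open[where S = "- \<real>\<^sub>\<le>\<^sub>0"])
      (use Suc in \<open>auto simp: closed_nonpos_Reals_complex\<close>)
  then have "(deriv ^^ Suc j) (\<lambda>y. f (Ln y)) y = deriv ((cov_deriv ^^ j) f) (Ln y) * inverse y"
    by (simp add: DERIV_imp_deriv)
  then show ?case unfolding cov_deriv_power_Suc cov_proj_def using y0 by (simp add: divide_inverse)
qed simp

text \<open>Cauchy's inequality on unit discs carries the decay from f to all its derivatives on the
  axis. Hence e^(2N) times the energy at N/n tends to 0, and the backward estimate along the real
  axis leaves nothing at any x \<ge> e.\<close>

lemma decaying_solution_eq_0: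
  fixes \<delta> C R :: real
  assumes n: "n \<ge> 2" and mu: "(\<Sum>l=1..n. mu l) = - (of_nat n * (of_nat n - 1) / 2)"
    and f: "f holomorphic_on UNIV"
    and ode: "\<And>u. euler_op mu n f u = (- of_nat n) ^ n * exp (of_nat n * u) * f u"
    and \<delta>: "\<delta> > 0"
    and decay: "\<And>u. Re u \<ge> R \<Longrightarrow> \<bar>Im u\<bar> < \<delta> \<Longrightarrow> norm (f u) \<le> C * norm (exp (- of_nat n * exp u)) / norm (exp u)"
  shows "f = (\<lambda>_. 0)"
proof (rule entire_eq_if_eq_on_ray[OF f])
  have n0: "n > 0" using n by simp
  define X where "X N = real N / real n" for N
  \<comment> \<open>The conditions on \<open>x\<close> keep the unit circle around it in the region
    of decay: its points have modulus at least x - 1 and argument at most 2/x in modulus.\<close>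
  have deriv_bound: "norm ((cov_deriv ^^ j) f (of_real (ln x))) \<le> fact j * (\<bar>C\<bar> * exp (real n) * exp (- real n * x) / (x - 1))"
    if x: "x \<ge> 3" "x > exp R + 1" "x > 2 / \<delta>" for x j
  proof -
    have slit: "y \<notin> \<real>\<^sub>\<le>\<^sub>0" if yx: "norm (of_real x - y) \<le> 1" for y :: complex
    proof
      assume "y \<in> \<real>\<^sub>\<le>\<^sub>0"
      then have "Re y \<le> 0" by (auto simp: complex_nonpos_Reals_iff)
      moreover have "\<bar>Re (of_real x - y)\<bar> \<le> 1" using abs_Re_le_cmod order_trans yx by blast
      ultimately show False using x by simp
    qed
    have "norm ((deriv ^^ j) (\<lambda>y. f (Ln y)) (of_real x)) \<le> fact j * (\<bar>C\<bar> * exp (real n) * exp (- real n * x) / (x - 1)) / 1 ^ j"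
    proof (rule Cauchy_inequality)
      have h: "(\<lambda>y. f (Ln y)) holomorphic_on - \<real>\<^sub>\<le>\<^sub>0"
        by (rule holomorphic_on_compose_gen[unfolded o_def, where t = UNIV, OF _ f]) (auto intro!: holomorphic_intros)
      have cb: "cball (complex_of_real x) 1 \<subseteq> - \<real>\<^sub>\<le>\<^sub>0" using slit by (auto simp: dist_norm)
      then show "(\<lambda>y. f (Ln y)) holomorphic_on ball (complex_of_real x) 1"
        using ball_subset_cball by (intro holomorphic_on_subset[OF h]) blast
      show "continuous_on (cball (complex_of_real x) 1) (\<lambda>y. f (Ln y))"
        by (rule holomorphic_on_imp_continuous_on[OF holomorphic_on_subset[OF h cb]])
      fix y :: complex assume y: "norm (of_real x - y) = 1"
      have y0: "y \<noteq> 0" using slit[of y] y by auto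
      have rey: "\<bar>x - Re y\<bar> \<le> 1" using abs_Re_le_cmod[of "of_real x - y"] y by simp
      have ny: "norm y \<ge> x - 1" using rey complex_Re_le_cmod[of y] by linarith
      define t where "t = (y - of_real x) / of_real x"
      have nt: "norm t = 1 / x" using x y by (simp add: t_def norm_divide norm_minus_commute)
      have ty: "y = of_real x * (1 + t)" using x by (simp add: t_def field_simps)
      have t1: "1 + t \<noteq> 0" using ty y0 by auto
      have "Ln y = of_real (ln x) + Ln (1 + t)" unfolding ty using Ln_times_of_real[of x "1 + t"] x t1 by (simp add: Ln_of_real)
      then have "\<bar>Im (Ln y)\<bar> \<le> norm (Ln (1 + t))" using abs_Im_le_cmod[of "Ln (1 + t)"] by simp
      also have "\<dots> \<le> 2 * norm t" by (rule norm_Ln_le) (use x in \<open>simp add: nt field_simps\<close>)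
      also have "\<dots> < \<delta>" using x \<delta> by (simp add: nt field_simps)
      finally have im: "\<bar>Im (Ln y)\<bar> < \<delta>" .
      have "exp R \<le> norm y" using ny x by linarith
      then have "R \<le> ln (norm y)" using y0 by (simp add: ln_ge_iff)
      then have "R \<le> Re (Ln y)" using y0 by simp
      from decay[OF this im] have "norm (f (Ln y)) \<le> C * exp (- real n * Re y) / norm y" using y0 by simp
      also have "\<dots> \<le> \<bar>C\<bar> * exp (- real n * Re y) / norm y" by (intro divide_right_mono mult_right_mono) auto
      also have "\<dots> \<le> \<bar>C\<bar> * (exp (real n) * exp (- real n * x)) / (x - 1)"
      proof (intro frac_le mult_left_mono ny)
        have "real n * x \<le> real n * (1 + Re y)" using rey by (intro mult_left_mono) auto
        then show "exp (- real n * Re y) \<le> exp (real n) * exp (- real n * x)"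
          by (simp add: exp_add[symmetric] algebra_simps)
      qed (use x in auto)
      finally show "norm (f (Ln y)) \<le> \<bar>C\<bar> * exp (real n) * exp (- real n * x) / (x - 1)" by (simp add: mult.assoc)
    qed simp
    moreover have "(cov_deriv ^^ j) f (Ln (of_real x)) = (deriv ^^ j) (\<lambda>y. f (Ln y)) (of_real x)"
      using x by (intro cov_deriv_power_Ln f) auto
    moreover have "Ln (of_real x) = of_real (ln x)" using x by (intro Ln_of_real) simp
    ultimately show ?thesis by simp
  qed
  have Xlim: "filterlim X at_top sequentially"
    unfolding X_def using n0 by (intro filterlim_tendsto_pos_mult_at_top[OF tendsto_const _ filterlim_real_sequentially, of "1 / real n", simplified]) auto
  have lim: "(\<lambda>N. exp (2 * real N) * energy n f (of_real (ln (X N)))) \<longlonglongrightarrow> 0"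
  proof (rule energy_limit_0)
    fix j assume "j < n"
    have "(\<lambda>N. fact j * (\<bar>C\<bar> * exp (real n)) * inverse (- 1 + X N)) \<longlonglongrightarrow> fact j * (\<bar>C\<bar> * exp (real n)) * 0"
      by (intro tendsto_intros tendsto_inverse_0_at_top filterlim_tendsto_add_at_top[OF tendsto_const] Xlim)
    then have "(\<lambda>N. fact j * (\<bar>C\<bar> * exp (real n)) * inverse (- 1 + X N)) \<longlonglongrightarrow> 0" by simp
    then show "(\<lambda>N. exp (of_nat N) * (cov_deriv ^^ j) f (of_real (ln (X N)))) \<longlonglongrightarrow> 0"
    proof (rule Lim_null_comparison[rotated])
      have "eventually (\<lambda>N. X N > max 3 (max (exp R + 1) (2 / \<delta>))) sequentially"
        using Xlim unfolding filterlim_at_top_dense by blast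
      then show "\<forall>\<^sub>F N in sequentially. norm (exp (of_nat N) * (cov_deriv ^^ j) f (of_real (ln (X N)))) \<le> fact j * (\<bar>C\<bar> * exp (real n)) * inverse (- 1 + X N)"
      proof eventually_elim
        case (elim N)
        have e: "real n * X N = real N" using n0 by (simp add: X_def)
        have "norm (exp (of_nat N) * (cov_deriv ^^ j) f (of_real (ln (X N)))) = exp (real N) * norm ((cov_deriv ^^ j) f (of_real (ln (X N))))"
          by (simp add: norm_mult)
        also have "\<dots> \<le> exp (real N) * (fact j * (\<bar>C\<bar> * exp (real n) * exp (- real n * X N) / (X N - 1)))"
          using elim by (intro mult_left_mono deriv_bound) auto
        also have "- real n * X N = - real N" using e by simp
        also have "exp (real N) * (fact j * (\<bar>C\<bar> * exp (real n) * exp (- real N) / (X N - 1)))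
          = fact j * (\<bar>C\<bar> * exp (real n)) * inverse (- 1 + X N) * (exp (real N) * exp (- real N))"
          by (simp add: divide_inverse)
        also have "exp (real N) * exp (- real N) = 1" by (simp add: exp_minus)
        finally show ?case by simp
      qed
    qed
  qed
  fix s :: real assume s: "s \<ge> 1"
  define x where "x = exp s"
  have x: "x \<ge> 2" using exp_ge_add_one_self[of s] s unfolding x_def by linarith
  define P where "P = 2 * real n * (\<Sum>j<n. norm (euler_coeff mu n j)) + real n"
  have gron: "energy n f (Ln (of_real x)) \<le> exp (2 * P) * (exp (2 * real N) * energy n f (of_real (ln (X N))))" if N: "X N \<ge> x" for N
  proof -
    define L where "L = X N - x"
    have L: "L \<ge> 0" using N by (simp add: L_def)
    have e: "complex_of_real x + of_real r * 1 = of_real (x + r)" for r by simp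
    have "energy n f (Ln (of_real x)) \<le> exp (2 * P) * (exp (2 * real n * L) * energy n f (Ln (of_real x + of_real L * 1)) + 0)"
      unfolding P_def
    proof (rule energy_gronwall[OF n mu f _ L x, where \<epsilon> = "\<lambda>_. 0"])
      fix r :: real assume r: "0 \<le> r"
      show "complex_of_real x + of_real r * 1 \<notin> \<real>\<^sub>\<le>\<^sub>0" unfolding e using x r by (simp add: complex_nonpos_Reals_iff del: of_real_add)
      show "norm (complex_of_real x + of_real r * 1) \<ge> (x + r) / 2" unfolding e norm_of_real using x r by simp
    qed (auto simp: ode)
    also have "Ln (of_real x + of_real L * 1) = of_real (ln (X N))"
      unfolding e using x N by (simp add: L_def Ln_of_real)
    also have "exp (2 * real n * L) * energy n f (of_real (ln (X N))) + 0 \<le> exp (2 * real N) * energy n f (of_real (ln (X N)))"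
    proof -
      have "real n * L \<le> real n * X N" using x by (intro mult_left_mono) (auto simp: L_def)
      also have "real n * X N = real N" using n0 by (simp add: X_def)
      finally show ?thesis by (simp add: mult_right_mono energy_nonneg)
    qed
    finally show ?thesis by simp
  qed
  have "energy n f (Ln (of_real x)) \<le> exp (2 * P) * 0"
  proof (rule tendsto_lowerbound)
    show "(\<lambda>N. exp (2 * P) * (exp (2 * real N) * energy n f (of_real (ln (X N))))) \<longlonglongrightarrow> exp (2 * P) * 0"
      by (intro tendsto_intros lim)
    have "eventually (\<lambda>N. X N \<ge> x) sequentially" using Xlim unfolding filterlim_at_top by blast
    then show "\<forall>\<^sub>F N in sequentially. energy n f (Ln (of_real x)) \<le> exp (2 * P) * (exp (2 * real N) * energy n f (of_real (ln (X N))))"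
      by (rule eventually_mono) (rule gron)
  qed simp
  then have "(norm (f (Ln (of_real x))))\<^sup>2 \<le> 0" using norm_le_energy[OF n0, of f "Ln (of_real x)"] by linarith
  then have "f (Ln (of_real x)) = 0" by simp
  then show "f (of_real s) = 0" using x by (simp add: Ln_of_real x_def)
qed simp

section \<open>Rotation of the Bessel equation and of its formal solution\<close>

lemma euler_op_shift:
  assumes f: "f holomorphic_on UNIV"
  shows "euler_op mu k (\<lambda>u. f (u + c)) = (\<lambda>u. euler_op mu k f (u + c))"
proof (induction k)
  case (Suc k)
  have d: "deriv (\<lambda>u. euler_op mu k f (u + c)) u = deriv (euler_op mu k f) (u + c)" for u
    using entire_deriv[OF holomorphic_euler_op[OF f], of mu k "u + c"] by (intro DERIV_imp_deriv) (simp only: DERIV_shift)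
  show ?case unfolding euler_op.simps Suc.IH d ..
qed simp

text \<open>Rotation by \<open>c\<close> and the factor y^((n-1)/2) bring the equation to the normal
  form with formal exponential e^(-ny); the hypothesis on \<epsilon> says that \<epsilon> (in)^n z^n
  becomes (-n)^n y^n.\<close>

lemma bessel_solution_twist:
  assumes n: "n > 0" and \<epsilon>: "\<epsilon> * (\<i> * of_nat n) ^ n * exp (of_nat n * c) = (- of_nat n) ^ n"
    and w: "w holomorphic_on UNIV"
  shows "bessel_solution n lam \<epsilon> w \<longleftrightarrow>
    (\<forall>u. euler_op (\<lambda>l. of_nat n * lam l - (of_nat n - 1) / 2) n (\<lambda>u. exp ((of_nat n - 1) / 2 * u) * w (u + c)) u
       = (- of_nat n) ^ n * exp (of_nat n * u) * (exp ((of_nat n - 1) / 2 * u) * w (u + c)))"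
proof -
  define a where "a = (of_nat n - 1) / (2 :: complex)"
  define D where "D = euler_op (\<lambda>l. of_nat n * lam l) n w"
  have hwc: "(\<lambda>u. w (u + c)) holomorphic_on UNIV"
    by (rule holomorphic_on_compose_gen[unfolded o_def, where t = UNIV, OF _ w]) (auto intro!: holomorphic_intros)
  have m: "(\<lambda>l. of_nat n * lam l - a + a) = (\<lambda>l. of_nat n * lam l)" by (simp add: fun_eq_iff)
  have op: "euler_op (\<lambda>l. of_nat n * lam l - a) n (\<lambda>u. exp (a * u) * w (u + c)) u = exp (a * u) * D (u + c)" for u
    unfolding euler_op_exp[OF hwc] m euler_op_shift[OF w] D_def ..
  have coeff: "\<epsilon> * (\<i> * of_nat n) ^ n * exp (of_nat n * (u + c)) = (- of_nat n) ^ n * exp (of_nat n * u)" for u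
    unfolding \<epsilon>[symmetric] by (simp add: distrib_left exp_add)
  have "bessel_solution n lam \<epsilon> w \<longleftrightarrow> (\<forall>z. D z = \<epsilon> * (\<i> * of_nat n) ^ n * exp (of_nat n * z) * w z)"
    unfolding bessel_solution_iff[OF n] D_def using w by simp
  also have "\<dots> \<longleftrightarrow> (\<forall>u. D (u + c) = \<epsilon> * (\<i> * of_nat n) ^ n * exp (of_nat n * (u + c)) * w (u + c))"
    by (metis diff_add_cancel)
  also have "\<dots> \<longleftrightarrow> (\<forall>u. exp (a * u) * D (u + c) = (- of_nat n) ^ n * exp (of_nat n * u) * (exp (a * u) * w (u + c)))"
    unfolding coeff by (intro iff_allI) (simp add: mult.left_commute[of _ "exp _"])
  finally show ?thesis unfolding op[unfolded a_def] a_def .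
qed

text \<open>Since in\<xi>z = -ny in the rotated variable, the powers of \<xi> in B_m and of z
  combine to the powers of -ny in \<open>partial_solution\<close>.\<close>

lemma hat_expansion_remainder:
  assumes n: "n > 0" and sum0: "(\<Sum>l=1..n. lam l) = 0" and \<xi>: "\<i> * cov_proj \<xi> * exp c = - 1"
  defines "mu \<equiv> \<lambda>l. of_nat n * lam l - (of_nat n - 1) / 2"
  shows "w (u + c) / (exp (\<i> * of_nat n * cov_proj \<xi> * cov_proj (u + c)) * cov_pow (u + c) (- (of_nat n - 1) / 2))
       - (\<Sum>m<M. bessel_B n lam \<xi> m / cov_proj (u + c) ^ m)
    = (exp ((of_nat n - 1) / 2 * c) * (exp ((of_nat n - 1) / 2 * u) * w (u + c)) - partial_solution n mu M u) / exp (- of_nat n * exp u)"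
proof -
  define A where "A = (of_nat n - 1) / (2 :: complex)"
  define G where "G = exp (- of_nat n * exp u)"
  have G: "G \<noteq> 0" by (simp add: G_def)
  have "\<i> * of_nat n * cov_proj \<xi> * cov_proj (u + c) = of_nat n * (\<i> * cov_proj \<xi> * exp c) * exp u"
    by (simp add: cov_proj_def exp_add mult_ac)
  then have k: "\<i> * of_nat n * cov_proj \<xi> * cov_proj (u + c) = - of_nat n * exp u" unfolding \<xi> by simp
  have "- (of_nat n - 1) / 2 * (u + c) = - (A * c + A * u)" by (simp add: A_def field_simps)
  then have p: "cov_pow (u + c) (- (of_nat n - 1) / 2) = inverse (exp (A * c) * exp (A * u))"
    by (simp only: cov_pow_def exp_minus exp_add)
  have "bessel_B n lam \<xi> m / cov_proj (u + c) ^ m = formal_beta n mu m / (- of_nat n) ^ m * exp_monomial n (- of_nat m) u / G" for m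
  proof -
    have "bessel_B n lam \<xi> m / cov_proj (u + c) ^ m = formal_beta n mu m / (\<i> * of_nat n * cov_proj \<xi> * cov_proj (u + c)) ^ m"
      unfolding bessel_B_eq[OF n sum0] mu_def by (simp add: power_mult_distrib)
    also have "\<dots> = formal_beta n mu m / (- of_nat n) ^ m * inverse (exp u ^ m)"
      unfolding k power_mult_distrib by (simp add: divide_inverse)
    also have "inverse (exp u ^ m) = exp_monomial n (- of_nat m) u / G"
      using G by (simp add: exp_monomial_def G_def exp_of_nat_mult[symmetric] exp_minus)
    finally show ?thesis by simp
  qed
  then have s: "(\<Sum>m<M. bessel_B n lam \<xi> m / cov_proj (u + c) ^ m) = partial_solution n mu M u / G"
    by (simp add: partial_solution_def sum_divide_distrib)
  show ?thesis unfolding s k p A_def[symmetric] G_def[symmetric] by (simp add: diff_divide_distrib divide_inverse right_diff_distrib mult_ac)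
qed

text \<open>After rotation the sector is symmetric about the real axis, the form in which the
  estimates are available.\<close>

lemma eventually_in_root_sector:
  assumes "cov_arg \<xi> = pi / 2 - \<theta>"
  shows "eventually Q (inf (filtercomap cov_mod at_top) (principal (root_sector n \<xi>))) \<longleftrightarrow>
    (\<exists>R. \<forall>u. exp (Re u) \<ge> R \<longrightarrow> \<bar>Im u\<bar> < pi / real n \<longrightarrow> Q (u + \<i> * of_real \<theta>))" (is "?l \<longleftrightarrow> ?r")
proof -
  have "?l \<longleftrightarrow> (\<exists>R. \<forall>z. exp (Re z) \<ge> R \<longrightarrow> \<bar>Im z - \<theta>\<bar> < pi / real n \<longrightarrow> Q z)"
    unfolding eventually_inf_principal eventually_filtercomap_at_top_linorder root_sector_def assms cov_mod_def
    by (simp add: cov_arg_def)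
  also have "\<dots> \<longleftrightarrow> ?r"
  proof (intro iff_exI iffI allI impI)
    fix R u assume "\<forall>z. exp (Re z) \<ge> R \<longrightarrow> \<bar>Im z - \<theta>\<bar> < pi / real n \<longrightarrow> Q z" "exp (Re u) \<ge> R" "\<bar>Im u\<bar> < pi / real n"
    then show "Q (u + \<i> * of_real \<theta>)" by simp
  next
    fix R z assume *: "\<forall>u. exp (Re u) \<ge> R \<longrightarrow> \<bar>Im u\<bar> < pi / real n \<longrightarrow> Q (u + \<i> * of_real \<theta>)" "exp (Re z) \<ge> R" "\<bar>Im z - \<theta>\<bar> < pi / real n"
    have "Q ((z - \<i> * of_real \<theta>) + \<i> * of_real \<theta>)" using *(2,3) by (intro *(1)[rule_format]) auto
    then show "Q z" by simp
  qed
  finally show ?thesis .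
qed

text \<open>Existence is the expansion in the half plane, which contains the rotated sector as
  \<pi>/n \<le> \<pi>/2. Uniqueness comes from the order M = 1: the leading terms of two candidates
  cancel, so after twisting their difference is O(e^(-ny)/|y|) and vanishes.\<close>

theorem J_root_eq:
  assumes n: "n \<ge> 2" and sum0: "(\<Sum>l=1..n. lam l) = 0"
    and \<xi>: "\<i> * cov_proj \<xi> * exp (\<i> * of_real \<theta>) = - 1" and arg: "cov_arg \<xi> = pi / 2 - \<theta>"
  shows "J_root n lam \<xi> = (\<lambda>z. mellin_barnes n lam (\<lambda>_. 1) (z - \<i> * of_real \<theta>)
      / (of_real (leading_const n) * exp ((of_nat n - 1) / 2 * (\<i> * of_real \<theta>))))"
proof -
  have n0: "n > 0" using n by simp
  define c where "c = \<i> * complex_of_real \<theta>"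
  define A where "A = (of_nat n - 1) / (2 :: complex)"
  define mu where "mu = (\<lambda>l. of_nat n * lam l - A)"
  define c0 where "c0 = complex_of_real (leading_const n)"
  \<comment> \<open>The integral is asymptotic to \<open>c0\<close> e^(-ny) y^(-A), whereas the
    formal solution starts with e^(-ny) z^(-A) and z = y e^c.\<close>
  define k where "k = 1 / (c0 * exp (A * c))"
  define T where "T w M z = w z / (exp (\<i> * of_nat n * cov_proj \<xi> * cov_proj z) * cov_pow z (- (of_nat n - 1) / 2))
             - (\<Sum>m<M. bessel_B n lam \<xi> m / cov_proj z ^ m)" for w M z
  define w0 where "w0 = (\<lambda>z. k * mellin_barnes n lam (\<lambda>_. 1) (z - c))"
  define F where "F = inf (filtercomap cov_mod at_top) (principal (root_sector n \<xi>))"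
  have c0: "c0 \<noteq> 0" using n by (simp add: c0_def leading_const_def)
  have \<xi>c: "\<i> * cov_proj \<xi> * exp c = - 1" using \<xi> by (simp add: c_def)
  have \<epsilon>: "cov_proj \<xi> ^ n * (\<i> * of_nat n) ^ n * exp (of_nat n * c) = (- of_nat n) ^ n"
  proof -
    have "cov_proj \<xi> ^ n * (\<i> * of_nat n) ^ n * exp (of_nat n * c) = (of_nat n * (\<i> * cov_proj \<xi> * exp c)) ^ n"
      unfolding exp_of_nat_mult power_mult_distrib[symmetric] by (simp add: mult_ac)
    then show ?thesis unfolding \<xi>c by simp
  qed
  note twist = bessel_solution_twist[OF n0 \<epsilon>, of _ lam, folded A_def, folded mu_def]
  have remainder: "T w M (u + c) = (exp (A * c) * (exp (A * u) * w (u + c)) - partial_solution n mu M u) / exp (- of_nat n * exp u)" for w M u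
    unfolding T_def A_def mu_def by (rule hat_expansion_remainder[OF n0 sum0 \<xi>c])
  have J_hat: "has_J_hat_expansion n lam \<xi> w \<longleftrightarrow> (\<forall>M. T w M \<in> O[F](\<lambda>z. 1 / cov_proj z ^ M))" for w
    unfolding has_J_hat_expansion_def T_def[abs_def] F_def ..
  note ev = eventually_in_root_sector[OF arg, where n = n, folded F_def c_def]
  define v where "v = twisted_mellin n lam"
  have hv: "v holomorphic_on UNIV" unfolding v_def by (rule holomorphic_twisted_mellin[OF n0 sum0])
  have ode: "euler_op mu n v u = (- of_nat n) ^ n * exp (of_nat n * u) * v u" for u
    unfolding v_def mu_def A_def by (rule twisted_mellin_ode[OF n0 sum0])
  have musum: "(\<Sum>l=1..n. mu l) = - (of_nat n * (of_nat n - 1) / 2)"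
    unfolding mu_def A_def by (rule sum_twisted_indices[OF sum0])
  have v0: "exp (A * u) * w0 (u + c) = k * v u" for u
    by (simp add: w0_def v_def twisted_mellin_def A_def)
  have hw0: "w0 holomorphic_on UNIV"
    unfolding w0_def
    by (intro holomorphic_intros holomorphic_on_compose_gen[unfolded o_def, where t = UNIV, OF _ holomorphic_mellin_barnes[OF n0 sum0 poly_growth_1]]) auto
  have sol0: "bessel_solution n lam (cov_proj \<xi> ^ n) w0"
    unfolding twist[OF hw0] v0
  proof
    fix u
    have "euler_op mu n (\<lambda>u. k * v u + 0 * v u) u = k * euler_op mu n v u + 0 * euler_op mu n v u"
      by (simp only: euler_op_lincomb[OF hv hv])
    then show "euler_op mu n (\<lambda>u. k * v u) u = (- of_nat n) ^ n * exp (of_nat n * u) * (k * v u)"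
      by (simp add: ode)
  qed
  have exp0: "has_J_hat_expansion n lam \<xi> w0"
    unfolding J_hat
  proof
    fix M
    obtain C where C: "\<And>y. Re y \<ge> 0 \<Longrightarrow> norm y \<ge> 2 \<Longrightarrow>
        norm (v (Ln y) / c0 - partial_solution n mu M (Ln y)) \<le> C * norm (exp (- of_nat n * y)) / norm y ^ M"
      using twisted_mellin_expansion[OF n sum0, of M] unfolding v_def c0_def mu_def A_def by blast
    show "T w0 M \<in> O[F](\<lambda>z. 1 / cov_proj z ^ M)"
    proof (rule bigoI[where c = C], unfold ev remainder v0, intro exI[of _ 2] allI impI)
      fix u :: complex assume u: "2 \<le> exp (Re u)" "\<bar>Im u\<bar> < pi / real n"
      define y where "y = exp u"
      have "pi / real n \<le> pi / 2" using n by (intro divide_left_mono) auto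
      then have im: "\<bar>Im u\<bar> < pi / 2" using u(2) by linarith
      then have "cos (Im u) \<ge> 0" by (intro cos_ge_zero) auto
      then have y: "Re y \<ge> 0" "norm y \<ge> 2" using u by (auto simp: y_def Re_exp)
      have Ln: "Ln y = u" unfolding y_def using im pi_gt_zero by (intro Ln_exp) (simp_all only: abs_less_iff, linarith+)
      have e: "exp (A * c) * (k * v u) = v u / c0" using c0 by (simp add: k_def)
      have "norm ((v u / c0 - partial_solution n mu M u) / exp (- of_nat n * y)) \<le> C * norm (exp (- of_nat n * y)) / norm y ^ M / norm (exp (- of_nat n * y))"
        unfolding norm_divide[of _ "exp (- of_nat n * y)"] using C[OF y] unfolding Ln by (intro divide_right_mono) auto
      also have "\<dots> = C * (1 / norm y ^ M)" by simp
      also have "1 / norm y ^ M = norm (1 / cov_proj (u + c) ^ M)"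
        by (simp add: cov_proj_def norm_divide norm_power y_def c_def)
      finally show "norm ((exp (A * c) * (k * v u) - partial_solution n mu M u) / exp (- of_nat n * exp u)) \<le> C * norm (1 / cov_proj (u + c) ^ M)"
        unfolding e y_def .
    qed
  qed
  have uniq: "w = w0" if sol: "bessel_solution n lam (cov_proj \<xi> ^ n) w" and exp: "has_J_hat_expansion n lam \<xi> w" for w
  proof -
    have hw: "w holomorphic_on UNIV" using sol by (simp add: bessel_solution_def)
    define x where "x = (\<lambda>u. exp (A * u) * w (u + c))"
    have hx: "x holomorphic_on UNIV" unfolding x_def
      by (intro holomorphic_intros holomorphic_on_compose_gen[unfolded o_def, where t = UNIV, OF _ hw]) auto
    have odex: "euler_op mu n x u = (- of_nat n) ^ n * exp (of_nat n * u) * x u" for u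
      using sol unfolding twist[OF hw] x_def by blast
    define d where "d = (\<lambda>u. 1 * x u + (- k) * v u)"
    have hd: "d holomorphic_on UNIV" unfolding d_def by (intro holomorphic_intros hx hv)
    have oded: "euler_op mu n d u = (- of_nat n) ^ n * exp (of_nat n * u) * d u" for u
      unfolding d_def euler_op_lincomb[OF hx hv] ode odex by (simp add: algebra_simps)
    have "(\<lambda>z. T w 1 z - T w0 1 z) \<in> O[F](\<lambda>z. 1 / cov_proj z ^ 1)"
      using exp exp0 unfolding J_hat by (intro sum_in_bigo) blast+
    then obtain C where C: "C > 0" and "eventually (\<lambda>z. norm (T w 1 z - T w0 1 z) \<le> C * norm (1 / cov_proj z ^ 1)) F"
      by (elim landau_o.bigE)
    then obtain R where R: "\<And>u. exp (Re u) \<ge> R \<Longrightarrow> \<bar>Im u\<bar> < pi / real n \<Longrightarrow> norm (T w 1 (u + c) - T w0 1 (u + c)) \<le> C * norm (1 / cov_proj (u + c) ^ 1)"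
      unfolding ev by blast
    have "d = (\<lambda>_. 0)"
    proof (rule decaying_solution_eq_0[OF n musum hd oded, where \<delta> = "pi / real n" and R = "ln (max R 1)" and C = "C / norm (exp (A * c))"])
      fix u :: complex assume u: "ln (max R 1) \<le> Re u" "\<bar>Im u\<bar> < pi / real n"
      have "R \<le> max R 1" by simp
      also have "max R 1 \<le> exp (Re u)" using u(1) exp_le_cancel_iff[of "ln (max R 1)" "Re u"] by (simp add: less_max_iff_disj)
      finally have "norm (T w 1 (u + c) - T w0 1 (u + c)) \<le> C * norm (1 / cov_proj (u + c) ^ 1)" using u(2) by (rule R)
      also have "norm (1 / cov_proj (u + c) ^ 1) = 1 / norm (exp u)" by (simp add: cov_proj_def norm_divide c_def)
      also have "T w 1 (u + c) - T w0 1 (u + c) = exp (A * c) * d u / exp (- of_nat n * exp u)"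
        unfolding remainder v0 d_def x_def by (simp add: diff_divide_distrib[symmetric] algebra_simps)
      finally show "norm (d u) \<le> C / norm (exp (A * c)) * norm (exp (- of_nat n * exp u)) / norm (exp u)"
        unfolding norm_mult norm_divide by (simp add: field_simps)
    qed (use n in auto)
    then have "exp (A * u) * w (u + c) = exp (A * u) * w0 (u + c)" for u
      unfolding v0 by (simp add: d_def x_def fun_eq_iff)
    then have "w (u + c) = w0 (u + c)" for u by simp
    then show ?thesis by (metis ext diff_add_cancel)
  qed
  have "J_root n lam \<xi> = w0"
    unfolding J_root_def using sol0 exp0 uniq by (intro the_equality) blast+
  then show ?thesis unfolding w0_def k_def c0_def c_def A_def by (simp add: fun_eq_iff)
qed

section \<open>The constants of the final identity\<close>

lemma sum_L_set:
  fixes f :: "nat \<Rightarrow> 'a :: comm_monoid_add"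
  assumes "\<forall>l\<in>{1..n}. sg l \<in> {1, -1}"
  shows "(\<Sum>l=1..n. f l) = (\<Sum>l\<in>L_set n sg 1. f l) + (\<Sum>l\<in>L_set n sg (-1). f l)"
proof -
  have "{1..n} = L_set n sg 1 \<union> L_set n sg (-1)" using assms unfolding L_set_def by blast
  moreover have "L_set n sg 1 \<inter> L_set n sg (-1) = {}" by (auto simp: L_set_def)
  moreover have "finite (L_set n sg 1)" "finite (L_set n sg (-1))" by (simp_all add: L_set_def)
  ultimately show ?thesis by (simp add: sum.union_disjoint)
qed

theorem corollary12p4:
  fixes n :: nat and sg :: "nat \<Rightarrow> int" and lam :: "nat \<Rightarrow> complex"
    and \<delta> :: int and z :: ucover
  assumes "n \<ge> 2"
    and "\<forall>l\<in>{1..n}. sg l \<in> {1, -1}"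
    and "(\<Sum>l=1..n. lam l) = 0"
    and "\<delta> \<in> {1, -1}"
  shows "cov_proj (xi_lift n sg) = xi_const n sg \<delta> \<and>
         cov_arg (xi_lift n sg) = pi - real (n_sgn n sg 1) / real n * pi \<and>
         J_fun n sg lam z =
           of_real ((2 * pi) powr ((real n - 1) / 2)) * c_const n sg lam \<delta> / of_real (sqrt (real n))
             * J_root n lam (xi_lift n sg) z"
proof -
  note n = assms(1) and sg = assms(2) and sum0 = assms(3)
  have n0: "n > 0" using n by simp
  define Np Nm where "Np = n_sgn n sg 1" and "Nm = n_sgn n sg (-1)"
  define \<theta> where "\<theta> = rotation n sg"
  define \<xi> where "\<xi> = xi_lift n sg"
  have N: "n = Np + Nm"
    using sum_L_set[OF sg, of "\<lambda>_. 1 :: nat"] by (simp add: Np_def Nm_def n_sgn_def)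
  then have Nr: "real n = real Np + real Nm" by simp
  have "sign_sum n sg = (\<Sum>l\<in>L_set n sg 1. sg l) + (\<Sum>l\<in>L_set n sg (-1). sg l)"
    unfolding sign_sum_def by (rule sum_L_set[OF sg])
  also have "(\<Sum>l\<in>L_set n sg 1. sg l) = (\<Sum>l\<in>L_set n sg 1. 1)" by (intro sum.cong) (auto simp: L_set_def)
  also have "(\<Sum>l\<in>L_set n sg (-1). sg l) = (\<Sum>l\<in>L_set n sg (-1). -1)" by (intro sum.cong) (auto simp: L_set_def)
  finally have ss: "sign_sum n sg = int Np - int Nm" by (simp add: Np_def Nm_def n_sgn_def)
  \<comment> \<open>The rotation that removes the signs from the integrand is the direction \<pi>/2
    - arg \<xi> at the centre of the sector; this match is what determines \<xi>.\<close>
  have \<theta>: "\<theta> = pi / 2 - real Nm / real n * pi"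
    unfolding \<theta>_def rotation_def ss using n0 Nr by (simp add: field_simps)
  have \<xi>c: "\<xi> = \<i> * of_real (pi / 2 - \<theta>)"
    unfolding \<xi>_def xi_lift_def cov_polar_def \<theta> Nm_def[symmetric] by (simp add: complex_eq_iff)
  have arg: "cov_arg \<xi> = pi / 2 - \<theta>" by (simp add: \<xi>c cov_arg_def)
  have \<xi>: "\<i> * cov_proj \<xi> * exp (\<i> * of_real \<theta>) = - 1"
    unfolding cov_proj_def \<xi>c cis_conv_exp[symmetric] mult.assoc cis_mult by (simp add: cis_pi_half)
  have "cov_proj \<xi> = xi_const n sg \<delta>"
  proof -
    have p: "cov_proj \<xi> = exp (of_real pi * \<i> * of_nat Nm / of_nat n)"
      unfolding cov_proj_def \<xi>c \<theta> by (simp add: field_simps)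
    have "- exp (- of_real pi * \<i> * of_nat Np / of_nat n) = exp (of_real pi * \<i> * of_nat Nm / of_nat n)"
    proof -
      have Npm: "of_nat Np = of_nat n - (of_nat Nm :: complex)" by (simp add: N)
      have "- of_real pi * \<i> * of_nat Np / of_nat n = of_real pi * \<i> * of_nat Nm / of_nat n - of_real pi * \<i>"
        unfolding Npm using n0 by (simp add: field_simps)
      then show ?thesis by (simp add: exp_diff)
    qed
    then show ?thesis using assms(4) p by (auto simp: xi_const_def Np_def Nm_def)
  qed
  moreover have "cov_arg \<xi> = pi - real Np / real n * pi"
    unfolding arg \<theta> using n0 Nr by (simp add: field_simps)
  moreover have "J_fun n sg lam z = of_real ((2 * pi) powr ((real n - 1) / 2)) * c_const n sg lam \<delta> / of_real (sqrt (real n)) * J_root n lam \<xi> z"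
  proof -
    \<comment> \<open>The phase by which \<open>J_root\<close> is normalised; it has to combine with
      \<open>J_factor\<close> to give \<open>c_const\<close>.\<close>
    define E where "E = exp ((of_nat n - 1) / 2 * (\<i> * complex_of_real \<theta>))"
    define s where "s d = (\<Sum>l\<in>L_set n sg d. lam l)" for d
    have s0: "s 1 + s (-1) = 0" using sum_L_set[OF sg, of lam] sum0 by (simp add: s_def)
    have "(\<Sum>l=1..n. of_int (sg l) * lam l) = (\<Sum>l\<in>L_set n sg 1. of_int (sg l) * lam l) + (\<Sum>l\<in>L_set n sg (-1). of_int (sg l) * lam l)"
      by (rule sum_L_set[OF sg])
    also have "(\<Sum>l\<in>L_set n sg 1. of_int (sg l) * lam l) = s 1" unfolding s_def by (intro sum.cong) (auto simp: L_set_def)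
    also have "(\<Sum>l\<in>L_set n sg (-1). of_int (sg l) * lam l) = - s (-1)" unfolding s_def sum_negf[symmetric] by (intro sum.cong) (auto simp: L_set_def)
    finally have J: "J_factor n sg lam = e2pi (- (s 1 - s (-1)) / 4)" by (simp add: J_factor_def)
    have E: "E = e2pi ((of_nat n - 1) * (of_nat Np - of_nat Nm) / (8 * of_nat n))"
      unfolding E_def e2pi_def \<theta>_def rotation_def ss using n0 by (intro arg_cong[where f = exp]) (simp add: field_simps)
    have e2pi_add: "e2pi a * e2pi b = e2pi (a + b)" for a b by (simp add: e2pi_def distrib_left exp_add)
    have nc: "(of_nat n :: complex) \<noteq> 0" "of_nat n = of_nat Np + (of_nat Nm :: complex)" using n0 by simp (simp add: N)
    have c_eq: "c_const n sg lam \<delta> = J_factor n sg lam * E"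
      unfolding J E e2pi_add c_const_def s_def[symmetric]
    proof (rule arg_cong[where f = e2pi])
      \<comment> \<open>The two partial sums of the lam_l are opposite, so a quarter of their
        difference is half of either up to sign. For this reason both choices of \<delta> give the
        same constant.\<close>
      have sm: "s (-1) = - s 1" using s0 by (simp add: add_eq_0_iff)
      \<comment> \<open>Writing the difference of the two counts as twice the first minus n, or n
        minus twice the second, produces the two forms of the exponent.\<close>
      have q: "(of_nat n - 1) * (of_nat Np - of_nat Nm) / (8 * of_nat n)
          = - ((of_nat n - 1) / 8) + (of_nat n - 1) * of_nat Np / (4 * of_nat n :: complex)"
        "(of_nat n - 1) * (of_nat Np - of_nat Nm) / (8 * of_nat n)
          = (of_nat n - 1) / 8 - (of_nat n - 1) * of_nat Nm / (4 * of_nat n :: complex)"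
      proof -
        have Npm: "of_nat Np = of_nat n - (of_nat Nm :: complex)" using nc(2) by simp
        show "(of_nat n - 1) * (of_nat Np - of_nat Nm) / (8 * of_nat n)
          = - ((of_nat n - 1) / 8) + (of_nat n - 1) * of_nat Np / (4 * of_nat n :: complex)"
          unfolding Npm using nc(1) by (simp add: divide_simps) (simp add: algebra_simps)
        show "(of_nat n - 1) * (of_nat Np - of_nat Nm) / (8 * of_nat n)
          = (of_nat n - 1) / 8 - (of_nat n - 1) * of_nat Nm / (4 * of_nat n :: complex)"
          unfolding Npm using nc(1) by (simp add: divide_simps) (simp add: algebra_simps)
      qed
      consider "\<delta> = 1" | "\<delta> = -1" using assms(4) by blast
      then show "- of_int \<delta> * (of_nat n - 1) / 8 + of_int \<delta> * (of_nat n - 1) * of_nat (n_sgn n sg \<delta>) / (4 * of_nat n) - of_int \<delta> * (1 / 2) * s \<delta>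
        = - (s 1 - s (-1)) / 4 + (of_nat n - 1) * (of_nat Np - of_nat Nm) / (8 * of_nat n)"
      proof cases
        case 1
        have e: "- (s 1 - s (-1)) / 4 = - (s 1 / 2)" unfolding sm by simp
        have "- of_int 1 * p / 8 + of_int 1 * p * m / r - of_int 1 * (1 / 2) * t = - (t / 2) + (- (p / 8) + p * m / r)"
          for p m r t :: complex by simp
        then show ?thesis unfolding 1 Np_def[symmetric] q(1) e .
      next
        case 2
        have e: "- (s 1 - s (-1)) / 4 = s (-1) / 2" unfolding sm by simp
        have "- of_int (-1) * p / 8 + of_int (-1) * p * m / r - of_int (-1) * (1 / 2) * t = t / 2 + (p / 8 - p * m / r)"
          for p m r t :: complex by simp
        then show ?thesis unfolding 2 Nm_def[symmetric] q(2) e .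
      qed
    qed
    define m where "m = mellin_barnes n lam (\<lambda>_. 1) (z - \<i> * of_real \<theta>)"
    define K where "K = complex_of_real (leading_const n)"
    have "K * (J_factor n sg lam * E) * (m / (K * E)) = J_factor n sg lam * m"
      using n0 by (simp add: K_def E_def leading_const_def)
    moreover have "complex_of_real ((2 * pi) powr ((real n - 1) / 2)) * c_const n sg lam \<delta> / of_real (sqrt (real n)) = K * c_const n sg lam \<delta>"
      by (simp add: K_def leading_const_def)
    moreover have "J_root n lam \<xi> z = m / (K * E)"
      unfolding J_root_eq[OF n sum0 \<xi> arg] E_def m_def K_def ..
    moreover have "J_fun n sg lam z = J_factor n sg lam * m"
      unfolding J_fun_eq[OF n0 sg sum0] \<theta>_def m_def ..
    ultimately show ?thesis by (simp only: c_eq)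
  qed
  ultimately show ?thesis unfolding \<xi>_def Np_def by blast
qed

end
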